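(* Let $n\ge 2$, let $m\ge 4$ be even, and let $P:\mathbf{R}^n\to\mathbf{R}$ be a real elliptic (inhomogeneous) polynomial of order $m$ with $P(\xi)>0$ for all $\xi\in\mathbf{R}^n$, whose principal part $P_m$ satisfies $$\det\Big(\frac{\partial^2 P_m(\xi)}{\partial\xi_i\partial\xi_j}\Big)_{n\times n}\neq 0\qquad\text{for all }\xi\in\mathbf{R}^n\setminus\{0\}.$$ Assume $n\ge m$. Let $$I_2(t,x)=\int_{\mathbf{R}^n}e^{i\langle x,\xi\rangle\pm itP^{1/2}(\xi)}P^{-1/2}(\xi)\,d\xi$$ (for either choice of the sign). Then there exists a constant $C>0$ such that for all $x\in\mathbf{R}^n$ $$|I_2(t,x)|\le\begin{cases} C|t|^{-\frac{n-m_1}{m_1}}\big(1+|t|^{-\frac1{m_1}}|x|\big)^{-\mu}, & 0<|t|\le 1,\\[2mm] C|t|^{-\frac1m}\big(1+|t|^{-1}|x|\big)^{-\mu}, & |t|\ge 1,\end{cases}$$ where $m_1:=\frac m2$ and $\mu:=\frac{mn-4n+2m}{2(m-2)}>0$.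
   Context: The principal part $P_m$ of $P$ is its homogeneous part of degree $m$; elliptic means $P_m(\xi)\ne0$ for $\xi\neq0$. $P^{1/2}(\xi)=\sqrt{P(\xi)}$ and $P^{-1/2}(\xi)=1/\sqrt{P(\xi)}$. For $t\ne 0$ the oscillatory integral $I_2(t,\cdot)$ is initially understood in the distributional sense, i.e. as the (unnormalized) inverse Fourier transform $\int e^{i\langle x,\xi\rangle}f(\xi)\,d\xi$ of the tempered distribution $f(\xi)=e^{\pm itP^{1/2}(\xi)}P^{-1/2}(\xi)$. It is known that, because $P$ is elliptic, $I_2(t,\cdot)$ is a $C^\infty$ function of $x$ for every fixed $t\neq0$. The constant $C$ is independent of $t$ and $x$. *)

theory Defs
  imports "HOL-Analysis.Analysis" "HOL-Library.Poly_Mapping"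
begin

text \<open>
  A real polynomial in the coordinates of \<open>real ^ 'n\<close> is given by its coefficients: a finitely
  supported map from exponent vectors to reals.
\<close>

type_synonym 'n polynomial = "('n \<Rightarrow>\<^sub>0 nat) \<Rightarrow>\<^sub>0 real"

definition monomial_degree :: "('n::finite \<Rightarrow>\<^sub>0 nat) \<Rightarrow> nat" where
  "monomial_degree \<alpha> = (\<Sum>i\<in>UNIV. Poly_Mapping.lookup \<alpha> i)"

definition monomial_value :: "('n::finite \<Rightarrow>\<^sub>0 nat) \<Rightarrow> real ^ 'n \<Rightarrow> real" where
  "monomial_value \<alpha> \<xi> = (\<Prod>i\<in>UNIV. (\<xi> $ i) ^ Poly_Mapping.lookup \<alpha> i)"

definition polynomial_order :: "'n::finite polynomial \<Rightarrow> nat" where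
  "polynomial_order P = Max (insert 0 (monomial_degree ` Poly_Mapping.keys P))"

definition polynomial_value :: "'n::finite polynomial \<Rightarrow> real ^ 'n \<Rightarrow> real" where
  "polynomial_value P \<xi> =
     (\<Sum>\<alpha>\<in>Poly_Mapping.keys P. Poly_Mapping.lookup P \<alpha> * monomial_value \<alpha> \<xi>)"

definition principal_part :: "'n::finite polynomial \<Rightarrow> real ^ 'n \<Rightarrow> real" where
  "principal_part P \<xi> =
     (\<Sum>\<alpha> | \<alpha> \<in> Poly_Mapping.keys P \<and> monomial_degree \<alpha> = polynomial_order P.
        Poly_Mapping.lookup P \<alpha> * monomial_value \<alpha> \<xi>)"

definition elliptic :: "'n::finite polynomial \<Rightarrow> bool" where
  "elliptic P \<longleftrightarrow> (\<forall>\<xi>. \<xi> \<noteq> 0 \<longrightarrow> principal_part P \<xi> \<noteq> 0)"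

definition partial_derivative ::
    "'n::finite \<Rightarrow> (real ^ 'n \<Rightarrow> 'b::real_normed_vector) \<Rightarrow> real ^ 'n \<Rightarrow> 'b" where
  "partial_derivative i f x = frechet_derivative f (at x) (axis i 1)"

definition hessian :: "(real ^ 'n::finite \<Rightarrow> real) \<Rightarrow> real ^ 'n \<Rightarrow> real ^ 'n ^ 'n" where
  "hessian f x = (\<chi> i j. partial_derivative i (partial_derivative j f) x)"

text \<open>
  Schwartz functions. \<open>foldr partial_derivative is \<phi>\<close> is the iterated partial derivative along the
  list \<open>is\<close> of coordinate directions; requiring all of these to be differentiable everywhere is
  requiring \<open>\<phi>\<close> to be smooth.
\<close>

definition schwartz :: "(real ^ 'n::finite \<Rightarrow> complex) \<Rightarrow> bool" where
  "schwartz \<phi> \<longleftrightarrow>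
     (\<forall>is x. foldr partial_derivative is \<phi> differentiable at x) \<and>
     (\<forall>is (k::nat). bounded (range (\<lambda>x. (1 + norm x) ^ k *\<^sub>R foldr partial_derivative is \<phi> x)))"

definition inverse_fourier :: "(real ^ 'n::finite \<Rightarrow> complex) \<Rightarrow> real ^ 'n \<Rightarrow> complex" where
  "inverse_fourier \<phi> \<xi> = (\<integral>x. cis (x \<bullet> \<xi>) * \<phi> x \<partial>lborel)"

text \<open>
  The (unnormalised) inverse Fourier transform of the tempered distribution \<open>f\<close> is the functional
  sending a Schwartz function \<open>\<phi>\<close> to the integral of \<open>f\<close> times the inverse Fourier transform of
  \<open>\<phi>\<close>. The following says that this distribution is the function \<open>g\<close>.
\<close>

definition is_distributional_inverse_fourier ::
    "(real ^ 'n::finite \<Rightarrow> complex) \<Rightarrow> (real ^ 'n \<Rightarrow> complex) \<Rightarrow> bool" where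
  "is_distributional_inverse_fourier f g \<longleftrightarrow>
     (\<forall>\<phi>. schwartz \<phi> \<longrightarrow>
        integrable lborel (\<lambda>x. g x * \<phi> x) \<and>
        (\<integral>x. g x * \<phi> x \<partial>lborel) = (\<integral>\<xi>. f \<xi> * inverse_fourier \<phi> \<xi> \<partial>lborel))"

definition I2_symbol :: "real \<Rightarrow> 'n::finite polynomial \<Rightarrow> real \<Rightarrow> real ^ 'n \<Rightarrow> complex" where
  "I2_symbol \<sigma> P t \<xi> =
     cis (\<sigma> * t * sqrt (polynomial_value P \<xi>)) / complex_of_real (sqrt (polynomial_value P \<xi>))"

text \<open>
  The oscillatory integral with sign \<open>\<sigma> \<in> {1, -1}\<close>. It does not converge absolutely in general, so
  its value at a point is that of the continuous function which the distributional inverse Fourier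
  transform is. A distribution is given by at most one continuous function; for elliptic
  \<open>P\<close> as in the theorem and \<open>t \<noteq> 0\<close> there is one, and it is even smooth, so this is the
  smooth function in question.
\<close>

definition I2 :: "real \<Rightarrow> 'n::finite polynomial \<Rightarrow> real \<Rightarrow> real ^ 'n \<Rightarrow> complex" where
  "I2 \<sigma> P t =
     (THE g. continuous_on UNIV g \<and> is_distributional_inverse_fourier (I2_symbol \<sigma> P t) g)"

end

theory Submission
 imports Defs "HOL-Complex_Analysis.Complex_Analysis" "HOL-Probability.Distributions"
begin

text \<open>
  Regularised by \<open>exp (- ep |\<xi>|\<^sup>2)\<close>, the integral is a superposition of Gaussian wave packets of width
  \<open>r = 1 / sqrt (|t| R ^ (q - 2))\<close> centred at the frequencies \<open>ze\<close>, where \<open>q = m / 2\<close> and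
  \<open>|x| = |t| R ^ (q - 1)\<close>. Moving one frequency coordinate into the complex domain makes a packet
  exponentially small in \<open>r\<close> times the phase gradient \<open>x + t \<nabla>(sqrt P)(ze)\<close>. Since the Hessian of the
  principal part is nondegenerate, so is that of its square root, and the gradient map is
  quantitatively injective; hence the packets add up to a constant times a single one, of size
  \<open>r ^ n / R ^ q\<close>, which is the claim when \<open>|x| / |t|\<close> is large. Otherwise only bounded frequencies
  matter. There \<open>sqrt P\<close> has along a coordinate axis a nonzero derivative of some order between 2 and
  \<open>m\<close>, because \<open>P\<close> is a polynomial of degree \<open>m\<close> in that coordinate, and van der Corput's lemma gives
  \<open>|t| powr (- 1 / m)\<close>. Small \<open>t\<close> is scaled to \<open>|t| = 1\<close>, which replaces \<open>P\<close> by \<open>ta ^ m P(\<xi> / ta)\<close> with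
  \<open>0 < ta \<le> 1\<close>; all estimates are uniform in \<open>ta\<close>. Gaussians as test functions identify the limit
  \<open>ep \<longlonglongrightarrow> 0\<close> with the oscillatory integral.
\<close>

text \<open>The packet width is forced by Taylor's formula: at frequency \<open>R\<close> the phase
  has a Hessian of size \<open>|t| R ^ (q - 2)\<close>, which is \<open>1 / r ^ 2\<close>, so over
  one packet the phase is linear up to O(1). With \<open>|x| = |t| R ^ (q - 1)\<close> the size
  \<open>r ^ n / R ^ q\<close> is exactly \<open>|t| powr (- n / 2)\<close> times
  \<open>(|x| / |t|) powr (- \<mu>)\<close>; this is the origin of \<open>\<mu>\<close>. The main
  obstacle is the origin. As \<open>ta\<close> tends to 0 the rescaled square root approaches a
  homogeneous function that need not be smooth there, and its holomorphic extension is controlled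
  only in a cone around real space of width proportional to \<open>ta + |\<xi>|\<close>. Low
  frequencies therefore need shifts that vary from line to line, and they have to be summed over all
  centres at once instead of being bounded packet by packet. The condition \<open>n \<ge> m\<close>
  makes the singularity \<open>|\<xi>| powr (- q)\<close> integrable with exponents at most 1/2 per
  coordinate, uniformly in \<open>ta\<close>. For \<open>ep = 0\<close> the integral itself need not
  converge absolutely, but the packet bounds do not depend on \<open>ep\<close>; the limit is taken
  packet by packet.\<close>

no_notation fps_nth (infixl \<open>$\<close> 75)

section \<open>Integration over lines, over products of coordinates, and against singular
  weights\<close>

lemma nn_integral_lborel_shift:
 fixes a :: "'a::euclidean_space"
 assumes [measurable]: "f \<in> borel_measurable borel"
 shows "(\<integral>\<^sup>+x. f (x + a) \<partial>lborel) = (\<integral>\<^sup>+x. f x \<partial>lborel)"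
proof -
 have "(\<integral>\<^sup>+x. f x \<partial>lborel) = (\<integral>\<^sup>+x. f x \<partial>(distr lborel borel ((+) a)))"
  by (simp add: lborel_distr_plus)
 also have "... = (\<integral>\<^sup>+x. f (a + x) \<partial>lborel)"
  by (rule nn_integral_distr) auto
 finally show ?thesis by (simp add: add.commute)
qed

lemma integral_lborel_shift:
 fixes a :: "'a::euclidean_space" and f :: "'a => 'b::{banach, second_countable_topology}"
 assumes [measurable]: "f \<in> borel_measurable borel"
 shows "(\<integral>x. f (x + a) \<partial>lborel) = (\<integral>x. f x \<partial>lborel)"
proof -
 have "(\<integral>x. f x \<partial>lborel) = (\<integral>x. f x \<partial>(distr lborel borel ((+) a)))"
  by (simp add: lborel_distr_plus)
 also have "... = (\<integral>x. f (a + x) \<partial>lborel)"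
  by (rule integral_distr) auto
 finally show ?thesis by (simp add: add.commute)
qed

lemma integrable_lborel_shift:
 fixes a :: "'a::euclidean_space" and f :: "'a => 'b::{banach, second_countable_topology}"
 assumes "integrable lborel f"
 shows "integrable lborel (%x. f (x + a))"
proof -
 have [measurable]: "f \<in> borel_measurable borel" using assms by auto
 have "integrable (distr lborel borel ((+) a)) f"
  using assms by (simp add: lborel_distr_plus)
 then show ?thesis
  by (subst (asm) integrable_distr_eq) (auto simp: add.commute)
qed

lemma nn_integral_unit_window:
 "(\<integral>\<^sup>+s. indicator {0..1} (c - s) \<partial>(lborel::real measure)) = 1"
proof -
 have "(%s. indicator {0..1} (c - s) :: ennreal) = indicator {c - 1..c}"
  by (auto simp: fun_eq_iff indicator_def)
 then show ?thesis by simp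
qed

text \<open>Averaging the starting point over a unit slab replaces a splitting of the space into a
  hyperplane and a line. For fixed \<open>s\<close>, translation invariance turns the window into
  \<open>indicator {0..1} (x \<bullet> e - s)\<close>, and the integral of this over
  \<open>s\<close> is 1.\<close>

lemma nn_integral_lines:
 fixes f :: "'a::euclidean_space => ennreal"
 assumes [measurable]: "f \<in> borel_measurable borel" and e: "e \<in> Basis"
 shows "(\<integral>\<^sup>+x. \<integral>\<^sup>+s. indicator {0..1} (x \<bullet> e) * f (x + s *\<^sub>R e) \<partial>lborel \<partial>lborel)
  = (\<integral>\<^sup>+x. f x \<partial>lborel)"
proof -
 have ee: "e \<bullet> e = 1" using e by (simp add: inner_same_Basis)
 have "(\<integral>\<^sup>+x. \<integral>\<^sup>+s. indicator {0..1} (x \<bullet> e) * f (x + s *\<^sub>R e) \<partial>lborel \<partial>lborel)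
   = (\<integral>\<^sup>+s. \<integral>\<^sup>+x. indicator {0..1} (x \<bullet> e) * f (x + s *\<^sub>R e) \<partial>lborel \<partial>lborel)"
  by (rule lborel_pair.Fubini'[symmetric]) measurable
 also have "... = (\<integral>\<^sup>+s. \<integral>\<^sup>+x. indicator {0..1} (x \<bullet> e - s) * f x \<partial>lborel \<partial>lborel)"
 proof (rule nn_integral_cong)
  fix s :: real
  have "(\<integral>\<^sup>+x. indicator {0..1} (x \<bullet> e) * f (x + s *\<^sub>R e) \<partial>lborel)
   = (\<integral>\<^sup>+x. indicator {0..1} ((x + s *\<^sub>R e) \<bullet> e - s) * f (x + s *\<^sub>R e) \<partial>lborel)"
   by (simp add: inner_add_left ee)
  also have "... = (\<integral>\<^sup>+x. indicator {0..1} (x \<bullet> e - s) * f x \<partial>lborel)"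
   by (rule nn_integral_lborel_shift) measurable
  finally show "(\<integral>\<^sup>+x. indicator {0..1} (x \<bullet> e) * f (x + s *\<^sub>R e) \<partial>lborel) = ..." .
 qed
 also have "... = (\<integral>\<^sup>+x. \<integral>\<^sup>+s. indicator {0..1} (x \<bullet> e - s) * f x \<partial>lborel \<partial>lborel)"
  by (rule lborel_pair.Fubini') measurable
 also have "... = (\<integral>\<^sup>+x. f x \<partial>lborel)"
  by (subst nn_integral_multc) (auto simp: nn_integral_unit_window)
 finally show ?thesis .
qed

lemma integral_lines:
 fixes F :: "'a::euclidean_space => complex"
 assumes F: "integrable lborel F" and e: "e \<in> Basis"
 shows "(\<integral>x. \<integral>s. indicator {0..1} (x \<bullet> e) *\<^sub>R F (x + s *\<^sub>R e) \<partial>lborel \<partial>lborel) = (\<integral>x. F x \<partial>lborel)"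
proof -
 have [measurable]: "F \<in> borel_measurable borel" using F by auto
 have ee: "e \<bullet> e = 1" using e by (simp add: inner_same_Basis)
 have fin: "(\<integral>\<^sup>+x. norm (F x) \<partial>lborel) < \<infinity>"
  using F by (simp add: integrable_iff_bounded)
 have "(\<integral>x. \<integral>s. indicator {0..1} (x \<bullet> e) *\<^sub>R F (x + s *\<^sub>R e) \<partial>lborel \<partial>lborel)
   = (\<integral>s. \<integral>x. indicator {0..1} (x \<bullet> e) *\<^sub>R F (x + s *\<^sub>R e) \<partial>lborel \<partial>lborel)"
 proof (rule lborel_pair.Fubini_integral[symmetric])
  show "integrable (lborel \<Otimes>\<^sub>M lborel)
    (%(x, s). indicator {0..1} (x \<bullet> e) *\<^sub>R F (x + s *\<^sub>R e))"
   unfolding integrable_iff_bounded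
  proof
   show "(\<integral>\<^sup>+ p. norm (case p of (x, s) => indicator {0..1} (x \<bullet> e) *\<^sub>R F (x + s *\<^sub>R e))
     \<partial>(lborel \<Otimes>\<^sub>M lborel)) < \<infinity>"
    using nn_integral_lines[of "%x. norm (F x)" e] e fin
    by (subst lborel.nn_integral_fst[symmetric])
      (auto simp: ennreal_mult' ennreal_indicator)
  qed measurable
 qed
 also have "... = (\<integral>s. \<integral>x. indicator {0..1} (x \<bullet> e - s) *\<^sub>R F x \<partial>lborel \<partial>lborel)"
 proof (rule Bochner_Integration.integral_cong[OF refl])
  fix s :: real
  have "(\<integral>x. indicator {0..1} (x \<bullet> e) *\<^sub>R F (x + s *\<^sub>R e) \<partial>lborel)
   = (\<integral>x. indicator {0..1} ((x + s *\<^sub>R e) \<bullet> e - s) *\<^sub>R F (x + s *\<^sub>R e) \<partial>lborel)"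
   by (simp add: inner_add_left ee)
  also have "... = (\<integral>x. indicator {0..1} (x \<bullet> e - s) *\<^sub>R F x \<partial>lborel)"
   by (rule integral_lborel_shift) measurable
  finally show "(\<integral>x. indicator {0..1} (x \<bullet> e) *\<^sub>R F (x + s *\<^sub>R e) \<partial>lborel) = ..." .
 qed
 also have "... = (\<integral>x. \<integral>s. indicator {0..1} (x \<bullet> e - s) *\<^sub>R F x \<partial>lborel \<partial>lborel)"
 proof (rule lborel_pair.Fubini_integral)
  show "integrable (lborel \<Otimes>\<^sub>M lborel) (%(x, s::real). indicator {0..1} (x \<bullet> e - s) *\<^sub>R F x)"
   unfolding integrable_iff_bounded
  proof
   show "(\<integral>\<^sup>+ p. norm (case p of (x, s) => indicator {0..1} (x \<bullet> e - s) *\<^sub>R F x)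
     \<partial>(lborel \<Otimes>\<^sub>M (lborel :: real measure))) < \<infinity>"
    using fin
    by (subst lborel.nn_integral_fst[symmetric])
      (auto simp: ennreal_mult' ennreal_indicator nn_integral_multc nn_integral_unit_window)
  qed measurable
 qed
 also have "... = (\<integral>x. F x \<partial>lborel)"
 proof (rule Bochner_Integration.integral_cong[OF refl])
  fix x :: 'a
  have *: "(%s::real. indicator {0..1} (x \<bullet> e - s) :: real) = indicator {x \<bullet> e - 1..x \<bullet> e}"
   by (auto simp: fun_eq_iff indicator_def)
  have "(\<integral>s. indicator {0..1} (x \<bullet> e - s) *\<^sub>R F x \<partial>(lborel::real measure))
    = (\<integral>s. indicator {x \<bullet> e - 1..x \<bullet> e} s *\<^sub>R F x \<partial>lborel)"
   using fun_cong[OF *] by simp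
  then show "(\<integral>s. indicator {0..1} (x \<bullet> e - s) *\<^sub>R F x \<partial>(lborel::real measure)) = F x"
   by simp
 qed
 finally show ?thesis .
qed

text \<open>Contours will be deformed in one coordinate, so integrals can be compared only line by
  line; the unit window turns these comparisons into one over the whole space. Only lines on which
  \<open>F\<close> is integrable need attention, because every other line integral is 0 by
  convention.\<close>

lemma line_domination:
 fixes F :: "'a::euclidean_space => complex" and B :: "'a => ennreal"
 assumes F: "integrable lborel F" and e: "e \<in> Basis"
  and [measurable]: "B \<in> borel_measurable borel"
  and dom: "\<And>x. integrable lborel (%s. F (x + s *\<^sub>R e)) ==>
    ennreal (norm (\<integral>s. F (x + s *\<^sub>R e) \<partial>lborel)) <= (\<integral>\<^sup>+s. B (x + s *\<^sub>R e) \<partial>lborel)"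
 shows "ennreal (norm (\<integral>x. F x \<partial>lborel)) <= (\<integral>\<^sup>+x. B x \<partial>lborel)"
proof -
 have dom': "ennreal (norm (\<integral>s. F (x + s *\<^sub>R e) \<partial>lborel)) <= (\<integral>\<^sup>+s. B (x + s *\<^sub>R e) \<partial>lborel)" for x
  using dom[of x] by (cases "integrable lborel (%s. F (x + s *\<^sub>R e))")
   (auto simp: not_integrable_integral_eq)
 let ?H = "%x. \<integral>s. indicator {0..1} (x \<bullet> e) *\<^sub>R F (x + s *\<^sub>R e) \<partial>lborel"
 have "ennreal (norm (\<integral>x. ?H x \<partial>lborel)) <= (\<integral>\<^sup>+x. norm (?H x) \<partial>lborel)"
 proof (cases "integrable lborel ?H")
  case True
  then show ?thesis by (rule integral_norm_bound_ennreal)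
 next
  case False
  then have "(\<integral>x. ?H x \<partial>lborel) = 0" by (rule not_integrable_integral_eq)
  then show ?thesis by (simp only:) simp
 qed
 also have "... <= (\<integral>\<^sup>+x. \<integral>\<^sup>+s. indicator {0..1} (x \<bullet> e) * B (x + s *\<^sub>R e) \<partial>lborel \<partial>lborel)"
  using dom' by (intro nn_integral_mono) (auto simp: indicator_def)
 also have "... = (\<integral>\<^sup>+x. B x \<partial>lborel)"
  by (rule nn_integral_lines) (use e in auto)
 finally show ?thesis unfolding integral_lines[OF F e] .
qed

lemma Basis_vec_axis: "(Basis :: (real^'n::finite) set) = range (%i. axis i 1)"
 by (auto simp: Basis_vec_def)

lemma nn_integral_vec_prod:
 fixes f :: "'n::finite => real => ennreal"
 assumes [measurable]: "\<And>i. f i \<in> borel_measurable borel"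
 shows "(\<integral>\<^sup>+x. (\<Prod>i\<in>UNIV. f i (x $ i)) \<partial>(lborel :: (real^'n) measure)) = (\<Prod>i\<in>UNIV. \<integral>\<^sup>+s. f i s \<partial>lborel)"
proof -
 have inj: "inj_on (%i. axis i (1::real)) UNIV"
  by (auto simp: inj_on_def axis_eq_axis)
 define ix where "ix = the_inv (%i::'n. axis i (1::real))"
 have ix: "ix (axis i 1) = i" for i
  unfolding ix_def using inj by (rule the_inv_f_f)
 have "(\<integral>\<^sup>+x. (\<Prod>b\<in>Basis. f (ix b) (x \<bullet> b)) \<partial>(lborel :: (real^'n) measure))
   = (\<Prod>b\<in>(Basis :: (real^'n) set). (\<integral>\<^sup>+x. f (ix b) x \<partial>lborel))"
  by (rule nn_integral_lborel_prod) auto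
 then show ?thesis
  unfolding Basis_vec_axis prod.reindex[OF inj] comp_def ix
  by (simp add: inner_axis)
qed

lemma nn_integral_gaussian:
 assumes "r > 0"
 shows "(\<integral>\<^sup>+s. ennreal (exp (- ((s - c)\<^sup>2 / r\<^sup>2))) \<partial>lborel) = ennreal (sqrt pi * r)"
proof -
 have \<sigma>: "r / sqrt 2 > 0" using assms by simp
 have eq: "exp (- ((s - c)\<^sup>2 / r\<^sup>2)) = sqrt pi * r * normal_density c (r / sqrt 2) s" for s
  using assms by (simp add: normal_density_def power_divide real_sqrt_mult field_simps)
 have "(\<integral>\<^sup>+s. ennreal (exp (- ((s - c)\<^sup>2 / r\<^sup>2))) \<partial>lborel)
   = (\<integral>\<^sup>+s. ennreal (sqrt pi * r) * ennreal (normal_density c (r / sqrt 2) s) \<partial>lborel)"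
  using assms by (intro nn_integral_cong) (simp add: eq ennreal_mult)
 also have "... = ennreal (sqrt pi * r) * (\<integral>\<^sup>+s. ennreal (normal_density c (r / sqrt 2) s) \<partial>lborel)"
  by (rule nn_integral_cmult) auto
 also have "(\<integral>\<^sup>+s. ennreal (normal_density c (r / sqrt 2) s) \<partial>lborel) = 1"
  using \<sigma> by (simp add: nn_integral_eq_integral)
 finally show ?thesis by simp
qed

lemma norm_vec_sq: "(norm (x :: real^'n::finite))\<^sup>2 = (\<Sum>i\<in>UNIV. (x $ i)\<^sup>2)"
 by (simp add: norm_vec_def L2_set_def sum_nonneg)

lemma exp_norm_prod:
 "exp (- ((norm (et - ze :: real^'n::finite))\<^sup>2 / r\<^sup>2)) = (\<Prod>i\<in>UNIV. exp (- ((et $ i - ze $ i)\<^sup>2 / r\<^sup>2)))"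
 by (simp add: norm_vec_sq exp_sum[symmetric] sum_divide_distrib sum_negf)

lemma nn_integral_gaussian_vec:
 fixes ze :: "real^'n::finite"
 assumes "r > 0"
 shows "(\<integral>\<^sup>+et. ennreal (exp (- ((norm (et - ze))\<^sup>2 / r\<^sup>2))) \<partial>lborel) = ennreal ((sqrt pi * r) ^ CARD('n))"
proof -
 have "(\<integral>\<^sup>+et. ennreal (exp (- ((norm (et - ze))\<^sup>2 / r\<^sup>2))) \<partial>lborel)
  = (\<integral>\<^sup>+et. (\<Prod>i\<in>UNIV. ennreal (exp (- ((et $ i - ze $ i)\<^sup>2 / r\<^sup>2)))) \<partial>lborel)"
  by (simp add: exp_norm_prod prod_ennreal)
 also have "... = (\<Prod>i\<in>UNIV. \<integral>\<^sup>+s. ennreal (exp (- ((s - ze $ i)\<^sup>2 / r\<^sup>2))) \<partial>lborel)"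
  by (rule nn_integral_vec_prod) measurable
 also have "... = ennreal ((sqrt pi * r) ^ CARD('n))"
  using assms by (simp add: nn_integral_gaussian ennreal_power)
 finally show ?thesis .
qed

lemma nn_integral_exp_abs:
 assumes "Y > 0"
 shows "(\<integral>\<^sup>+s. ennreal (exp (- (Y * \<bar>s\<bar>))) \<partial>lborel) <= ennreal (2 / Y)"
proof -
 have half: "(\<integral>\<^sup>+s. ennreal (exp (- (Y * s))) * indicator {0..} s \<partial>lborel) = ennreal (1 / Y)"
  using nn_integral_has_integral_lebesgue[OF _ has_integral_exp_minus_to_infinity[OF assms, of 0]]
  by (simp add: nn_integral_completion mult.commute indicator_mult_ennreal)
 have "(\<integral>\<^sup>+s. ennreal (exp (- (Y * \<bar>s\<bar>))) \<partial>lborel)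
   <= (\<integral>\<^sup>+s. ennreal (exp (- (Y * s))) * indicator {0..} s
      + ennreal (exp (- (Y * (- s)))) * indicator {0..} (- s) \<partial>lborel)"
  by (intro nn_integral_mono) (auto simp: indicator_def abs_if)
 also have "... = (\<integral>\<^sup>+s. ennreal (exp (- (Y * s))) * indicator {0..} s \<partial>lborel)
   + (\<integral>\<^sup>+s. ennreal (exp (- (Y * (- s)))) * indicator {0..} (- s) \<partial>lborel)"
  by (rule nn_integral_add) auto
 also have "(\<integral>\<^sup>+s. ennreal (exp (- (Y * (- s)))) * indicator {0..} (- s) \<partial>lborel)
   = (\<integral>\<^sup>+s. ennreal (exp (- (Y * s))) * indicator {0..} s \<partial>lborel)"
  using nn_integral_real_affine[of "%s. ennreal (exp (- (Y * s))) * indicator {0..} s" "-1" 0]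
  by simp
 finally show ?thesis unfolding half using assms
  by (simp flip: ennreal_plus)
qed

lemma nn_integral_even_le:
 assumes [measurable]: "f \<in> borel_measurable borel"
 shows "(\<integral>\<^sup>+s. f \<bar>s\<bar> \<partial>(lborel :: real measure)) <= 2 * (\<integral>\<^sup>+s. f s * indicator {0..} s \<partial>lborel)"
proof -
 have "(\<integral>\<^sup>+s. f \<bar>s\<bar> \<partial>lborel) <= (\<integral>\<^sup>+s. f s * indicator {0..} s + f (- s) * indicator {0..} (- s) \<partial>lborel)"
  by (intro nn_integral_mono) (auto simp: indicator_def abs_if)
 also have "... = (\<integral>\<^sup>+s. f s * indicator {0..} s \<partial>lborel) + (\<integral>\<^sup>+s. f (- s) * indicator {0..} (- s) \<partial>lborel)"
  by (rule nn_integral_add) auto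
 also have "(\<integral>\<^sup>+s. f (- s) * indicator {0..} (- s) \<partial>lborel) = (\<integral>\<^sup>+s. f s * indicator {0..} s \<partial>lborel)"
  using nn_integral_real_affine[of "%s. f s * indicator {0..} s" "-1" 0] by simp
 finally show ?thesis by (simp add: mult_2)
qed

lemma nn_integral_weight_near:
 assumes "0 <= be" "be < 1" "0 <= A" "0 <= ta"
 shows "(\<integral>\<^sup>+s. ennreal ((ta + \<bar>s\<bar>) powr (- be)) * indicator {-A..A} s \<partial>lborel)
  <= ennreal (2 * A powr (1 - be) / (1 - be))"
proof -
 let ?f = "%s. ennreal (s powr (- be)) * indicator {..A} s"
 have "(\<integral>\<^sup>+s. ennreal ((ta + \<bar>s\<bar>) powr (- be)) * indicator {-A..A} s \<partial>lborel) <= (\<integral>\<^sup>+s. ?f \<bar>s\<bar> \<partial>lborel)"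
 proof (rule nn_integral_mono_AE)
  \<comment> \<open>\<open>0 powr a\<close> is 0, so at \<open>s = 0\<close> the comparison fails
    for \<open>ta > 0\<close>; a null set is discarded.\<close>
  show "AE s in lborel. ennreal ((ta + \<bar>s\<bar>) powr (- be)) * indicator {-A..A} s <= ?f \<bar>s\<bar>"
   using AE_lborel_singleton[of "0::real"]
  proof eventually_elim
   case (elim s)
   then have "(ta + \<bar>s\<bar>) powr (- be) <= \<bar>s\<bar> powr (- be)"
    using assms by (intro powr_mono2') auto
   then show ?case by (auto simp: indicator_def ennreal_leI abs_le_iff)
  qed
 qed
 also have "... <= 2 * (\<integral>\<^sup>+s. ?f s * indicator {0..} s \<partial>lborel)"
  by (rule nn_integral_even_le) measurable
 also have "(\<integral>\<^sup>+s. ?f s * indicator {0..} s \<partial>lborel) = (\<integral>\<^sup>+s. ennreal (s powr (- be)) * indicator {0..A} s \<partial>lborel)"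
  by (intro nn_integral_cong) (auto simp: indicator_def)
 also have "... = ennreal (A powr (- be + 1) / (- be + 1))"
  using assms by (intro nn_integral_has_integral_lebesgue' has_integral_powr_from_0) auto
 finally show ?thesis
  using assms by (simp add: ennreal_mult'[symmetric, of 2, simplified])
qed

lemma nn_integral_weight_far:
 assumes "0 < A" "0 <= ta"
 shows "(\<integral>\<^sup>+s. ennreal ((ta + \<bar>s\<bar>) powr (- (3/2))) * indicator {A..} \<bar>s\<bar> \<partial>lborel)
  <= ennreal (4 * A powr (- (1/2)))"
proof -
 let ?f = "%s. ennreal (s powr (- (3/2))) * indicator {A..} s"
 have "(\<integral>\<^sup>+s. ennreal ((ta + \<bar>s\<bar>) powr (- (3/2))) * indicator {A..} \<bar>s\<bar> \<partial>lborel) <= (\<integral>\<^sup>+s. ?f \<bar>s\<bar> \<partial>lborel)"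
  using assms by (intro nn_integral_mono) (auto simp: indicator_def intro!: ennreal_leI powr_mono2')
 also have "... <= 2 * (\<integral>\<^sup>+s. ?f s * indicator {0..} s \<partial>lborel)"
  by (rule nn_integral_even_le) measurable
 also have "(\<integral>\<^sup>+s. ?f s * indicator {0..} s \<partial>lborel) = (\<integral>\<^sup>+s. ennreal (s powr (- (3/2))) * indicator {A..} s \<partial>lborel)"
  using assms by (intro nn_integral_cong) (auto simp: indicator_def)
 also have "... = ennreal (- (A powr (- (3/2) + 1)) / (- (3/2) + 1))"
  using assms by (intro nn_integral_has_integral_lebesgue' has_integral_powr_to_inf) auto
 finally show ?thesis
  using assms by (simp add: ennreal_mult'[symmetric, of 2, simplified])
qed

text \<open>The integral is cut at \<open>\<bar>s\<bar> = A\<close>: inside, the weight is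
  integrated and \<open>g\<close> is at most 1; outside, the weight is at most
  \<open>A powr (- be)\<close> and \<open>g\<close> is integrated. The bound on \<open>be\<close>
  keeps the factor \<open>1 / (1 - be)\<close> below 2.\<close>

lemma nn_integral_weight_mult:
 fixes g :: "real => real"
 assumes "0 <= be" "be <= 1/2" "0 < A" "0 <= ta"
  and [measurable]: "g \<in> borel_measurable borel" and g: "\<And>s. 0 <= g s" "\<And>s. g s <= 1"
  and G: "(\<integral>\<^sup>+s. g s \<partial>lborel) <= ennreal (G * A)" "0 <= G"
 shows "(\<integral>\<^sup>+s. ennreal ((ta + \<bar>s\<bar>) powr (- be) * g s) \<partial>lborel) <= ennreal ((4 + G) * A powr (1 - be))"
proof -
 have "(\<integral>\<^sup>+s. ennreal ((ta + \<bar>s\<bar>) powr (- be) * g s) \<partial>lborel)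
  <= (\<integral>\<^sup>+s. ennreal ((ta + \<bar>s\<bar>) powr (- be)) * indicator {-A..A} s + ennreal (A powr (- be)) * g s \<partial>lborel)"
 proof (rule nn_integral_mono)
  fix s :: real
  show "ennreal ((ta + \<bar>s\<bar>) powr (- be) * g s)
   <= ennreal ((ta + \<bar>s\<bar>) powr (- be)) * indicator {-A..A} s + ennreal (A powr (- be)) * g s"
  proof (cases "\<bar>s\<bar> <= A")
   case True
   then have "ennreal ((ta + \<bar>s\<bar>) powr (- be) * g s) <= ennreal ((ta + \<bar>s\<bar>) powr (- be))"
    using g[of s] by (intro ennreal_leI mult_left_le) auto
   then show ?thesis using True by (auto simp: indicator_def abs_le_iff intro: order_trans add_increasing2)
  next
   case False
   then have "(ta + \<bar>s\<bar>) powr (- be) <= A powr (- be)"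
    using assms by (intro powr_mono2') auto
   then have "(ta + \<bar>s\<bar>) powr (- be) * g s <= A powr (- be) * g s"
    using g[of s] by (intro mult_right_mono) auto
   then show ?thesis using g[of s] by (auto simp: ennreal_mult'[symmetric] intro!: add_increasing ennreal_leI)
  qed
 qed
 also have "... = (\<integral>\<^sup>+s. ennreal ((ta + \<bar>s\<bar>) powr (- be)) * indicator {-A..A} s \<partial>lborel)
   + ennreal (A powr (- be)) * (\<integral>\<^sup>+s. g s \<partial>lborel)"
  by (subst nn_integral_add) (auto simp: nn_integral_cmult)
 also have "... <= ennreal (2 * A powr (1 - be) / (1 - be)) + ennreal (A powr (- be)) * ennreal (G * A)"
  using assms by (intro add_mono mult_left_mono nn_integral_weight_near) auto
 also have "... = ennreal (2 * A powr (1 - be) / (1 - be) + A powr (- be) * (G * A))"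
  using assms by (simp add: ennreal_mult'[symmetric] ennreal_plus[symmetric] del: ennreal_plus)
 also have "... <= ennreal ((4 + G) * A powr (1 - be))"
 proof (rule ennreal_leI)
  have "2 * A powr (1 - be) / (1 - be) <= 4 * A powr (1 - be)"
   using assms by (simp add: field_simps)
  moreover have "A powr (- be) * (G * A) = G * A powr (1 - be)"
   using assms by (simp add: powr_diff powr_minus field_simps)
  ultimately show "2 * A powr (1 - be) / (1 - be) + A powr (- be) * (G * A) <= (4 + G) * A powr (1 - be)"
   by (simp only: distrib_right)
 qed
 finally show ?thesis .
qed

text \<open>Distributing the exponent \<open>q\<close> over the coordinates makes the radial weight
  a product, to which Tonelli's theorem applies. Different distributions are used in different
  regions.\<close>

lemma inverse_power_le_prod_powr:
 fixes et :: "real^'n::finite"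
 assumes "0 < ta" and be: "\<And>i. 0 <= be i" "(\<Sum>i\<in>UNIV. be i) = real q"
 shows "1 / (ta + norm et) ^ q <= (\<Prod>i\<in>UNIV. (ta + \<bar>et $ i\<bar>) powr (- be i))"
proof -
 have pos: "ta + norm et > 0" using assms by (simp add: add_pos_nonneg)
 have "1 / (ta + norm et) ^ q = (ta + norm et) powr (\<Sum>i\<in>UNIV. - be i)"
  using pos by (simp add: sum_negf be powr_minus powr_realpow divide_inverse)
 also have "... = (\<Prod>i\<in>UNIV. (ta + norm et) powr (- be i))"
  using pos by (intro powr_sum) auto
 also have "... <= (\<Prod>i\<in>UNIV. (ta + \<bar>et $ i\<bar>) powr (- be i))"
  using assms component_le_norm_cart[of et] by (intro prod_mono conjI powr_mono2') (auto intro: add_pos_nonneg)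
 finally show ?thesis .
qed

text \<open>An equal share \<open>q / n\<close> for each coordinate is at most 1/2 exactly because
  \<open>2 * q \<le> n\<close>. Each one-dimensional singularity is then integrable with a bound
  that does not involve \<open>ta\<close>.\<close>

lemma nn_integral_weight_vec:
 fixes g :: "'n::finite => real => real"
 assumes q: "2 * q <= CARD('n)" and "0 < A" "0 < ta"
  and [measurable]: "\<And>i. g i \<in> borel_measurable borel"
  and g: "\<And>i s. 0 <= g i s" "\<And>i s. g i s <= 1"
  and G: "\<And>i. (\<integral>\<^sup>+s. g i s \<partial>lborel) <= ennreal (G * A)" "0 <= G"
 shows "(\<integral>\<^sup>+et. ennreal (1 / (ta + norm et) ^ q * (\<Prod>i\<in>UNIV. g i (et $ i))) \<partial>(lborel :: (real^'n) measure))
  <= ennreal ((4 + G) ^ CARD('n) * A ^ (CARD('n) - q))"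
proof -
 define be where "be = real q / real CARD('n)"
 have n: "real CARD('n) > 0" by simp
 have be: "0 <= be" "be <= 1/2" "real CARD('n) * be = real q"
  using q n by (auto simp: be_def field_simps)
 have "(\<integral>\<^sup>+et. ennreal (1 / (ta + norm et) ^ q * (\<Prod>i\<in>UNIV. g i (et $ i))) \<partial>(lborel :: (real^'n) measure))
  <= (\<integral>\<^sup>+et. (\<Prod>i\<in>UNIV. ennreal ((ta + \<bar>et $ i\<bar>) powr (- be) * g i (et $ i))) \<partial>(lborel :: (real^'n) measure))"
 proof (rule nn_integral_mono)
  fix et :: "real^'n"
  have "1 / (ta + norm et) ^ q * (\<Prod>i\<in>UNIV. g i (et $ i))
   <= (\<Prod>i\<in>UNIV. (ta + \<bar>et $ i\<bar>) powr (- be)) * (\<Prod>i\<in>UNIV. g i (et $ i))"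
   using assms be by (intro mult_right_mono inverse_power_le_prod_powr prod_nonneg) auto
  then show "ennreal (1 / (ta + norm et) ^ q * (\<Prod>i\<in>UNIV. g i (et $ i)))
   <= (\<Prod>i\<in>UNIV. ennreal ((ta + \<bar>et $ i\<bar>) powr (- be) * g i (et $ i)))"
   using g by (subst prod_ennreal) (auto simp: prod.distrib intro!: ennreal_leI)
 qed
 also have "... = (\<Prod>i\<in>UNIV. \<integral>\<^sup>+s. ennreal ((ta + \<bar>s\<bar>) powr (- be) * g i s) \<partial>lborel)"
  by (rule nn_integral_vec_prod) measurable
 also have "... <= (\<Prod>i\<in>(UNIV::'n set). ennreal ((4 + G) * A powr (1 - be)))"
  using assms be by (intro prod_mono_ennreal nn_integral_weight_mult) auto
 also have "... = ennreal ((4 + G) ^ CARD('n) * (A powr (1 - be)) ^ CARD('n))"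
  using assms by (simp add: ennreal_power power_mult_distrib)
 also have "(A powr (1 - be)) ^ CARD('n) = A ^ (CARD('n) - q)"
 proof -
  have "(A powr (1 - be)) ^ CARD('n) = A powr ((1 - be) * real CARD('n))"
   using assms by (simp add: powr_powr[symmetric] powr_realpow)
  also have "(1 - be) * real CARD('n) = real (CARD('n) - q)"
   using be q by (simp add: algebra_simps of_nat_diff)
  also have "A powr real (CARD('n) - q) = A ^ (CARD('n) - q)"
   using \<open>0 < A\<close> by (rule powr_realpow)
  finally show ?thesis .
 qed
 finally show ?thesis .
qed

lemma nn_integral_weight_gaussian:
 fixes ze :: "real^'n::finite"
 assumes "2 * q <= CARD('n)" "0 < r" "0 < ta"
 shows "(\<integral>\<^sup>+et. ennreal (1 / (ta + norm et) ^ q * exp (- ((norm (et - ze))\<^sup>2 / r\<^sup>2))) \<partial>lborel)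
  <= ennreal ((4 + sqrt pi) ^ CARD('n) * r ^ (CARD('n) - q))"
 unfolding exp_norm_prod using assms
 by (intro nn_integral_weight_vec) (auto simp: nn_integral_gaussian)

lemma nn_integral_weight_cube:
 assumes "2 * q <= CARD('n::finite)" "0 < a" "0 < ta"
 shows "(\<integral>\<^sup>+et. ennreal (1 / (ta + norm et) ^ q * (\<Prod>i\<in>UNIV. indicator {-a..a} (et $ i)))
   \<partial>(lborel :: (real^'n) measure)) <= ennreal (6 ^ CARD('n) * a ^ (CARD('n) - q))"
 using assms nn_integral_weight_vec[of q a ta "%i. indicator {-a..a}" 2]
 by (simp add: ennreal_indicator)

lemma nn_integral_exp_norm:
 assumes "c > 0"
 shows "(\<integral>\<^sup>+et. ennreal (exp (- (c * norm (et - ze)))) \<partial>(lborel :: (real^'n::finite) measure))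
  <= ennreal ((2 * real CARD('n) / c) ^ CARD('n))"
proof -
 let ?c = "c / real CARD('n)"
 have c: "?c > 0" using assms by simp
 have "(\<integral>\<^sup>+et. ennreal (exp (- (c * norm (et - ze)))) \<partial>(lborel :: (real^'n) measure))
  = (\<integral>\<^sup>+et. ennreal (exp (- (c * norm (et)))) \<partial>(lborel :: (real^'n) measure))"
  using nn_integral_lborel_shift[of "%et. ennreal (exp (- (c * norm et)))" "- ze"] by simp
 also have "... <= (\<integral>\<^sup>+et. (\<Prod>i\<in>UNIV. ennreal (exp (- (?c * \<bar>et $ i\<bar>)))) \<partial>(lborel :: (real^'n) measure))"
 proof (rule nn_integral_mono)
  fix et :: "real^'n"
  have "(\<Sum>i\<in>UNIV. \<bar>et $ i\<bar>) <= (\<Sum>i\<in>(UNIV::'n set). norm et)"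
   by (intro sum_mono component_le_norm_cart)
  then have "?c * (\<Sum>i\<in>UNIV. \<bar>et $ i\<bar>) <= ?c * (real CARD('n) * norm et)"
   using c by (intro mult_left_mono) auto
  then have "exp (- (c * norm et)) <= (\<Prod>i\<in>UNIV. exp (- (?c * \<bar>et $ i\<bar>)))"
   by (simp add: exp_sum[symmetric] sum_negf sum_distrib_left)
  then show "ennreal (exp (- (c * norm et))) <= (\<Prod>i\<in>UNIV. ennreal (exp (- (?c * \<bar>et $ i\<bar>))))"
   by (subst prod_ennreal) (auto intro!: ennreal_leI)
 qed
 also have "... = (\<Prod>i\<in>(UNIV::'n set). \<integral>\<^sup>+s. ennreal (exp (- (?c * \<bar>s\<bar>))) \<partial>lborel)"
  by (rule nn_integral_vec_prod[where f = "%i s. ennreal (exp (- (?c * \<bar>s\<bar>)))"]) measurable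
 also have "... <= (\<Prod>i\<in>(UNIV::'n set). ennreal (2 / ?c))"
  by (intro prod_mono_ennreal nn_integral_exp_abs c)
 also have "... = ennreal ((2 * real CARD('n) / c) ^ CARD('n))"
  using assms by (simp add: ennreal_power)
 finally show ?thesis .
qed

text \<open>There is no exponential decay in direction \<open>k\<close>, so the weight itself has to
  provide integrability there. For \<open>\<bar>et $ k\<bar> \<le> 1 / Y\<close> equal shares
  suffice. Beyond, direction \<open>k\<close> receives the exponent 3/2, which is integrable at
  infinity, and the other coordinates share the remaining \<open>q - 3/2\<close>, again at most 1/2
  each.\<close>

lemma nn_integral_weight_slab:
 fixes k :: "'n::finite"
 assumes q: "2 <= q" "2 * q <= CARD('n)" and "0 < Y" "0 < ta"
 shows "(\<integral>\<^sup>+et. ennreal (1 / (ta + norm et) ^ q * exp (- (Y * (\<Sum>j\<in>UNIV - {k}. \<bar>et $ j\<bar>))))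
   \<partial>(lborel :: (real^'n) measure)) <= ennreal (2 * 6 ^ CARD('n) / Y ^ (CARD('n) - q))"
proof -
 define be where "be = real q / real CARD('n)"
 define be' where "be' = (real q - 3/2) / (real CARD('n) - 1)"
 have n: "real CARD('n) > 0" "real CARD('n) > 1" "real CARD('n) \<ge> 4" using q by auto
 have be: "0 <= be" "be <= 1/2" "real CARD('n) * be = real q"
  using q n by (auto simp: be_def field_simps)
 have be': "0 <= be'" "be' <= 1/2" "(real CARD('n) - 1) * be' = real q - 3/2"
  using q n by (auto simp: be'_def field_simps)
 have cardk: "card (UNIV - {k}) = CARD('n) - 1" by simp
 have split: "(\<Prod>i\<in>UNIV. h i) = h k * (\<Prod>i\<in>UNIV - {k}. h i)" for h :: "'n => 'z::comm_monoid_mult"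
  by (simp add: prod.remove[of UNIV k])
 define f where "f = (%i s. if i = k then (ta + \<bar>s\<bar>) powr (- be) * indicator {-(1/Y)..1/Y} s
   else (ta + \<bar>s\<bar>) powr (- be) * exp (- (Y * \<bar>s\<bar>)))"
 define f' where "f' = (%i s. if i = k then (ta + \<bar>s\<bar>) powr (- (3/2)) * indicator {1/Y..} \<bar>s\<bar>
   else (ta + \<bar>s\<bar>) powr (- be') * exp (- (Y * \<bar>s\<bar>)))"
 have [measurable]: "f i \<in> borel_measurable borel" "f' i \<in> borel_measurable borel" for i
  unfolding f_def f'_def by (cases "i = k"; simp; measurable)+
 have nn: "0 <= f i s" "0 <= f' i s" for i s unfolding f_def f'_def by auto
 have e: "exp (- (Y * (\<Sum>j\<in>UNIV - {k}. \<bar>et $ j\<bar>))) = (\<Prod>j\<in>UNIV - {k}. exp (- (Y * \<bar>et $ j\<bar>)))" for et :: "real^'n"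
  by (simp add: exp_sum[symmetric] sum_negf sum_distrib_left)
 have "(\<integral>\<^sup>+et. ennreal (1 / (ta + norm et) ^ q * exp (- (Y * (\<Sum>j\<in>UNIV - {k}. \<bar>et $ j\<bar>)))) \<partial>(lborel :: (real^'n) measure))
  <= (\<integral>\<^sup>+et. (\<Prod>i\<in>UNIV. ennreal (f i (et $ i))) + (\<Prod>i\<in>UNIV. ennreal (f' i (et $ i))) \<partial>(lborel :: (real^'n) measure))"
 proof (rule nn_integral_mono)
  fix et :: "real^'n"
  have "1 / (ta + norm et) ^ q * exp (- (Y * (\<Sum>j\<in>UNIV - {k}. \<bar>et $ j\<bar>)))
   <= (\<Prod>i\<in>UNIV. f i (et $ i)) + (\<Prod>i\<in>UNIV. f' i (et $ i))"
  proof (cases "\<bar>et $ k\<bar> <= 1 / Y")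
   case True
   have "1 / (ta + norm et) ^ q * exp (- (Y * (\<Sum>j\<in>UNIV - {k}. \<bar>et $ j\<bar>)))
     <= (\<Prod>i\<in>UNIV. (ta + \<bar>et $ i\<bar>) powr (- be)) * exp (- (Y * (\<Sum>j\<in>UNIV - {k}. \<bar>et $ j\<bar>)))"
    using assms be by (intro mult_right_mono inverse_power_le_prod_powr) auto
   also have "... = (\<Prod>i\<in>UNIV. f i (et $ i))"
    unfolding e split using True by (auto simp: f_def prod.distrib indicator_def abs_le_iff)
   finally show ?thesis using nn by (simp add: add_increasing2 prod_nonneg)
  next
   case False
   define b where "b = (%i. if i = k then 3/2 else be')"
   have "(\<Sum>i\<in>UNIV. b i) = 3/2 + (\<Sum>i\<in>UNIV - {k}. b i)"
    by (simp add: sum.remove[of UNIV k] b_def)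
   also have "(\<Sum>i\<in>UNIV - {k}. b i) = (real CARD('n) - 1) * be'"
    using n by (simp add: b_def of_nat_diff)
   finally have b: "(\<Sum>i\<in>UNIV. b i) = real q" using be' by simp
   have "1 / (ta + norm et) ^ q * exp (- (Y * (\<Sum>j\<in>UNIV - {k}. \<bar>et $ j\<bar>)))
     <= (\<Prod>i\<in>UNIV. (ta + \<bar>et $ i\<bar>) powr (- b i)) * exp (- (Y * (\<Sum>j\<in>UNIV - {k}. \<bar>et $ j\<bar>)))"
    using assms be' b by (intro mult_right_mono inverse_power_le_prod_powr) (auto simp: b_def)
   also have "... = (\<Prod>i\<in>UNIV. f' i (et $ i))"
    unfolding e split using False by (auto simp: f'_def b_def prod.distrib indicator_def)
   finally show ?thesis using nn by (simp add: add_increasing prod_nonneg)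
  qed
  then have "ennreal (1 / (ta + norm et) ^ q * exp (- (Y * (\<Sum>j\<in>UNIV - {k}. \<bar>et $ j\<bar>))))
   <= ennreal ((\<Prod>i\<in>UNIV. f i (et $ i)) + (\<Prod>i\<in>UNIV. f' i (et $ i)))" by (rule ennreal_leI)
  then show "ennreal (1 / (ta + norm et) ^ q * exp (- (Y * (\<Sum>j\<in>UNIV - {k}. \<bar>et $ j\<bar>))))
   <= (\<Prod>i\<in>UNIV. ennreal (f i (et $ i))) + (\<Prod>i\<in>UNIV. ennreal (f' i (et $ i)))"
   using nn by (simp add: prod_ennreal prod_nonneg)
 qed
 also have "... = (\<integral>\<^sup>+et. (\<Prod>i\<in>UNIV. ennreal (f i (et $ i))) \<partial>(lborel :: (real^'n) measure))
   + (\<integral>\<^sup>+et. (\<Prod>i\<in>UNIV. ennreal (f' i (et $ i))) \<partial>(lborel :: (real^'n) measure))"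
  by (rule nn_integral_add) measurable
 also have "... = (\<Prod>i\<in>UNIV. \<integral>\<^sup>+s. ennreal (f i s) \<partial>lborel) + (\<Prod>i\<in>UNIV. \<integral>\<^sup>+s. ennreal (f' i s) \<partial>lborel)"
  by (intro arg_cong2[where f = "(+)"] nn_integral_vec_prod) measurable
 also have "... <= ennreal (6 ^ CARD('n) / Y ^ (CARD('n) - q)) + ennreal (6 ^ CARD('n) / Y ^ (CARD('n) - q))"
 proof (rule add_mono)
  have invY: "(1 / Y) powr x = Y powr (- x)" for x using \<open>0 < Y\<close> by (simp add: powr_def ln_inverse ln_div exp_minus)
  have side: "(\<integral>\<^sup>+s. ennreal ((ta + \<bar>s\<bar>) powr (- b) * exp (- (Y * \<bar>s\<bar>))) \<partial>lborel) <= ennreal (6 * Y powr (b - 1))"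
   if "0 <= b" "b <= 1/2" for b
   using nn_integral_weight_mult[of b "1/Y" ta "%s. exp (- (Y * \<bar>s\<bar>))" 2] assms that
    nn_integral_exp_abs[of Y] by (simp add: invY)
  have Ypow: "Y powr (real q - real CARD('n)) = 1 / Y ^ (CARD('n) - q)"
  proof -
   have "real q - real CARD('n) = - real (CARD('n) - q)" using q by (simp add: of_nat_diff)
   then show ?thesis using \<open>0 < Y\<close> by (simp only: powr_minus powr_realpow) (simp add: divide_inverse)
  qed
  have "(\<Prod>i\<in>UNIV. \<integral>\<^sup>+s. ennreal (f i s) \<partial>lborel) <= (\<Prod>i\<in>(UNIV::'n set). ennreal (6 * Y powr (be - 1)))"
  proof (rule prod_mono_ennreal)
   fix i :: 'n
   show "(\<integral>\<^sup>+s. ennreal (f i s) \<partial>lborel) <= ennreal (6 * Y powr (be - 1))"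
   proof (cases "i = k")
    case True
    have "(\<integral>\<^sup>+s. ennreal (f i s) \<partial>lborel) <= ennreal (2 * (1/Y) powr (1 - be) / (1 - be))"
     using nn_integral_weight_near[of be "1/Y" ta] assms be True
     by (simp add: f_def ennreal_mult' ennreal_indicator)
    also have "... <= ennreal (6 * Y powr (be - 1))"
    proof (rule ennreal_leI)
     have "2 * Y powr (be - 1) <= 6 * Y powr (be - 1) * (1 - be)"
      using mult_left_mono[of "1/3" "1 - be" "6 * Y powr (be - 1)"] be by simp
     then show "2 * (1/Y) powr (1 - be) / (1 - be) <= 6 * Y powr (be - 1)"
      using be by (simp add: invY field_simps)
    qed
    finally show ?thesis .
   qed (use side[OF be(1,2)] in \<open>simp add: f_def\<close>)
  qed
  also have "... = ennreal (6 ^ CARD('n) * (Y powr (be - 1)) ^ CARD('n))"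
   using assms by (simp add: ennreal_power power_mult_distrib)
  also have "(Y powr (be - 1)) ^ CARD('n) = Y powr (real q - real CARD('n))"
  proof -
   have "(Y powr (be - 1)) ^ CARD('n) = Y powr ((be - 1) * real CARD('n))"
    using assms by (simp add: powr_powr[symmetric] powr_realpow)
   then show ?thesis using be by (simp add: algebra_simps)
  qed
  finally show "(\<Prod>i\<in>UNIV. \<integral>\<^sup>+s. ennreal (f i s) \<partial>lborel) <= ennreal (6 ^ CARD('n) / Y ^ (CARD('n) - q))"
   by (simp add: Ypow)
  have "(\<Prod>i\<in>UNIV. \<integral>\<^sup>+s. ennreal (f' i s) \<partial>lborel)
   <= ennreal (6 * Y powr (1/2)) * (\<Prod>i\<in>UNIV - {k}. ennreal (6 * Y powr (be' - 1)))"
  proof (subst split, rule mult_mono)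
   have "(\<integral>\<^sup>+s. ennreal (f' k s) \<partial>lborel) <= ennreal (4 * (1/Y) powr (- (1/2)))"
    using nn_integral_weight_far[of "1/Y" ta] assms
    by (simp add: f'_def ennreal_mult' ennreal_indicator)
   also have "... <= ennreal (6 * Y powr (1/2))"
    by (rule ennreal_leI) (simp add: invY)
   finally show "(\<integral>\<^sup>+s. ennreal (f' k s) \<partial>lborel) <= ennreal (6 * Y powr (1/2))" .
   show "(\<Prod>i\<in>UNIV - {k}. \<integral>\<^sup>+s. ennreal (f' i s) \<partial>lborel) <= (\<Prod>i\<in>UNIV - {k}. ennreal (6 * Y powr (be' - 1)))"
    using side[OF be'(1,2)] by (intro prod_mono_ennreal) (auto simp: f'_def)
  qed auto
  also have "... = ennreal (6 ^ CARD('n) * (Y powr (1/2) * (Y powr (be' - 1)) ^ (CARD('n) - 1)))"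
  proof -
   have "(6::real) ^ CARD('n) = 6 * 6 ^ (CARD('n) - 1)"
    using n by (simp flip: power_Suc)
   then show ?thesis
    using assms by (simp add: ennreal_power power_mult_distrib ennreal_mult'[symmetric] mult_ac)
  qed
  also have "Y powr (1/2) * (Y powr (be' - 1)) ^ (CARD('n) - 1) = Y powr (real q - real CARD('n))"
  proof -
   have "(Y powr (be' - 1)) ^ (CARD('n) - 1) = Y powr ((be' - 1) * real (CARD('n) - 1))"
    using assms by (simp only: powr_powr[symmetric]) (rule powr_realpow[symmetric], simp)
   moreover have "1/2 + (be' - 1) * real (CARD('n) - 1) = real q - real CARD('n)"
    using be' n by (simp add: algebra_simps of_nat_diff)
   ultimately show ?thesis by (simp add: powr_add[symmetric])
  qed
  finally show "(\<Prod>i\<in>UNIV. \<integral>\<^sup>+s. ennreal (f' i s) \<partial>lborel) <= ennreal (6 ^ CARD('n) / Y ^ (CARD('n) - q))"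
   by (simp add: Ypow)
 qed
 also have "... = ennreal (2 * 6 ^ CARD('n) / Y ^ (CARD('n) - q))"
  using \<open>0 < Y\<close> by (simp add: ennreal_plus[symmetric] del: ennreal_plus)
 finally show ?thesis .
qed

section \<open>Van der Corput estimates\<close>

lemma cis_has_vector_derivative:
 assumes "(f has_real_derivative f') (at x within S)"
 shows "((%x. cis (f x)) has_vector_derivative (\<i> * of_real f' * cis (f x))) (at x within S)"
proof -
 have "((%x. exp (\<i> * of_real (f x))) has_vector_derivative (of_real f' * \<i>) * exp (\<i> * of_real (f x))) (at x within S)"
  by (rule has_vector_derivative_eq_rhs, rule field_vector_diff_chain_within[unfolded o_def, where g = "%z. exp (\<i> * z)" and f = "%x. of_real (f x)" and g' = "\<i> * exp (\<i> * of_real (f x))"])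
    (auto intro!: derivative_eq_intros has_vector_derivative_of_real assms simp flip: has_real_derivative_iff_has_vector_derivative)
 then show ?thesis by (simp add: cis_conv_exp mult_ac)
qed

lemma norm_add3_le: "norm (x + y + z) <= norm x + norm y + norm z"
 using norm_triangle_ineq[of "x + y" z] norm_triangle_ineq[of x y] by linarith

text \<open>Integration by parts against \<open>1 / D 1\<close>. Because \<open>D 2\<close> has a
  fixed sign, \<open>1 / D 1\<close> is monotone, and its total variation is bounded by its end
  values.\<close>

lemma van_der_Corput_first:
 fixes D :: "nat => real => real"
 assumes ab: "a <= b" and D: "\<And>j x. (D j has_real_derivative D (Suc j) x) (at x)"
  and L: "0 < \<Lambda>" "\<And>x. x \<in> {a..b} ==> \<Lambda> <= D 1 x"
  and sgn: "(\<forall>x\<in>{a..b}. 0 <= D 2 x) \<or> (\<forall>x\<in>{a..b}. D 2 x <= 0)"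
 shows "norm (integral {a..b} (%x. cis (D 0 x))) <= 3 / \<Lambda>"
proof -
 have cont: "continuous_on S (D j)" for j S
  using D by (meson DERIV_isCont continuous_at_imp_continuous_on)
 have D1: "(D 1 has_real_derivative D 2 x) (at x)" for x using D[of 1 x] by (simp add: numeral_2_eq_2)
 note D1' = D1[unfolded One_nat_def]
 have nz: "D 1 x > 0" if "x \<in> {a..b}" for x using L that by (meson less_le_trans)
 \<comment> \<open>The derivative of \<open>G\<close> is \<open>\<i> * cis (D 0 x)\<close> up to the
   error \<open>h\<close> introduced below; the norm of \<open>h\<close> is, up to a fixed sign, the
   derivative of \<open>- 1 / D 1\<close>.\<close>
 define G where "G = (%x. cis (D 0 x) * of_real (1 / D 1 x))"
 define g where "g = (%x. \<i> * cis (D 0 x) - cis (D 0 x) * of_real (D 2 x / (D 1 x)\<^sup>2))"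
 have "(G has_vector_derivative g x) (at x within {a..b})" if x: "x \<in> {a..b}" for x
 proof -
  have "((%x. 1 / D 1 x) has_real_derivative - D 2 x / (D 1 x)\<^sup>2) (at x within {a..b})"
   using nz[OF x] by (auto intro!: derivative_eq_intros DERIV_subset[OF D1'] simp: power2_eq_square)
  then have 1: "((%x. of_real (1 / D 1 x) :: complex) has_vector_derivative of_real (- D 2 x / (D 1 x)\<^sup>2)) (at x within {a..b})"
   by (intro has_vector_derivative_of_real) (simp add: has_real_derivative_iff_has_vector_derivative)
  have 2: "((%x. cis (D 0 x)) has_vector_derivative \<i> * of_real (D 1 x) * cis (D 0 x)) (at x within {a..b})"
   using D[of 0 x] by (intro cis_has_vector_derivative) (auto intro: DERIV_subset)
  show ?thesis
   unfolding G_def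
  proof (rule has_vector_derivative_eq_rhs[OF has_vector_derivative_mult[OF 2 1]])
   show "cis (D 0 x) * of_real (- D 2 x / (D 1 x)\<^sup>2) + \<i> * of_real (D 1 x) * cis (D 0 x) * of_real (1 / D 1 x) = g x"
    using nz[OF x] by (simp add: g_def)
  qed
 qed
 then have int: "(g has_integral G b - G a) {a..b}"
  by (intro fundamental_theorem_of_calculus ab) auto
 define h where "h = (%x. cis (D 0 x) * of_real (D 2 x / (D 1 x)\<^sup>2))"
 have ih: "h integrable_on {a..b}" unfolding h_def
  using nz by (intro integrable_continuous_interval continuous_intros cont) force
 have ic: "(%x. cis (D 0 x)) integrable_on {a..b}"
  by (intro integrable_continuous_interval continuous_intros cont)
 have eq: "\<i> * integral {a..b} (%x. cis (D 0 x)) = (G b - G a) + integral {a..b} h"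
 proof -
  have "\<i> * integral {a..b} (%x. cis (D 0 x)) = integral {a..b} (%x. \<i> * cis (D 0 x))"
   using ic by (simp add: integral_mult_right)
  also have "... = integral {a..b} (%x. g x + h x)" by (simp add: g_def h_def)
  also have "... = integral {a..b} g + integral {a..b} h"
   using int ih by (intro integral_add) auto
  finally show ?thesis using int by (simp add: integral_unique)
 qed
 have bound: "1 / D 1 x <= 1 / \<Lambda>" "0 <= 1 / D 1 x" if "x \<in> {a..b}" for x
  using L nz[OF that] that by (auto intro!: frac_le)
 have ia: "a \<in> {a..b}" and ib: "b \<in> {a..b}" using ab by auto
 have inv: "((%x. D 2 x / (D 1 x)\<^sup>2) has_integral 1 / D 1 a - 1 / D 1 b) {a..b}"
 proof -
  have "((%x. D 2 x / (D 1 x)\<^sup>2) has_integral (- 1 / D 1 b) - (- 1 / D 1 a)) {a..b}"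
  proof (rule fundamental_theorem_of_calculus[OF ab])
   fix x assume x: "x \<in> {a..b}"
   show "((%x. - 1 / D 1 x) has_vector_derivative D 2 x / (D 1 x)\<^sup>2) (at x within {a..b})"
    unfolding has_real_derivative_iff_has_vector_derivative[symmetric]
    using nz[OF x] by (auto intro!: derivative_eq_intros DERIV_subset[OF D1'] simp: power2_eq_square)
  qed
  then show ?thesis by simp
 qed
 have "norm (integral {a..b} h) <= integral {a..b} (%x. \<bar>D 2 x / (D 1 x)\<^sup>2\<bar>)"
 proof (rule integral_norm_bound_integral[OF ih])
  show "(%x. \<bar>D 2 x / (D 1 x)\<^sup>2\<bar>) integrable_on {a..b}"
   using nz by (intro integrable_continuous_interval continuous_intros cont) force
  show "norm (h x) <= \<bar>D 2 x / (D 1 x)\<^sup>2\<bar>" for x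
   by (simp only: h_def norm_mult norm_cis norm_of_real mult_1_left order_refl)
 qed
 also have "... <= 1 / \<Lambda>"
  using sgn
 proof
  assume s: "\<forall>x\<in>{a..b}. 0 <= D 2 x"
  have "integral {a..b} (%x. \<bar>D 2 x / (D 1 x)\<^sup>2\<bar>) = integral {a..b} (%x. D 2 x / (D 1 x)\<^sup>2)"
   using s by (intro integral_cong) auto
  also have "... = 1 / D 1 a - 1 / D 1 b" using inv by (rule integral_unique)
  finally show ?thesis using bound[OF ia] bound[OF ib] by linarith
 next
  assume s: "\<forall>x\<in>{a..b}. D 2 x <= 0"
  have "integral {a..b} (%x. \<bar>D 2 x / (D 1 x)\<^sup>2\<bar>) = integral {a..b} (%x. - (D 2 x / (D 1 x)\<^sup>2))"
   using s by (intro integral_cong) auto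
  also have "... = - (1 / D 1 a - 1 / D 1 b)" using has_integral_neg[OF inv] by (rule integral_unique)
  finally show ?thesis using bound[OF ia] bound[OF ib] by linarith
 qed
 finally have hb: "norm (integral {a..b} h) <= 1 / \<Lambda>" .
 have Gb: "norm (G x) <= 1 / \<Lambda>" if "x \<in> {a..b}" for x
 proof -
  have "norm (G x) = 1 / D 1 x" using nz[OF that] by (simp add: G_def norm_mult norm_divide)
  then show ?thesis using bound[OF that] by simp
 qed
 have "norm (integral {a..b} (%x. cis (D 0 x))) = norm (\<i> * integral {a..b} (%x. cis (D 0 x)))"
  by (simp add: norm_mult)
 also have "... <= norm (G b) + norm (G a) + norm (integral {a..b} h)"
  unfolding eq using norm_triangle_ineq[of "G b - G a" "integral {a..b} h"] norm_triangle_ineq4[of "G b" "G a"] by linarith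
 also have "... <= 3 / \<Lambda>" using Gb[of a] Gb[of b] hb ab by simp
 finally show ?thesis .
qed

text \<open>The point where the level \<open>v\<close> is crossed, or an end point if it is not
  crossed. The premises \<open>a < c\<close> and \<open>c < b\<close> excuse degenerate pieces, for
  which the inequality may fail.\<close>

lemma increasing_split:
 fixes f :: "real => real"
 assumes ab: "a <= b" and cont: "continuous_on {a..b} f" and mono: "\<And>x y. x \<in> {a..b} ==> y \<in> {a..b} ==> x <= y ==> f x <= f y"
 obtains c where "c \<in> {a..b}" "a < c ==> \<forall>x\<in>{a..c}. f x <= v" "c < b ==> \<forall>x\<in>{c..b}. v <= f x"
proof (cases "v <= f a")
 case True
 have "v <= f x" if "x \<in> {a..b}" for x
  using mono[of a x] that True by auto
 then show thesis using ab by (intro that[of a]) auto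
next
 case False
 show thesis
 proof (cases "f b <= v")
  case True
  have "f x <= v" if "x \<in> {a..b}" for x
   using mono[of x b] that True by auto
  then show thesis using ab by (intro that[of b]) auto
 next
  case False2: False
  then obtain c where c: "a <= c" "c <= b" "f c = v"
   using IVT'[of f a v b] False ab cont by auto
  have "f x <= v" if "x \<in> {a..c}" for x
   using mono[of x c] that c by auto
  moreover have "v <= f x" if "x \<in> {c..b}" for x
   using mono[of c x] that c by auto
  ultimately show thesis using c by (intro that[of c]) auto
 qed
qed

lemma norm_integral_cis_neg:
 assumes "continuous_on {a..b} f"
 shows "norm (integral {a..b} (%x. cis (- f x))) = norm (integral {a..b} (%x. cis (f x)))"
proof -
 have "integral {a..b} (%x. cis (- f x)) = cnj (integral {a..b} (%x. cis (f x)))"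
  using assms by (simp add: integral_cnj cis_cnj)
 then show ?thesis by simp
qed

text \<open>The recursion follows the induction below: two outer pieces contribute
  \<open>vdc_const k\<close> each, the middle piece contributes 2.\<close>

fun vdc_const :: "nat => real" where
 "vdc_const 0 = 3"
| "vdc_const (Suc k) = (if k = 0 then 3 else 2 * vdc_const k + 2)"

lemma vdc_const_pos: "vdc_const k > 0"
 by (induction k) auto

text \<open>Since \<open>D (Suc k)\<close> is at least \<open>\<Lambda>\<close>, the function
  \<open>D k\<close> increases with slope at least \<open>\<Lambda>\<close>. It has absolute value
  at least \<open>de\<close> outside an interval of length at most
  \<open>2 * (de / \<Lambda>)\<close>; outside the induction hypothesis applies, inside the trivial
  bound. The monotonicity that the case \<open>k = 1\<close> requires is supplied by the lower bound
  for the second derivative.\<close>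

lemma van_der_Corput_aux:
 fixes D :: "nat => real => real"
 assumes "a <= b" and "\<And>j x. (D j has_real_derivative D (Suc j) x) (at x)"
  and "0 < \<Lambda>" "\<And>x. x \<in> {a..b} ==> \<Lambda> <= D k x"
  and "k \<ge> 1" and "k = 1 ==> (\<forall>x\<in>{a..b}. 0 <= D 2 x) \<or> (\<forall>x\<in>{a..b}. D 2 x <= 0)"
 shows "norm (integral {a..b} (%x. cis (D 0 x))) <= vdc_const k * \<Lambda> powr (- (1 / real k))"
 using assms(5,1-4,6)
proof (induction k arbitrary: D a b \<Lambda> rule: nat_induct_at_least)
 case base
 have "norm (integral {a..b} (%x. cis (D 0 x))) <= 3 / \<Lambda>"
  using base by (intro van_der_Corput_first[where D = D]) auto
 then show ?case using base by (simp add: powr_minus divide_inverse)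
next
 case (Suc k)
 note ab = \<open>a <= b\<close> and D = Suc.prems(2) and L = Suc.prems(3,4)
 have cont: "continuous_on S (D j)" for j S
  using D by (meson DERIV_isCont continuous_at_imp_continuous_on)
 have slope: "\<Lambda> * (y - x) <= D k y - D k x" if "x \<in> {a..b}" "y \<in> {a..b}" "x <= y" for x y
 proof (cases "x < y")
  case True
  then obtain z where "x < z" "z < y" "D k y - D k x = (y - x) * D (Suc k) z"
   using MVT2[of x y "D k" "D (Suc k)"] D by blast
  moreover have "\<Lambda> * (y - x) <= D (Suc k) z * (y - x)"
   using that calculation L(2)[of z] True by (intro mult_right_mono) auto
  ultimately show ?thesis by (simp add: mult.commute)
 qed (use that in auto)
 have mono: "D k x <= D k y" if "x \<in> {a..b}" "y \<in> {a..b}" "x <= y" for x y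
 proof -
  have "0 <= \<Lambda> * (y - x)" using L(1) that by simp
  then show ?thesis using slope[OF that] by linarith
 qed
 \<comment> \<open>This level balances the two contributions: \<open>de powr (- 1 / k)\<close> and
   \<open>de / \<Lambda>\<close> are equal.\<close>
 define de where "de = \<Lambda> powr (real k / real (Suc k))"
 have de: "de > 0" using L by (simp add: de_def)
 have e1: "de powr (- (1 / real k)) = \<Lambda> powr (- (1 / real (Suc k)))"
  using Suc.hyps by (simp add: de_def powr_powr field_simps)
 have e2: "de / \<Lambda> = \<Lambda> powr (- (1 / real (Suc k)))"
 proof -
  have "de / \<Lambda> = \<Lambda> powr (real k / real (Suc k) - 1)" using L by (simp add: de_def powr_diff)
  also have "real k / real (Suc k) - 1 = - (1 / real (Suc k))" by (simp add: field_simps)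
  finally show ?thesis .
 qed
 obtain c1 where c1: "c1 \<in> {a..b}" "a < c1 ==> \<forall>x\<in>{a..c1}. D k x <= - de" "c1 < b ==> \<forall>x\<in>{c1..b}. - de <= D k x"
 proof (rule increasing_split[OF ab cont, where v = "- de"])
  show "D k x <= D k y" if "x \<in> {a..b}" "y \<in> {a..b}" "x <= y" for x y
   using that by (intro mono) auto
 qed blast
 have c1b: "c1 <= b" using c1 by auto
 obtain c2 where c2: "c2 \<in> {c1..b}" "c1 < c2 ==> \<forall>x\<in>{c1..c2}. D k x <= de" "c2 < b ==> \<forall>x\<in>{c2..b}. de <= D k x"
 proof (rule increasing_split[OF c1b cont, where v = de])
  show "D k x <= D k y" if "x \<in> {c1..b}" "y \<in> {c1..b}" "x <= y" for x y
   using that c1 by (intro mono) auto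
 qed blast
 have i: "(%x. cis (D 0 x)) integrable_on {x..y}" for x y
  by (intro integrable_continuous_interval continuous_intros cont)
 have I1: "norm (integral {a..c1} (%x. cis (D 0 x))) <= vdc_const k * de powr (- (1 / real k))"
 proof (cases "a < c1")
  case True
  have "norm (integral {a..c1} (%x. cis ((%j x. - D j x) 0 x))) <= vdc_const k * de powr (- (1 / real k))"
  proof (rule Suc.IH[where D = "%j x. - D j x"])
   show "(\<forall>x\<in>{a..c1}. 0 <= - D 2 x) \<or> (\<forall>x\<in>{a..c1}. - D 2 x <= 0)" if "k = 1"
   proof -
    have "\<forall>x\<in>{a..c1}. - D 2 x <= 0"
    proof
     fix x assume "x \<in> {a..c1}"
     then show "- D 2 x <= 0" using L(1) L(2)[of x] that c1(1) by (simp add: numeral_2_eq_2)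
    qed
    then show ?thesis by blast
   qed
   show "de <= - D k x" if "x \<in> {a..c1}" for x using c1(2) True that by force
  qed (use True D de in \<open>auto intro: DERIV_minus\<close>)
  then show ?thesis using norm_integral_cis_neg[OF cont[of _ 0], of a c1] by simp
 next
  case False
  then have "{a..c1} = {} \<or> {a..c1} = {c1}" using c1 by auto
  then show ?thesis using vdc_const_pos[of k] by auto
 qed
 have I3: "norm (integral {c2..b} (%x. cis (D 0 x))) <= vdc_const k * de powr (- (1 / real k))"
 proof (cases "c2 < b")
  case True
  show ?thesis
  proof (rule Suc.IH[where D = D])
   show "(\<forall>x\<in>{c2..b}. 0 <= D 2 x) \<or> (\<forall>x\<in>{c2..b}. D 2 x <= 0)" if "k = 1"
   proof -
    have "\<forall>x\<in>{c2..b}. 0 <= D 2 x"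
    proof
     fix x assume "x \<in> {c2..b}"
     then show "0 <= D 2 x" using L(1) L(2)[of x] that c1(1) c2(1) by (simp add: numeral_2_eq_2)
    qed
    then show ?thesis by blast
   qed
   show "de <= D k x" if "x \<in> {c2..b}" for x using c2(3) True that by force
  qed (use True D de in auto)
 next
  case False
  then have "{c2..b} = {} \<or> {c2..b} = {c2}" using c2 by auto
  then show ?thesis using vdc_const_pos[of k] by auto
 qed
 have len: "c2 - c1 <= 2 * (de / \<Lambda>)"
 proof (cases "c1 < c2")
  case True
  then have "D k c2 <= de" "- de <= D k c1" using c1 c2 by auto
  moreover have "\<Lambda> * (c2 - c1) <= D k c2 - D k c1" using slope[of c1 c2] c1(1) c2(1) True by auto
  ultimately have "\<Lambda> * (c2 - c1) <= 2 * de" by linarith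
  then show ?thesis using L by (simp add: field_simps)
 next
  case False
  then have "c2 - c1 <= 0" by simp
  also have "0 <= 2 * (de / \<Lambda>)" using de L(1) by simp
  finally show ?thesis .
 qed
 have I2: "norm (integral {c1..c2} (%x. cis (D 0 x))) <= 1 * (c2 - c1)"
  using c2 by (intro integral_bound continuous_intros cont) auto
 have "integral {a..c1} (%x. cis (D 0 x)) + integral {c1..b} (%x. cis (D 0 x)) = integral {a..b} (%x. cis (D 0 x))"
  using c1(1) i by (intro Henstock_Kurzweil_Integration.integral_combine) auto
 moreover have "integral {c1..c2} (%x. cis (D 0 x)) + integral {c2..b} (%x. cis (D 0 x)) = integral {c1..b} (%x. cis (D 0 x))"
  using c2(1) i by (intro Henstock_Kurzweil_Integration.integral_combine) auto
 ultimately have "integral {a..b} (%x. cis (D 0 x)) = integral {a..c1} (%x. cis (D 0 x))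
   + integral {c1..c2} (%x. cis (D 0 x)) + integral {c2..b} (%x. cis (D 0 x))"
  by (simp only: add.assoc)
 then have "norm (integral {a..b} (%x. cis (D 0 x))) <= norm (integral {a..c1} (%x. cis (D 0 x)))
   + norm (integral {c1..c2} (%x. cis (D 0 x))) + norm (integral {c2..b} (%x. cis (D 0 x)))"
  by (simp only: norm_add3_le)
 also have "... <= vdc_const k * de powr (- (1 / real k)) + 2 * (de / \<Lambda>) + vdc_const k * de powr (- (1 / real k))"
  using len by (intro add_mono I1 I3 order_trans[OF I2]) simp
 also have "... = vdc_const (Suc k) * \<Lambda> powr (- (1 / real (Suc k)))"
  unfolding e1 e2 using Suc.hyps by (simp add: algebra_simps)
 finally show ?case .
qed

text \<open>A continuous \<open>D k\<close> that stays away from 0 has constant sign, and a negative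
  sign is removed by complex conjugation. From order 2 on, no monotonicity assumption is
  left.\<close>

lemma van_der_Corput:
 fixes D :: "nat => real => real"
 assumes ab: "a <= b" and D: "\<And>j x. (D j has_real_derivative D (Suc j) x) (at x)"
  and L: "0 < \<Lambda>" "\<And>x. x \<in> {a..b} ==> \<Lambda> <= \<bar>D k x\<bar>" and k: "k \<ge> 2"
 shows "norm (integral {a..b} (%x. cis (D 0 x))) <= vdc_const k * \<Lambda> powr (- (1 / real k))"
proof -
 have cont: "continuous_on S (D j)" for j S
  using D by (meson DERIV_isCont continuous_at_imp_continuous_on)
 have "(\<forall>x\<in>{a..b}. \<Lambda> <= D k x) \<or> (\<forall>x\<in>{a..b}. \<Lambda> <= - D k x)"
 proof (rule ccontr)
  assume "\<not> ?thesis"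
  then obtain x y where xy: "x \<in> {a..b}" "y \<in> {a..b}" "D k x < \<Lambda>" "- D k y < \<Lambda>" by force
  then have "D k x <= 0" "0 <= D k y" using L(2)[of x] L(2)[of y] by auto
  then have "\<exists>z\<in>closed_segment x y. D k z = 0"
   using IVT'_closed_segment_real[of 0 "D k" x y] cont by (auto simp: closed_segment_eq_real_ivl)
  then obtain z where "z \<in> closed_segment x y" "D k z = 0" by blast
  moreover from this have "z \<in> {a..b}"
   using xy(1,2) by (auto simp: closed_segment_eq_real_ivl split: if_splits)
  ultimately show False using L(2)[of z] L(1) by simp
 qed
 then show ?thesis
 proof
  assume "\<forall>x\<in>{a..b}. \<Lambda> <= D k x"
  then show ?thesis using assms by (intro van_der_Corput_aux[where D = D]) auto
 next
  assume *: "\<forall>x\<in>{a..b}. \<Lambda> <= - D k x"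
  have "norm (integral {a..b} (%x. cis ((%j x. - D j x) 0 x))) <= vdc_const k * \<Lambda> powr (- (1 / real k))"
   using * assms by (intro van_der_Corput_aux[where D = "%j x. - D j x"]) (auto intro: DERIV_minus)
  then show ?thesis using norm_integral_cis_neg[OF cont[of _ 0], of a b] by simp
 qed
qed

lemma norm_integral_short_pieces:
 fixes f :: "real => complex"
 assumes cont: "continuous_on {a..b} f" and "0 < de" "0 <= M"
  and short: "\<And>x y. a <= x ==> x <= y ==> y <= b ==> y - x <= de ==> norm (integral {x..y} f) <= M"
  and "a <= b"
 shows "norm (integral {a..b} f) <= M * ((b - a) / de + 1)"
proof -
 have *: "norm (integral {a..y} f) <= M * real n" if "a <= y" "y <= b" "y - a <= real n * de" for y n
  using that
 proof (induction n arbitrary: y)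
  case 0
  then have y: "y = a" by simp
  show ?case unfolding y by simp
 next
  case (Suc n)
  define z where "z = max a (y - de)"
  have z: "a <= z" "z <= y" "y - z <= de" using Suc.prems \<open>0 < de\<close> by (auto simp: z_def)
  have "z - a <= real n * de" using Suc.prems \<open>0 < de\<close> by (auto simp: z_def algebra_simps max_def)
  then have 1: "norm (integral {a..z} f) <= M * real n" using Suc z by auto
  have 2: "norm (integral {z..y} f) <= M" using short z Suc.prems by auto
  have "f integrable_on {a..y}"
   using Suc.prems by (intro integrable_continuous_interval continuous_on_subset[OF cont]) auto
  then have "integral {a..y} f = integral {a..z} f + integral {z..y} f"
   using z Henstock_Kurzweil_Integration.integral_combine[of a z y f] by simp
  then have "norm (integral {a..y} f) <= M * real n + M"
   using norm_triangle_ineq[of "integral {a..z} f" "integral {z..y} f"] 1 2 by simp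
  then show ?case by (simp add: algebra_simps)
 qed
 define n where "n = nat \<lceil>(b - a) / de\<rceil>"
 have 1: "(b - a) / de <= real n" unfolding n_def by linarith
 have 2: "real n <= (b - a) / de + 1"
 proof -
  have "0 <= (b - a) / de" using assms by simp
  then have "real n = of_int \<lceil>(b - a) / de\<rceil>" unfolding n_def by simp
  then show ?thesis by linarith
 qed
 have "norm (integral {a..b} f) <= M * real n"
  using 1 \<open>0 < de\<close> \<open>a <= b\<close> by (intro *) (auto simp: divide_le_eq)
 also have "... <= M * ((b - a) / de + 1)"
  using 2 \<open>0 <= M\<close> by (rule mult_left_mono)
 finally show ?thesis .
qed

text \<open>Integration by parts against the primitive \<open>U\<close> of \<open>f\<close>: only
  the partial integrals of \<open>f\<close>, not \<open>f\<close> itself, enter the bound, so their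
  oscillatory decay survives the amplitude.\<close>

lemma norm_integral_amplitude:
 fixes f :: "real => complex" and A A' :: "real => real"
 assumes ab: "a <= b" and cont: "continuous_on {a..b} f" and A: "\<And>x. x \<in> {a..b} ==> (A has_real_derivative A' x) (at x within {a..b})"
  and cA: "continuous_on {a..b} A'" and B: "\<And>x. x \<in> {a..b} ==> \<bar>A x\<bar> <= B" "\<And>x. x \<in> {a..b} ==> \<bar>A' x\<bar> <= B"
  and M: "\<And>y. y \<in> {a..b} ==> norm (integral {a..y} f) <= M"
 shows "norm (integral {a..b} (%x. of_real (A x) * f x)) <= M * B * (1 + (b - a))"
proof -
 define U where "U = (%y. integral {a..y} f)"
 have U: "(U has_vector_derivative f x) (at x within {a..b})" if "x \<in> {a..b}" for x
  unfolding U_def using that by (rule integral_has_vector_derivative[OF cont])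
 have cU: "continuous_on {a..b} U"
  using U by (meson continuous_on_eq_continuous_within has_vector_derivative_continuous)
 have M0: "0 <= M" using order_trans[OF norm_ge_zero M[of a]] ab by auto
 have B0: "0 <= B" proof -
  have "\<bar>A a\<bar> <= B" using B(1)[of a] ab by auto
  then show ?thesis by linarith
 qed
 have "((%x. of_real (A' x) * U x + of_real (A x) * f x) has_integral of_real (A b) * U b - of_real (A a) * U a) {a..b}"
 proof (rule fundamental_theorem_of_calculus[OF ab])
  fix x assume x: "x \<in> {a..b}"
  have "((%x. of_real (A x) :: complex) has_vector_derivative of_real (A' x)) (at x within {a..b})"
   using A[OF x] by (intro has_vector_derivative_of_real) (simp add: has_real_derivative_iff_has_vector_derivative)
  from has_vector_derivative_mult[OF this U[OF x]]
  show "((%x. of_real (A x) * U x) has_vector_derivative of_real (A' x) * U x + of_real (A x) * f x) (at x within {a..b})"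
   by (simp add: add.commute)
 qed
 moreover have U0: "U a = 0" by (simp add: U_def)
 moreover have i: "(%x. of_real (A' x) * U x) integrable_on {a..b}"
  by (intro integrable_continuous_interval continuous_intros cA cU)
 ultimately have "((%x. (of_real (A' x) * U x + of_real (A x) * f x) - of_real (A' x) * U x) has_integral
   of_real (A b) * U b - integral {a..b} (%x. of_real (A' x) * U x)) {a..b}"
  by (intro has_integral_diff) (auto simp: integrable_integral)
 then have "integral {a..b} (%x. of_real (A x) * f x) = of_real (A b) * U b - integral {a..b} (%x. of_real (A' x) * U x)"
  by (simp add: integral_unique)
 then have "norm (integral {a..b} (%x. of_real (A x) * f x)) <= norm (of_real (A b) * U b) + norm (integral {a..b} (%x. of_real (A' x) * U x))"
  by (metis norm_triangle_ineq4)
 also have "norm (of_real (A b) * U b) <= B * M"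
  unfolding norm_mult U_def using ab B M B0 M0 by (intro mult_mono) auto
 also have "norm (integral {a..b} (%x. of_real (A' x) * U x)) <= B * M * (b - a)"
 proof (rule integral_bound[OF ab])
  show "continuous_on {a..b} (%x. of_real (A' x) * U x)" by (intro continuous_intros cA cU)
  fix x assume "x \<in> {a..b}"
  then show "norm (of_real (A' x) * U x) <= B * M"
   unfolding norm_mult U_def using B M B0 by (intro mult_mono) auto
 qed
 finally show ?thesis by (simp add: algebra_simps)
qed

text \<open>The order of the derivative that is bounded below may change from one short piece to the
  next; since \<open>\<bar>t\<bar> \<ge> 1\<close>, the worst exponent is that of the highest order
  \<open>M\<close>. The linear term \<open>p * x\<close> does not contribute to derivatives of order
  2 or more, which is why orders start at 2 and why the bound is uniform in
  \<open>p\<close>.\<close>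

lemma van_der_Corput_local:
 fixes D :: "nat => real => real"
 assumes ab: "a <= b" and D: "\<And>j x. (D j has_real_derivative D (Suc j) x) (at x)"
  and t: "\<bar>t\<bar> \<ge> 1" and c: "0 < c" "c <= 1" and de: "0 < de"
  and loc: "\<And>x. x \<in> {a..b} ==> \<exists>l\<in>{2..M}. \<forall>y\<in>{a..b}. \<bar>y - x\<bar> <= de --> c <= \<bar>D l y\<bar>"
 shows "norm (integral {a..b} (%x. cis (t * D 0 x + p * x)))
  <= (\<Sum>l\<le>M. vdc_const l) / c * \<bar>t\<bar> powr (- (1 / real M)) * ((b - a) / de + 1)"
proof -
 have t0: "\<bar>t\<bar> > 0" using t by auto
 define E where "E = (%j x. t * D j x + (if j = 0 then p * x else if j = 1 then p else 0))"
 have E: "(E j has_real_derivative E (Suc j) x) (at x)" for j x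
  unfolding E_def by (auto intro!: derivative_eq_intros D)
 have contE: "continuous_on S (E j)" for j S
  using E by (meson DERIV_isCont continuous_at_imp_continuous_on)
 have "norm (integral {a..b} (%x. cis (E 0 x)))
  <= (\<Sum>l\<le>M. vdc_const l) / c * \<bar>t\<bar> powr (- (1 / real M)) * ((b - a) / de + 1)"
 proof (rule norm_integral_short_pieces[OF _ de _ _ ab])
  fix x y assume xy: "a <= x" "x <= y" "y <= b" "y - x <= de"
  then obtain l where l: "l \<in> {2..M}" "\<And>z. z \<in> {a..b} ==> \<bar>z - x\<bar> <= de ==> c <= \<bar>D l z\<bar>"
   using loc[of x] by auto
  have "norm (integral {x..y} (%x. cis (E 0 x))) <= vdc_const l * (\<bar>t\<bar> * c) powr (- (1 / real l))"
  proof (rule van_der_Corput[where D = E])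
   fix z assume "z \<in> {x..y}"
   then have "c <= \<bar>D l z\<bar>" using l(2)[of z] xy by auto
   then show "\<bar>t\<bar> * c <= \<bar>E l z\<bar>" using l t0 by (auto simp: E_def abs_mult)
  qed (use t0 c l xy E in auto)
  also have "... <= (\<Sum>l\<le>M. vdc_const l) * (\<bar>t\<bar> powr (- (1 / real M)) * (1 / c))"
  proof (rule mult_mono)
   show "vdc_const l <= (\<Sum>l\<le>M. vdc_const l)"
    using l by (intro member_le_sum) (auto intro: less_imp_le[OF vdc_const_pos])
   have "\<bar>t\<bar> powr (- (1 / real l)) <= \<bar>t\<bar> powr (- (1 / real M))"
    using l t by (intro powr_mono) (auto intro!: frac_le)
   moreover have "c powr (- (1 / real l)) <= 1 / c"
   proof -
    have "c powr (- (1 / real l)) <= c powr (- 1)"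
     using l c by (intro powr_mono') auto
    then show ?thesis using c by (simp add: powr_minus divide_inverse)
   qed
   ultimately show "(\<bar>t\<bar> * c) powr (- (1 / real l)) <= \<bar>t\<bar> powr (- (1 / real M)) * (1 / c)"
    using c t0 mult_mono[of "\<bar>t\<bar> powr (- (1 / real l))" "\<bar>t\<bar> powr (- (1 / real M))" "c powr (- (1 / real l))" "1 / c"]
    by (subst powr_mult) auto
  qed (auto intro!: sum_nonneg less_imp_le[OF vdc_const_pos])
  finally show "norm (integral {x..y} (%x. cis (E 0 x))) <= (\<Sum>l\<le>M. vdc_const l) / c * \<bar>t\<bar> powr (- (1 / real M))"
   by (simp add: mult_ac)
 qed (use c in \<open>auto intro!: continuous_intros contE mult_nonneg_nonneg divide_nonneg_nonneg sum_nonneg less_imp_le[OF vdc_const_pos]\<close>)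
 then show ?thesis by (simp add: E_def)
qed

section \<open>Deforming one coordinate into the complex domain\<close>

definition cvec :: "real^'n => complex^'n" where
 "cvec et = (\<chi> i. of_real (et $ i))"

lemma cvec_nth [simp]: "cvec et $ i = of_real (et $ i)"
 by (simp add: cvec_def)

lemma cvec_shift: "cvec (x + s *\<^sub>R axis k 1) = cvec x + axis k (of_real s)"
 by (simp add: vec_eq_iff axis_def)

text \<open>The parabolic arc of height \<open>ka\<close> returns to the real axis at both ends of
  the interval, so that a primitive of \<open>F\<close> takes the same end values along both paths
  and no vertical sides appear. As \<open>\<bar>ka\<bar> \<le> a\<close>, the arc has speed at most
  3.\<close>

lemma integral_arc_shift:
 fixes F :: "complex => complex"
 assumes \<Omega>: "convex \<Omega>" "open \<Omega>" "F holomorphic_on \<Omega>" and a: "0 < a" "\<bar>ka\<bar> <= a"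
  and real_in: "\<And>s. s \<in> {c - a..c + a} ==> of_real s \<in> \<Omega>"
  and arc_in: "\<And>s. s \<in> {c - a..c + a} ==> Complex s (ka * (1 - ((s - c) / a)\<^sup>2)) \<in> \<Omega>"
 shows "norm (integral {c - a..c + a} (%s. F (of_real s)))
  <= 3 * integral {c - a..c + a} (%s. norm (F (Complex s (ka * (1 - ((s - c) / a)\<^sup>2)))))"
  and "continuous_on {c - a..c + a} (%s. F (Complex s (ka * (1 - ((s - c) / a)\<^sup>2))))"
  and "continuous_on {c - a..c + a} (%s. F (of_real s))"
proof -
 define I where "I = {c - a..c + a}"
 define \<gamma> where "\<gamma> = (%s. Complex s (ka * (1 - ((s - c) / a)\<^sup>2)))"
 define \<gamma>' where "\<gamma>' = (%s. 1 - \<i> * of_real (ka * (2 * ((s - c) / a) / a)))"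
 obtain G where G: "\<And>x. x \<in> \<Omega> ==> (G has_field_derivative F x) (at x within \<Omega>)"
  using holomorphic_convex_primitive'[OF \<Omega>] by blast
 then have G': "(G has_field_derivative F x) (at x)" if "x \<in> \<Omega>" for x
  using that \<Omega>(2) by (metis at_within_open)
 have contF: "continuous_on \<Omega> F" using \<Omega> by (simp add: holomorphic_on_imp_continuous_on)
 have d\<gamma>: "(\<gamma> has_vector_derivative \<gamma>' s) (at s within S)" for s S
 proof -
  have "((%s. ka * (1 - ((s - c) / a)\<^sup>2)) has_real_derivative - (ka * (2 * ((s - c) / a) / a))) (at s within S)"
   using a by (auto intro!: derivative_eq_intros simp: field_simps eval_nat_numeral)
  then have "((%s. of_real s + \<i> * of_real (ka * (1 - ((s - c) / a)\<^sup>2))) has_vector_derivative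
    of_real 1 + \<i> * of_real (- (ka * (2 * ((s - c) / a) / a)))) (at s within S)"
   by (intro has_vector_derivative_add has_vector_derivative_mult_right has_vector_derivative_of_real)
    (auto intro: has_vector_derivative_id simp flip: has_real_derivative_iff_has_vector_derivative)
  then show ?thesis by (simp add: \<gamma>_def \<gamma>'_def Complex_eq)
 qed
 have cont\<gamma>: "continuous_on I \<gamma>"
  using d\<gamma> by (meson continuous_on_eq_continuous_within has_vector_derivative_continuous)
 show c1: "continuous_on {c - a..c + a} (%s. F (Complex s (ka * (1 - ((s - c) / a)\<^sup>2))))"
  using cont\<gamma> arc_in unfolding I_def \<gamma>_def by (intro continuous_on_compose2[OF contF]) auto
 show c2: "continuous_on {c - a..c + a} (%s. F (of_real s))"
  using real_in by (intro continuous_on_compose2[OF contF] continuous_intros) auto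
 have le: "c - a <= c + a" using a by simp
 have "((%s. \<gamma>' s * F (\<gamma> s)) has_integral G (\<gamma> (c + a)) - G (\<gamma> (c - a))) {c - a..c + a}"
 proof (rule fundamental_theorem_of_calculus[OF le])
  fix s assume s: "s \<in> {c - a..c + a}"
  show "((%s. G (\<gamma> s)) has_vector_derivative \<gamma>' s * F (\<gamma> s)) (at s within {c - a..c + a})"
   by (rule field_vector_diff_chain_within[unfolded o_def, OF d\<gamma> has_field_derivative_at_within[OF G']])
    (use arc_in[OF s] in \<open>simp add: \<gamma>_def\<close>)
 qed
 moreover have "((%s. of_real 1 * F (of_real s)) has_integral G (of_real (c + a)) - G (of_real (c - a))) {c - a..c + a}"
 proof (rule fundamental_theorem_of_calculus[OF le])
  fix s assume s: "s \<in> {c - a..c + a}"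
  have "(of_real has_vector_derivative of_real 1) (at s within {c - a..c + a})"
   by (intro has_vector_derivative_of_real DERIV_ident)
  then show "((%s. G (of_real s)) has_vector_derivative of_real 1 * F (of_real s)) (at s within {c - a..c + a})"
   by (rule field_vector_diff_chain_within[unfolded o_def, OF _ has_field_derivative_at_within[OF G']])
    (use real_in[OF s] in simp)
 qed
 moreover have "\<gamma> (c + a) = of_real (c + a)" "\<gamma> (c - a) = of_real (c - a)"
  using a by (auto simp: \<gamma>_def complex_eq_iff)
 ultimately have eq: "integral I (%s. F (of_real s)) = integral I (%s. \<gamma>' s * F (\<gamma> s))"
  and ig: "(%s. \<gamma>' s * F (\<gamma> s)) integrable_on I"
  unfolding I_def by (auto simp: integral_unique)
 have b: "norm (\<gamma>' s) <= 3" if "s \<in> I" for s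
 proof -
  have "norm (\<gamma>' s) <= 1 + \<bar>ka * (2 * ((s - c) / a) / a)\<bar>"
   unfolding \<gamma>'_def by (rule order_trans[OF norm_triangle_ineq4]) (simp only: norm_one norm_mult norm_ii norm_of_real mult_1_left order_refl)
  also have "\<bar>ka * (2 * ((s - c) / a) / a)\<bar> = 2 * (\<bar>ka\<bar> / a) * (\<bar>s - c\<bar> / a)"
   using a by (simp only: abs_mult abs_divide abs_of_pos[OF a(1)]) simp
  also have "... <= 2 * 1 * 1"
   using a that by (intro mult_mono) (auto simp: I_def abs_le_iff)
  finally show ?thesis by simp
 qed
 have "norm (integral I (%s. \<gamma>' s * F (\<gamma> s))) <= integral I (%s. 3 * norm (F (\<gamma> s)))"
 proof (rule integral_norm_bound_integral[OF ig])
  show "(%s. 3 * norm (F (\<gamma> s))) integrable_on I"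
   using c1 unfolding I_def \<gamma>_def by (intro integrable_continuous_interval continuous_intros)
  show "norm (\<gamma>' s * F (\<gamma> s)) <= 3 * norm (F (\<gamma> s))" if "s \<in> I" for s
   using b[OF that] by (simp add: norm_mult mult_right_mono)
 qed
 then show "norm (integral {c - a..c + a} (%s. F (of_real s)))
  <= 3 * integral {c - a..c + a} (%s. norm (F (Complex s (ka * (1 - ((s - c) / a)\<^sup>2)))))"
  using eq by (simp add: I_def \<gamma>_def)
qed

lemma line_shift_bound:
 fixes F :: "complex => complex" and f :: "real => complex"
 assumes f: "integrable lborel f"
  and \<Omega>: "convex \<Omega>" "open \<Omega>" "F holomorphic_on \<Omega>" and a: "0 < a" "\<bar>ka\<bar> <= a"
  and real_in: "\<And>s. s \<in> {c - a..c + a} ==> of_real s \<in> \<Omega>"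
  and arc_in: "\<And>s. s \<in> {c - a..c + a} ==> Complex s (ka * (1 - ((s - c) / a)\<^sup>2)) \<in> \<Omega>"
  and fF: "\<And>s. s \<in> {c - a..c + a} ==> f s = F (of_real s)"
 shows "ennreal (norm (\<integral>s. f s \<partial>lborel)) <=
  (\<integral>\<^sup>+s. (if s \<in> {c - a..c + a} then ennreal (3 * norm (F (Complex s (ka * (1 - ((s - c) / a)\<^sup>2)))))
     else ennreal (norm (f s))) \<partial>lborel)"
proof -
 define I where "I = {c - a..c + a}"
 define g where "g = (%s. 3 * norm (F (Complex s (ka * (1 - ((s - c) / a)\<^sup>2)))))"
 note arc = integral_arc_shift[OF \<Omega> a real_in arc_in]
 have [measurable]: "f \<in> borel_measurable borel" "I \<in> sets borel" using f by (auto simp: I_def)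
 have sI: "set_integrable lborel I f" "set_integrable lborel (-I) f"
  using f unfolding set_integrable_def by (auto intro!: integrable_mult_indicator)
 have cg: "continuous_on I g" unfolding g_def I_def by (intro continuous_intros arc(2))
 have g0: "0 <= g s" for s by (simp add: g_def)
 have "(\<integral>s. f s \<partial>lborel) = (LINT s:I|lborel. f s) + (LINT s:-I|lborel. f s)"
  using set_integral_Un[OF _ sI] by (simp add: set_lebesgue_integral_def)
 then have "ennreal (norm (\<integral>s. f s \<partial>lborel))
   <= ennreal (norm (LINT s:I|lborel. f s)) + ennreal (norm (LINT s:-I|lborel. f s))"
  by (simp add: norm_triangle_ineq ennreal_leI flip: ennreal_plus)
 also have "... <= (\<integral>\<^sup>+s. ennreal (g s) * indicator I s \<partial>lborel) + (\<integral>\<^sup>+s. ennreal (norm (f s)) * indicator (-I) s \<partial>lborel)"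
 proof (rule add_mono)
  show "ennreal (norm (LINT s:I|lborel. f s)) <= (\<integral>\<^sup>+s. ennreal (g s) * indicator I s \<partial>lborel)"
  proof -
  have "(LINT s:I|lborel. f s) = integral I f"
   by (rule set_borel_integral_eq_integral[OF sI(1)])
  also have "... = integral I (%s. F (of_real s))"
   using fF by (intro integral_cong) (auto simp: I_def)
  finally have "norm (LINT s:I|lborel. f s) <= integral I g"
   using arc(1) by (simp add: I_def g_def)
  moreover have "(\<integral>\<^sup>+s. ennreal (g s) * indicator I s \<partial>lborel) = ennreal (integral I g)"
  proof (rule nn_integral_has_integral_lebesgue')
   have "g integrable_on I" using cg unfolding I_def by (rule integrable_continuous_interval)
   then show "(g has_integral integral I g) I" by (rule integrable_integral)
  qed (use g0 in auto)
  ultimately show ?thesis by (simp add: ennreal_leI)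
 qed
  show "ennreal (norm (LINT s:-I|lborel. f s)) <= (\<integral>\<^sup>+s. ennreal (norm (f s)) * indicator (-I) s \<partial>lborel)"
  using integral_norm_bound_ennreal[OF sI(2)[unfolded set_integrable_def]]
  by (auto simp: set_lebesgue_integral_def indicator_def of_bool_def if_distrib cong: if_cong
    intro!: nn_integral_mono elim!: order_trans)
 qed
 also have "(\<integral>\<^sup>+s. ennreal (g s) * indicator I s \<partial>lborel) + (\<integral>\<^sup>+s. ennreal (norm (f s)) * indicator (-I) s \<partial>lborel)
  = (\<integral>\<^sup>+s. ennreal (g s) * indicator I s + ennreal (norm (f s)) * indicator (-I) s \<partial>lborel)"
 proof (rule nn_integral_add[symmetric])
  have "(%s. indicator I s *\<^sub>R g s) \<in> borel_measurable borel"
   using cg by (intro borel_measurable_continuous_on_indicator) auto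
  then have "(%s. ennreal (indicator I s *\<^sub>R g s)) \<in> borel_measurable borel" by measurable
  also have "(%s. ennreal (indicator I s *\<^sub>R g s)) = (%s. ennreal (g s) * indicator I s)"
   by (auto simp: indicator_def)
  finally show "(%s. ennreal (g s) * indicator I s) \<in> borel_measurable lborel" by simp
 qed measurable
 also have "... = (\<integral>\<^sup>+s. (if s \<in> I then ennreal (g s) else ennreal (norm (f s))) \<partial>lborel)"
  by (intro nn_integral_cong) auto
 finally show ?thesis unfolding I_def g_def .
qed

text \<open>Inside a cube around \<open>c\<close> each line parallel to axis \<open>k\<close> is
  replaced by an arc; outside, the integrand is estimated as it stands. The height \<open>ka\<close>
  may vary between lines and is only required to be constant along each of them: far from the origin
  a constant will do, near the origin it has to follow the cone of analyticity.\<close>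

lemma packet_domination:
 fixes F :: "complex^'n::finite => complex" and c :: "real^'n" and ka :: "real^'n => real" and B :: "real^'n => real"
 assumes F: "integrable lborel (%et. F (cvec et))" and a: "0 < a"
  and ka_line: "\<And>et s. ka (et + s *\<^sub>R axis k 1) = ka et"
  and hol: "\<And>x. \<lbrakk>\<forall>j. j ~= k --> \<bar>x $ j - c $ j\<bar> <= a\<rbrakk> \<Longrightarrow> \<bar>ka x\<bar> <= a \<and>
   (\<exists>\<Omega>. convex \<Omega> \<and> open \<Omega> \<and> (%w. F (cvec x + axis k w)) holomorphic_on \<Omega> \<and>
    (\<forall>s. \<bar>x $ k + s - c $ k\<bar> <= a --> of_real s \<in> \<Omega> \<and>
      Complex s (ka x * (1 - ((x $ k + s - c $ k) / a)\<^sup>2)) \<in> \<Omega>))"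
  and [measurable]: "B \<in> borel_measurable borel"
  and B_in: "\<And>et. (\<forall>j. \<bar>et $ j - c $ j\<bar> <= a) ==>
   3 * norm (F (cvec et + axis k (\<i> * of_real (ka et * (1 - ((et $ k - c $ k) / a)\<^sup>2))))) <= B et"
  and B_out: "\<And>et. \<not> (\<forall>j. \<bar>et $ j - c $ j\<bar> <= a) ==> norm (F (cvec et)) <= B et"
 shows "ennreal (norm (\<integral>et. F (cvec et) \<partial>lborel)) <= (\<integral>\<^sup>+et. ennreal (B et) \<partial>lborel)"
proof (rule line_domination[where e = "axis k 1"])
 fix x :: "real^'n"
 let ?f = "%s. F (cvec (x + s *\<^sub>R axis k 1))"
 assume int: "integrable lborel ?f"
 have nth: "(x + s *\<^sub>R axis k 1) $ j = (if j = k then x $ k + s else x $ j)" for s j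
  by (simp add: axis_def)
 show "ennreal (norm (\<integral>s. ?f s \<partial>lborel)) <= (\<integral>\<^sup>+s. ennreal (B (x + s *\<^sub>R axis k 1)) \<partial>lborel)"
 proof (cases "\<forall>j. j ~= k --> \<bar>x $ j - c $ j\<bar> <= a")
  case False
  then have "\<not> (\<forall>j. \<bar>(x + s *\<^sub>R axis k 1) $ j - c $ j\<bar> <= a)" for s
   unfolding nth by metis
  then have "norm (?f s) <= B (x + s *\<^sub>R axis k 1)" for s by (rule B_out)
  then have "(\<integral>\<^sup>+s. ennreal (norm (?f s)) \<partial>lborel) <= (\<integral>\<^sup>+s. ennreal (B (x + s *\<^sub>R axis k 1)) \<partial>lborel)"
   by (intro nn_integral_mono ennreal_leI)
  with integral_norm_bound_ennreal[OF int] show ?thesis by (rule order_trans)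
 next
  case True
  obtain \<Omega> where \<Omega>: "convex \<Omega>" "open \<Omega>" "(%w. F (cvec x + axis k w)) holomorphic_on \<Omega>"
   "\<And>s. \<bar>x $ k + s - c $ k\<bar> <= a ==> of_real s \<in> \<Omega> \<and> Complex s (ka x * (1 - ((x $ k + s - c $ k) / a)\<^sup>2)) \<in> \<Omega>"
   and kaa: "\<bar>ka x\<bar> <= a"
   using hol[OF True] by blast
  \<comment> \<open>The line is parametrised by the increment \<open>s\<close> of coordinate
    \<open>k\<close> from \<open>x\<close>, which moves the centre of the interval to
    \<open>c $ k - x $ k\<close>.\<close>
  define c' where "c' = c $ k - x $ k"
  have cc: "x $ k + s - c $ k = s - c'" for s by (simp add: c'_def)
  have "ennreal (norm (\<integral>s. ?f s \<partial>lborel)) <=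
   (\<integral>\<^sup>+s. (if s \<in> {c' - a..c' + a} then ennreal (3 * norm (F (cvec x + axis k (Complex s (ka x * (1 - ((s - c') / a)\<^sup>2))))))
     else ennreal (norm (?f s))) \<partial>lborel)"
   using \<Omega>(4) unfolding cc by (intro line_shift_bound[OF int \<Omega>(1-3) a kaa]) (auto simp: cvec_shift abs_le_iff)
  also have "... <= (\<integral>\<^sup>+s. ennreal (B (x + s *\<^sub>R axis k 1)) \<partial>lborel)"
  proof (rule nn_integral_mono)
   fix s
   show "(if s \<in> {c' - a..c' + a} then ennreal (3 * norm (F (cvec x + axis k (Complex s (ka x * (1 - ((s - c') / a)\<^sup>2))))))
     else ennreal (norm (?f s))) <= ennreal (B (x + s *\<^sub>R axis k 1))"
   proof (cases "s \<in> {c' - a..c' + a}")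
    case s: True
    have "cvec x + axis k (Complex s (ka x * (1 - ((s - c') / a)\<^sup>2)))
     = cvec (x + s *\<^sub>R axis k 1) + axis k (\<i> * of_real (ka (x + s *\<^sub>R axis k 1) * (1 - (((x + s *\<^sub>R axis k 1) $ k - c $ k) / a)\<^sup>2)))"
     unfolding ka_line nth cvec_shift by (simp add: vec_eq_iff axis_def Complex_eq cc)
    moreover have "\<forall>j. \<bar>(x + s *\<^sub>R axis k 1) $ j - c $ j\<bar> <= a"
     unfolding nth using True s by (auto simp: c'_def abs_le_iff)
    ultimately show ?thesis using s B_in[of "x + s *\<^sub>R axis k 1"] by (simp add: ennreal_leI)
   next
    case s: False
    have "\<not> (\<forall>j. \<bar>(x + s *\<^sub>R axis k 1) $ j - c $ j\<bar> <= a)"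
     unfolding nth using s by (auto simp: c'_def abs_le_iff intro!: exI[of _ k])
    then show ?thesis using s B_out[of "x + s *\<^sub>R axis k 1"] by (auto simp: ennreal_leI)
   qed
  qed
  finally show ?thesis .
 qed
qed (use F in \<open>auto simp: Basis_vec_axis\<close>)

section \<open>Polynomials homogeneous in a parameter and the coordinates together\<close>

lemma scaleR_complex: "r *\<^sub>R (z :: complex) = of_real r * z"
 by (simp add: scaleR_conv_of_real)

lemma axis_zero [simp]: "axis j 0 = (0 :: 'a::zero^'n::finite)"
 by (simp add: vec_eq_iff axis_def)

lemma norm_axis: "norm (axis k x :: complex^'n::finite) = norm x"
proof -
 have "(norm (axis k x $ i))\<^sup>2 = (if i = k then (norm x)\<^sup>2 else 0)" for i
  by (simp add: axis_def)
 then show ?thesis by (simp add: norm_vec_def L2_set_def)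
qed

lemma bounded_linear_cvec: "bounded_linear (cvec :: real^'n::finite => complex^'n)"
proof (rule bounded_linear_intro[where K = 1])
 show "norm (cvec x) <= norm x * 1" for x :: "real^'n"
  by (simp add: norm_vec_def)
qed (simp_all add: vec_eq_iff scaleR_complex)

lemma norm_cvec [simp]: "norm (cvec x) = norm (x :: real^'n::finite)"
 by (simp add: norm_vec_def)

lemma continuous_on_cvec [continuous_intros]:
 "continuous_on S f ==> continuous_on S (%x. cvec (f x))"
 using bounded_linear.continuous_on[OF bounded_linear_cvec] .

lemma cvec_add: "cvec (x + y) = cvec x + cvec y"
 and cvec_scaleR: "cvec (s *\<^sub>R x) = s *\<^sub>R cvec x"
 by (simp_all add: vec_eq_iff scaleR_complex)

text \<open>
  Polynomials with real coefficients in a real parameter \<open>ta\<close> and complex coordinates.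
\<close>

inductive cpoly :: "(real => complex^'n::finite => complex) => bool" where
 const: "cpoly (%ta z. of_real c)"
| param: "cpoly (%ta z. of_real ta)"
| coord: "cpoly (%ta z. z $ i)"
| add: "cpoly f ==> cpoly g ==> cpoly (%ta z. f ta z + g ta z)"
| mult: "cpoly f ==> cpoly g ==> cpoly (%ta z. f ta z * g ta z)"

lemma cpoly_sum: "(\<And>i. i \<in> A ==> cpoly (f i)) ==> cpoly (%ta z. \<Sum>i\<in>A. f i ta z)"
 using cpoly.const[of 0] by (induction A rule: infinite_finite_induct) (auto intro: cpoly.add)

lemma cpoly_power: "cpoly f ==> cpoly (%ta z. f ta z ^ k)"
 using cpoly.const[of 1] by (induction k) (auto intro: cpoly.mult)

lemma cpoly_prod: "(\<And>i. i \<in> A ==> cpoly (f i)) ==> cpoly (%ta z. \<Prod>i\<in>A. f i ta z)"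
 using cpoly.const[of 1] by (induction A rule: infinite_finite_induct) (auto intro: cpoly.mult)

lemma cpoly_continuous_on:
 assumes "cpoly f" "continuous_on S g" "continuous_on S h"
 shows "continuous_on S (%x. f (g x) (h x))"
 using assms by (induction rule: cpoly.induct) (auto intro!: continuous_intros)

lemma cpoly_Im_cvec: "cpoly f ==> Im (f ta (cvec x)) = 0"
 by (induction rule: cpoly.induct) auto

lemma cpoly_cvec: "cpoly f ==> f ta (cvec x) = of_real (Re (f ta (cvec x)))"
 by (simp add: complex_eq_iff cpoly_Im_cvec)

definition pdif :: "'n::finite => (real => complex^'n => complex) => real => complex^'n => complex" where
 "pdif j f ta z = frechet_derivative (f ta) (at z) (axis j 1)"

text \<open>The partial derivatives are shown to be polynomials in the same induction that produces
  them, so that \<open>pdif\<close> can be iterated. The derivative is complex linear in the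
  increment, which gives holomorphy in each coordinate.\<close>

lemma cpoly_deriv_ex:
 assumes "cpoly f"
 shows "\<exists>D. (\<forall>j. cpoly (D j)) \<and> (\<forall>ta z. (f ta has_derivative (%w. \<Sum>j\<in>UNIV. w $ j * D j ta z)) (at z))"
 using assms
proof induction
 case (const c)
 show ?case by (rule exI[of _ "%j ta z. of_real 0"]) (auto intro: cpoly.const[of 0, simplified])
next
 case param
 show ?case by (rule exI[of _ "%j ta z. of_real 0"]) (auto intro: cpoly.const[of 0, simplified])
next
 case (coord i)
 have "(\<Sum>j\<in>UNIV. w $ j * (of_real (if j = i then 1 else 0))) = w $ i" for w :: "complex^'a"
  by (simp add: if_distrib cong: if_cong)
 moreover have "((%z. z $ i) has_derivative (%w. w $ i)) (at z)" for z :: "complex^'a"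
  by (intro bounded_linear_imp_has_derivative bounded_linear_vec_nth)
 ultimately show ?case
  by (intro exI[of _ "%j ta z. of_real (if j = i then 1 else 0)"]) (auto intro: cpoly.const[of 0, simplified] cpoly.const[of 1, simplified])
next
 case (add f g)
 obtain D where D: "\<forall>j. cpoly (D j)" "\<forall>ta z. (f ta has_derivative (%w. \<Sum>j\<in>UNIV. w $ j * D j ta z)) (at z)"
  using add.IH(1) by (elim exE conjE)
 obtain E where E: "\<forall>j. cpoly (E j)" "\<forall>ta z. (g ta has_derivative (%w. \<Sum>j\<in>UNIV. w $ j * E j ta z)) (at z)"
  using add.IH(2) by (elim exE conjE)
 have "((%z. f ta z + g ta z) has_derivative (%w. \<Sum>j\<in>UNIV. w $ j * (D j ta z + E j ta z))) (at z)" for ta z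
  using has_derivative_add[OF D(2)[rule_format, of ta z] E(2)[rule_format, of ta z]]
  by (rule has_derivative_eq_rhs) (simp add: fun_eq_iff sum.distrib[symmetric] algebra_simps)
 then show ?case
  using D(1) E(1) by (intro exI[of _ "%j ta z. D j ta z + E j ta z"] conjI allI cpoly.add) blast+
next
 case (mult f g)
 obtain D where D: "\<forall>j. cpoly (D j)" "\<forall>ta z. (f ta has_derivative (%w. \<Sum>j\<in>UNIV. w $ j * D j ta z)) (at z)"
  using mult.IH(1) by (elim exE conjE)
 obtain E where E: "\<forall>j. cpoly (E j)" "\<forall>ta z. (g ta has_derivative (%w. \<Sum>j\<in>UNIV. w $ j * E j ta z)) (at z)"
  using mult.IH(2) by (elim exE conjE)
 have "((%z. f ta z * g ta z) has_derivative (%w. \<Sum>j\<in>UNIV. w $ j * (f ta z * E j ta z + D j ta z * g ta z))) (at z)" for ta z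
  using has_derivative_mult[OF D(2)[rule_format, of ta z] E(2)[rule_format, of ta z]]
  by (rule has_derivative_eq_rhs) (simp add: fun_eq_iff sum_distrib_left sum_distrib_right sum.distrib[symmetric] algebra_simps)
 then show ?case
  using D(1) E(1) mult.hyps
  by (intro exI[of _ "%j ta z. f ta z * E j ta z + D j ta z * g ta z"] conjI allI cpoly.add cpoly.mult) blast+
qed

lemma sum_axis_mult: "(\<Sum>j\<in>UNIV. axis k w $ j * h j) = w * (h k :: 'a::comm_ring_1)"
proof -
 have "axis k w $ j * h j = (if j = k then w * h k else 0)" for j
  by (simp add: axis_def)
 then show ?thesis by simp
qed

lemma
 assumes "cpoly f"
 shows cpoly_pdif: "cpoly (pdif j f)"
  and cpoly_has_derivative: "(f ta has_derivative (%w. \<Sum>j\<in>UNIV. w $ j * pdif j f ta z)) (at z)"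
proof -
 obtain D where D: "\<forall>j. cpoly (D j)" "\<forall>ta z. (f ta has_derivative (%w. \<Sum>j\<in>UNIV. w $ j * D j ta z)) (at z)"
  using cpoly_deriv_ex[OF assms] by (elim exE conjE)
 have "pdif j f ta z = D j ta z" for j ta z
 proof -
  have "frechet_derivative (f ta) (at z) = (%w. \<Sum>j\<in>UNIV. w $ j * D j ta z)"
   using D(2) by (intro frechet_derivative_at[symmetric]) blast
  then show ?thesis by (simp add: pdif_def sum_axis_mult)
 qed
 then have "pdif j f = D j" for j by (simp add: fun_eq_iff)
 then show "cpoly (pdif j f)" "(f ta has_derivative (%w. \<Sum>j\<in>UNIV. w $ j * pdif j f ta z)) (at z)"
  using D by auto
qed

lemma cpoly_field_derivative:
 assumes "cpoly f"
 shows "((%w. f ta (z + axis k w)) has_field_derivative pdif k f ta (z + axis k w)) (at w)"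
proof -
 have "((%w. z + axis k w) has_derivative (%h. axis k h)) (at w)"
 proof -
  have "bounded_linear (axis k :: complex => complex^'a)"
   proof (rule bounded_linear_intro[where K = 1])
   show "norm (axis k x :: complex^'a) <= norm x * 1" for x
    by (simp add: norm_axis)
  qed (auto simp: vec_eq_iff axis_def)
  then show ?thesis by (auto intro!: derivative_eq_intros bounded_linear_imp_has_derivative)
 qed
 from has_derivative_compose[OF this cpoly_has_derivative[OF assms]]
 show ?thesis unfolding sum_axis_mult has_field_derivative_def
  by (rule has_derivative_eq_rhs) (simp add: fun_eq_iff mult.commute)
qed

lemma cpoly_real_derivative:
 assumes "cpoly f"
 shows "((%s. Re (f ta (cvec (x + s *\<^sub>R u)))) has_real_derivative
  (\<Sum>j\<in>UNIV. u $ j * Re (pdif j f ta (cvec (x + s *\<^sub>R u))))) (at s)"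
proof -
 have "((%s. cvec (x + s *\<^sub>R u)) has_derivative (%h. h *\<^sub>R cvec u)) (at s)"
  unfolding cvec_add cvec_scaleR by (auto intro!: derivative_eq_intros)
 from has_derivative_compose[OF this cpoly_has_derivative[OF assms]]
 have "((%s. f ta (cvec (x + s *\<^sub>R u))) has_vector_derivative
   (\<Sum>j\<in>UNIV. of_real (u $ j) * pdif j f ta (cvec (x + s *\<^sub>R u)))) (at s)"
  unfolding has_vector_derivative_def
  by (rule has_derivative_eq_rhs) (simp add: fun_eq_iff scaleR_complex sum_distrib_left mult_ac)
 from bounded_linear.has_vector_derivative[OF bounded_linear_Re this] show ?thesis
  by (simp add: has_real_derivative_iff_has_vector_derivative)
qed

text \<open>The parameter is scaled together with the coordinates. Estimates uniform in
  \<open>ta\<close> thereby reduce to compact sets of pairs \<open>(ta, z)\<close>.\<close>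

definition homog :: "nat => (real => complex^'n::finite => complex) => bool" where
 "homog d f \<longleftrightarrow> (\<forall>s>0. \<forall>ta z. f (s * ta) (s *\<^sub>R z) = of_real s ^ d * f ta z)"

lemma homog_pdif:
 assumes "cpoly f" "homog (Suc d) f"
 shows "homog d (pdif j f)"
 unfolding homog_def
proof (intro allI impI)
 fix s ta :: real and z assume s: "s > 0"
 have 1: "((%w. f (s * ta) (s *\<^sub>R z + axis j w)) has_field_derivative pdif j f (s * ta) (s *\<^sub>R z)) (at 0)"
  using cpoly_field_derivative[OF assms(1), of "s * ta" "s *\<^sub>R z" j 0] by simp
 have 0: "((%w. f ta (z + axis j w)) has_field_derivative pdif j f ta z) (at (0 / of_real s))"
  using cpoly_field_derivative[OF assms(1), of ta z j 0] by simp
 have "((%w. of_real s ^ Suc d * f ta (z + axis j (w / of_real s))) has_field_derivative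
   of_real s ^ Suc d * (pdif j f ta z * (1 / of_real s))) (at 0)"
  by (rule DERIV_cmult, rule DERIV_chain2[where g = "%w. w / of_real s", OF 0]) (use s in \<open>auto intro!: derivative_eq_intros\<close>)
 moreover have "of_real s ^ Suc d * f ta (z + axis j (w / of_real s)) = f (s * ta) (s *\<^sub>R z + axis j w)" for w
 proof -
  have "s *\<^sub>R (z + axis j (w / of_real s)) = s *\<^sub>R z + axis j w"
   using s by (simp add: vec_eq_iff axis_def scaleR_complex distrib_left)
  then show ?thesis using assms(2) s unfolding homog_def by metis
 qed
 ultimately have 2: "((%w. f (s * ta) (s *\<^sub>R z + axis j w)) has_field_derivative
   of_real s ^ Suc d * (pdif j f ta z * (1 / of_real s))) (at 0)" by simp
 show "pdif j f (s * ta) (s *\<^sub>R z) = of_real s ^ d * pdif j f ta z"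
  using DERIV_unique[OF 1 2] s by simp
qed

lemma homog_normalize:
 assumes "homog d f" "0 < N"
 shows "f ta z = of_real N ^ d * f (ta / N) ((1 / N) *\<^sub>R z)"
proof -
 have "f (N * (ta / N)) (N *\<^sub>R ((1 / N) *\<^sub>R z)) = of_real N ^ d * f (ta / N) ((1 / N) *\<^sub>R z)"
  using assms unfolding homog_def by blast
 then show ?thesis using assms by simp
qed

text \<open>Division by \<open>N\<close> moves the pair into the compact set
  \<open>{0..1} \<times> cball 0 2\<close>; the factor \<open>N ^ d\<close> is restored by
  homogeneity.\<close>

lemma homog_bound:
 assumes "cpoly f" "homog d f"
 shows "\<exists>C>0. \<forall>ta z N. 0 <= ta --> 0 < N --> ta <= N --> norm z <= 2 * N --> norm (f ta z) <= C * N ^ d"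
proof -
 have "compact ((%p. f (fst p) (snd p)) ` ({0..1} \<times> cball 0 2))"
  by (intro compact_continuous_image cpoly_continuous_on[OF assms(1)] continuous_intros compact_Times) auto
 then obtain C where C: "C > 0" "\<And>ta z. ta \<in> {0..1} ==> norm z <= 2 ==> norm (f ta z) <= C"
  using compact_imp_bounded[THEN bounded_pos[THEN iffD1]] by (force simp: mem_cball_0)
 have "norm (f ta z) <= C * N ^ d" if "0 <= ta" "0 < N" "ta <= N" "norm z <= 2 * N" for ta z N
 proof -
  have "norm (f ta z) = N ^ d * norm (f (ta / N) ((1 / N) *\<^sub>R z))"
   using that by (subst homog_normalize[OF assms(2) that(2)]) (simp add: norm_mult norm_power)
  also have "... <= N ^ d * C"
   using that by (intro mult_left_mono C) (auto simp: field_simps)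
  finally show ?thesis by (simp add: mult.commute)
 qed
 with C(1) show ?thesis by blast
qed

section \<open>The square root of an elliptic symbol and its derivatives\<close>

locale elliptic_symbol =
 fixes p :: "real => complex^'n::finite => complex" and q :: nat
 assumes cp: "cpoly p" and hp: "homog (2 * q) p" and q2: "2 <= q" and qn: "2 * q <= CARD('n)"
  and pos: "\<And>ta et. 0 <= ta ==> 0 < ta + norm et ==> 0 < Re (p ta (cvec et))"
  and nondeg: "\<And>et w :: real^'n. et ~= 0 ==>
   (\<And>k. (\<Sum>j\<in>UNIV. Re (pdif j (pdif k p) 0 (cvec et)) * w $ j) = 0) ==> w = 0"
begin

text \<open>The principal branch suffices, since the real part of \<open>p\<close> is positive in a
  cone around the real points. \<open>fi1\<close> and \<open>fi2\<close> are the first and second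
  partial derivatives written out in terms of \<open>p\<close>, so that bounds for \<open>p\<close>
  carry over to them; the functions \<open>pr\<close> and \<open>fir\<close> with their derivatives
  are the values at real points.\<close>

definition fi :: "real => complex^'n => complex" where
 "fi ta z = csqrt (p ta z)"

definition fi1 :: "'n => real => complex^'n => complex" where
 "fi1 k ta z = pdif k p ta z / (2 * fi ta z)"

definition fi2 :: "'n => 'n => real => complex^'n => complex" where
 "fi2 k j ta z = pdif j (pdif k p) ta z / (2 * fi ta z) - pdif k p ta z * pdif j p ta z / (4 * fi ta z ^ 3)"

definition pr :: "real => real^'n => real" where
 "pr ta et = Re (p ta (cvec et))"

definition pr1 :: "'n => real => real^'n => real" where
 "pr1 k ta et = Re (pdif k p ta (cvec et))"

definition pr2 :: "'n => 'n => real => real^'n => real" where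
 "pr2 k j ta et = Re (pdif j (pdif k p) ta (cvec et))"

definition fir :: "real => real^'n => real" where
 "fir ta et = sqrt (pr ta et)"

definition fir1 :: "'n => real => real^'n => real" where
 "fir1 k ta et = pr1 k ta et / (2 * fir ta et)"

definition fir2 :: "'n => 'n => real => real^'n => real" where
 "fir2 k j ta et = pr2 k j ta et / (2 * fir ta et) - pr1 k ta et * pr1 j ta et / (4 * fir ta et ^ 3)"

lemma cp1: "cpoly (pdif k p)" and cp2: "cpoly (pdif j (pdif k p))"
 by (auto intro: cpoly_pdif cp)

lemma hp1: "homog (2 * q - 1) (pdif k p)"
 using q2 hp by (intro homog_pdif cp) simp

lemma hp2: "homog (2 * q - 2) (pdif j (pdif k p))"
proof -
 have "2 * q - 1 = Suc (2 * q - 2)" using q2 by simp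
 then show ?thesis using hp1[of k] by (intro homog_pdif[OF cp1]) simp
qed

lemma p_cvec: "p ta (cvec et) = of_real (pr ta et)"
 and p1_cvec: "pdif k p ta (cvec et) = of_real (pr1 k ta et)"
 and p2_cvec: "pdif j (pdif k p) ta (cvec et) = of_real (pr2 k j ta et)"
 unfolding pr_def pr1_def pr2_def using cpoly_cvec cp cp1 cp2 by blast+

lemma pr_pos: "0 <= ta ==> 0 < ta + norm et ==> 0 < pr ta et"
 unfolding pr_def by (rule pos)

lemma fir_pos: "0 <= ta ==> 0 < ta + norm et ==> 0 < fir ta et"
 unfolding fir_def by (simp add: pr_pos)

lemma pr_nonneg: "0 <= ta ==> 0 <= pr ta et"
proof (cases "0 < ta + norm et")
 case False
 assume "0 <= ta"
 with False have "ta = 0" "norm et = 0" using norm_ge_zero[of et] by linarith+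
 then have "ta = 0" "et = 0" by auto
 \<comment> \<open>Scaling by 2 fixes the origin and multiplies the value there by
   \<open>2 ^ (2 * q)\<close>, so the value is 0.\<close>
 moreover have "p (2 * 0) (2 *\<^sub>R cvec (0 :: real^'n)) = of_real 2 ^ (2 * q) * p 0 (cvec 0)"
  using hp unfolding homog_def by (metis zero_less_numeral)
 then have "(of_real 2 ^ (2 * q) - 1) * p 0 (cvec (0 :: real^'n)) = 0"
  by (simp add: algebra_simps flip: cvec_scaleR)
 then have "p 0 (cvec (0 :: real^'n)) = 0"
  using q2 power_eq_1_iff[of 2 "2 * q" ] one_less_power[of "2 :: real" "2 * q"]
  by (auto simp: complex_eq_iff simp flip: of_real_power)
 ultimately show ?thesis by (simp add: pr_def)
qed (simp add: less_imp_le pr_pos)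

lemma fi_cvec: "0 <= ta ==> fi ta (cvec et) = of_real (fir ta et)"
 unfolding fi_def fir_def p_cvec by (rule of_real_sqrt[symmetric]) (rule pr_nonneg)

lemma fi1_cvec: "0 <= ta ==> fi1 k ta (cvec et) = of_real (fir1 k ta et)"
 and fi2_cvec: "0 <= ta ==> fi2 k j ta (cvec et) = of_real (fir2 k j ta et)"
 by (simp_all add: fi1_def fi2_def fir1_def fir2_def fi_cvec p1_cvec p2_cvec)

lemma pr_continuous: "continuous_on S g ==> continuous_on S h ==> continuous_on S (%x. pr (g x) (h x))"
 and pr1_continuous: "continuous_on S g ==> continuous_on S h ==> continuous_on S (%x. pr1 k (g x) (h x))"
 and pr2_continuous: "continuous_on S g ==> continuous_on S h ==> continuous_on S (%x. pr2 k j (g x) (h x))"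
 unfolding pr_def pr1_def pr2_def
 by (intro continuous_on_Re cpoly_continuous_on continuous_on_cvec cp cp1 cp2; assumption)+

lemma fir_continuous: "continuous_on S g ==> continuous_on S h ==> continuous_on S (%x. fir (g x) (h x))"
 unfolding fir_def by (intro continuous_intros pr_continuous)

lemma
 assumes "continuous_on S g" "continuous_on S h" "\<And>x. x \<in> S ==> 0 <= g x \<and> 0 < g x + norm (h x)"
 shows fir1_continuous: "continuous_on S (%x. fir1 k (g x) (h x))"
  and fir2_continuous: "continuous_on S (%x. fir2 k j (g x) (h x))"
 using fir_pos[of "g _" "h _"] assms unfolding fir1_def fir2_def
 by (intro continuous_intros pr1_continuous pr2_continuous fir_continuous; force)+

lemma pr_deriv: "((%s. pr ta (x + s *\<^sub>R u)) has_real_derivative (\<Sum>j\<in>UNIV. u $ j * pr1 j ta (x + s *\<^sub>R u))) (at s)"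
 unfolding pr_def pr1_def by (rule cpoly_real_derivative[OF cp])

lemma pr1_deriv: "((%s. pr1 k ta (x + s *\<^sub>R u)) has_real_derivative (\<Sum>j\<in>UNIV. u $ j * pr2 k j ta (x + s *\<^sub>R u))) (at s)"
 unfolding pr1_def pr2_def by (rule cpoly_real_derivative[OF cp1])

lemma fir_deriv:
 assumes "0 <= ta" "0 < ta + norm (x + s *\<^sub>R u)"
 shows "((%s. fir ta (x + s *\<^sub>R u)) has_real_derivative (\<Sum>j\<in>UNIV. u $ j * fir1 j ta (x + s *\<^sub>R u))) (at s)"
proof -
 have "(sqrt has_real_derivative inverse (sqrt (pr ta (x + s *\<^sub>R u))) / 2) (at (pr ta (x + s *\<^sub>R u)))"
  using pr_pos[OF assms] by (rule DERIV_real_sqrt)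
 then have "((%s. sqrt (pr ta (x + s *\<^sub>R u))) has_real_derivative
   inverse (sqrt (pr ta (x + s *\<^sub>R u))) / 2 * (\<Sum>j\<in>UNIV. u $ j * pr1 j ta (x + s *\<^sub>R u))) (at s)"
  by (rule DERIV_chain2) (rule pr_deriv)
 moreover have "inverse (sqrt (pr ta (x + s *\<^sub>R u))) / 2 * (\<Sum>j\<in>UNIV. u $ j * pr1 j ta (x + s *\<^sub>R u))
   = (\<Sum>j\<in>UNIV. u $ j * fir1 j ta (x + s *\<^sub>R u))"
  unfolding sum_distrib_left
 proof (rule sum.cong[OF refl])
  fix j
  show "inverse (sqrt (pr ta (x + s *\<^sub>R u))) / 2 * (u $ j * pr1 j ta (x + s *\<^sub>R u)) = u $ j * fir1 j ta (x + s *\<^sub>R u)"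
   unfolding fir1_def fir_def divide_inverse inverse_mult_distrib by (simp only: mult_ac)
 qed
 ultimately show ?thesis unfolding fir_def by (simp only:)
qed

lemma fir1_deriv:
 assumes "0 <= ta" "0 < ta + norm (x + s *\<^sub>R u)"
 shows "((%s. fir1 k ta (x + s *\<^sub>R u)) has_real_derivative (\<Sum>j\<in>UNIV. u $ j * fir2 k j ta (x + s *\<^sub>R u))) (at s)"
proof -
 let ?y = "x + s *\<^sub>R u"
 have nz: "2 * fir ta ?y ~= 0" and nz': "fir ta ?y > 0" using fir_pos[OF assms] by auto
 have "((%s. pr1 k ta (x + s *\<^sub>R u) / (2 * fir ta (x + s *\<^sub>R u))) has_real_derivative
   ((\<Sum>j\<in>UNIV. u $ j * pr2 k j ta ?y) * (2 * fir ta ?y) - pr1 k ta ?y * (2 * (\<Sum>j\<in>UNIV. u $ j * fir1 j ta ?y))) / ((2 * fir ta ?y) * (2 * fir ta ?y))) (at s)"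
  using DERIV_divide[OF pr1_deriv DERIV_cmult[OF fir_deriv[OF assms], of 2] nz] by simp
 then show ?thesis
  unfolding fir1_def[of k]
 proof (rule DERIV_cong)
  have "u $ j * fir2 k j ta ?y = (u $ j * pr2 k j ta ?y) * (1 / (2 * fir ta ?y)) - (u $ j * fir1 j ta ?y) * (pr1 k ta ?y / (2 * fir ta ?y ^ 2))" for j
   using nz' by (simp add: fir2_def fir1_def field_simps power2_eq_square power3_eq_cube)
  then have "(\<Sum>j\<in>UNIV. u $ j * fir2 k j ta ?y) = (\<Sum>j\<in>UNIV. u $ j * pr2 k j ta ?y) * (1 / (2 * fir ta ?y))
    - (\<Sum>j\<in>UNIV. u $ j * fir1 j ta ?y) * (pr1 k ta ?y / (2 * fir ta ?y ^ 2))"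
   by (simp only: sum_subtractf sum_distrib_right)
  then show "((\<Sum>j\<in>UNIV. u $ j * pr2 k j ta ?y) * (2 * fir ta ?y) - pr1 k ta ?y * (2 * (\<Sum>j\<in>UNIV. u $ j * fir1 j ta ?y))) / ((2 * fir ta ?y) * (2 * fir ta ?y))
    = (\<Sum>j\<in>UNIV. u $ j * fir2 k j ta ?y)"
   using nz' by (simp only:) (simp add: field_simps power2_eq_square)
 qed
qed

lemma fi_field_deriv:
 assumes "0 < Re (p ta (z + axis k w))"
 shows "((%w. fi ta (z + axis k w)) has_field_derivative fi1 k ta (z + axis k w)) (at w)"
proof -
 have "p ta (z + axis k w) \<notin> \<real>\<^sub>\<le>\<^sub>0" using assms by (auto simp: complex_nonpos_Reals_iff)
 then have "((%w. csqrt (p ta (z + axis k w))) has_field_derivative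
   pdif k p ta (z + axis k w) / (2 * csqrt (p ta (z + axis k w)))) (at w)"
  by (intro has_field_derivative_csqrt' cpoly_field_derivative cp)
 then show ?thesis unfolding fi_def fi1_def .
qed

lemma fi1_field_deriv:
 assumes "0 < Re (p ta (z + axis k w))"
 shows "((%w. fi1 k ta (z + axis k w)) has_field_derivative fi2 k k ta (z + axis k w)) (at w)"
proof -
 let ?y = "z + axis k w"
 have nz: "2 * fi ta ?y ~= 0" "fi ta ?y ~= 0" using assms by (auto simp: fi_def)
 have "((%w. pdif k p ta (z + axis k w) / (2 * fi ta (z + axis k w))) has_field_derivative
   (pdif k (pdif k p) ta ?y * (2 * fi ta ?y) - pdif k p ta ?y * (2 * fi1 k ta ?y)) / ((2 * fi ta ?y) * (2 * fi ta ?y))) (at w)"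
  by (intro DERIV_divide DERIV_cmult cpoly_field_derivative cp1 fi_field_deriv assms nz)
 moreover have "(pdif k (pdif k p) ta ?y * (2 * fi ta ?y) - pdif k p ta ?y * (2 * fi1 k ta ?y)) / ((2 * fi ta ?y) * (2 * fi ta ?y)) = fi2 k k ta ?y"
  using nz(2) unfolding fi2_def fi1_def by (simp add: field_simps power2_eq_square power3_eq_cube)
 ultimately show ?thesis unfolding fi1_def[of k] by (simp only:)
qed

lemma pr_lower:
 obtains c where "0 < c" "\<And>ta et. 0 <= ta ==> ta + norm et = 1 ==> c <= pr ta et"
proof -
 define K :: "(real \<times> (real^'n)) set" where "K = {x. 0 <= fst x \<and> fst x + norm (snd x) = 1}"
 have "closed K" unfolding K_def Collect_conj_eq
  by (intro closed_Int closed_Collect_le closed_Collect_eq continuous_intros)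
 moreover have "K \<subseteq> {0..1} \<times> cball 0 1"
 proof
  fix x assume "x \<in> K"
  then have "0 <= fst x" "fst x + norm (snd x) = 1" by (auto simp: K_def)
  moreover from this have "fst x <= 1" "norm (snd x) <= 1" using norm_ge_zero[of "snd x"] by linarith+
  ultimately show "x \<in> {0..1} \<times> cball 0 1" by (simp add: mem_Times_iff)
 qed
 moreover have "compact ({0..1} \<times> cball (0 :: real^'n) 1 :: (real \<times> (real^'n)) set)"
  by (intro compact_Times compact_Icc compact_cball)
 ultimately have K: "compact K"
  by (metis closed_Int_compact inf.absorb1)
 have "(1, 0) \<in> K" by (simp add: K_def)
 then have ne: "K ~= {}" by blast
 have "continuous_on K (%x. pr (fst x) (snd x))"
  by (intro pr_continuous continuous_intros)
 from continuous_attains_inf[OF K ne this] obtain x where x: "x \<in> K" "\<And>y. y \<in> K ==> pr (fst x) (snd x) <= pr (fst y) (snd y)"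
  by blast
 show thesis
 proof (rule that)
  show "0 < pr (fst x) (snd x)" using x(1) by (intro pr_pos) (auto simp: K_def)
  show "pr (fst x) (snd x) <= pr ta et" if "0 <= ta" "ta + norm et = 1" for ta et
   using x(2)[of "(ta, et)"] that by (simp add: K_def)
 qed
qed

text \<open>Uniform continuity on a compact set gives a neighbourhood of fixed width of the
  normalised real points; by homogeneity it becomes a cone of width proportional to
  \<open>ta + norm et\<close>. In this cone \<open>csqrt\<close> meets no branch cut, and its width
  limits all later complex shifts.\<close>

lemma p_near_real:
 obtains c d where "0 < c" "0 < d" "d <= 1/2"
  "\<And>ta et z. 0 <= ta ==> 0 < ta + norm et ==> norm (z - cvec et) <= d * (ta + norm et) ==>
    c * (ta + norm et) ^ (2 * q) <= Re (p ta z)"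
proof -
 obtain c where c: "0 < c" "\<And>ta et. 0 <= ta ==> ta + norm et = 1 ==> c <= pr ta et"
  by (rule pr_lower) blast
 have "uniformly_continuous_on ({0..1} \<times> cball 0 2) (%x. p (fst x) (snd x))"
  by (intro compact_uniformly_continuous cpoly_continuous_on[OF cp] continuous_intros compact_Times compact_Icc compact_cball)
 then obtain d where d: "d > 0" "\<And>x y. x \<in> {0..1} \<times> cball 0 2 ==> y \<in> {0..1} \<times> cball 0 2 ==> dist y x < d
   ==> dist (p (fst y) (snd y)) (p (fst x) (snd x)) < c / 2"
  unfolding uniformly_continuous_on_def using c(1) by (metis half_gt_zero)
 define d' where "d' = min (d / 2) (1 / 2)"
 have d': "0 < d'" "d' < d" "d' <= 1/2" using d(1) by (auto simp: d'_def min_def)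
 show thesis
 proof (rule that[of "c / 2" d'])
  fix ta :: real and et :: "real^'n" and z
  assume ta: "0 <= ta" and N: "0 < ta + norm et" and z: "norm (z - cvec et) <= d' * (ta + norm et)"
  define N where "N = ta + norm et"
  have N: "N > 0" using N by (simp add: N_def)
  have "(1 / N) *\<^sub>R z - cvec ((1 / N) *\<^sub>R et) = (1 / N) *\<^sub>R (z - cvec et)"
   unfolding cvec_scaleR scaleR_diff_right ..
  then have "norm ((1 / N) *\<^sub>R z - cvec ((1 / N) *\<^sub>R et)) = norm (z - cvec et) / N"
   using N by (simp only: norm_scaleR) simp
  also have "... <= d'" using z N unfolding N_def[symmetric] by (simp only: divide_le_eq) simp
  finally have nz: "norm ((1 / N) *\<^sub>R z - cvec ((1 / N) *\<^sub>R et)) <= d'" .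
  have "norm ((1 / N) *\<^sub>R et) = norm et / N" using N by simp
  moreover have "ta / N + norm et / N = 1" using N unfolding add_divide_distrib[symmetric] N_def by simp
  ultimately have t1: "0 <= ta / N" "ta / N + norm ((1 / N) *\<^sub>R et) = 1"
   using ta N by auto
  have n1: "norm ((1 / N) *\<^sub>R et) <= 1" "ta / N <= 1" using t1 norm_ge_zero[of "(1 / N) *\<^sub>R et"] by linarith+
  have "norm ((1 / N) *\<^sub>R z) <= norm ((1 / N) *\<^sub>R z - cvec ((1 / N) *\<^sub>R et)) + norm (cvec ((1 / N) *\<^sub>R et))"
   using norm_triangle_ineq[of "(1 / N) *\<^sub>R z - cvec ((1 / N) *\<^sub>R et)" "cvec ((1 / N) *\<^sub>R et)"]
   by (simp only: diff_add_cancel)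
  then have n2: "norm ((1 / N) *\<^sub>R z) <= 2" using nz n1 d'(3) unfolding norm_cvec by linarith
  have "dist (p (ta / N) ((1 / N) *\<^sub>R z)) (p (ta / N) (cvec ((1 / N) *\<^sub>R et))) < c / 2"
  proof -
   have "(ta / N, cvec ((1 / N) *\<^sub>R et)) \<in> {0..1} \<times> cball 0 2" "(ta / N, (1 / N) *\<^sub>R z) \<in> {0..1} \<times> cball 0 2"
    unfolding mem_Times_iff fst_conv snd_conv mem_cball_0 atLeastAtMost_iff norm_cvec
    using n1 n2 t1(1) by linarith+
   moreover have "dist (ta / N, (1 / N) *\<^sub>R z) (ta / N, cvec ((1 / N) *\<^sub>R et)) < d"
    using nz d'(2) unfolding dist_Pair_Pair dist_self dist_norm by simp
   ultimately show ?thesis using d(2) by fastforce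
  qed
  then have "\<bar>Re (p (ta / N) ((1 / N) *\<^sub>R z)) - pr (ta / N) ((1 / N) *\<^sub>R et)\<bar> < c / 2"
   unfolding dist_norm pr_def minus_complex.sel(1)[symmetric] by (rule le_less_trans[OF abs_Re_le_cmod])
  then have "c / 2 <= Re (p (ta / N) ((1 / N) *\<^sub>R z))" using c(2)[OF t1] by linarith
  then have "c / 2 * N ^ (2 * q) <= Re (p (ta / N) ((1 / N) *\<^sub>R z)) * N ^ (2 * q)"
   using N by (intro mult_right_mono) auto
  also have "... = Re (p ta z)"
   using homog_normalize[OF hp N, of ta z] by (simp add: mult.commute flip: of_real_power)
  finally show "c / 2 * (ta + norm et) ^ (2 * q) <= Re (p ta z)" by (simp add: N_def)
 qed (use c d' in auto)
qed

end

text \<open>Uniform continuity carries a positive minimum at parameter 0 over to small parameters.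
  The nondegeneracy of the principal part is transferred to the inhomogeneous polynomial in this
  way.\<close>

lemma compact_positive_param:
 fixes f :: "real \<times> 'a::metric_space => real"
 assumes S: "compact S" and cont: "continuous_on ({0..1} \<times> S) f" and pos: "\<And>x. x \<in> S ==> 0 < f (0, x)"
 obtains c d where "0 < c" "0 < d" "d <= 1" "\<And>ta x. 0 <= ta ==> ta <= d ==> x \<in> S ==> c <= f (ta, x)"
proof (cases "S = {}")
 case True
 then show thesis using that[of 1 1] by simp
next
 case False
 have "continuous_on S (%x. f (0, x))"
  by (rule continuous_on_compose2[OF cont]) (auto intro!: continuous_intros)
 from continuous_attains_inf[OF S False this]
 obtain x0 where x0: "x0 \<in> S" "\<And>x. x \<in> S ==> f (0, x0) <= f (0, x)" by blast
 define c where "c = f (0, x0)"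
 have c: "0 < c" using pos x0 by (simp add: c_def)
 have "uniformly_continuous_on ({0..1} \<times> S) f"
  by (intro compact_uniformly_continuous cont compact_Times compact_Icc S)
 then obtain d where d: "d > 0" "\<And>x y. x \<in> {0..1} \<times> S ==> y \<in> {0..1} \<times> S ==> dist y x < d ==> dist (f y) (f x) < c / 2"
  unfolding uniformly_continuous_on_def using half_gt_zero[OF c] by blast
 show thesis
 proof (rule that[of "c / 2" "min 1 (d / 2)"])
  fix ta x assume *: "0 <= ta" "ta <= min 1 (d / 2)" "x \<in> S"
  have "dist (ta, x) (0, x) = ta" using * by (simp add: dist_Pair_Pair)
  then have "dist (f (ta, x)) (f (0, x)) < c / 2" using * d(1) by (intro d(2)) auto
  moreover have "c <= f (0, x)" using x0 * by (simp add: c_def)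
  ultimately show "c / 2 <= f (ta, x)" unfolding dist_real_def by linarith
 qed (use c d in auto)
qed

text \<open>Obtained by differentiating \<open>s ^ d\<close> times the value at \<open>x\<close> in
  \<open>s\<close> at 1. The parameter has to be 0, where joint homogeneity becomes homogeneity in
  \<open>x\<close> alone.\<close>

lemma homog_euler:
 assumes "cpoly f" "homog d f"
 shows "(\<Sum>j\<in>UNIV. x $ j * Re (pdif j f 0 (cvec x))) = real d * Re (f 0 (cvec x))"
proof -
 have 1: "((%s. Re (f 0 (cvec (0 + s *\<^sub>R x)))) has_real_derivative (\<Sum>j\<in>UNIV. x $ j * Re (pdif j f 0 (cvec (0 + 1 *\<^sub>R x))))) (at 1)"
  by (rule cpoly_real_derivative[OF assms(1)])
 have "((%s. s ^ d * Re (f 0 (cvec x))) has_real_derivative real d * 1 ^ (d - 1) * Re (f 0 (cvec x))) (at 1)"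
  by (auto intro!: derivative_eq_intros)
 moreover have "\<forall>\<^sub>F s in nhds (1::real). s \<in> {0<..}"
  by (intro eventually_nhds_in_open) auto
 then have "\<forall>\<^sub>F s in nhds 1. s ^ d * Re (f 0 (cvec x)) = Re (f 0 (cvec (0 + s *\<^sub>R x)))"
 proof eventually_elim
  case (elim s)
  then have "0 < s" by simp
  then have "f (s * 0) (s *\<^sub>R cvec x) = of_real s ^ d * f 0 (cvec x)"
   using assms(2) unfolding homog_def by blast
  then have "f 0 (cvec (0 + s *\<^sub>R x)) = of_real (s ^ d) * f 0 (cvec x)"
   by (simp add: cvec_scaleR)
  then show ?case by simp
 qed
 ultimately have "((%s. Re (f 0 (cvec (0 + s *\<^sub>R x)))) has_real_derivative real d * 1 ^ (d - 1) * Re (f 0 (cvec x))) (at 1)"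
  by (subst DERIV_cong_ev[OF refl _ refl, symmetric]) auto
 from DERIV_unique[OF 1 this] show ?thesis by simp
qed

context elliptic_symbol
begin

lemma homog_bounds_uniform:
 obtains A where "0 < A" 
  "\<And>ta z N k j. 0 <= ta ==> 0 < N ==> ta <= N ==> norm z <= 2 * N ==>
    norm (p ta z) <= A * N ^ (2 * q) \<and> norm (pdif k p ta z) <= A * N ^ (2 * q - 1) \<and>
    norm (pdif j (pdif k p) ta z) <= A * N ^ (2 * q - 2)"
proof -
 define P :: "(real => complex^'n => complex) => nat => real => bool"
  where "P = (%f d C. \<forall>ta z N. 0 <= ta --> 0 < N --> ta <= N --> norm z <= 2 * N --> norm (f ta z) <= C * N ^ d)"
 obtain A0 where A0: "0 < A0" "P p (2 * q) A0" using homog_bound[OF cp hp] unfolding P_def by blast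
 have "\<forall>k. \<exists>C. 0 < C \<and> P (pdif k p) (2 * q - 1) C" using homog_bound[OF cp1 hp1] unfolding P_def by blast
 from choice[OF this] obtain A1 where A1: "\<And>k. 0 < A1 k \<and> P (pdif k p) (2 * q - 1) (A1 k)" by blast
 have "\<forall>x. \<exists>C. 0 < C \<and> P (pdif (fst x) (pdif (snd x) p)) (2 * q - 2) C" using homog_bound[OF cp2 hp2] unfolding P_def by blast
 from choice[OF this] obtain A2 where A2: "\<And>x. 0 < A2 x \<and> P (pdif (fst x) (pdif (snd x) p)) (2 * q - 2) (A2 x)" by blast
 define A where "A = A0 + (\<Sum>k\<in>UNIV. A1 k) + (\<Sum>x\<in>UNIV. A2 x)"
 have s1: "A1 k <= (\<Sum>k\<in>UNIV. A1 k)" for k using A1 by (intro member_le_sum) (auto intro: less_imp_le)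
 have s2: "A2 x <= (\<Sum>x\<in>UNIV. A2 x)" for x using A2 by (intro member_le_sum) (auto intro: less_imp_le)
 have n1: "0 <= (\<Sum>k\<in>UNIV. A1 k)" "0 <= (\<Sum>x\<in>UNIV. A2 x)" using A1 A2 by (auto intro!: sum_nonneg intro: less_imp_le)
 have le: "A0 <= A" "A1 k <= A" "A2 x <= A" for k x
  using s1[of k] s2[of x] n1 A0 unfolding A_def by linarith+
 have mono: "norm (f ta z) <= A * N ^ d"
  if "P f d C" "C <= A" "0 <= ta" "0 < N" "ta <= N" "norm z <= 2 * N" for f d C ta N z
 proof -
  have "norm (f ta z) <= C * N ^ d" using that unfolding P_def by blast
  also have "... <= A * N ^ d" using that by (intro mult_right_mono) auto
  finally show ?thesis .
 qed
 show thesis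
 proof (rule that[of A])
  show "0 < A" using A0 le by linarith
  show "norm (p ta z) <= A * N ^ (2 * q) \<and> norm (pdif k p ta z) <= A * N ^ (2 * q - 1) \<and>
    norm (pdif j (pdif k p) ta z) <= A * N ^ (2 * q - 2)" if "0 <= ta" "0 < N" "ta <= N" "norm z <= 2 * N" for ta z N k j
   using mono[OF A0(2) le(1) that] mono[OF _ le(2) that, of "pdif k p" "2 * q - 1" k] A1[of k]
    mono[OF _ le(3) that, of "pdif j (pdif k p)" "2 * q - 2" "(j, k)"] A2[of "(j, k)"] by simp
 qed
qed

text \<open>With \<open>N = ta + norm et\<close>, the square root behaves in the cone like a
  homogeneous function of degree \<open>q\<close>, each derivative lowering the degree by one. The
  lower bound for \<open>fi\<close> comes from that for the real part of \<open>p\<close>; the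
  derivatives are quotients whose numerators are homogeneous polynomials.\<close>

lemma symbol_estimates:
 obtains c0 C where "0 < c0" "c0 <= 1/2" "1 <= C"
  "\<And>ta et z. 0 <= ta ==> 0 < ta + norm et ==> norm (z - cvec et) <= c0 * (ta + norm et) ==>
    0 < Re (p ta z) \<and> (ta + norm et) ^ q <= C * norm (fi ta z) \<and> norm (fi ta z) <= C * (ta + norm et) ^ q
    \<and> (\<forall>k j. norm (fi1 k ta z) <= C * (ta + norm et) ^ (q - 1) \<and> norm (fi2 k j ta z) <= C * (ta + norm et) ^ (q - 2))"
proof -
 obtain c d where c: "0 < c" and d: "0 < d" "d <= 1/2" and lower:
  "\<And>ta et z. 0 <= ta ==> 0 < ta + norm et ==> norm (z - cvec et) <= d * (ta + norm et) ==>
    c * (ta + norm et) ^ (2 * q) <= Re (p ta z)"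
  by (rule p_near_real) blast
 obtain A where A: "0 < A" and upper:
  "\<And>ta z N k j. 0 <= ta ==> 0 < N ==> ta <= N ==> norm z <= 2 * N ==>
    norm (p ta z) <= A * N ^ (2 * q) \<and> norm (pdif k p ta z) <= A * N ^ (2 * q - 1) \<and>
    norm (pdif j (pdif k p) ta z) <= A * N ^ (2 * q - 2)"
  by (rule homog_bounds_uniform) blast
 define s where "s = sqrt c"
 have s: "0 < s" using c by (simp add: s_def)
 define C where "C = 1 + 1 / s + sqrt A + (A / (2 * s) + A\<^sup>2 / (4 * s ^ 3))"
 have nn: "0 <= 1 / s" "0 <= sqrt A" "0 <= A / (2 * s)" "0 <= A\<^sup>2 / (4 * s ^ 3)" using s A by auto
 have C: "1 <= C" "1 / s <= C" "sqrt A <= C" "A / (2 * s) <= C" "A / (2 * s) + A\<^sup>2 / (4 * s ^ 3) <= C"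
  unfolding C_def using nn by linarith+
 show thesis
 proof (rule that[OF d C(1)])
  fix ta :: real and et :: "real^'n" and z
  assume ta: "0 <= ta" and N0: "0 < ta + norm et" and z: "norm (z - cvec et) <= d * (ta + norm et)"
  define N where "N = ta + norm et"
  have N: "0 < N" "ta <= N" using N0 by (auto simp: N_def)
  have "norm z <= norm (z - cvec et) + norm (cvec et)"
   using norm_triangle_ineq[of "z - cvec et" "cvec et"] by (simp only: diff_add_cancel)
  also have "... <= (1/2) * N + N"
  proof (rule add_mono)
   have "d * N <= (1/2) * N" using d N by (intro mult_right_mono) auto
   then show "norm (z - cvec et) <= (1/2) * N" using z unfolding N_def by linarith
   show "norm (cvec et) <= N" using ta by (simp add: N_def)
  qed
  finally have z2: "norm z <= 2 * N" using N by simp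
  have lo: "c * N ^ (2 * q) <= Re (p ta z)" using lower[OF ta N0 z] by (simp add: N_def)
  then have pos: "0 < Re (p ta z)" using c N by (smt (verit) mult_pos_pos zero_less_power)
  have up: "norm (p ta z) <= A * N ^ (2 * q)" "norm (pdif k p ta z) <= A * N ^ (2 * q - 1)"
    "norm (pdif j (pdif k p) ta z) <= A * N ^ (2 * q - 2)" for k j
   using upper[OF ta N z2] by blast+
  have nphi: "norm (fi ta z) = sqrt (norm (p ta z))"
  proof -
  have "(norm (fi ta z))\<^sup>2 = norm (p ta z)" unfolding fi_def norm_power[symmetric] by simp
  then show ?thesis by (simp add: real_sqrt_unique)
 qed
  have sq: "sqrt (N ^ (2 * q)) = N ^ q"
  proof -
   have "N ^ (2 * q) = (N ^ q)\<^sup>2" by (simp add: power_mult[symmetric] mult.commute)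
   then show ?thesis using N by simp
  qed
  have lphi: "s * N ^ q <= norm (fi ta z)"
  proof -
   have "sqrt (c * N ^ (2 * q)) <= sqrt (norm (p ta z))"
    using lo complex_Re_le_cmod[of "p ta z"] by (intro real_sqrt_le_mono) linarith
   then show ?thesis unfolding nphi real_sqrt_mult sq s_def .
  qed
  have uphi: "norm (fi ta z) <= sqrt A * N ^ q"
  proof -
   have "sqrt (norm (p ta z)) <= sqrt (A * N ^ (2 * q))" using up(1) by (rule real_sqrt_le_mono)
   then show ?thesis unfolding nphi real_sqrt_mult sq .
  qed
  have Nq: "0 < N ^ k" and Nq0: "0 <= N ^ k" for k using N by simp_all
  have phi0: "0 < norm (fi ta z)" using lphi s Nq[of q] by (smt (verit) mult_pos_pos)
  have p1: "norm (fi1 k ta z) <= A / (2 * s) * N ^ (q - 1)" for k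
  proof -
   have "norm (fi1 k ta z) = norm (pdif k p ta z) / (2 * norm (fi ta z))"
    unfolding fi1_def norm_divide norm_mult by simp
   also have "... <= A * N ^ (2 * q - 1) / (2 * (s * N ^ q))"
    using up(2) lphi s Nq Nq0 A by (intro frac_le mult_pos_pos mult_nonneg_nonneg) auto
   also have "N ^ (2 * q - 1) = N ^ q * N ^ (q - 1)"
   proof -
    have "2 * q - 1 = q + (q - 1)" using q2 by simp
    then show ?thesis by (simp only: power_add)
   qed
   finally show ?thesis using N s by simp
  qed
  have p2: "norm (fi2 k j ta z) <= (A / (2 * s) + A\<^sup>2 / (4 * s ^ 3)) * N ^ (q - 2)" for k j
  proof -
   have "norm (fi2 k j ta z) <= norm (pdif j (pdif k p) ta z) / (2 * norm (fi ta z))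
     + norm (pdif k p ta z) * norm (pdif j p ta z) / (4 * norm (fi ta z) ^ 3)"
    unfolding fi2_def by (rule order_trans[OF norm_triangle_ineq4]) (simp add: norm_divide norm_mult norm_power)
   also have "... <= A * N ^ (2 * q - 2) / (2 * (s * N ^ q)) + (A * N ^ (2 * q - 1)) * (A * N ^ (2 * q - 1)) / (4 * (s * N ^ q) ^ 3)"
    using up lphi s N Nq Nq0 A by (intro add_mono frac_le mult_mono power_mono mult_nonneg_nonneg mult_pos_pos zero_less_power) auto
   also have "A * N ^ (2 * q - 2) / (2 * (s * N ^ q)) = A / (2 * s) * N ^ (q - 2)"
   proof -
    have "2 * q - 2 = q + (q - 2)" using q2 by simp
    then have "N ^ (2 * q - 2) = N ^ q * N ^ (q - 2)" by (simp only: power_add)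
    then show ?thesis using N s by simp
   qed
   also have "(A * N ^ (2 * q - 1)) * (A * N ^ (2 * q - 1)) / (4 * (s * N ^ q) ^ 3) = A\<^sup>2 / (4 * s ^ 3) * N ^ (q - 2)"
   proof -
    have "N ^ (2 * q - 1) * N ^ (2 * q - 1) = (N ^ q) ^ 3 * N ^ (q - 2)"
    proof -
     have "(2 * q - 1) + (2 * q - 1) = q * 3 + (q - 2)" using q2 by simp
     then show ?thesis by (simp only: power_mult[symmetric] power_add[symmetric])
    qed
    then have "(A * N ^ (2 * q - 1)) * (A * N ^ (2 * q - 1)) = A\<^sup>2 * ((N ^ q) ^ 3 * N ^ (q - 2))"
     by (simp only: power2_eq_square mult_ac)
    then show ?thesis using N s by (simp add: power_mult_distrib)
   qed
   finally show ?thesis by (simp only: distrib_right)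
  qed
  have "N ^ q <= C * norm (fi ta z)"
  proof -
   have "N ^ q <= (1 / s) * norm (fi ta z)" using lphi s by (simp add: field_simps)
   also have "... <= C * norm (fi ta z)" using C by (intro mult_right_mono) auto
   finally show ?thesis .
  qed
  moreover have "norm (fi ta z) <= C * N ^ q"
   using uphi mult_right_mono[OF C(3), of "N ^ q"] Nq[of q] by linarith
  moreover have "norm (fi1 k ta z) <= C * N ^ (q - 1)" for k
   using p1[of k] mult_right_mono[OF C(4), of "N ^ (q - 1)"] Nq[of "q - 1"] by linarith
  moreover have "norm (fi2 k j ta z) <= C * N ^ (q - 2)" for k j
   using p2[of k j] mult_right_mono[OF C(5), of "N ^ (q - 2)"] Nq[of "q - 2"] by linarith
  ultimately show "0 < Re (p ta z) \<and> (ta + norm et) ^ q <= C * norm (fi ta z) \<and> norm (fi ta z) <= C * (ta + norm et) ^ q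
    \<and> (\<forall>k j. norm (fi1 k ta z) <= C * (ta + norm et) ^ (q - 1) \<and> norm (fi2 k j ta z) <= C * (ta + norm et) ^ (q - 2))"
   using pos unfolding N_def by blast
 qed
qed

end

text \<open>Fixing \<open>c0\<close> and \<open>C\<close> allows later constants such as
  \<open>lip\<close>, \<open>hi_const\<close> and \<open>lo_rate\<close> to be defined from them,
  which shows at once that they do not depend on \<open>t\<close>, \<open>ta\<close>,
  \<open>ep\<close> or the space variable.\<close>

locale elliptic_estimates = elliptic_symbol p q for p :: "real => complex^'n::finite => complex" and q +
 fixes c0 C :: real
 assumes c0: "0 < c0" "c0 <= 1/2" and C1: "1 <= C"
  and est: "\<And>ta et z. 0 <= ta ==> 0 < ta + norm et ==> norm (z - cvec et) <= c0 * (ta + norm et) ==>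
    0 < Re (p ta z) \<and> (ta + norm et) ^ q <= C * norm (fi ta z) \<and> norm (fi ta z) <= C * (ta + norm et) ^ q
    \<and> (\<forall>k j. norm (fi1 k ta z) <= C * (ta + norm et) ^ (q - 1) \<and> norm (fi2 k j ta z) <= C * (ta + norm et) ^ (q - 2))"
begin

lemma real_est:
 assumes "0 <= ta" "0 < ta + norm et"
 shows "(ta + norm et) ^ q <= C * fir ta et" "fir ta et <= C * (ta + norm et) ^ q"
  "\<bar>fir1 k ta et\<bar> <= C * (ta + norm et) ^ (q - 1)" "\<bar>fir2 k j ta et\<bar> <= C * (ta + norm et) ^ (q - 2)"
proof -
 have "norm (cvec et - cvec et) <= c0 * (ta + norm et)" using assms c0 by simp
 note e = est[OF assms this, unfolded fi_cvec[OF assms(1)] fi1_cvec[OF assms(1)] fi2_cvec[OF assms(1)] norm_of_real]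
 show "(ta + norm et) ^ q <= C * fir ta et" "fir ta et <= C * (ta + norm et) ^ q"
  using e fir_pos[OF assms] by auto
 show "\<bar>fir1 k ta et\<bar> <= C * (ta + norm et) ^ (q - 1)" "\<bar>fir2 k j ta et\<bar> <= C * (ta + norm et) ^ (q - 2)"
  using e by blast+
qed

text \<open>At real points \<open>fi\<close> and \<open>fi1\<close> are real, so an imaginary shift
  \<open>b\<close> gives the phase the imaginary part \<open>b * fir1\<close> to first order. This
  is the source of the exponential gain; the second estimate measures the error.\<close>

lemma
 assumes "0 <= ta" "0 < ta + norm et" "\<bar>b\<bar> <= c0 * (ta + norm et)"
 shows Im_fi_bound: "\<bar>Im (fi ta (cvec et + axis k (\<i> * of_real b)))\<bar> <= C * \<bar>b\<bar> * (ta + norm et) ^ (q - 1)"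
  and Im_fi_taylor: "\<bar>Im (fi ta (cvec et + axis k (\<i> * of_real b))) - b * fir1 k ta et\<bar> <= C * b\<^sup>2 * (ta + norm et) ^ (q - 2)"
proof -
 let ?z = "%w. cvec et + axis k w"
 define S where "S = cball (0::complex) (c0 * (ta + norm et))"
 have S: "convex S" "0 \<in> S" "\<i> * of_real b \<in> S" using assms c0 by (auto simp: S_def norm_mult)
 have e: "0 < Re (p ta (?z w))" "norm (fi1 k ta (?z w)) <= C * (ta + norm et) ^ (q - 1)"
  "norm (fi2 k k ta (?z w)) <= C * (ta + norm et) ^ (q - 2)" if "w \<in> S" for w
 proof -
  have "norm (?z w - cvec et) <= c0 * (ta + norm et)"
   using that by (simp add: S_def norm_axis)
  from est[OF assms(1,2) this] show "0 < Re (p ta (?z w))" "norm (fi1 k ta (?z w)) <= C * (ta + norm et) ^ (q - 1)"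
   "norm (fi2 k k ta (?z w)) <= C * (ta + norm et) ^ (q - 2)" by blast+
 qed
 have d0: "((%w. fi ta (?z w)) has_field_derivative fi1 k ta (?z w)) (at w within S)" if "w \<in> S" for w
  by (rule has_field_derivative_at_within[OF fi_field_deriv[OF e(1)[OF that]]])
 have d1: "((%w. fi1 k ta (?z w)) has_field_derivative fi2 k k ta (?z w)) (at w within S)" if "w \<in> S" for w
  by (rule has_field_derivative_at_within[OF fi1_field_deriv[OF e(1)[OF that]]])
 have "norm (fi ta (?z (\<i> * of_real b)) - fi ta (?z 0)) <= C * (ta + norm et) ^ (q - 1) * norm (\<i> * of_real b - 0)"
  by (rule field_differentiable_bound[OF S(1) d0 e(2) S(3,2)])
 then have "norm (fi ta (?z (\<i> * of_real b)) - of_real (fir ta et)) <= C * \<bar>b\<bar> * (ta + norm et) ^ (q - 1)"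
  by (simp add: norm_mult fi_cvec[OF assms(1)] mult_ac)
 with abs_Im_le_cmod[of "fi ta (?z (\<i> * of_real b)) - of_real (fir ta et)"]
 show "\<bar>Im (fi ta (?z (\<i> * of_real b)))\<bar> <= C * \<bar>b\<bar> * (ta + norm et) ^ (q - 1)" by simp
 define f where "f = (%i::nat. if i = 0 then (%w. fi ta (?z w)) else if i = 1 then (%w. fi1 k ta (?z w)) else (%w. fi2 k k ta (?z w)))"
 have "norm (f 0 (\<i> * of_real b) - (\<Sum>i\<le>1. f i 0 * (\<i> * of_real b - 0) ^ i / fact i))
   <= C * (ta + norm et) ^ (q - 2) * norm (\<i> * of_real b - 0) ^ Suc 1 / fact 1"
 proof (rule complex_Taylor[OF S(1)])
  show "(f i has_field_derivative f (Suc i) x) (at x within S)" if "x \<in> S" "i <= 1" for i x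
  proof (cases "i = 0")
   case True
   then show ?thesis using d0[OF that(1)] by (simp add: f_def)
  next
   case False
   then have "i = 1" using that by simp
   then show ?thesis using d1[OF that(1)] by (simp add: f_def)
  qed
  show "norm (f (Suc 1) x) <= C * (ta + norm et) ^ (q - 2)" if "x \<in> S" for x
   using e(3)[OF that] by (simp add: f_def)
 qed (use S in auto)
 moreover have "(\<Sum>i\<le>1. f i 0 * (\<i> * of_real b - 0) ^ i / fact i) = of_real (fir ta et) + of_real (fir1 k ta et) * (\<i> * of_real b)"
  by (simp add: f_def fi_cvec[OF assms(1)] fi1_cvec[OF assms(1)])
 ultimately have "norm (fi ta (?z (\<i> * of_real b)) - (of_real (fir ta et) + of_real (fir1 k ta et) * (\<i> * of_real b)))
   <= C * b\<^sup>2 * (ta + norm et) ^ (q - 2)"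
  by (simp add: f_def norm_mult power_mult_distrib mult_ac power2_eq_square)
 with abs_Im_le_cmod[of "fi ta (?z (\<i> * of_real b)) - (of_real (fir ta et) + of_real (fir1 k ta et) * (\<i> * of_real b))"]
 show "\<bar>Im (fi ta (?z (\<i> * of_real b))) - b * fir1 k ta et\<bar> <= C * b\<^sup>2 * (ta + norm et) ^ (q - 2)"
  by (simp add: mult.commute)
qed

text \<open>The segment from \<open>ze\<close> to \<open>et\<close> keeps distance at least
  \<open>norm ze / 2\<close> from the origin, and on it \<open>ta\<close> plus the norm is at most
  \<open>3 * norm ze\<close>; the mean value theorem and the second-order estimate give the
  rest.\<close>

lemma fir1_lipschitz:
 assumes "0 <= ta" "ta <= norm ze" "ze ~= 0" "norm (et - ze) <= norm ze / 2"
 shows "\<bar>fir1 k ta et - fir1 k ta ze\<bar> <= (real CARD('n) * C * 3 ^ q) * norm (et - ze) * norm ze ^ (q - 2)"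
proof -
 define L where "L = norm ze"
 have L: "0 < L" using assms by (simp add: L_def)
 let ?u = "et - ze"
 have near: "L / 2 <= norm (ze + s *\<^sub>R ?u)" "ta + norm (ze + s *\<^sub>R ?u) <= 3 * L" "0 < ta + norm (ze + s *\<^sub>R ?u)"
  if "0 <= s" "s <= 1" for s
 proof -
  have "norm (s *\<^sub>R ?u) <= 1 * (L / 2)"
   unfolding norm_scaleR using that assms by (intro mult_mono) (auto simp: L_def)
  moreover have "norm ze <= norm (ze + s *\<^sub>R ?u) + norm (s *\<^sub>R ?u)"
   by (metis add_diff_cancel_right' norm_triangle_ineq4)
  ultimately show 1: "L / 2 <= norm (ze + s *\<^sub>R ?u)" unfolding L_def by linarith
  show "ta + norm (ze + s *\<^sub>R ?u) <= 3 * L"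
   using norm_triangle_ineq[of ze "s *\<^sub>R ?u"] \<open>norm (s *\<^sub>R ?u) <= 1 * (L / 2)\<close> assms(2) L unfolding L_def by linarith
  show "0 < ta + norm (ze + s *\<^sub>R ?u)" using 1 L assms(1) by linarith
 qed
 obtain s where s: "0 < s" "s < 1" and eq: "fir1 k ta (ze + 1 *\<^sub>R ?u) - fir1 k ta (ze + 0 *\<^sub>R ?u) = (1 - 0) * (\<Sum>j\<in>UNIV. ?u $ j * fir2 k j ta (ze + s *\<^sub>R ?u))"
  using MVT2[of 0 1 "%s. fir1 k ta (ze + s *\<^sub>R ?u)" "%s. \<Sum>j\<in>UNIV. ?u $ j * fir2 k j ta (ze + s *\<^sub>R ?u)"]
   fir1_deriv[OF assms(1) near(3)] by auto
 have "\<bar>\<Sum>j\<in>UNIV. ?u $ j * fir2 k j ta (ze + s *\<^sub>R ?u)\<bar> <= (\<Sum>j\<in>(UNIV :: 'n set). norm ?u * (C * (3 * L) ^ (q - 2)))"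
 proof (rule order_trans[OF sum_abs], rule sum_mono)
  fix j
  have "\<bar>fir2 k j ta (ze + s *\<^sub>R ?u)\<bar> <= C * (ta + norm (ze + s *\<^sub>R ?u)) ^ (q - 2)"
   using s near by (intro real_est assms) auto
  also have "... <= C * (3 * L) ^ (q - 2)"
   using near[of s] s C1 by (intro mult_left_mono power_mono) auto
  finally show "\<bar>?u $ j * fir2 k j ta (ze + s *\<^sub>R ?u)\<bar> <= norm ?u * (C * (3 * L) ^ (q - 2))"
   unfolding abs_mult by (intro mult_mono component_le_norm_cart) auto
 qed
 also have "... = real CARD('n) * C * 3 ^ (q - 2) * norm ?u * L ^ (q - 2)"
  by (simp add: power_mult_distrib)
 also have "... <= real CARD('n) * C * 3 ^ q * norm ?u * L ^ (q - 2)"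
  using C1 L by (intro mult_right_mono mult_left_mono power_increasing) auto
 finally show ?thesis using eq by (simp add: L_def)
qed

end

section \<open>The gradient map: lower bound and local injectivity\<close>

context elliptic_estimates
begin

lemma pr_homog: "0 < s ==> pr (s * ta) (s *\<^sub>R et) = s ^ (2 * q) * pr ta et"
 and pr1_homog: "0 < s ==> pr1 k (s * ta) (s *\<^sub>R et) = s ^ (2 * q - 1) * pr1 k ta et"
proof -
 assume s: "0 < s"
 have "p (s * ta) (s *\<^sub>R cvec et) = of_real s ^ (2 * q) * p ta (cvec et)"
  "pdif k p (s * ta) (s *\<^sub>R cvec et) = of_real s ^ (2 * q - 1) * pdif k p ta (cvec et)"
  using hp hp1[of k] s unfolding homog_def by blast+
 then show "pr (s * ta) (s *\<^sub>R et) = s ^ (2 * q) * pr ta et"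
  "pr1 k (s * ta) (s *\<^sub>R et) = s ^ (2 * q - 1) * pr1 k ta et"
  unfolding cvec_scaleR[symmetric] p_cvec p1_cvec of_real_power[symmetric] of_real_mult[symmetric] of_real_eq_iff .
qed

lemma fir_homog: "0 < s ==> fir (s * ta) (s *\<^sub>R et) = s ^ q * fir ta et"
proof -
 assume s: "0 < s"
 have "s ^ (2 * q) = (s ^ q)\<^sup>2" by (simp add: power_mult[symmetric] mult.commute)
 then show ?thesis using s unfolding fir_def pr_homog[OF s] real_sqrt_mult by simp
qed

lemma fir1_homog: "0 < s ==> fir1 k (s * ta) (s *\<^sub>R et) = s ^ (q - 1) * fir1 k ta et"
proof -
 assume s: "0 < s"
 have "2 * q - 1 = (q - 1) + q" using q2 by simp
 then have "s ^ (2 * q - 1) = s ^ (q - 1) * s ^ q" by (simp only: power_add)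
 then show ?thesis using s unfolding fir1_def pr1_homog[OF s] fir_homog[OF s] by simp
qed

lemma fir1_normalize:
 assumes "0 < L"
 shows "fir1 k ta et = L ^ (q - 1) * fir1 k (ta / L) ((1 / L) *\<^sub>R et)"
 using fir1_homog[OF assms, of k "ta / L" "(1 / L) *\<^sub>R et"] assms by simp

text \<open>By Euler's relation, a zero of the gradient at \<open>ta = 0\<close> would be a zero of
  the principal polynomial. Compactness extends the lower bound to small
  \<open>ta / norm ze\<close>, homogeneity to all scales.\<close>

lemma gradient_lower:
 obtains c d where "0 < c" "0 < d" "d <= 1"
  "\<And>ta ze. 0 <= ta ==> ta <= d * norm ze ==> ze ~= 0 ==> \<exists>k. c * norm ze ^ (q - 1) <= \<bar>fir1 k ta ze\<bar>"
proof -
 define f where "f = (%x. \<Sum>k\<in>UNIV. \<bar>fir1 k (fst x) (snd x)\<bar>)"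
 have cont: "continuous_on ({0..1} \<times> sphere 0 1) f"
  unfolding f_def
 proof (intro continuous_on_sum continuous_on_rabs fir1_continuous continuous_intros)
  fix x :: "real \<times> (real^'n)" assume "x \<in> {0..1} \<times> sphere 0 1"
  then show "0 <= fst x \<and> 0 < fst x + norm (snd x)" by auto
 qed
 have pos: "0 < f (0, x)" if "x \<in> sphere 0 1" for x
 proof (rule ccontr)
  assume "\<not> 0 < f (0, x)"
  moreover have "0 <= f (0, x)" unfolding f_def by (intro sum_nonneg) auto
  ultimately have "f (0, x) = 0" by linarith
  then have "fir1 k 0 x = 0" for k unfolding f_def by (simp add: sum_nonneg_eq_0_iff)
  moreover have x: "0 < 0 + norm x" using that by simp
  have "fir 0 x > 0" by (rule fir_pos[OF order_refl x])
  ultimately have "pr1 k 0 x = 0" for k unfolding fir1_def by (metis divide_eq_0_iff mult_eq_0_iff less_irrefl zero_neq_numeral)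
  then have "real (2 * q) * pr 0 x = 0"
   using homog_euler[OF cp hp, of x] unfolding pr1_def pr_def by simp
  then show False using pr_pos[OF order_refl x] q2 by simp
 qed
 obtain c d where cd: "0 < c" "0 < d" "d <= 1" "\<And>ta x. 0 <= ta ==> ta <= d ==> x \<in> sphere 0 1 ==> c <= f (ta, x)"
  using compact_positive_param[OF compact_sphere cont pos] by blast
 show thesis
 proof (rule that[of "c / real CARD('n)" d])
  fix ta and ze :: "real^'n" assume *: "0 <= ta" "ta <= d * norm ze" "ze ~= 0"
  define L where "L = norm ze"
  have L: "0 < L" using * by (simp add: L_def)
  have "c <= f (ta / L, (1 / L) *\<^sub>R ze)"
   using * L by (intro cd) (auto simp: L_def field_simps)
  have "\<exists>k. c / real CARD('n) <= \<bar>fir1 k (ta / L) ((1 / L) *\<^sub>R ze)\<bar>"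
  proof (rule ccontr)
   assume "\<not> ?thesis"
   then have "f (ta / L, (1 / L) *\<^sub>R ze) < (\<Sum>k\<in>(UNIV :: 'n set). c / real CARD('n))"
    unfolding f_def fst_conv snd_conv by (intro sum_strict_mono) (auto simp: not_le)
   then show False using \<open>c <= f (ta / L, (1 / L) *\<^sub>R ze)\<close> by simp
  qed
  then obtain k where "c / real CARD('n) <= \<bar>fir1 k (ta / L) ((1 / L) *\<^sub>R ze)\<bar>" by blast
  then have "L ^ (q - 1) * (c / real CARD('n)) <= L ^ (q - 1) * \<bar>fir1 k (ta / L) ((1 / L) *\<^sub>R ze)\<bar>"
   using L by (intro mult_left_mono) auto
  also have "... = \<bar>fir1 k ta ze\<bar>"
   using L by (subst (2) fir1_normalize[OF L]) (simp add: abs_mult)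
  finally show "\<exists>k. c / real CARD('n) * norm ze ^ (q - 1) <= \<bar>fir1 k ta ze\<bar>"
   by (auto simp: L_def mult.commute)
 qed (use cd in auto)
qed

text \<open>
  If the Hessian of the square root of a homogeneous polynomial annihilates \<open>w\<close>, then Euler's
  relation makes the Hessian of the polynomial annihilate a vector \<open>w - \<alpha> et\<close>; so \<open>w\<close> is a multiple
  of \<open>et\<close>, in which direction the square root has degree \<open>q \<noteq> 1\<close>.
\<close>

lemma hessian_sqrt_nondegenerate:
 assumes "et ~= 0" and zero: "\<And>k. (\<Sum>j\<in>UNIV. w $ j * fir2 k j 0 et) = 0"
 shows "w = 0"
proof -
 define P where "P = pr 0 et"
 define S where "S = (\<Sum>j\<in>UNIV. pr1 j 0 et * w $ j)"
 \<comment> \<open>Below, the Hessian of the polynomial sends \<open>w\<close> to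
   \<open>S / (2 * P)\<close> times the gradient, and by Euler it sends \<open>et\<close> to
   \<open>2 * q - 1\<close> times the gradient. This \<open>\<alpha>\<close> makes the two images
   cancel.\<close>
 define \<alpha> where "\<alpha> = S / (2 * P * real (2 * q - 1))"
 have x: "0 < 0 + norm et" using assms by simp
 have P: "0 < P" unfolding P_def by (rule pr_pos[OF order_refl x])
 have phi: "0 < fir 0 et" "(fir 0 et)\<^sup>2 = P" using fir_pos[OF order_refl x] P by (auto simp: fir_def P_def)
 have m: "0 < real (2 * q - 1)" using q2 by simp
 have H: "(\<Sum>j\<in>UNIV. pr2 k j 0 et * w $ j) = pr1 k 0 et * S / (2 * P)" for k
 proof -
  have "w $ j * fir2 k j 0 et = (pr2 k j 0 et * w $ j) * (1 / (2 * fir 0 et)) - (pr1 j 0 et * w $ j) * (pr1 k 0 et / (4 * fir 0 et ^ 3))" for j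
   unfolding fir2_def by (simp add: field_simps)
  then have "(\<Sum>j\<in>UNIV. pr2 k j 0 et * w $ j) * (1 / (2 * fir 0 et)) - S * (pr1 k 0 et / (4 * fir 0 et ^ 3)) = 0"
   using zero[of k] unfolding S_def by (simp only: sum_subtractf sum_distrib_right)
  then have "(\<Sum>j\<in>UNIV. pr2 k j 0 et * w $ j) = S * pr1 k 0 et / (2 * (fir 0 et)\<^sup>2)"
   using phi(1) by (simp add: field_simps power2_eq_square power3_eq_cube)
  then show ?thesis unfolding phi(2) by (simp add: mult.commute)
 qed
 have E: "(\<Sum>j\<in>UNIV. pr2 k j 0 et * et $ j) = real (2 * q - 1) * pr1 k 0 et" for k
  using homog_euler[OF cp1 hp1, of et k] unfolding pr1_def pr2_def by (simp only: mult.commute)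
 have "w - \<alpha> *\<^sub>R et = 0"
 proof (rule nondeg[OF assms(1)])
  fix k
  have "(\<Sum>j\<in>UNIV. Re (pdif j (pdif k p) 0 (cvec et)) * (w - \<alpha> *\<^sub>R et) $ j)
    = (\<Sum>j\<in>UNIV. pr2 k j 0 et * w $ j) - \<alpha> * (\<Sum>j\<in>UNIV. pr2 k j 0 et * et $ j)"
   unfolding pr2_def sum_distrib_left sum_subtractf[symmetric]
   by (intro sum.cong refl) (simp add: algebra_simps)
  also have "... = 0" unfolding H E \<alpha>_def using P m by (simp add: field_simps)
  finally show "(\<Sum>j\<in>UNIV. Re (pdif j (pdif k p) 0 (cvec et)) * (w - \<alpha> *\<^sub>R et) $ j) = 0" .
 qed
 then have w: "w = \<alpha> *\<^sub>R et" by simp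
 \<comment> \<open>Inserting \<open>w = \<alpha> *\<^sub>R et\<close> into \<open>S\<close> gives
   \<open>\<alpha> * 2 q P\<close>, while the definition of \<open>\<alpha>\<close> gives
   \<open>S = \<alpha> * 2 P (2 q - 1)\<close>. The factors differ because
   \<open>q \<ge> 2\<close>.\<close>
 have "S = \<alpha> * (\<Sum>j\<in>UNIV. et $ j * pr1 j 0 et)"
  unfolding S_def w sum_distrib_left by (intro sum.cong refl) simp
 also have "(\<Sum>j\<in>UNIV. et $ j * pr1 j 0 et) = real (2 * q) * P"
  using homog_euler[OF cp hp, of et] unfolding pr1_def P_def pr_def .
 finally have "\<alpha> * (2 * P * real (2 * q - 1)) = \<alpha> * (real (2 * q) * P)"
  using P m unfolding \<alpha>_def by simp
 then have "\<alpha> * P * (2 * real (2 * q - 1) - real (2 * q)) = 0" by (simp add: algebra_simps)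
 moreover have "2 * real (2 * q - 1) - real (2 * q) > 0" using q2 by (simp add: of_nat_diff)
 ultimately have "\<alpha> = 0" using P q2 by auto
 then show ?thesis using w by simp
qed

text \<open>The mean value theorem expresses differences of the gradient through the Hessian, whose
  action on unit vectors is bounded below at \<open>ta = 0\<close> by compactness. Nearby points and
  small parameters change its entries little. Injectivity is thus obtained only at distances up to
  \<open>d * norm ze\<close>, and an annulus will have to be cut into pieces.\<close>

lemma gradient_injective:
 obtains c d where "0 < c" "0 < d" "d <= 1/2"
  "\<And>ta ze et. 0 <= ta ==> ta <= d * norm ze ==> ze ~= 0 ==> norm (et - ze) <= d * norm ze ==>
    \<exists>k. c * norm ze ^ (q - 2) * norm (et - ze) <= \<bar>fir1 k ta et - fir1 k ta ze\<bar>"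
proof -
 define M where "M = (%x. (\<chi> k j. fir2 k j (fst x) (snd x)) :: real^'n^'n)"
 define K where "K = {x :: real^'n. 1/2 <= norm x \<and> norm x <= 2}"
 have "closed K" unfolding K_def Collect_conj_eq
  by (intro closed_Int closed_Collect_le continuous_intros)
 moreover have "K \<subseteq> cball 0 2" by (auto simp: K_def)
 ultimately have K: "compact K" by (metis closed_Int_compact compact_cball inf.absorb1)
 have contM: "continuous_on ({0..1} \<times> K) (%x. fir2 k j (fst x) (snd x))" for k j
  by (rule fir2_continuous) (auto intro!: continuous_intros simp: K_def)
 have "continuous_on ({0..1} \<times> K) M" unfolding M_def
  by (intro continuous_on_vec_lambda contM)
 then have uc: "uniformly_continuous_on ({0..1} \<times> K) M"
  by (intro compact_uniformly_continuous compact_Times compact_Icc K)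
 have sK: "sphere 0 1 \<subseteq> K" by (auto simp: K_def)
 define g where "g = (%x :: (real^'n) \<times> (real^'n). \<Sum>k\<in>UNIV. \<bar>\<Sum>j\<in>UNIV. snd x $ j * fir2 k j 0 (fst x)\<bar>)"
 have contg: "continuous_on (sphere 0 1 \<times> sphere 0 1) g"
  unfolding g_def
 proof (intro continuous_on_sum continuous_on_rabs continuous_on_mult fir2_continuous continuous_intros)
  fix x :: "(real^'n) \<times> (real^'n)" assume "x \<in> sphere 0 1 \<times> sphere 0 1"
  then show "0 <= (0::real) \<and> 0 < 0 + norm (fst x)" by auto
 qed
 have ne: "sphere (0 :: real^'n) 1 ~= {}" by simp
 then have "sphere (0 :: real^'n) 1 \<times> sphere (0 :: real^'n) 1 ~= {}" by blast
 from continuous_attains_inf[OF _ this contg]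
 obtain x0 where x0: "x0 \<in> sphere 0 1 \<times> sphere 0 1" "\<And>x. x \<in> sphere 0 1 \<times> sphere 0 1 ==> g x0 <= g x"
  using compact_Times[OF compact_sphere compact_sphere] by blast
 define c where "c = g x0"
 have c: "0 < c"
 proof (rule ccontr)
  assume "\<not> 0 < c"
  moreover have "0 <= c" unfolding c_def g_def by (intro sum_nonneg) auto
  ultimately have "g x0 = 0" by (simp add: c_def)
  then have "(\<Sum>j\<in>UNIV. snd x0 $ j * fir2 k j 0 (fst x0)) = 0" for k
   unfolding g_def by (simp add: sum_nonneg_eq_0_iff)
  then have "snd x0 = 0" using x0(1) by (intro hessian_sqrt_nondegenerate[of "fst x0"]) auto
  then show False using x0(1) by auto
 qed
 define n where "n = real CARD('n)"
 have n: "0 < n" by (simp add: n_def)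
 \<comment> \<open>Each of the \<open>n\<close> components has an error of at most
   \<open>n * ep\<close>, which adds up to half of the lower bound \<open>c\<close>.\<close>
 define ep where "ep = c / (2 * n * n)"
 have ep: "0 < ep" using c n by (simp add: ep_def)
 obtain d where d: "d > 0" "\<And>x y. x \<in> {0..1} \<times> K ==> y \<in> {0..1} \<times> K ==> dist y x < d ==> dist (M y) (M x) < ep"
  using uc ep unfolding uniformly_continuous_on_def by blast
 define d' where "d' = min (1/2) (d / 4)"
 have d': "0 < d'" "d' <= 1/2" "d' <= d / 4" using d(1) by (auto simp: d'_def)
 have unit: "\<exists>k. c / (2 * n) * norm (et - ze) <= \<bar>fir1 k ta et - fir1 k ta ze\<bar>"
  if ta: "0 <= ta" "ta <= d'" and ze: "norm ze = 1" and et: "norm (et - ze) <= d'" for ta and ze et :: "real^'n"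
 proof (cases "et = ze")
  case True
  then show ?thesis by simp
 next
  case False
  define \<rho> where "\<rho> = norm (et - ze)"
  define w where "w = (1 / \<rho>) *\<^sub>R (et - ze)"
  have \<rho>: "0 < \<rho>" "\<rho> <= d'" using False et by (auto simp: \<rho>_def)
  have w: "norm w = 1" "et = ze + \<rho> *\<^sub>R w" using \<rho>(1) by (auto simp: w_def) (simp add: \<rho>_def)
  have seg: "ze + s *\<^sub>R w \<in> K" "dist (ze + s *\<^sub>R w) ze <= d'" "0 < ta + norm (ze + s *\<^sub>R w)" if "0 <= s" "s <= \<rho>" for s
  proof -
   have s: "norm (s *\<^sub>R w) <= d'" using that \<rho> w(1) by simp
   then show "dist (ze + s *\<^sub>R w) ze <= d'" by (simp add: dist_norm)
   have "norm ze <= norm (ze + s *\<^sub>R w) + norm (s *\<^sub>R w)"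
    using norm_triangle_ineq4[of "ze + s *\<^sub>R w" "s *\<^sub>R w"] by (simp only: add_diff_cancel_right')
   then have lo: "1 / 2 <= norm (ze + s *\<^sub>R w)" using s d'(2) ze by linarith
   then show "ze + s *\<^sub>R w \<in> K"
    using norm_triangle_ineq[of ze "s *\<^sub>R w"] s d'(2) ze unfolding K_def mem_Collect_eq by linarith
   show "0 < ta + norm (ze + s *\<^sub>R w)" using lo ta(1) by linarith
  qed
  \<comment> \<open>Each component \<open>k\<close> has its own intermediate point. Hence the
    comparison is made with the Hessian entries at \<open>ze\<close> and not with the Hessian at one
    common point.\<close>
  have "\<exists>s. 0 < s \<and> s < \<rho> \<and> fir1 k ta et - fir1 k ta ze = \<rho> * (\<Sum>j\<in>UNIV. w $ j * fir2 k j ta (ze + s *\<^sub>R w))" for k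
   using MVT2[of 0 \<rho> "%s. fir1 k ta (ze + s *\<^sub>R w)" "%s. \<Sum>j\<in>UNIV. w $ j * fir2 k j ta (ze + s *\<^sub>R w)"]
    fir1_deriv[OF ta(1) seg(3)] \<rho>(1) unfolding w(2) by auto
  then obtain s where s: "\<And>k. 0 < s k" "\<And>k. s k < \<rho>"
   "\<And>k. fir1 k ta et - fir1 k ta ze = \<rho> * (\<Sum>j\<in>UNIV. w $ j * fir2 k j ta (ze + s k *\<^sub>R w))" by metis
  have close: "\<bar>fir2 k j ta (ze + s k *\<^sub>R w) - fir2 k j 0 ze\<bar> <= ep" for k j
  proof -
   have in1: "(ta, ze + s k *\<^sub>R w) \<in> {0..1} \<times> K" using seg(1)[of "s k"] s(1,2)[of k] ta d' by simp
   have in2: "(0 :: real, ze) \<in> {0..1} \<times> K" using ze by (simp add: K_def)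
   have "dist (ta, ze + s k *\<^sub>R w) (0, ze) <= dist ta 0 + dist (ze + s k *\<^sub>R w) ze"
    unfolding dist_Pair_Pair by (rule sqrt_sum_squares_le_sum) auto
   also have "... <= d' + d'" using seg(2)[of "s k"] s(1,2)[of k] ta by (intro add_mono) auto
   also have "... < d" using d' d(1) by linarith
   finally have "dist (M (ta, ze + s k *\<^sub>R w)) (M (0, ze)) < ep" by (rule d(2)[OF in2 in1])
   then have "norm ((M (ta, ze + s k *\<^sub>R w) - M (0, ze)) $ k $ j) < ep"
    unfolding dist_norm
    using Finite_Cartesian_Product.norm_nth_le[of "(M (ta, ze + s k *\<^sub>R w) - M (0, ze)) $ k" j]
     Finite_Cartesian_Product.norm_nth_le[of "M (ta, ze + s k *\<^sub>R w) - M (0, ze)" k] by linarith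
   then show ?thesis by (simp add: M_def)
  qed
  have "(ze, w) \<in> sphere 0 1 \<times> sphere 0 1" using w(1) ze by simp
  then have "c <= g (ze, w)" unfolding c_def by (rule x0(2))
  also have "g (ze, w) <= (\<Sum>k\<in>UNIV. \<bar>\<Sum>j\<in>UNIV. w $ j * fir2 k j ta (ze + s k *\<^sub>R w)\<bar> + n * ep)"
   unfolding g_def fst_conv snd_conv
  proof (rule sum_mono)
   fix k
   have "\<bar>(\<Sum>j\<in>UNIV. w $ j * fir2 k j ta (ze + s k *\<^sub>R w)) - (\<Sum>j\<in>UNIV. w $ j * fir2 k j 0 ze)\<bar>
     <= (\<Sum>j\<in>(UNIV :: 'n set). ep)"
    unfolding sum_subtractf[symmetric] right_diff_distrib[symmetric]
   proof (rule order_trans[OF sum_abs], rule sum_mono)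
    fix j
    have "\<bar>w $ j\<bar> <= 1" using component_le_norm_cart[of w j] w(1) by simp
    then have "\<bar>w $ j\<bar> * \<bar>fir2 k j ta (ze + s k *\<^sub>R w) - fir2 k j 0 ze\<bar> <= 1 * ep"
     using close[of k j] ep by (intro mult_mono) auto
    then show "\<bar>w $ j * (fir2 k j ta (ze + s k *\<^sub>R w) - fir2 k j 0 ze)\<bar> <= ep" by (simp add: abs_mult)
   qed
   then show "\<bar>\<Sum>j\<in>UNIV. w $ j * fir2 k j 0 ze\<bar> <= \<bar>\<Sum>j\<in>UNIV. w $ j * fir2 k j ta (ze + s k *\<^sub>R w)\<bar> + n * ep"
    by (simp add: n_def)
  qed
  also have "... = (\<Sum>k\<in>UNIV. \<bar>\<Sum>j\<in>UNIV. w $ j * fir2 k j ta (ze + s k *\<^sub>R w)\<bar>) + n * (n * ep)"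
   by (simp add: sum.distrib n_def)
  also have "n * (n * ep) = c / 2" using n by (simp add: ep_def)
  finally have sum: "c / 2 <= (\<Sum>k\<in>UNIV. \<bar>\<Sum>j\<in>UNIV. w $ j * fir2 k j ta (ze + s k *\<^sub>R w)\<bar>)" by simp
  have "\<exists>k. c / (2 * n) <= \<bar>\<Sum>j\<in>UNIV. w $ j * fir2 k j ta (ze + s k *\<^sub>R w)\<bar>"
  proof (rule ccontr)
   assume "\<not> ?thesis"
   then have "(\<Sum>k\<in>UNIV. \<bar>\<Sum>j\<in>UNIV. w $ j * fir2 k j ta (ze + s k *\<^sub>R w)\<bar>) < (\<Sum>k\<in>(UNIV :: 'n set). c / (2 * n))"
    by (intro sum_strict_mono) (auto simp: not_le)
   also have "... = c / 2" using n by (simp add: n_def)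
   finally show False using sum by simp
  qed
  then obtain k where "c / (2 * n) <= \<bar>\<Sum>j\<in>UNIV. w $ j * fir2 k j ta (ze + s k *\<^sub>R w)\<bar>" by blast
  then have "c / (2 * n) * \<rho> <= \<bar>\<Sum>j\<in>UNIV. w $ j * fir2 k j ta (ze + s k *\<^sub>R w)\<bar> * \<rho>"
   using \<rho> by (intro mult_right_mono) auto
  also have "... = \<bar>fir1 k ta et - fir1 k ta ze\<bar>" unfolding s(3) abs_mult using \<rho> by simp
  finally show ?thesis unfolding \<rho>_def by blast
 qed
 show thesis
 proof (rule that[of "c / (2 * n)" d'])
  fix ta and ze et :: "real^'n"
  assume *: "0 <= ta" "ta <= d' * norm ze" "ze ~= 0" "norm (et - ze) <= d' * norm ze"
  define L where "L = norm ze"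
  have L: "0 < L" using * by (simp add: L_def)
  have nd: "norm ((1 / L) *\<^sub>R et - (1 / L) *\<^sub>R ze) = norm (et - ze) / L"
   unfolding scaleR_diff_right[symmetric] using L by simp
  have "\<exists>k. c / (2 * n) * norm ((1 / L) *\<^sub>R et - (1 / L) *\<^sub>R ze)
    <= \<bar>fir1 k (ta / L) ((1 / L) *\<^sub>R et) - fir1 k (ta / L) ((1 / L) *\<^sub>R ze)\<bar>"
  proof (rule unit)
   show "0 <= ta / L" "ta / L <= d'" using * L by (auto simp: L_def[symmetric] divide_le_eq)
   show "norm ((1 / L) *\<^sub>R ze) = 1" using L by (simp add: L_def)
   show "norm ((1 / L) *\<^sub>R et - (1 / L) *\<^sub>R ze) <= d'"
    unfolding nd using * L by (simp add: L_def[symmetric] divide_le_eq)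
  qed
  then obtain k where k: "c / (2 * n) * (norm (et - ze) / L)
    <= \<bar>fir1 k (ta / L) ((1 / L) *\<^sub>R et) - fir1 k (ta / L) ((1 / L) *\<^sub>R ze)\<bar>"
   unfolding nd by blast
  have "q - 1 = Suc (q - 2)" using q2 by simp
  then have Lq: "L ^ (q - 1) = L ^ (q - 2) * L" by simp
  have "c / (2 * n) * L ^ (q - 2) * norm (et - ze) = L ^ (q - 1) * (c / (2 * n) * (norm (et - ze) / L))"
   using L unfolding Lq by simp
  also have "... <= L ^ (q - 1) * \<bar>fir1 k (ta / L) ((1 / L) *\<^sub>R et) - fir1 k (ta / L) ((1 / L) *\<^sub>R ze)\<bar>"
   using k L by (intro mult_left_mono) auto
  also have "... = \<bar>L ^ (q - 1) * fir1 k (ta / L) ((1 / L) *\<^sub>R et) - L ^ (q - 1) * fir1 k (ta / L) ((1 / L) *\<^sub>R ze)\<bar>"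
   using L by (simp add: abs_mult right_diff_distrib[symmetric])
  also have "... = \<bar>fir1 k ta et - fir1 k ta ze\<bar>"
   by (simp only: fir1_normalize[OF L, symmetric])
  finally show "\<exists>k. c / (2 * n) * norm ze ^ (q - 2) * norm (et - ze) <= \<bar>fir1 k ta et - fir1 k ta ze\<bar>"
   unfolding L_def by blast
 qed (use c n d' in auto)
qed

end

section \<open>Gaussian wave packets away from the origin\<close>

lemma nn_integral_lincomb:
 fixes f g :: "'a => real"
 assumes [measurable]: "f \<in> borel_measurable M" "g \<in> borel_measurable M"
  and ab: "0 <= a" "0 <= b" and nonneg: "\<And>x. 0 <= f x" "\<And>x. 0 <= g x"
 shows "(\<integral>\<^sup>+x. ennreal (a * f x + b * g x) \<partial>M)
  = ennreal a * (\<integral>\<^sup>+x. ennreal (f x) \<partial>M) + ennreal b * (\<integral>\<^sup>+x. ennreal (g x) \<partial>M)"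
proof -
 have "ennreal (a * f x + b * g x) = ennreal a * ennreal (f x) + ennreal b * ennreal (g x)" for x
  using ab nonneg by (simp add: ennreal_mult)
 then have "(\<integral>\<^sup>+x. ennreal (a * f x + b * g x) \<partial>M) = (\<integral>\<^sup>+x. ennreal a * ennreal (f x) + ennreal b * ennreal (g x) \<partial>M)"
  by simp
 also have "... = (\<integral>\<^sup>+x. ennreal a * ennreal (f x) \<partial>M) + (\<integral>\<^sup>+x. ennreal b * ennreal (g x) \<partial>M)"
  by (rule nn_integral_add) measurable
 also have "(\<integral>\<^sup>+x. ennreal a * ennreal (f x) \<partial>M) = ennreal a * (\<integral>\<^sup>+x. ennreal (f x) \<partial>M)"
  by (rule nn_integral_cmult) measurable
 also have "(\<integral>\<^sup>+x. ennreal b * ennreal (g x) \<partial>M) = ennreal b * (\<integral>\<^sup>+x. ennreal (g x) \<partial>M)"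
  by (rule nn_integral_cmult) measurable
 finally show ?thesis .
qed

text \<open>Complex squares are summed instead of squared moduli, so that the Gaussian extends
  holomorphically in every coordinate.\<close>

definition gauss :: "real => real^'n::finite => complex^'n => complex" where
 "gauss r ze z = exp (- (\<Sum>j\<in>UNIV. (z $ j - of_real (ze $ j))\<^sup>2) / of_real (r\<^sup>2))"

lemma norm_sq_shift:
 fixes et ze :: "real^'n::finite"
 shows "(\<Sum>j\<in>UNIV. ((cvec et + axis k (\<i> * of_real b)) $ j - of_real (ze $ j))\<^sup>2)
  = of_real ((norm (et - ze))\<^sup>2 - b\<^sup>2) + 2 * \<i> * of_real (b * (et $ k - ze $ k))"
proof -
 have "((cvec et + axis k (\<i> * of_real b)) $ j - of_real (ze $ j))\<^sup>2
   = of_real ((et $ j - ze $ j)\<^sup>2) + (if j = k then 2 * \<i> * of_real (b * (et $ k - ze $ k)) - of_real (b\<^sup>2) else 0)" for j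
  by (auto simp: axis_def power2_eq_square algebra_simps)
 then have "(\<Sum>j\<in>UNIV. ((cvec et + axis k (\<i> * of_real b)) $ j - of_real (ze $ j))\<^sup>2)
  = (\<Sum>j\<in>UNIV. of_real ((et $ j - ze $ j)\<^sup>2)) + (2 * \<i> * of_real (b * (et $ k - ze $ k)) - of_real (b\<^sup>2))"
  by (simp only: sum.distrib) simp
 also have "(\<Sum>j\<in>UNIV. of_real ((et $ j - ze $ j)\<^sup>2)) = (of_real ((norm (et - ze))\<^sup>2) :: complex)"
  by (simp only: norm_vec_sq of_real_sum vector_minus_component)
 finally show ?thesis by simp
qed

lemma norm_gauss_shift:
 "norm (gauss r ze (cvec et + axis k (\<i> * of_real b))) = exp (- (((norm (et - ze))\<^sup>2 - b\<^sup>2) / r\<^sup>2))"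
 unfolding gauss_def norm_sq_shift norm_exp_eq_Re by (simp add: diff_divide_distrib)

lemma gauss_cvec: "gauss r ze (cvec et) = of_real (exp (- ((norm (et - ze))\<^sup>2 / r\<^sup>2)))"
 using norm_sq_shift[of et undefined 0 ze] by (simp add: gauss_def exp_of_real[symmetric])

lemma holomorphic_axis_nth: "(%w. (z + axis k w) $ j) holomorphic_on S"
 by (cases "j = k") (auto simp: axis_def intro!: holomorphic_intros)

lemma holomorphic_gauss: "(%w. gauss r ze (z + axis k w)) holomorphic_on S"
 unfolding gauss_def
 by (cases "r = 0") (auto intro!: holomorphic_intros holomorphic_axis_nth simp del: vector_add_component)

lemma sum_abs_le_card_norm: "(\<Sum>j\<in>A. \<bar>x $ j\<bar>) <= real CARD('n) * norm (x :: real^'n::finite)"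
proof -
 have "(\<Sum>j\<in>A. \<bar>x $ j\<bar>) <= (\<Sum>j\<in>(UNIV :: 'n set). \<bar>x $ j\<bar>)" by (intro sum_mono2) auto
 also have "... <= (\<Sum>j\<in>(UNIV :: 'n set). norm x)" by (intro sum_mono component_le_norm_cart)
 finally show ?thesis by simp
qed

lemma norm_le_card_bound:
 fixes x :: "real^'n::finite"
 assumes "\<And>j. \<bar>x $ j\<bar> <= a"
 shows "norm x <= real CARD('n) * a"
proof -
 have "norm x <= (\<Sum>j\<in>UNIV. \<bar>x $ j\<bar>)" by (rule norm_le_l1_cart)
 also have "... <= (\<Sum>j\<in>(UNIV :: 'n set). a)" using assms by (intro sum_mono)
 finally show ?thesis by simp
qed

context elliptic_symbol
begin

text \<open>The holomorphic extension of the regularised integrand. The centre 0 of the damping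
  factor is written out so that \<open>norm_sq_shift\<close> covers it together with the Gaussian of
  a packet.\<close>

definition osc :: "real => real => real => real^'n => complex^'n => complex" where
 "osc ta t ep y z = exp (\<i> * ((\<Sum>j\<in>UNIV. of_real (y $ j) * z $ j) + of_real t * fi ta z)
   - of_real ep * (\<Sum>j\<in>UNIV. (z $ j - of_real ((0 :: real^'n) $ j))\<^sup>2)) / fi ta z"

lemma norm_osc_shift:
 "norm (osc ta t ep y (cvec et + axis k (\<i> * of_real b)))
  = exp (- (y $ k * b + t * Im (fi ta (cvec et + axis k (\<i> * of_real b)))) - ep * ((norm et)\<^sup>2 - b\<^sup>2))
   / norm (fi ta (cvec et + axis k (\<i> * of_real b)))"
proof -
 have "of_real (y $ j) * (cvec et + axis k (\<i> * of_real b)) $ j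
   = of_real (y $ j * et $ j) + (if j = k then \<i> * of_real (y $ k * b) else 0)" for j
  by (simp add: axis_def algebra_simps)
 then have "(\<Sum>j\<in>UNIV. of_real (y $ j) * (cvec et + axis k (\<i> * of_real b)) $ j)
   = of_real (\<Sum>j\<in>UNIV. y $ j * et $ j) + \<i> * of_real (y $ k * b)"
  by (simp only: sum.distrib of_real_sum) simp
 then show ?thesis
  unfolding osc_def norm_sq_shift norm_divide norm_exp_eq_Re by (simp add: mult.commute)
qed

lemma osc_cvec:
 assumes "0 <= ta"
 shows "osc ta t ep y (cvec et) = of_real (exp (- ep * (norm et)\<^sup>2) / fir ta et) * cis (y \<bullet> et + t * fir ta et)"
proof -
 have "(\<Sum>j\<in>UNIV. of_real (y $ j) * cvec et $ j) = (of_real (y \<bullet> et) :: complex)"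
  by (simp add: inner_vec_def)
 moreover have "(\<Sum>j\<in>UNIV. (cvec et $ j - of_real ((0 :: real^'n) $ j))\<^sup>2) = (of_real ((norm et)\<^sup>2) :: complex)"
  using norm_sq_shift[of et undefined 0 0] by simp
 ultimately have "osc ta t ep y (cvec et) = exp (\<i> * of_real (y \<bullet> et + t * fir ta et) + of_real (- ep * (norm et)\<^sup>2)) / of_real (fir ta et)"
  unfolding osc_def fi_cvec[OF assms] by (simp add: algebra_simps)
 then show ?thesis
  unfolding exp_add cis_conv_exp by (simp add: exp_of_real[symmetric] mult_ac)
qed

lemma norm_osc_cvec:
 assumes "0 <= ta" "0 < ta + norm et"
 shows "norm (osc ta t ep y (cvec et)) = exp (- ep * (norm et)\<^sup>2) / fir ta et"
 using fir_pos[OF assms] by (simp add: osc_cvec[OF assms(1)] norm_mult norm_divide)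

lemma holomorphic_osc:
 assumes "\<And>w. w \<in> \<Omega> ==> 0 < Re (p ta (z + axis k w))"
 shows "(%w. osc ta t ep y (z + axis k w)) holomorphic_on \<Omega>"
proof -
 have "(%w. fi ta (z + axis k w)) holomorphic_on \<Omega>"
  unfolding holomorphic_on_def
  using fi_field_deriv[OF assms] by (meson field_differentiable_at_within field_differentiable_def)
 moreover have "fi ta (z + axis k w) ~= 0" if "w \<in> \<Omega>" for w
  using assms[OF that] by (auto simp: fi_def)
 ultimately show ?thesis unfolding osc_def
  by (intro holomorphic_intros holomorphic_axis_nth)
qed

lemma osc_measurable: "0 < ta ==> (%et. osc ta t ep y (cvec et)) \<in> borel_measurable borel"
proof -
 assume ta: "0 < ta"
 then have "0 < ta + norm et" for et :: "real^'n" by (simp add: add_pos_nonneg)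
 then have "fir ta et ~= 0" for et using fir_pos[of ta et] ta by force
 then have "continuous_on UNIV (%et. osc ta t ep y (cvec et))"
  unfolding osc_cvec[OF less_imp_le[OF ta]]
  by (intro continuous_intros fir_continuous) auto
 then show ?thesis by (rule borel_measurable_continuous_onI)
qed

definition packet :: "real => real => real => real => real^'n => real^'n => complex" where
 "packet ta t ep r y ze = (\<integral>et. osc ta t ep y (cvec et) * gauss r ze (cvec et) \<partial>lborel)"

end

context elliptic_estimates
begin

lemma inverse_fi_le:
 assumes "0 <= ta" "0 < ta + norm et" "norm (z - cvec et) <= c0 * (ta + norm et)"
 shows "1 / norm (fi ta z) <= C / (ta + norm et) ^ q"
proof -
 have e: "(ta + norm et) ^ q <= C * norm (fi ta z)" using est[OF assms] by blast
 have N: "0 < (ta + norm et) ^ q" using assms by simp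
 then have "0 < C * norm (fi ta z)" using e by linarith
 then have "0 < norm (fi ta z)" using C1 by (simp add: zero_less_mult_iff)
 then show ?thesis using e N by (simp add: field_simps)
qed

lemma norm_osc_le:
 assumes "0 < ta" "0 <= ep"
 shows "norm (osc ta t ep y (cvec et)) <= C / (ta + norm et) ^ q"
proof -
 have N: "0 < ta + norm et" using assms by (simp add: add_pos_nonneg)
 have "norm (osc ta t ep y (cvec et)) <= 1 / fir ta et"
  unfolding norm_osc_cvec[OF less_imp_le[OF assms(1)] N]
  using assms fir_pos[OF less_imp_le[OF assms(1)] N] by (intro divide_right_mono) auto
 also have "1 / fir ta et = 1 / norm (fi ta (cvec et))"
  using fir_pos[OF less_imp_le[OF assms(1)] N] assms by (simp add: fi_cvec)
 also have "... <= C / (ta + norm et) ^ q"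
  using assms N c0 by (intro inverse_fi_le) auto
 finally show ?thesis .
qed

lemma packet_integrable:
 assumes "0 < ta" "0 <= ep" "0 < r"
 shows "integrable lborel (%et. osc ta t ep y (cvec et) * gauss r ze (cvec et))"
proof (rule integrableI_bounded)
 show "(%et. osc ta t ep y (cvec et) * gauss r ze (cvec et)) \<in> borel_measurable lborel"
  using osc_measurable[OF assms(1)] unfolding gauss_cvec by measurable
 have "(\<integral>\<^sup>+et. norm (osc ta t ep y (cvec et) * gauss r ze (cvec et)) \<partial>lborel)
  <= (\<integral>\<^sup>+et. ennreal (C / ta ^ q) * ennreal (exp (- ((norm (et - ze))\<^sup>2 / r\<^sup>2))) \<partial>lborel)"
 proof (rule nn_integral_mono)
  fix et :: "real^'n"
  have "norm (osc ta t ep y (cvec et)) <= C / (ta + norm et) ^ q" by (rule norm_osc_le[OF assms(1,2)])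
  also have "... <= C / ta ^ q"
   using assms C1 by (intro divide_left_mono power_mono mult_pos_pos zero_less_power) (auto intro: add_pos_nonneg)
  finally have "norm (osc ta t ep y (cvec et)) * exp (- ((norm (et - ze))\<^sup>2 / r\<^sup>2)) <= C / ta ^ q * exp (- ((norm (et - ze))\<^sup>2 / r\<^sup>2))"
   by (intro mult_right_mono) auto
  then show "ennreal (norm (osc ta t ep y (cvec et) * gauss r ze (cvec et)))
   <= ennreal (C / ta ^ q) * ennreal (exp (- ((norm (et - ze))\<^sup>2 / r\<^sup>2)))"
   using assms C1 by (subst ennreal_mult[symmetric]) (auto simp: norm_mult gauss_cvec intro!: ennreal_leI)
 qed
 also have "... < \<infinity>"
  using assms by (subst nn_integral_cmult) (auto simp: nn_integral_gaussian_vec ennreal_mult_less_top)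
 finally show "(\<integral>\<^sup>+et. norm (osc ta t ep y (cvec et) * gauss r ze (cvec et)) \<partial>lborel) < \<infinity>" .
qed

lemma arc_in_strip:
 assumes "0 < (a::real)" "\<bar>s\<bar> <= a"
 shows "0 <= 1 - (s / a)\<^sup>2" "1 - (s / a)\<^sup>2 <= 1"
proof -
 have "\<bar>s / a\<bar> <= 1" using assms by simp
 then show "0 <= 1 - (s / a)\<^sup>2" using abs_square_le_1[of "s / a"] by simp
qed simp

text \<open>No cancellation is used: the integrable singularity of the weight alone gives
  \<open>r ^ (CARD('n) - q)\<close>, with no dependence on \<open>t\<close>, \<open>ta\<close> or
  the centre.\<close>

lemma packet_crude:
 assumes "0 < ta" "0 <= ep" "0 < r"
 shows "norm (packet ta t ep r y ze) <= C * (4 + sqrt pi) ^ CARD('n) * r ^ (CARD('n) - q)"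
proof -
 have "ennreal (norm (packet ta t ep r y ze)) <= (\<integral>\<^sup>+et. norm (osc ta t ep y (cvec et) * gauss r ze (cvec et)) \<partial>lborel)"
  unfolding packet_def by (rule integral_norm_bound_ennreal[OF packet_integrable[OF assms]])
 also have "... <= (\<integral>\<^sup>+et. ennreal C * ennreal (1 / (ta + norm et) ^ q * exp (- ((norm (et - ze))\<^sup>2 / r\<^sup>2))) \<partial>lborel)"
 proof (rule nn_integral_mono)
  fix et :: "real^'n"
  have "norm (osc ta t ep y (cvec et)) * exp (- ((norm (et - ze))\<^sup>2 / r\<^sup>2)) <= C / (ta + norm et) ^ q * exp (- ((norm (et - ze))\<^sup>2 / r\<^sup>2))"
   by (intro mult_right_mono norm_osc_le assms) auto
  then show "ennreal (norm (osc ta t ep y (cvec et) * gauss r ze (cvec et)))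
   <= ennreal C * ennreal (1 / (ta + norm et) ^ q * exp (- ((norm (et - ze))\<^sup>2 / r\<^sup>2)))"
   using assms C1 by (subst ennreal_mult[symmetric]) (auto simp: norm_mult gauss_cvec intro!: ennreal_leI)
 qed
 also have "... <= ennreal C * ennreal ((4 + sqrt pi) ^ CARD('n) * r ^ (CARD('n) - q))"
  using nn_integral_weight_gaussian[OF qn assms(3,1), of ze] by (subst nn_integral_cmult) (auto intro!: mult_left_mono)
 also have "... = ennreal (C * (4 + sqrt pi) ^ CARD('n) * r ^ (CARD('n) - q))"
  using assms C1 by (subst ennreal_mult[symmetric]) (auto simp: mult_ac)
 finally show ?thesis using assms C1 by (subst (asm) ennreal_le_iff) auto
qed

end

context elliptic_estimates
begin

lemma exp_diff_split: "exp (a - c) = exp a * exp (- c :: real)"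
 by (simp add: exp_diff exp_minus divide_inverse)

definition lip :: real where "lip = real CARD('n) * C * 3 ^ q"

lemma lip_pos: "0 < lip"
 using C1 by (simp add: lip_def)

lemma C_le_lip: "C * 3 ^ (q - 2) <= lip"
proof -
 have "C * 3 ^ (q - 2) <= 1 * (C * 3 ^ q)"
  using C1 unfolding mult_1_left by (intro mult_left_mono power_increasing) auto
 also have "1 * (C * 3 ^ q) <= real CARD('n) * (C * 3 ^ q)" using C1 by (intro mult_right_mono) (auto simp: Suc_leI)
 finally show ?thesis by (simp add: lip_def mult_ac)
qed

text \<open>
  The exponent of the packet after the shift: the gain \<open>ka \<theta> \<Gamma>\<close> survives, while all Taylor
  errors are absorbed into a quarter of the Gaussian.
\<close>

lemma packet_exponent:
 assumes ta: "0 < ta" "ta <= L" and L: "L = norm ze" "ze ~= 0" and near: "norm (et - ze) <= L / 2"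
  and ep: "0 <= ep" "ep <= 1" and r: "0 < r" "r <= 1" "2 * r <= c0 * L"
  and ka: "0 <= ka" "ka <= r" "\<bar>t\<bar> * ka * r * L ^ (q - 2) <= 1"
  and \<theta>: "0 <= \<theta>" "\<theta> <= 1" and G: "G = y $ k + t * fir1 k ta ze" and b: "b = ka * \<theta> * (if 0 <= G then 1 else -1)"
 shows "norm (osc ta t ep y (cvec et + axis k (\<i> * of_real b)) * gauss r ze (cvec et + axis k (\<i> * of_real b)))
  <= C * 2 ^ q / L ^ q * (exp (2 + lip + lip\<^sup>2) * exp (- (ka * \<theta> * \<bar>G\<bar>) - 3/4 * ((norm (et - ze))\<^sup>2 / r\<^sup>2)))"
proof -
 let ?z = "cvec et + axis k (\<i> * of_real b)"
 have L0: "0 < L" using L by simp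
 have neta: "L / 2 <= norm et" "norm et <= 3 / 2 * L"
 proof -
  have "norm ze <= norm et + norm (et - ze)" using norm_triangle_ineq4[of et "et - ze"] by simp
  then show "L / 2 <= norm et" using near L by linarith
  have "norm et <= norm ze + norm (et - ze)" using norm_triangle_ineq[of ze "et - ze"] by simp
  then show "norm et <= 3 / 2 * L" using near L by linarith
 qed
 have N: "0 < ta + norm et" "L / 2 <= ta + norm et" "ta + norm et <= 3 * L" using neta ta L0 by linarith+
 have babs: "\<bar>b\<bar> <= ka" "\<bar>b\<bar> <= r"
 proof -
  have "\<bar>b\<bar> = ka * \<theta>" using ka \<theta> by (auto simp: b abs_mult)
  also have "... <= ka * 1" using ka \<theta> by (intro mult_left_mono) auto
  finally show "\<bar>b\<bar> <= ka" by simp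
  then show "\<bar>b\<bar> <= r" using ka by linarith
 qed
 have bdom: "\<bar>b\<bar> <= c0 * (ta + norm et)"
 proof -
  have "c0 * (L / 2) <= c0 * (ta + norm et)" using N c0 by (intro mult_left_mono) auto
  then show ?thesis using babs r by linarith
 qed
 define x where "x = norm (et - ze) / r"
 have x: "0 <= x" "norm (et - ze) = x * r" using r by (auto simp: x_def)
 have bb: "b\<^sup>2 <= r\<^sup>2" "b\<^sup>2 <= ka * r"
 proof -
  have "b\<^sup>2 = \<bar>b\<bar> * \<bar>b\<bar>" by (simp add: power2_eq_square)
  also have "... <= ka * r" using babs ka by (intro mult_mono) auto
  finally show "b\<^sup>2 <= ka * r" .
  also have "... <= r * r" using ka r by (intro mult_right_mono) auto
  finally show "b\<^sup>2 <= r\<^sup>2" by (simp add: power2_eq_square)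
 qed
 have taylor: "\<bar>Im (fi ta ?z) - b * fir1 k ta et\<bar> <= lip * (ka * r) * L ^ (q - 2)"
 proof -
  have "\<bar>Im (fi ta ?z) - b * fir1 k ta et\<bar> <= C * b\<^sup>2 * (ta + norm et) ^ (q - 2)"
   using ta N bdom by (intro Im_fi_taylor) auto
  also have "... <= C * (ka * r) * (3 * L) ^ (q - 2)"
   using bb C1 N ka r by (intro mult_mono mult_left_mono power_mono mult_nonneg_nonneg) auto
  also have "... = (C * 3 ^ (q - 2)) * (ka * r) * L ^ (q - 2)" by (simp add: power_mult_distrib)
  also have "... <= lip * (ka * r) * L ^ (q - 2)"
   using C_le_lip ka r L0 by (intro mult_right_mono mult_nonneg_nonneg) auto
  finally show ?thesis .
 qed
 have lipsch: "\<bar>b * fir1 k ta et - b * fir1 k ta ze\<bar> <= lip * x * (ka * r) * L ^ (q - 2)"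
 proof -
  have "\<bar>fir1 k ta et - fir1 k ta ze\<bar> <= lip * norm (et - ze) * L ^ (q - 2)"
   using fir1_lipschitz[of ta ze et k] ta L near by (simp add: lip_def)
  then have "\<bar>b\<bar> * \<bar>fir1 k ta et - fir1 k ta ze\<bar> <= ka * (lip * norm (et - ze) * L ^ (q - 2))"
   using babs ka by (intro mult_mono) auto
  then show ?thesis unfolding x(2) by (simp add: abs_mult right_diff_distrib[symmetric] mult_ac)
 qed
 \<comment> \<open>One error comes from stopping at first order in \<open>b\<close>, the other from
   taking the gradient at \<open>ze\<close> instead of \<open>et\<close>. The hypothesis on
   \<open>ka\<close> bounds both by a constant times \<open>1 + x\<close>, with \<open>x\<close> the
   distance to the centre in units of \<open>r\<close>.\<close>
 have "\<bar>t\<bar> * \<bar>Im (fi ta ?z) - b * fir1 k ta ze\<bar> <= \<bar>t\<bar> * (lip * (ka * r) * L ^ (q - 2) + lip * x * (ka * r) * L ^ (q - 2))"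
  using taylor lipsch by (intro mult_left_mono) auto
 also have "... = (lip + lip * x) * (\<bar>t\<bar> * ka * r * L ^ (q - 2))" by (simp add: algebra_simps)
 also have "... <= (lip + lip * x) * 1"
  using ka lip_pos x by (intro mult_left_mono) auto
 finally have terr: "\<bar>t * (Im (fi ta ?z) - b * fir1 k ta ze)\<bar> <= lip + lip * x" by (simp add: abs_mult)
 \<comment> \<open>Completing the square exchanges the term linear in \<open>x\<close> for a
   constant and a quarter of the Gaussian exponent.\<close>
 have am: "lip * x <= lip\<^sup>2 + 1/4 * x\<^sup>2"
  using zero_le_power2[of "lip - x / 2"] by (simp add: power2_eq_square algebra_simps)
 have bG: "b * G = ka * \<theta> * \<bar>G\<bar>" by (auto simp: b)
 have e1: "- (y $ k * b + t * Im (fi ta ?z)) <= - (ka * \<theta> * \<bar>G\<bar>) + (lip + lip * x)"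
 proof -
  have "y $ k * b + t * Im (fi ta ?z) = b * G + t * (Im (fi ta ?z) - b * fir1 k ta ze)"
   by (simp add: G algebra_simps)
  then show ?thesis using terr bG by linarith
 qed
 have b1: "b\<^sup>2 <= 1" using bb(1) r power_le_one[of r 2] by linarith
 have e2: "- ep * ((norm et)\<^sup>2 - b\<^sup>2) <= 1"
 proof -
  have "- ep * ((norm et)\<^sup>2 - b\<^sup>2) = ep * b\<^sup>2 - ep * (norm et)\<^sup>2" by (simp add: algebra_simps)
  moreover have "ep * b\<^sup>2 <= 1 * 1" using ep b1 by (intro mult_mono) auto
  moreover have "0 <= ep * (norm et)\<^sup>2" using ep by simp
  ultimately show ?thesis by linarith
 qed
 have xx: "(norm (et - ze))\<^sup>2 / r\<^sup>2 = x\<^sup>2" by (simp add: x_def power_divide)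
 have e3: "- (((norm (et - ze))\<^sup>2 - b\<^sup>2) / r\<^sup>2) <= - x\<^sup>2 + 1"
 proof -
  have "b\<^sup>2 / r\<^sup>2 <= 1" using bb(1) r by simp
  then show ?thesis unfolding diff_divide_distrib xx by linarith
 qed
 have inv: "1 / norm (fi ta ?z) <= C * 2 ^ q / L ^ q"
 proof -
  have "1 / norm (fi ta ?z) <= C / (ta + norm et) ^ q"
   using ta N bdom by (intro inverse_fi_le) (auto simp: norm_axis norm_mult)
  also have "... <= C / (L / 2) ^ q"
   using N L0 C1 by (intro divide_left_mono power_mono mult_pos_pos zero_less_power) auto
  finally show ?thesis by (simp add: power_divide)
 qed
 have "norm (osc ta t ep y ?z * gauss r ze ?z)
   = 1 / norm (fi ta ?z) * exp (- (y $ k * b + t * Im (fi ta ?z)) - ep * ((norm et)\<^sup>2 - b\<^sup>2) - (((norm (et - ze))\<^sup>2 - b\<^sup>2) / r\<^sup>2))"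
  unfolding norm_mult norm_osc_shift norm_gauss_shift exp_diff_split[of "_ - _"]
  by (simp only: divide_inverse mult_1_left mult_ac)
 also have "... <= C * 2 ^ q / L ^ q * exp ((2 + lip + lip\<^sup>2) + (- (ka * \<theta> * \<bar>G\<bar>) - 3/4 * x\<^sup>2))"
 proof (rule mult_mono[OF inv])
  show "exp (- (y $ k * b + t * Im (fi ta ?z)) - ep * ((norm et)\<^sup>2 - b\<^sup>2) - (((norm (et - ze))\<^sup>2 - b\<^sup>2) / r\<^sup>2))
    <= exp ((2 + lip + lip\<^sup>2) + (- (ka * \<theta> * \<bar>G\<bar>) - 3/4 * x\<^sup>2))"
   using e1 e2 e3 am by (subst exp_le_cancel_iff) linarith
 qed (use C1 L0 in auto)
 finally show ?thesis unfolding xx exp_add .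
qed

definition hi_const :: real where
 "hi_const = (3 * (C * 2 ^ q * exp (2 + lip + lip\<^sup>2)) + C) * (4 + sqrt pi) ^ CARD('n) * 2 ^ CARD('n) * 2"

text \<open>All lines through a cube around the centre are shifted by the same height
  \<open>ka\<close>, in the direction in which the phase gradient \<open>G\<close> produces decay.
  Where the arc has at least half its height, the gain is
  \<open>exp (- ka * \<bar>G\<bar> / 2)\<close>; everywhere else the point is so far from the centre
  that part of the Gaussian yields the second term.\<close>

lemma packet_high:
 assumes ta: "0 < ta" "ta <= norm ze" and ze: "ze ~= 0"
  and ep: "0 <= ep" "ep <= 1" and r: "0 < r" "r <= 1" "4 * real CARD('n) * r <= c0 * norm ze"
  and ka: "0 <= ka" "ka <= r" "\<bar>t\<bar> * ka * r * norm ze ^ (q - 2) <= 1"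
 shows "norm (packet ta t ep r y ze) <= hi_const * r ^ CARD('n) *
  (exp (- (ka * \<bar>y $ k + t * fir1 k ta ze\<bar> / 2)) / norm ze ^ q
   + exp (- ((norm ze)\<^sup>2 / (64 * (real CARD('n))\<^sup>2 * r\<^sup>2))) / r ^ q)"
proof -
 define n where "n = real CARD('n)"
 define L where "L = norm ze"
 \<comment> \<open>The cube of half side \<open>a\<close> lies in the ball of radius
   \<open>L / 2\<close> around \<open>ze\<close>, where \<open>ta + norm et\<close> is comparable to
   \<open>L\<close>.\<close>
 define a where "a = L / (2 * n)"
 define G where "G = y $ k + t * fir1 k ta ze"
 define sg where "sg = (if 0 <= G then 1 else -1 :: real)"
 have n: "4 <= n" using qn q2 by (simp add: n_def)
 have L0: "0 < L" using ze by (simp add: L_def)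
 have a: "0 < a" "n * a = L / 2" "a <= L / 8"
  using n L0 by (auto simp: a_def field_simps)
 have rL: "2 * r <= c0 * L" "r <= a" "r < c0 * (L / 4)" "r <= L"
 proof -
  have "4 * r <= n * r" using n r by (intro mult_right_mono) auto
  moreover have r3: "4 * (n * r) <= c0 * L" using r(3) by (simp add: n_def L_def mult.assoc)
  ultimately have 16: "16 * r <= c0 * L" by linarith
  then show "2 * r <= c0 * L" "r < c0 * (L / 4)" using r(1) by linarith+
  have "c0 * L <= (1/2) * L" using c0 L0 by (intro mult_right_mono) auto
  then have "4 * (n * r) <= L / 2" using r3 by linarith
  moreover have "0 <= n * r" using n r(1) by simp
  ultimately have "2 * (n * r) <= L" using L0 by linarith
  then show "r <= a" using n r(1) by (simp add: a_def field_simps)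
  then show "r <= L" using a(3) L0 by linarith
 qed
 \<comment> \<open>A quarter of the Gaussian exponent at distance \<open>a / 2\<close> from the
   centre, the least distance at which the arc may be lower than half its height.\<close>
 define E where "E = exp (- (L\<^sup>2 / (64 * n\<^sup>2 * r\<^sup>2)))"
 have E: "exp (- (a\<^sup>2 / (16 * r\<^sup>2))) = E" unfolding E_def a_def by (simp add: power_divide power_mult_distrib mult_ac)
 define F where "F = (%z. osc ta t ep y z * gauss r ze z)"
 \<comment> \<open>A Gaussian of width \<open>sqrt 2 * r\<close> is the half of the original
   exponent that remains for integration.\<close>
 define r' where "r' = sqrt 2 * r"
 have r': "0 < r'" "r'\<^sup>2 = 2 * r\<^sup>2" "r' <= 2 * r" using r by (auto simp: r'_def power_mult_distrib sqrt2_less_2 less_imp_le)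
 define Q where "Q = C * 2 ^ q * exp (2 + lip + lip\<^sup>2)"
 have Q: "0 <= Q" using C1 by (simp add: Q_def)
 define B where "B = (%et :: real^'n. (3 * Q / L ^ q * (exp (- (ka * \<bar>G\<bar> / 2)) + E)) * exp (- ((norm (et - ze))\<^sup>2 / r'\<^sup>2))
   + (C * E) * (1 / (ta + norm et) ^ q * exp (- ((norm (et - ze))\<^sup>2 / r'\<^sup>2))))"
 have near: "norm (et - ze) <= L / 2" if "\<forall>j. \<bar>et $ j - ze $ j\<bar> <= a" for et
  using norm_le_card_bound[of "et - ze" a] that a by (simp add: n_def)
 have "ennreal (norm (\<integral>et. F (cvec et) \<partial>lborel)) <= (\<integral>\<^sup>+et. ennreal (B et) \<partial>lborel)"
 proof (rule packet_domination[where ka = "%_. ka * sg" and a = a and c = ze and k = k])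
  show "integrable lborel (%et. F (cvec et))" unfolding F_def by (rule packet_integrable[OF ta(1) ep(1) r(1)])
  show "0 < a" by (rule a(1))
  show "B \<in> borel_measurable borel" unfolding B_def by measurable
 next
  fix x :: "real^'n" assume x: "\<forall>j. j ~= k --> \<bar>x $ j - ze $ j\<bar> <= a"
  define s0 where "s0 = ze $ k - x $ k"
  define d where "d = c0 * (L / 4)"
  have d: "0 < d" "r < d" using c0 L0 rL by (auto simp: d_def)
  \<comment> \<open>At the points of this box the real part is at distance at most
    \<open>n * a + a \<le> 3/4 * L\<close> from the centre, hence has norm at least
    \<open>L / 4\<close>; the height \<open>d\<close> then keeps the box in the cone where the
    symbol has positive real part.\<close>
  define \<Omega> where "\<Omega> = box (Complex (s0 - 2 * a) (- d)) (Complex (s0 + 2 * a) d)"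
  have in\<Omega>: "w \<in> \<Omega> \<longleftrightarrow> s0 - 2 * a < Re w \<and> Re w < s0 + 2 * a \<and> - d < Im w \<and> Im w < d" for w
   unfolding \<Omega>_def in_box_complex_iff by auto
  have "0 < Re (p ta (cvec x + axis k w))" if w: "w \<in> \<Omega>" for w
  proof -
   define et where "et = x + Re w *\<^sub>R axis k 1"
   have et: "et $ j = (if j = k then x $ k + Re w else x $ j)" for j by (simp add: et_def axis_def)
   have "norm (et - ze) <= (\<Sum>j\<in>UNIV. \<bar>(et - ze) $ j\<bar>)" by (rule norm_le_l1_cart)
   also have "... <= (\<Sum>j\<in>(UNIV :: 'n set). a + (if j = k then a else 0))"
    using w x unfolding in\<Omega> s0_def by (intro sum_mono) (auto simp: et abs_le_iff)
   also have "... = n * a + a" by (simp add: sum.distrib n_def)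
   finally have "norm (et - ze) <= 3 / 4 * L" using a by linarith
   moreover have "norm ze <= norm et + norm (et - ze)" using norm_triangle_ineq4[of et "et - ze"] by simp
   ultimately have N: "L / 4 <= norm et" unfolding L_def by linarith
   have "cvec x + axis k w = cvec et + axis k (\<i> * of_real (Im w))"
    unfolding et_def cvec_shift by (simp add: vec_eq_iff axis_def complex_eq_iff)
   moreover have "norm (axis k (\<i> * of_real (Im w)) :: complex^'n) <= c0 * (ta + norm et)"
   proof -
    have "c0 * (L / 4) <= c0 * (ta + norm et)" using N ta c0 by (intro mult_left_mono) auto
    moreover have "\<bar>Im w\<bar> < d" using w unfolding in\<Omega> by linarith
    ultimately show ?thesis unfolding norm_axis d_def by (simp add: norm_mult)
   qed
   ultimately show ?thesis using est[of ta et "cvec x + axis k w"] ta N L0 by auto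
  qed
  then have "(%w. F (cvec x + axis k w)) holomorphic_on \<Omega>"
   unfolding F_def by (intro holomorphic_on_mult holomorphic_osc holomorphic_gauss) auto
  moreover have "of_real s \<in> \<Omega> \<and> Complex s (ka * sg * (1 - ((x $ k + s - ze $ k) / a)\<^sup>2)) \<in> \<Omega>"
   if s: "\<bar>x $ k + s - ze $ k\<bar> <= a" for s
  proof -
   note th = arc_in_strip[OF a(1) s]
   have "\<bar>ka * sg * (1 - ((x $ k + s - ze $ k) / a)\<^sup>2)\<bar> <= ka * 1"
    unfolding abs_mult using th ka by (intro mult_mono) (auto simp: sg_def)
   then have "\<bar>ka * sg * (1 - ((x $ k + s - ze $ k) / a)\<^sup>2)\<bar> < d" using ka d by linarith
   then show ?thesis using s a d unfolding in\<Omega> s0_def by (auto simp: abs_le_iff abs_less_iff)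
  qed
  moreover have "\<bar>ka * sg\<bar> <= a" using ka rL by (auto simp: sg_def)
  moreover have "convex \<Omega>" "open \<Omega>" unfolding \<Omega>_def by (auto intro: convex_box open_box)
  ultimately show "\<bar>ka * sg\<bar> <= a \<and> (\<exists>\<Omega>. convex \<Omega> \<and> open \<Omega> \<and> (%w. F (cvec x + axis k w)) holomorphic_on \<Omega> \<and>
    (\<forall>s. \<bar>x $ k + s - ze $ k\<bar> <= a --> of_real s \<in> \<Omega> \<and> Complex s (ka * sg * (1 - ((x $ k + s - ze $ k) / a)\<^sup>2)) \<in> \<Omega>))"
   by blast
 next
  fix et :: "real^'n" assume box: "\<forall>j. \<bar>et $ j - ze $ j\<bar> <= a"
  define \<theta> where "\<theta> = 1 - ((et $ k - ze $ k) / a)\<^sup>2"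
  have \<theta>: "0 <= \<theta>" "\<theta> <= 1" using arc_in_strip[OF a(1), of "et $ k - ze $ k"] box by (auto simp: \<theta>_def)
  define X where "X = (norm (et - ze))\<^sup>2 / r\<^sup>2"
  have X: "0 <= X" by (simp add: X_def)
  have b: "ka * sg * \<theta> = ka * \<theta> * (if 0 <= G then 1 else -1)" by (simp add: sg_def)
  have "norm (F (cvec et + axis k (\<i> * of_real (ka * sg * \<theta>)))) <= C * 2 ^ q / L ^ q * (exp (2 + lip + lip\<^sup>2) * exp (- (ka * \<theta> * \<bar>G\<bar>) - 3/4 * X))"
   unfolding F_def X_def
   by (rule packet_exponent[OF ta(1) _ L_def ze near[OF box] ep r(1,2) rL(1) ka(1,2) _ \<theta> G_def b])
    (use ta ka in \<open>auto simp: L_def\<close>)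
  also have "... = Q / L ^ q * exp (- (ka * \<theta> * \<bar>G\<bar>) - 3/4 * X)" by (simp add: Q_def)
  also have "... <= Q / L ^ q * ((exp (- (ka * \<bar>G\<bar> / 2)) + E) * exp (- (X / 2)))"
  proof (rule mult_left_mono)
   \<comment> \<open>In the middle half of the interval the arc factor \<open>\<theta>\<close> is at
     least 3/4, so the gain survives with factor 1/2. In the outer half the distance to the centre
     is at least \<open>a / 2\<close>, and a quarter of the Gaussian is spent on
     \<open>E\<close>.\<close>
   show "exp (- (ka * \<theta> * \<bar>G\<bar>) - 3/4 * X) <= (exp (- (ka * \<bar>G\<bar> / 2)) + E) * exp (- (X / 2))"
   proof (cases "\<bar>et $ k - ze $ k\<bar> <= a / 2")
    case True
    then have "\<bar>(et $ k - ze $ k) / a\<bar> <= 1/2" using a by (simp add: field_simps)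
    then have "((et $ k - ze $ k) / a)\<^sup>2 <= (1/2)\<^sup>2" by (subst power2_le_iff_abs_le) auto
    moreover have "(1/2 :: real)\<^sup>2 = 1/4" by (simp add: power2_eq_square)
    ultimately have "1/2 <= \<theta>" unfolding \<theta>_def by linarith
    then have "(ka * \<bar>G\<bar>) * (1/2) <= (ka * \<bar>G\<bar>) * \<theta>" using ka by (intro mult_left_mono) auto
    then have "- (ka * \<theta> * \<bar>G\<bar>) - 3/4 * X <= - (ka * \<bar>G\<bar> / 2) + - (X / 2)" using X by (simp add: mult_ac)
    then have "exp (- (ka * \<theta> * \<bar>G\<bar>) - 3/4 * X) <= exp (- (ka * \<bar>G\<bar> / 2)) * exp (- (X / 2))"
     unfolding exp_add[symmetric] by simp
    also have "... <= (exp (- (ka * \<bar>G\<bar> / 2)) + E) * exp (- (X / 2))"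
     by (intro mult_right_mono) (auto simp: E_def)
    finally show ?thesis .
   next
    case False
    then have "a / 2 <= norm (et - ze)"
     using component_le_norm_cart[of "et - ze" k] by simp
    then have "(a / 2)\<^sup>2 <= (norm (et - ze))\<^sup>2" using a by (intro power_mono) auto
    then have "(a / 2)\<^sup>2 / r\<^sup>2 <= X" unfolding X_def by (intro divide_right_mono) auto
    then have "a\<^sup>2 / (16 * r\<^sup>2) <= X / 4" by (simp add: power_divide field_simps)
    moreover have "0 <= ka * \<theta> * \<bar>G\<bar>" using ka \<theta> by simp
    ultimately have "- (ka * \<theta> * \<bar>G\<bar>) - 3/4 * X <= - (a\<^sup>2 / (16 * r\<^sup>2)) + - (X / 2)" by linarith
    then have "exp (- (ka * \<theta> * \<bar>G\<bar>) - 3/4 * X) <= E * exp (- (X / 2))"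
     unfolding E[symmetric] exp_add[symmetric] by simp
    also have "... <= (exp (- (ka * \<bar>G\<bar> / 2)) + E) * exp (- (X / 2))"
     by (intro mult_right_mono) auto
    finally show ?thesis .
   qed
  qed (use Q L0 in auto)
  finally have "3 * norm (F (cvec et + axis k (\<i> * of_real (ka * sg * \<theta>)))) <= (3 * Q / L ^ q * (exp (- (ka * \<bar>G\<bar> / 2)) + E)) * exp (- (X / 2))"
   by simp
  also have "X / 2 = (norm (et - ze))\<^sup>2 / r'\<^sup>2" by (simp add: X_def r'(2))
  also have "(3 * Q / L ^ q * (exp (- (ka * \<bar>G\<bar> / 2)) + E)) * exp (- ((norm (et - ze))\<^sup>2 / r'\<^sup>2)) <= B et"
   using C1 ta by (simp add: B_def E_def)
  finally show "3 * norm (F (cvec et + axis k (\<i> * of_real (ka * sg * (1 - ((et $ k - ze $ k) / a)\<^sup>2))))) <= B et"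
   by (simp only: \<theta>_def)
 next
  fix et :: "real^'n" assume "\<not> (\<forall>j. \<bar>et $ j - ze $ j\<bar> <= a)"
  then obtain j where "a < \<bar>(et - ze) $ j\<bar>" by (auto simp: not_le)
  then have far: "a <= norm (et - ze)" using component_le_norm_cart[of "et - ze" j] by linarith
  define X where "X = (norm (et - ze))\<^sup>2 / r\<^sup>2"
  have "a\<^sup>2 / r\<^sup>2 <= X" unfolding X_def using far a by (intro divide_right_mono power_mono) auto
  moreover have "a\<^sup>2 / (16 * r\<^sup>2) = a\<^sup>2 / r\<^sup>2 / 16" "0 <= a\<^sup>2 / r\<^sup>2" by simp_all
  ultimately have "- X <= - (a\<^sup>2 / (16 * r\<^sup>2)) + - (X / 2)" by linarith
  then have e: "exp (- X) <= E * exp (- (X / 2))"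
   unfolding E[symmetric] exp_add[symmetric] by simp
  have "norm (F (cvec et)) = norm (osc ta t ep y (cvec et)) * exp (- X)"
   unfolding F_def norm_mult gauss_cvec X_def by simp
  also have "... <= C / (ta + norm et) ^ q * (E * exp (- (X / 2)))"
   using C1 ta by (intro mult_mono norm_osc_le e) (auto simp: ep)
  also have "X / 2 = (norm (et - ze))\<^sup>2 / r'\<^sup>2" by (simp add: X_def r'(2))
  also have "C / (ta + norm et) ^ q * (E * exp (- ((norm (et - ze))\<^sup>2 / r'\<^sup>2))) <= B et"
  proof -
   have "0 <= (3 * Q / L ^ q * (exp (- (ka * \<bar>G\<bar> / 2)) + E)) * exp (- ((norm (et - ze))\<^sup>2 / r'\<^sup>2))"
    using Q L0 by (simp add: E_def)
   moreover have "C / (ta + norm et) ^ q * (E * exp (- ((norm (et - ze))\<^sup>2 / r'\<^sup>2)))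
     = (C * E) * (1 / (ta + norm et) ^ q * exp (- ((norm (et - ze))\<^sup>2 / r'\<^sup>2)))" by simp
   ultimately show ?thesis unfolding B_def by linarith
  qed
  finally show "norm (F (cvec et)) <= B et" .
 qed auto
 also have "(\<integral>\<^sup>+et. ennreal (B et) \<partial>lborel) = 
   ennreal (3 * Q / L ^ q * (exp (- (ka * \<bar>G\<bar> / 2)) + E)) * (\<integral>\<^sup>+et. ennreal (exp (- ((norm (et - ze))\<^sup>2 / r'\<^sup>2))) \<partial>lborel)
   + ennreal (C * E) * (\<integral>\<^sup>+et. ennreal (1 / (ta + norm et) ^ q * exp (- ((norm (et - ze))\<^sup>2 / r'\<^sup>2))) \<partial>lborel)"
 proof -
  have nn: "0 <= 3 * Q / L ^ q * (exp (- (ka * \<bar>G\<bar> / 2)) + E)" "0 <= C * E" using Q L0 C1 by (auto simp: E_def)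
  show ?thesis
   unfolding B_def by (rule nn_integral_lincomb[OF _ _ nn]) (use ta in \<open>auto simp: add_nonneg_nonneg\<close>)
 qed
 also have "... <= ennreal (3 * Q / L ^ q * (exp (- (ka * \<bar>G\<bar> / 2)) + E)) * ennreal ((sqrt pi * r') ^ CARD('n))
   + ennreal (C * E) * ennreal ((4 + sqrt pi) ^ CARD('n) * r' ^ (CARD('n) - q))"
  using nn_integral_weight_gaussian[OF qn r'(1) ta(1), of ze]
  by (intro add_mono mult_left_mono) (auto simp: nn_integral_gaussian_vec[OF r'(1)])
 also have "... = ennreal (3 * Q / L ^ q * (exp (- (ka * \<bar>G\<bar> / 2)) + E) * (sqrt pi * r') ^ CARD('n)
   + C * E * ((4 + sqrt pi) ^ CARD('n) * r' ^ (CARD('n) - q)))"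
  using Q L0 C1 r' by (simp add: ennreal_mult[symmetric] ennreal_plus[symmetric] E_def del: ennreal_plus)
 finally have main: "norm (packet ta t ep r y ze) <= 3 * Q / L ^ q * (exp (- (ka * \<bar>G\<bar> / 2)) + E) * (sqrt pi * r') ^ CARD('n)
   + C * E * ((4 + sqrt pi) ^ CARD('n) * r' ^ (CARD('n) - q))"
  unfolding packet_def F_def using Q L0 C1 r' by (subst (asm) ennreal_le_iff) (auto simp: E_def)
 define A where "A = (4 + sqrt pi) ^ CARD('n) * 2 ^ CARD('n)"
 have A0: "0 < A" unfolding A_def by (intro mult_pos_pos zero_less_power) (auto intro: add_pos_nonneg)
 have g1: "(sqrt pi * r') ^ CARD('n) <= A * r ^ CARD('n)"
 proof -
  have "(sqrt pi * r') ^ CARD('n) <= ((4 + sqrt pi) * (2 * r)) ^ CARD('n)"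
   using r' r by (intro power_mono mult_mono) auto
  then show ?thesis by (simp only: A_def power_mult_distrib mult_ac)
 qed
 have g2: "(4 + sqrt pi) ^ CARD('n) * r' ^ (CARD('n) - q) <= A * (r ^ CARD('n) / r ^ q)"
 proof -
  have "r' ^ (CARD('n) - q) <= (2 * r) ^ (CARD('n) - q)" using r' by (intro power_mono) auto
  also have "... = 2 ^ (CARD('n) - q) * (r ^ CARD('n) / r ^ q)"
   using r qn by (simp add: power_mult_distrib power_diff)
  also have "... <= 2 ^ CARD('n) * (r ^ CARD('n) / r ^ q)"
   using r by (intro mult_right_mono power_increasing) auto
  finally have "(4 + sqrt pi) ^ CARD('n) * r' ^ (CARD('n) - q) <= (4 + sqrt pi) ^ CARD('n) * (2 ^ CARD('n) * (r ^ CARD('n) / r ^ q))"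
   by (intro mult_left_mono) auto
  then show ?thesis by (simp add: A_def)
 qed
 have Lr: "1 / L ^ q <= 1 / r ^ q" using rL r by (intro divide_left_mono power_mono mult_pos_pos zero_less_power) auto
 define e where "e = exp (- (ka * \<bar>G\<bar> / 2))"
 have eE: "0 <= e" "0 <= E" by (auto simp: e_def E_def)
 have "3 * Q / L ^ q * (e + E) * (sqrt pi * r') ^ CARD('n) <= 3 * Q / L ^ q * (e + E) * (A * r ^ CARD('n))"
  using Q L0 eE g1 by (intro mult_left_mono) auto
 also have "... = 3 * Q * A * r ^ CARD('n) * (e * (1 / L ^ q) + E * (1 / L ^ q))" by (simp add: algebra_simps add_divide_distrib)
 also have "... <= 3 * Q * A * r ^ CARD('n) * (e * (1 / L ^ q) + E * (1 / r ^ q))"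
  using Q A0 r eE Lr by (intro mult_left_mono add_left_mono) auto
 finally have t1: "3 * Q / L ^ q * (e + E) * (sqrt pi * r') ^ CARD('n) <= 3 * Q * A * r ^ CARD('n) * (e / L ^ q + E / r ^ q)" by simp
 have "C * E * ((4 + sqrt pi) ^ CARD('n) * r' ^ (CARD('n) - q)) <= C * E * (A * (r ^ CARD('n) / r ^ q))"
  using C1 eE by (intro mult_left_mono g2) auto
 also have "... = C * A * r ^ CARD('n) * (0 + E / r ^ q)" by simp
 also have "... <= C * A * r ^ CARD('n) * (e / L ^ q + E / r ^ q)"
  using C1 A0 r eE L0 by (intro mult_left_mono add_right_mono) auto
 finally have t2: "C * E * ((4 + sqrt pi) ^ CARD('n) * r' ^ (CARD('n) - q)) <= C * A * r ^ CARD('n) * (e / L ^ q + E / r ^ q)" .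
 have "norm (packet ta t ep r y ze) <= (3 * Q + C) * A * r ^ CARD('n) * (e / L ^ q + E / r ^ q)"
  using main t1 t2 unfolding e_def[symmetric] by (simp add: algebra_simps)
 also have "... <= hi_const * r ^ CARD('n) * (e / L ^ q + E / r ^ q)"
  using Q C1 A0 r eE L0 unfolding hi_const_def Q_def[symmetric] A_def[symmetric]
  by (intro mult_right_mono) (auto simp: A_def mult_ac)
 finally show ?thesis unfolding e_def E_def G_def L_def n_def .
qed

end

section \<open>Packets near the origin\<close>

lemma indicator_Icc_abs: "indicator {-b..b} (s :: real) = (if \<bar>s\<bar> <= b then 1 else 0)"
 by (auto simp: indicator_def abs_le_iff)

context elliptic_estimates
begin

text \<open>The slope \<open>c0 / n\<close> of the shift, reduced by 1/2 for the part of the gain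
  lost to the phase \<open>t * fi\<close> and by 1/2 for the height of the arc.\<close>

definition lo_rate :: real where "lo_rate = c0 / (4 * real CARD('n))"

lemma lo_rate_pos: "0 < lo_rate"
 using c0 by (simp add: lo_rate_def)

text \<open>
  Near the origin the symbol is only analytic in a cone, so each line parallel to the \<open>k\<close>-th axis is
  shifted by an amount proportional to its distance from the origin.
\<close>

lemma packet_low:
 fixes y :: "real^'n"
 assumes ta: "0 < ta" and ep: "0 <= ep" "ep <= 1" and r: "0 < r" "r <= 1" "r <= a"
  and Y: "\<bar>t\<bar> * C * (ta + real CARD('n) * a) ^ (q - 1) <= \<bar>y $ k\<bar> / 2"
  and ze: "\<And>j. \<bar>ze $ j\<bar> <= a / 4"
 shows "ennreal (norm (packet ta t ep r y ze)) <= 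
  (\<integral>\<^sup>+et. ennreal (3 * C * exp 2 * (1 / (ta + norm et) ^ q *
    ((if \<forall>j. \<bar>et $ j\<bar> <= a then exp (- (lo_rate * min (\<Sum>j\<in>UNIV - {k}. \<bar>et $ j\<bar>) r * \<bar>y $ k\<bar>)) else 0)
     + exp (- (a\<^sup>2 / (32 * r\<^sup>2))))
    * exp (- ((norm (et - ze))\<^sup>2 / (sqrt 2 * r)\<^sup>2)))) \<partial>lborel)"
proof -
 define n where "n = real CARD('n)"
 have n: "4 <= n" using qn q2 by (simp add: n_def)
 have a: "0 < a" using r by linarith
 define S where "S = (%et :: real^'n. \<Sum>j\<in>UNIV - {k}. \<bar>et $ j\<bar>)"
 have S0: "0 <= S et" for et unfolding S_def by (intro sum_nonneg) auto
 have Sn: "S et <= n * norm et" for et unfolding S_def n_def by (rule sum_abs_le_card_norm)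
 define sg where "sg = (if 0 <= y $ k then 1 else -1 :: real)"
 \<comment> \<open>\<open>S\<close> leaves out coordinate \<open>k\<close> and is constant along
   each line; it is at most \<open>n * norm et\<close>, so a shift by \<open>c0 / n * S et\<close>
   stays in the cone. The cap \<open>r\<close> keeps the loss \<open>b^2 / r^2\<close> in the
   Gaussian below 1.\<close>
 define ka where "ka = (%et. c0 / n * min (S et) r)"
 have ka: "0 <= ka et" "ka et <= r" "ka et <= c0 * (S et / n)" for et
 proof -
  have 1: "0 <= c0 / n" "c0 / n <= 1" using c0 n by (auto simp: divide_le_eq)
  show "0 <= ka et" unfolding ka_def using 1 S0 r by (intro mult_nonneg_nonneg) auto
  have "ka et <= 1 * r" unfolding ka_def using 1 S0 r by (intro mult_mono) auto
  then show "ka et <= r" by simp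
  have "ka et <= c0 / n * S et" unfolding ka_def using 1 by (intro mult_left_mono) auto
  then show "ka et <= c0 * (S et / n)" by simp
 qed
 define Y' where "Y' = \<bar>y $ k\<bar>"
 define E where "E = exp (- (a\<^sup>2 / (32 * r\<^sup>2)))"
 define F where "F = (%z. osc ta t ep y z * gauss r ze z)"
 have r2: "(sqrt 2 * r)\<^sup>2 = 2 * r\<^sup>2" by (simp add: power_mult_distrib)
 define W where "W = (%et. if \<forall>j. \<bar>et $ j\<bar> <= a then exp (- (lo_rate * min (S et) r * Y')) else 0)"
 define B where "B = (%et :: real^'n. 3 * C * exp 2 * (1 / (ta + norm et) ^ q * (W et + E)
    * exp (- ((norm (et - ze))\<^sup>2 / (sqrt 2 * r)\<^sup>2))))"
 have Bge: "3 * C * exp 2 * (1 / (ta + norm et) ^ q * w * exp (- (X / 2))) <= B et"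
  if "w <= W et + E" "X = (norm (et - ze))\<^sup>2 / r\<^sup>2" for et w X
 proof -
  have "X / 2 = (norm (et - ze))\<^sup>2 / (sqrt 2 * r)\<^sup>2" using that(2) by (simp add: r2)
  then show ?thesis unfolding B_def using that(1) ta C1
   by (simp only:) (intro mult_left_mono mult_right_mono, auto)
 qed
 have "ennreal (norm (\<integral>et. F (cvec et) \<partial>lborel)) <= (\<integral>\<^sup>+et. ennreal (B et) \<partial>lborel)"
 proof (rule packet_domination[where ka = "%et. ka et * sg" and a = a and c = 0 and k = k])
  show "integrable lborel (%et. F (cvec et))" unfolding F_def by (rule packet_integrable[OF ta(1) ep(1) r(1)])
  show "0 < a" by (rule a)
  have "W = (%et. exp (- (lo_rate * min (S et) r * Y')) * (\<Prod>j\<in>UNIV. indicator {-a..a} (et $ j)))"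
  proof
   fix et :: "real^'n"
   show "W et = exp (- (lo_rate * min (S et) r * Y')) * (\<Prod>j\<in>UNIV. indicator {-a..a} (et $ j))"
   proof (cases "\<forall>j. \<bar>et $ j\<bar> <= a")
    case True
    then have "indicator {-a..a} (et $ j) = (1::real)" for j by (simp only: indicator_Icc_abs) simp
    then show ?thesis using True by (simp add: W_def)
   next
    case False
    then obtain j where "\<not> \<bar>et $ j\<bar> <= a" by blast
    then have "indicator {-a..a} (et $ j) = (0::real)" by (simp only: indicator_Icc_abs) simp
    then have "(\<Prod>j\<in>UNIV. indicator {-a..a} (et $ j)) = (0::real)" by (intro prod_zero) auto
    then show ?thesis using False by (simp only: W_def if_False mult_zero_right)
   qed
  qed
  moreover have "(%et. exp (- (lo_rate * min (S et) r * Y')) * (\<Prod>j\<in>UNIV. indicator {-a..a} (et $ j))) \<in> borel_measurable borel"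
   unfolding S_def by measurable
  ultimately have [measurable]: "W \<in> borel_measurable borel" by simp
  show "B \<in> borel_measurable borel" unfolding B_def by measurable
  show "ka (et + s *\<^sub>R axis k 1) * sg = ka et * sg" for et s
  proof -
   have "S (et + s *\<^sub>R axis k 1) = S et" unfolding S_def by (intro sum.cong) (auto simp: axis_def)
   then show ?thesis by (simp add: ka_def)
  qed
 next
  fix x :: "real^'n"
  \<comment> \<open>Every point of the line has norm at least \<open>S x / n\<close>, so the whole
    horizontal strip of this half height lies in the cone. The summand \<open>c0 * ta\<close> leaves
    room above the arc.\<close>
  define d where "d = c0 * (ta + S x / n)"
  have d: "ka x < d" "0 < d"
  proof -
   have "d = c0 * ta + c0 * (S x / n)" by (simp add: d_def distrib_left)
   moreover have "0 < c0 * ta" using c0 ta by simp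
   ultimately show "ka x < d" using ka(3)[of x] by linarith
   then show "0 < d" using ka(1)[of x] by linarith
  qed
  define \<Omega> where "\<Omega> = {w. Im w < d} \<inter> {w. - d < Im w}"
  have "convex \<Omega>" "open \<Omega>" unfolding \<Omega>_def
   by (intro convex_Int convex_halfspace_Im_lt convex_halfspace_Im_gt) (intro open_Int open_halfspace_Im_lt open_halfspace_Im_gt)
  moreover have "0 < Re (p ta (cvec x + axis k w))" if w: "w \<in> \<Omega>" for w
  proof -
   define et where "et = x + Re w *\<^sub>R axis k 1"
   have "S et = S x" unfolding S_def et_def by (intro sum.cong) (auto simp: axis_def)
   then have "S x / n <= norm et" using Sn[of et] n by (simp add: divide_le_eq mult.commute)
   then have "c0 * (ta + S x / n) <= c0 * (ta + norm et)" using c0 by (intro mult_left_mono) auto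
   moreover have "\<bar>Im w\<bar> < d" using w unfolding \<Omega>_def by auto
   ultimately have "norm (axis k (\<i> * of_real (Im w)) :: complex^'n) <= c0 * (ta + norm et)"
    unfolding norm_axis d_def by (simp add: norm_mult)
   moreover have "cvec x + axis k w = cvec et + axis k (\<i> * of_real (Im w))"
    unfolding et_def cvec_shift by (simp add: vec_eq_iff axis_def complex_eq_iff)
   moreover have "0 < ta + norm et" using ta by (simp add: add_pos_nonneg)
   ultimately show ?thesis using est[of ta et "cvec x + axis k w"] ta by auto
  qed
  then have "(%w. F (cvec x + axis k w)) holomorphic_on \<Omega>"
   unfolding F_def by (intro holomorphic_on_mult holomorphic_osc holomorphic_gauss) auto
  moreover have "of_real s \<in> \<Omega> \<and> Complex s (ka x * sg * (1 - ((x $ k + s - (0 :: real^'n) $ k) / a)\<^sup>2)) \<in> \<Omega>"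
   if s: "\<bar>x $ k + s - (0 :: real^'n) $ k\<bar> <= a" for s
  proof -
   note th = arc_in_strip[OF a s]
   have "\<bar>ka x * sg * (1 - ((x $ k + s - (0 :: real^'n) $ k) / a)\<^sup>2)\<bar> <= ka x * 1"
    unfolding abs_mult using th ka by (intro mult_mono) (auto simp: sg_def)
   then have "\<bar>ka x * sg * (1 - ((x $ k + s - (0 :: real^'n) $ k) / a)\<^sup>2)\<bar> < d" using d by linarith
   then show ?thesis using d unfolding \<Omega>_def by (auto simp: abs_less_iff)
  qed
  moreover have "\<bar>ka x * sg\<bar> <= a" using ka[of x] r by (auto simp: sg_def)
  ultimately show "\<bar>ka x * sg\<bar> <= a \<and> (\<exists>\<Omega>. convex \<Omega> \<and> open \<Omega> \<and> (%w. F (cvec x + axis k w)) holomorphic_on \<Omega> \<and>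
    (\<forall>s. \<bar>x $ k + s - (0 :: real^'n) $ k\<bar> <= a --> of_real s \<in> \<Omega> \<and> Complex s (ka x * sg * (1 - ((x $ k + s - (0 :: real^'n) $ k) / a)\<^sup>2)) \<in> \<Omega>))"
   by blast
 next
  fix et :: "real^'n" assume "\<forall>j. \<bar>et $ j - (0 :: real^'n) $ j\<bar> <= a"
  then have box: "\<forall>j. \<bar>et $ j\<bar> <= a" by simp
  define \<theta> where "\<theta> = 1 - ((et $ k - (0 :: real^'n) $ k) / a)\<^sup>2"
  have \<theta>: "0 <= \<theta>" "\<theta> <= 1" using arc_in_strip[OF a, of "et $ k - (0 :: real^'n) $ k"] box by (auto simp: \<theta>_def)
  define b where "b = ka et * sg * \<theta>"
  let ?z = "cvec et + axis k (\<i> * of_real b)"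
  have N: "0 < ta + norm et" "ta + norm et <= ta + n * a"
   using ta norm_le_card_bound[of et a] box by (auto simp: n_def add_pos_nonneg)
  have ba: "\<bar>b\<bar> = ka et * \<theta>" using ka \<theta> by (auto simp: b_def sg_def abs_mult)
  have ba2: "\<bar>b\<bar> <= ka et" unfolding ba using ka \<theta> by (simp add: mult_left_le)
  have bdom: "\<bar>b\<bar> <= c0 * (ta + norm et)"
  proof -
   have "S et / n <= norm et" using Sn[of et] n by (simp add: divide_le_eq mult.commute)
   then have "c0 * (S et / n) <= c0 * (ta + norm et)" using c0 ta by (intro mult_left_mono) auto
   then show ?thesis using ba2 ka(3)[of et] by linarith
  qed
  define X where "X = (norm (et - ze))\<^sup>2 / r\<^sup>2"
  have X: "0 <= X" by (simp add: X_def)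
  \<comment> \<open>On the cube the term \<open>t * fi\<close> changes by at most half of what the
    linear phase gains under the shift; this is the purpose of the assumption on
    \<open>y $ k\<close>.\<close>
  have "\<bar>t\<bar> * \<bar>Im (fi ta ?z)\<bar> <= \<bar>t\<bar> * (C * \<bar>b\<bar> * (ta + norm et) ^ (q - 1))"
   using ta N bdom by (intro mult_left_mono Im_fi_bound) auto
  also have "... = \<bar>b\<bar> * (\<bar>t\<bar> * C * (ta + norm et) ^ (q - 1))" by (simp add: mult_ac)
  also have "... <= \<bar>b\<bar> * (\<bar>t\<bar> * C * (ta + n * a) ^ (q - 1))"
   using N C1 by (intro mult_left_mono power_mono) auto
  also have "... <= \<bar>b\<bar> * (Y' / 2)" using Y unfolding Y'_def n_def by (intro mult_left_mono) auto
  finally have tI: "\<bar>t * Im (fi ta ?z)\<bar> <= \<bar>b\<bar> * Y' / 2" by (simp add: abs_mult)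
  have "y $ k * b = \<bar>b\<bar> * Y'" unfolding ba by (simp add: b_def sg_def Y'_def)
  then have e1: "- (y $ k * b + t * Im (fi ta ?z)) <= - (ka et * \<theta> * Y' / 2)"
   using tI unfolding ba by linarith
  have br: "b\<^sup>2 <= r\<^sup>2" using ba2 ka(2)[of et] by (intro power2_le_iff_abs_le[THEN iffD2]) (use r in auto)
  have b1: "b\<^sup>2 <= 1" using br r power_le_one[of r 2] by linarith
  have e2: "- ep * ((norm et)\<^sup>2 - b\<^sup>2) <= 1"
  proof -
   have "- ep * ((norm et)\<^sup>2 - b\<^sup>2) = ep * b\<^sup>2 - ep * (norm et)\<^sup>2" by (simp add: algebra_simps)
   moreover have "ep * b\<^sup>2 <= 1 * 1" using ep b1 by (intro mult_mono) auto
   moreover have "0 <= ep * (norm et)\<^sup>2" using ep by simp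
   ultimately show ?thesis by linarith
  qed
  have e3: "- (((norm (et - ze))\<^sup>2 - b\<^sup>2) / r\<^sup>2) <= - X + 1"
  proof -
   have "b\<^sup>2 / r\<^sup>2 <= 1" using br r by simp
   then show ?thesis unfolding diff_divide_distrib X_def by linarith
  qed
  have inv: "1 / norm (fi ta ?z) <= C * (1 / (ta + norm et) ^ q)"
   using inverse_fi_le[of ta et ?z] ta N bdom by (auto simp: norm_axis norm_mult)
  have "norm (F ?z)
    = 1 / norm (fi ta ?z) * exp (- (y $ k * b + t * Im (fi ta ?z)) - ep * ((norm et)\<^sup>2 - b\<^sup>2) - (((norm (et - ze))\<^sup>2 - b\<^sup>2) / r\<^sup>2))"
   unfolding F_def norm_mult norm_osc_shift norm_gauss_shift exp_diff_split[of "_ - _"]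
   by (simp only: divide_inverse mult_1_left mult_ac)
  also have "... <= C * (1 / (ta + norm et) ^ q) * exp (2 + (- (ka et * \<theta> * Y' / 2) - X))"
  proof (rule mult_mono[OF inv])
   show "exp (- (y $ k * b + t * Im (fi ta ?z)) - ep * ((norm et)\<^sup>2 - b\<^sup>2) - (((norm (et - ze))\<^sup>2 - b\<^sup>2) / r\<^sup>2))
     <= exp (2 + (- (ka et * \<theta> * Y' / 2) - X))"
    using e1 e2 e3 by (subst exp_le_cancel_iff) linarith
  qed (use C1 N in auto)
  also have "... <= C * (1 / (ta + norm et) ^ q) * (exp 2 * ((W et + E) * exp (- (X / 2))))"
  proof (rule mult_left_mono)
   have "exp (- (ka et * \<theta> * Y' / 2) - X) <= (W et + E) * exp (- (X / 2))"
   proof (cases "\<bar>et $ k\<bar> <= a / 2")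
    case True
    then have "\<bar>et $ k / a\<bar> <= 1/2" using a by (simp add: field_simps)
    then have "(et $ k / a)\<^sup>2 <= (1/2)\<^sup>2" by (subst power2_le_iff_abs_le) auto
    moreover have "(1/2 :: real)\<^sup>2 = 1/4" by (simp add: power2_eq_square)
    ultimately have "1/2 <= \<theta>" unfolding \<theta>_def by (simp only: zero_index diff_zero)
    then have "(ka et * Y') * (1/2) <= (ka et * Y') * \<theta>" using ka by (intro mult_left_mono) (auto simp: Y'_def)
    moreover have "lo_rate * min (S et) r * Y' = ka et * Y' * (1/4)" by (simp add: lo_rate_def ka_def n_def)
    moreover have "ka et * \<theta> * Y' = (ka et * Y') * \<theta>" by simp
    ultimately have "- (ka et * \<theta> * Y' / 2) - X <= - (lo_rate * min (S et) r * Y') + - (X / 2)" using X by linarith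
    then have "exp (- (ka et * \<theta> * Y' / 2) - X) <= W et * exp (- (X / 2))"
     using box unfolding W_def by (simp add: exp_add[symmetric])
    also have "... <= (W et + E) * exp (- (X / 2))"
     by (intro mult_right_mono) (auto simp: E_def)
    finally show ?thesis .
   next
    case False
    then have "a / 4 <= \<bar>(et - ze) $ k\<bar>" using ze[of k] unfolding vector_minus_component by linarith
    then have "a / 4 <= norm (et - ze)" using component_le_norm_cart[of "et - ze" k] by linarith
    then have "(a / 4)\<^sup>2 <= (norm (et - ze))\<^sup>2" using a by (intro power_mono) auto
    then have "(a / 4)\<^sup>2 / r\<^sup>2 <= X" unfolding X_def by (intro divide_right_mono) auto
    then have "a\<^sup>2 / (32 * r\<^sup>2) <= X / 2" by (simp add: power_divide field_simps)
    moreover have "0 <= ka et * \<theta> * Y'" using ka \<theta> by (simp add: Y'_def)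
    ultimately have "- (ka et * \<theta> * Y' / 2) - X <= - (a\<^sup>2 / (32 * r\<^sup>2)) + - (X / 2)" by linarith
    then have "exp (- (ka et * \<theta> * Y' / 2) - X) <= E * exp (- (X / 2))"
     unfolding E_def exp_add[symmetric] by simp
    also have "... <= (W et + E) * exp (- (X / 2))"
     by (intro mult_right_mono) (auto simp: W_def)
    finally show ?thesis .
   qed
   then show "exp (2 + (- (ka et * \<theta> * Y' / 2) - X)) <= exp 2 * ((W et + E) * exp (- (X / 2)))"
    unfolding exp_add by simp
  qed (use C1 N in auto)
  finally have "3 * norm (F ?z) <= 3 * (C * (1 / (ta + norm et) ^ q) * (exp 2 * ((W et + E) * exp (- (X / 2)))))"
   by (rule mult_left_mono) simp
  also have "... = 3 * C * exp 2 * (1 / (ta + norm et) ^ q * (W et + E) * exp (- (X / 2)))"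
   by (simp only: mult_ac)
  also have "... <= B et" by (rule Bge[OF order_refl X_def])
  finally show "3 * norm (F (cvec et + axis k (\<i> * of_real (ka et * sg * (1 - ((et $ k - (0 :: real^'n) $ k) / a)\<^sup>2))))) <= B et"
   by (simp only: b_def \<theta>_def)
 next
  fix et :: "real^'n" assume "\<not> (\<forall>j. \<bar>et $ j - (0 :: real^'n) $ j\<bar> <= a)"
  then obtain j where "a < \<bar>et $ j\<bar>" by (auto simp: not_le)
  then have "a / 4 <= \<bar>(et - ze) $ j\<bar>" using ze[of j] a unfolding vector_minus_component by linarith
  then have far: "a / 4 <= norm (et - ze)" using component_le_norm_cart[of "et - ze" j] by linarith
  define X where "X = (norm (et - ze))\<^sup>2 / r\<^sup>2"
  have "(a / 4)\<^sup>2 / r\<^sup>2 <= X" unfolding X_def using far a by (intro divide_right_mono power_mono) auto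
  then have "a\<^sup>2 / (32 * r\<^sup>2) <= X / 2" by (simp add: power_divide field_simps)
  then have "- X <= - (a\<^sup>2 / (32 * r\<^sup>2)) + - (X / 2)" by linarith
  then have e: "exp (- X) <= E * exp (- (X / 2))"
   unfolding E_def exp_add[symmetric] by simp
  have N: "0 < ta + norm et" using ta by (simp add: add_pos_nonneg)
  have "norm (F (cvec et)) = norm (osc ta t ep y (cvec et)) * exp (- X)"
   unfolding F_def norm_mult gauss_cvec X_def by simp
  also have "... <= C / (ta + norm et) ^ q * (E * exp (- (X / 2)))"
   using C1 ta by (intro mult_mono norm_osc_le e) (auto simp: ep)
  also have "... = (C * 1) * (1 / (ta + norm et) ^ q * E * exp (- (X / 2)))" by simp
  also have "... <= (3 * C * exp 2) * (1 / (ta + norm et) ^ q * E * exp (- (X / 2)))"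
  proof (rule mult_right_mono)
   have "C * 1 <= 3 * C * exp 2" using C1 by (intro mult_mono) auto
   then show "C * 1 <= 3 * C * exp 2" .
  qed (use N in \<open>auto simp: E_def\<close>)
  also have "... <= B et" by (rule Bge[OF _ X_def]) (auto simp: W_def)
  finally show "norm (F (cvec et)) <= B et" .
 qed
 then show ?thesis
  unfolding packet_def F_def B_def W_def E_def Y'_def S_def .
qed

definition lo_const :: real where
 "lo_const = 3 * C * exp 2 * ((4 + sqrt pi) ^ CARD('n) * 2 ^ CARD('n) * 6 ^ CARD('n) * 2) * (1 + 1 / lo_rate ^ (CARD('n) - q))"

text \<open>The centres are integrated first: each \<open>et\<close> then carries the full Gaussian
  mass of order \<open>r ^ n\<close>, and the weight has to be integrated only once. Bounding
  packets one at a time would lose the decay in \<open>S\<close>, since a centre with small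
  \<open>S\<close> has no decay of its own. The minimum of \<open>S\<close> and \<open>r\<close>
  leaves an exponential in \<open>S\<close>, handled by the slab estimate, and a constant on the
  cube.\<close>

lemma packet_low_sum:
 fixes y :: "real^'n"
 assumes ta: "0 < ta" and ep: "0 <= ep" "ep <= 1" and r: "0 < r" "r <= 1" "r <= a"
  and Y: "\<bar>t\<bar> * C * (ta + real CARD('n) * a) ^ (q - 1) <= \<bar>y $ k\<bar> / 2" "y $ k ~= 0"
 shows "(\<integral>\<^sup>+ze. (\<Prod>j\<in>UNIV. indicator {-(a/4)..a/4} (ze $ j)) * ennreal (norm (packet ta t ep r y ze)) \<partial>lborel)
  <= ennreal (lo_const * r ^ CARD('n) * (1 / \<bar>y $ k\<bar> ^ (CARD('n) - q) + a ^ (CARD('n) - q) * exp (- (lo_rate * r * \<bar>y $ k\<bar>))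
    + a ^ CARD('n) / r ^ q * exp (- (a\<^sup>2 / (32 * r\<^sup>2)))))"
proof -
 have a: "0 < a" using r by linarith
 define Q where "Q = 3 * C * exp 2"
 have Q: "0 <= Q" using C1 by (simp add: Q_def)
 define S where "S = (%et :: real^'n. \<Sum>j\<in>UNIV - {k}. \<bar>et $ j\<bar>)"
 define Y' where "Y' = \<bar>y $ k\<bar>"
 have Y': "0 < Y'" using Y by (simp add: Y'_def)
 define E where "E = exp (- (a\<^sup>2 / (32 * r\<^sup>2)))"
 define e1 where "e1 = exp (- (lo_rate * r * Y'))"
 define r' where "r' = sqrt 2 * r"
 have r': "0 < r'" "r' <= 2 * r" using r by (auto simp: r'_def sqrt2_less_2 less_imp_le)
 define N where "N = (%et :: real^'n. 1 / (ta + norm et) ^ q)"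
 have N0: "0 <= N et" for et using ta by (simp add: N_def)
 define g where "g = (%et ze :: real^'n. exp (- ((norm (et - ze))\<^sup>2 / r'\<^sup>2)))"
 define I where "I = (%ze :: real^'n. (\<Prod>j\<in>UNIV. indicator {-(a/4)..a/4} (ze $ j)) :: ennreal)"
 define Ia where "Ia = (%et :: real^'n. (\<Prod>j\<in>UNIV. indicator {-a..a} (et $ j)) :: real)"
 have Ia0: "0 <= Ia et" for et unfolding Ia_def by (intro prod_nonneg) auto
 define h where "h = (%et. Q * (N et * exp (- (lo_rate * Y' * S et)) + e1 * (N et * Ia et)))"
 have h0: "0 <= h et" for et unfolding h_def e1_def using Q N0 Ia0 by (intro mult_nonneg_nonneg add_nonneg_nonneg) auto
 have [measurable]: "N \<in> borel_measurable borel" "S \<in> borel_measurable borel" "Ia \<in> borel_measurable borel" "I \<in> borel_measurable borel"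
  unfolding N_def S_def Ia_def I_def by measurable
 have [measurable]: "h \<in> borel_measurable borel" unfolding h_def by measurable
 have [measurable]: "(%x. g (snd x) (fst x)) \<in> borel_measurable (borel \<Otimes>\<^sub>M borel)" unfolding g_def by measurable
 have gm [measurable]: "(%ze. g et ze) \<in> borel_measurable borel" "(%et. g et ze) \<in> borel_measurable borel" for et ze
  unfolding g_def by measurable
 have g0: "0 <= g et ze" for et ze by (simp add: g_def)
 have per: "I ze * ennreal (norm (packet ta t ep r y ze)) <= (\<integral>\<^sup>+et. ennreal (h et) * ennreal (g et ze) \<partial>lborel)
   + I ze * ennreal (Q * E * ((4 + sqrt pi) ^ CARD('n) * r' ^ (CARD('n) - q)))" for ze
 proof (cases "\<forall>j. \<bar>ze $ j\<bar> <= a / 4")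
  case False
  then obtain j where "\<not> \<bar>ze $ j\<bar> <= a / 4" by blast
  then have "indicator {-(a/4)..a/4} (ze $ j) = (0::ennreal)" by (simp only: indicator_Icc_abs) simp
  then have "I ze = 0" unfolding I_def by (intro prod_zero) auto
  then show ?thesis by simp
 next
  case True
  then have "indicator {-(a/4)..a/4} (ze $ j) = (1::ennreal)" for j by (simp only: indicator_Icc_abs) simp
  then have I1: "I ze = 1" unfolding I_def by simp
  have "ennreal (norm (packet ta t ep r y ze)) <= 
   (\<integral>\<^sup>+et. ennreal (3 * C * exp 2 * (1 / (ta + norm et) ^ q *
    ((if \<forall>j. \<bar>et $ j\<bar> <= a then exp (- (lo_rate * min (\<Sum>j\<in>UNIV - {k}. \<bar>et $ j\<bar>) r * \<bar>y $ k\<bar>)) else 0)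
     + exp (- (a\<^sup>2 / (32 * r\<^sup>2))))
    * exp (- ((norm (et - ze))\<^sup>2 / (sqrt 2 * r)\<^sup>2)))) \<partial>lborel)"
   using True by (intro packet_low[OF ta ep r Y(1)]) auto
  also have "... <= (\<integral>\<^sup>+et. ennreal (1 * (h et * g et ze) + Q * E * (N et * g et ze)) \<partial>lborel)"
  proof (rule nn_integral_mono)
   fix et :: "real^'n"
   define w where "w = (if \<forall>j. \<bar>et $ j\<bar> <= a then exp (- (lo_rate * min (S et) r * Y')) else 0)"
   \<comment> \<open>An exponential of a negative minimum is bounded by the sum of the two
     exponentials; the second needs the cube indicator in order to be integrable.\<close>
   have w: "w <= exp (- (lo_rate * Y' * S et)) + e1 * Ia et"
   proof (cases "\<forall>j. \<bar>et $ j\<bar> <= a")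
    case True
    then have "indicator {-a..a} (et $ j) = (1::real)" for j by (simp only: indicator_Icc_abs) simp
    then have "Ia et = 1" by (simp add: Ia_def)
    moreover have "w <= exp (- (lo_rate * Y' * S et)) + e1"
     using True by (auto simp: w_def e1_def min_def mult_ac)
    ultimately show ?thesis by simp
   next
    case False
    then have "w = 0" by (simp only: w_def if_False)
    then show ?thesis using Ia0[of et] by (simp add: e1_def)
   qed
   have "Q * (N et * (w + E) * g et ze) <= Q * (N et * ((exp (- (lo_rate * Y' * S et)) + e1 * Ia et) + E) * g et ze)"
    using Q N0[of et] g0[of et ze] w by (intro mult_left_mono mult_right_mono add_right_mono) auto
   also have "... = h et * g et ze + Q * E * (N et * g et ze)" by (simp add: h_def algebra_simps)
   finally have "ennreal (Q * (N et * (w + E) * g et ze)) <= ennreal (h et * g et ze + Q * E * (N et * g et ze))"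
    by (rule ennreal_leI)
   then show "ennreal (3 * C * exp 2 * (1 / (ta + norm et) ^ q *
    ((if \<forall>j. \<bar>et $ j\<bar> <= a then exp (- (lo_rate * min (\<Sum>j\<in>UNIV - {k}. \<bar>et $ j\<bar>) r * \<bar>y $ k\<bar>)) else 0)
     + exp (- (a\<^sup>2 / (32 * r\<^sup>2))))
    * exp (- ((norm (et - ze))\<^sup>2 / (sqrt 2 * r)\<^sup>2)))) <= ennreal (1 * (h et * g et ze) + Q * E * (N et * g et ze))"
    unfolding mult_1_left Q_def N_def w_def g_def E_def S_def Y'_def r'_def .
  qed
  also have "... = (\<integral>\<^sup>+et. ennreal (h et) * ennreal (g et ze) \<partial>lborel) + ennreal (Q * E) * (\<integral>\<^sup>+et. ennreal (N et * g et ze) \<partial>lborel)"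
  proof -
   have "(\<integral>\<^sup>+et. ennreal (1 * (h et * g et ze) + Q * E * (N et * g et ze)) \<partial>lborel)
    = ennreal 1 * (\<integral>\<^sup>+et. ennreal (h et * g et ze) \<partial>lborel) + ennreal (Q * E) * (\<integral>\<^sup>+et. ennreal (N et * g et ze) \<partial>lborel)"
    using Q h0 N0 g0 by (intro nn_integral_lincomb) (auto simp: E_def)
   then show ?thesis using h0 g0 by (simp add: ennreal_mult)
  qed
  also have "... <= (\<integral>\<^sup>+et. ennreal (h et) * ennreal (g et ze) \<partial>lborel) + ennreal (Q * E) * ennreal ((4 + sqrt pi) ^ CARD('n) * r' ^ (CARD('n) - q))"
   using nn_integral_weight_gaussian[OF qn r'(1) ta, of ze] unfolding N_def g_def by (intro add_left_mono mult_left_mono) auto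
  also have "... = (\<integral>\<^sup>+et. ennreal (h et) * ennreal (g et ze) \<partial>lborel) + ennreal (Q * E * ((4 + sqrt pi) ^ CARD('n) * r' ^ (CARD('n) - q)))"
   using Q r' by (simp add: ennreal_mult E_def)
  finally show ?thesis by (simp add: I1)
 qed
 have "(\<integral>\<^sup>+ze. I ze * ennreal (norm (packet ta t ep r y ze)) \<partial>lborel)
   <= (\<integral>\<^sup>+ze. (\<integral>\<^sup>+et. ennreal (h et) * ennreal (g et ze) \<partial>lborel) + I ze * ennreal (Q * E * ((4 + sqrt pi) ^ CARD('n) * r' ^ (CARD('n) - q))) \<partial>lborel)"
  by (rule nn_integral_mono) (rule per)
 also have "... = (\<integral>\<^sup>+ze. \<integral>\<^sup>+et. ennreal (h et) * ennreal (g et ze) \<partial>lborel \<partial>lborel)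
   + (\<integral>\<^sup>+ze. I ze \<partial>lborel) * ennreal (Q * E * ((4 + sqrt pi) ^ CARD('n) * r' ^ (CARD('n) - q)))"
 proof -
  have "(\<integral>\<^sup>+ze. (\<integral>\<^sup>+et. ennreal (h et) * ennreal (g et ze) \<partial>lborel) + I ze * ennreal (Q * E * ((4 + sqrt pi) ^ CARD('n) * r' ^ (CARD('n) - q))) \<partial>lborel)
   = (\<integral>\<^sup>+ze. (\<integral>\<^sup>+et. ennreal (h et) * ennreal (g et ze) \<partial>lborel) \<partial>lborel)
    + (\<integral>\<^sup>+ze. I ze * ennreal (Q * E * ((4 + sqrt pi) ^ CARD('n) * r' ^ (CARD('n) - q))) \<partial>lborel)"
   unfolding g_def by (rule nn_integral_add) measurable
  moreover have "(\<integral>\<^sup>+ze. I ze * ennreal (Q * E * ((4 + sqrt pi) ^ CARD('n) * r' ^ (CARD('n) - q))) \<partial>lborel)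
    = (\<integral>\<^sup>+ze. I ze \<partial>lborel) * ennreal (Q * E * ((4 + sqrt pi) ^ CARD('n) * r' ^ (CARD('n) - q)))"
   by (rule nn_integral_multc) measurable
  ultimately show ?thesis by (simp only:)
 qed
 also have "(\<integral>\<^sup>+ze. \<integral>\<^sup>+et. ennreal (h et) * ennreal (g et ze) \<partial>lborel \<partial>lborel) = (\<integral>\<^sup>+et. \<integral>\<^sup>+ze. ennreal (h et) * ennreal (g et ze) \<partial>lborel \<partial>lborel)"
  unfolding g_def by (rule lborel_pair.Fubini') measurable
 also have "... = (\<integral>\<^sup>+et. ennreal (h et) * ennreal ((sqrt pi * r') ^ CARD('n)) \<partial>lborel)"
 proof (rule nn_integral_cong)
  fix et :: "real^'n"
  have "(\<integral>\<^sup>+ze. ennreal (g et ze) \<partial>lborel) = ennreal ((sqrt pi * r') ^ CARD('n))"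
   unfolding g_def by (subst norm_minus_commute) (rule nn_integral_gaussian_vec[OF r'(1)])
  then show "(\<integral>\<^sup>+ze. ennreal (h et) * ennreal (g et ze) \<partial>lborel) = ennreal (h et) * ennreal ((sqrt pi * r') ^ CARD('n))"
   by (subst nn_integral_cmult) (auto simp: gm)
 qed
 also have "... = (\<integral>\<^sup>+et. ennreal (h et) \<partial>lborel) * ennreal ((sqrt pi * r') ^ CARD('n))"
  by (rule nn_integral_multc) measurable
 finally have step1: "(\<integral>\<^sup>+ze. I ze * ennreal (norm (packet ta t ep r y ze)) \<partial>lborel)
   <= (\<integral>\<^sup>+et. ennreal (h et) \<partial>lborel) * ennreal ((sqrt pi * r') ^ CARD('n))
    + (\<integral>\<^sup>+ze. I ze \<partial>lborel) * ennreal (Q * E * ((4 + sqrt pi) ^ CARD('n) * r' ^ (CARD('n) - q)))" .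
 have hb: "(\<integral>\<^sup>+et. ennreal (h et) \<partial>lborel) <= ennreal (Q * (2 * 6 ^ CARD('n) / (lo_rate * Y') ^ (CARD('n) - q) + e1 * (6 ^ CARD('n) * a ^ (CARD('n) - q))))"
 proof -
  have e10: "0 <= e1" by (simp add: e1_def)
  have "h et = Q * (N et * exp (- (lo_rate * Y' * S et))) + (Q * e1) * (N et * Ia et)" for et
   by (simp add: h_def algebra_simps)
  then have "(\<integral>\<^sup>+et. ennreal (h et) \<partial>lborel) = (\<integral>\<^sup>+et. ennreal (Q * (N et * exp (- (lo_rate * Y' * S et))) + (Q * e1) * (N et * Ia et)) \<partial>lborel)"
   by (simp only:)
  also have "... = ennreal Q * (\<integral>\<^sup>+et. ennreal (N et * exp (- (lo_rate * Y' * S et))) \<partial>lborel) + ennreal (Q * e1) * (\<integral>\<^sup>+et. ennreal (N et * Ia et) \<partial>lborel)"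
   using Q e10 N0 Ia0 by (intro nn_integral_lincomb) auto
  also have "... = ennreal Q * ((\<integral>\<^sup>+et. ennreal (N et * exp (- (lo_rate * Y' * S et))) \<partial>lborel) + ennreal e1 * (\<integral>\<^sup>+et. ennreal (N et * Ia et) \<partial>lborel))"
   using Q e10 by (simp add: ennreal_mult distrib_left mult.assoc)
  also have "... <= ennreal Q * (ennreal (2 * 6 ^ CARD('n) / (lo_rate * Y') ^ (CARD('n) - q)) + ennreal e1 * ennreal (6 ^ CARD('n) * a ^ (CARD('n) - q)))"
  proof (intro mult_left_mono add_mono)
   show "(\<integral>\<^sup>+et. ennreal (N et * exp (- (lo_rate * Y' * S et))) \<partial>lborel) <= ennreal (2 * 6 ^ CARD('n) / (lo_rate * Y') ^ (CARD('n) - q))"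
    unfolding N_def S_def using lo_rate_pos Y' ta by (intro nn_integral_weight_slab q2 qn) auto
   show "(\<integral>\<^sup>+et. ennreal (N et * Ia et) \<partial>lborel) <= ennreal (6 ^ CARD('n) * a ^ (CARD('n) - q))"
    unfolding N_def Ia_def by (rule nn_integral_weight_cube[OF qn a ta])
  qed auto
  also have "... = ennreal (Q * (2 * 6 ^ CARD('n) / (lo_rate * Y') ^ (CARD('n) - q) + e1 * (6 ^ CARD('n) * a ^ (CARD('n) - q))))"
  proof -
   have "0 <= e1" "0 <= 2 * 6 ^ CARD('n) / (lo_rate * Y') ^ (CARD('n) - q)" "0 <= e1 * (6 ^ CARD('n) * a ^ (CARD('n) - q))"
    using lo_rate_pos Y' a by (auto simp: e1_def)
   then show ?thesis using Q a by (simp add: ennreal_mult)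
  qed
  finally show ?thesis .
 qed
 have Ieq: "(\<integral>\<^sup>+ze. I ze \<partial>lborel) = ennreal ((a / 2) ^ CARD('n))"
  unfolding I_def using a by (subst nn_integral_vec_prod) (auto simp: ennreal_power)
 have "(\<integral>\<^sup>+ze. I ze * ennreal (norm (packet ta t ep r y ze)) \<partial>lborel)
   <= ennreal (Q * (2 * 6 ^ CARD('n) / (lo_rate * Y') ^ (CARD('n) - q) + e1 * (6 ^ CARD('n) * a ^ (CARD('n) - q)))) * ennreal ((sqrt pi * r') ^ CARD('n))
    + ennreal ((a / 2) ^ CARD('n)) * ennreal (Q * E * ((4 + sqrt pi) ^ CARD('n) * r' ^ (CARD('n) - q)))"
  by (rule order_trans[OF step1], unfold Ieq, intro add_right_mono mult_right_mono hb) auto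
 also have "... = ennreal (Q * (2 * 6 ^ CARD('n) / (lo_rate * Y') ^ (CARD('n) - q) + e1 * (6 ^ CARD('n) * a ^ (CARD('n) - q))) * (sqrt pi * r') ^ CARD('n)
    + (a / 2) ^ CARD('n) * (Q * E * ((4 + sqrt pi) ^ CARD('n) * r' ^ (CARD('n) - q))))"
 proof -
  have "0 <= e1" "0 <= E" by (auto simp: e1_def E_def)
  then have nn: "0 <= Q * (2 * 6 ^ CARD('n) / (lo_rate * Y') ^ (CARD('n) - q) + e1 * (6 ^ CARD('n) * a ^ (CARD('n) - q)))"
   "0 <= (sqrt pi * r') ^ CARD('n)" "0 <= (a / 2) ^ CARD('n)" "0 <= Q * E * ((4 + sqrt pi) ^ CARD('n) * r' ^ (CARD('n) - q))"
   using Q lo_rate_pos Y' a r' by auto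
  show ?thesis unfolding ennreal_mult[OF nn(1,2), symmetric] ennreal_mult[OF nn(3,4), symmetric]
   by (rule ennreal_plus[symmetric]) (use nn in \<open>auto intro: mult_nonneg_nonneg\<close>)
 qed
 also have "... <= ennreal (lo_const * r ^ CARD('n) * (1 / Y' ^ (CARD('n) - q) + a ^ (CARD('n) - q) * e1 + a ^ CARD('n) / r ^ q * E))"
 proof (rule ennreal_leI)
  define A where "A = (4 + sqrt pi) ^ CARD('n) * 2 ^ CARD('n)"
  define l where "l = 1 / lo_rate ^ (CARD('n) - q)"
  define u1 where "u1 = 1 / Y' ^ (CARD('n) - q)"
  define u2 where "u2 = a ^ (CARD('n) - q) * e1"
  define u3 where "u3 = a ^ CARD('n) / r ^ q * E"
  define s where "s = (6::real) ^ CARD('n)"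
  have s: "1 <= s" by (simp add: s_def)
  have A0: "0 < A" unfolding A_def by (intro mult_pos_pos zero_less_power) (auto intro: add_pos_nonneg)
  have l0: "0 <= l" using lo_rate_pos by (simp add: l_def)
  have u: "0 <= u1" "0 <= u2" "0 <= u3" using Y' a r by (auto simp: u1_def u2_def u3_def e1_def E_def)
  have g1: "(sqrt pi * r') ^ CARD('n) <= A * r ^ CARD('n)"
  proof -
   have "(sqrt pi * r') ^ CARD('n) <= ((4 + sqrt pi) * (2 * r)) ^ CARD('n)"
    using r' r by (intro power_mono mult_mono) auto
   then show ?thesis by (simp only: A_def power_mult_distrib mult_ac)
  qed
  have g2: "(4 + sqrt pi) ^ CARD('n) * r' ^ (CARD('n) - q) <= A * (r ^ CARD('n) / r ^ q)"
  proof -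
   have "r' ^ (CARD('n) - q) <= (2 * r) ^ (CARD('n) - q)" using r' by (intro power_mono) auto
   also have "... = 2 ^ (CARD('n) - q) * (r ^ CARD('n) / r ^ q)"
    using r qn by (simp add: power_mult_distrib power_diff)
   also have "... <= 2 ^ CARD('n) * (r ^ CARD('n) / r ^ q)"
    using r by (intro mult_right_mono power_increasing) auto
   finally have "(4 + sqrt pi) ^ CARD('n) * r' ^ (CARD('n) - q) <= (4 + sqrt pi) ^ CARD('n) * (2 ^ CARD('n) * (r ^ CARD('n) / r ^ q))"
    by (intro mult_left_mono) auto
   then show ?thesis by (simp add: A_def)
  qed
  have x1: "2 * 6 ^ CARD('n) / (lo_rate * Y') ^ (CARD('n) - q) + e1 * (6 ^ CARD('n) * a ^ (CARD('n) - q)) = s * (2 * l * u1 + u2)"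
   by (simp add: s_def l_def u1_def u2_def power_mult_distrib algebra_simps)
  have "Q * (s * (2 * l * u1 + u2)) * (sqrt pi * r') ^ CARD('n) <= Q * (s * (2 * l * u1 + u2)) * (A * r ^ CARD('n))"
   using Q s l0 u by (intro mult_left_mono g1) auto
  also have "... = Q * A * r ^ CARD('n) * s * (2 * l * u1 + u2)" by simp
  finally have t1: "Q * (s * (2 * l * u1 + u2)) * (sqrt pi * r') ^ CARD('n) <= Q * A * r ^ CARD('n) * s * (2 * l * u1 + u2)" .
  have "(a / 2) ^ CARD('n) * (Q * E * ((4 + sqrt pi) ^ CARD('n) * r' ^ (CARD('n) - q))) <= a ^ CARD('n) * (Q * E * (A * (r ^ CARD('n) / r ^ q)))"
   using Q a r' by (intro mult_mono mult_left_mono g2 power_mono) (auto simp: E_def)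
  also have "... = Q * A * r ^ CARD('n) * 1 * u3" by (simp add: u3_def mult_ac)
  also have "... <= Q * A * r ^ CARD('n) * s * u3"
   using Q A0 r u s by (intro mult_right_mono mult_left_mono) auto
  finally have "Q * (s * (2 * l * u1 + u2)) * (sqrt pi * r') ^ CARD('n) + (a / 2) ^ CARD('n) * (Q * E * ((4 + sqrt pi) ^ CARD('n) * r' ^ (CARD('n) - q)))
   <= Q * A * r ^ CARD('n) * s * (2 * l * u1 + u2 + u3)" using t1 by (simp add: distrib_left)
  also have "... <= Q * A * r ^ CARD('n) * s * (2 * (1 + l) * (u1 + u2 + u3))"
  proof (rule mult_left_mono)
   have "0 <= l * u2" "0 <= l * u3" using l0 u by auto
   then show "2 * l * u1 + u2 + u3 <= 2 * (1 + l) * (u1 + u2 + u3)" using u by (simp add: algebra_simps)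
  qed (use Q A0 r s in auto)
  also have "... = lo_const * r ^ CARD('n) * (u1 + u2 + u3)"
   unfolding lo_const_def Q_def[symmetric] A_def l_def[symmetric] s_def by simp
  finally show "Q * (2 * 6 ^ CARD('n) / (lo_rate * Y') ^ (CARD('n) - q) + e1 * (6 ^ CARD('n) * a ^ (CARD('n) - q))) * (sqrt pi * r') ^ CARD('n)
    + (a / 2) ^ CARD('n) * (Q * E * ((4 + sqrt pi) ^ CARD('n) * r' ^ (CARD('n) - q)))
   <= lo_const * r ^ CARD('n) * (1 / Y' ^ (CARD('n) - q) + a ^ (CARD('n) - q) * e1 + a ^ CARD('n) / r ^ q * E)"
   unfolding x1 u1_def u2_def u3_def .
 qed
 finally show ?thesis unfolding I_def Y'_def e1_def E_def .
qed

end

section \<open>Summation over packet centres away from the origin\<close>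

lemma exp_neg_le_power:
 fixes c x :: real
 assumes "0 < c" "0 < x"
 shows "exp (- (c * x)) <= (real k / c) ^ k / x ^ k"
proof (cases "k = 0")
 case True
 then show ?thesis using assms by simp
next
 case False
 define u where "u = c * x / real k"
 have u: "0 < u" using assms False by (simp add: u_def)
 have u': "u <= exp u" using exp_ge_add_one_self[of u] by linarith
 have "u ^ k <= exp u ^ k" using u u' by (intro power_mono) auto
 also have "... = exp (c * x)" using False by (simp add: exp_of_nat_mult[symmetric] u_def)
 finally have "exp (- (c * x)) <= 1 / u ^ k"
  using u assms by (simp add: exp_minus field_simps)
 also have "... = (real k / c) ^ k / x ^ k" using assms False by (simp add: u_def power_divide power_mult_distrib)
 finally show ?thesis .
qed

text \<open>Completing the square gives \<open>c * u^2 \<ge> 2 * u - 1 / c\<close>. One factor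
  \<open>exp (- u)\<close> absorbs the power of \<open>u\<close>, the other one remains.\<close>

lemma exp_neg_square_le:
 fixes c u :: real
 assumes "0 < c" "0 < u"
 shows "u ^ k * exp (- (c * u\<^sup>2)) <= exp (1 / c) * real k ^ k * exp (- u)"
proof -
 have "0 <= (c * u - 1)\<^sup>2 / c" using assms by simp
 also have "(c * u - 1)\<^sup>2 / c = c * u\<^sup>2 - 2 * u + 1 / c" using assms by (simp add: power2_eq_square field_simps)
 finally have "exp (- (c * u\<^sup>2)) <= exp (1 / c + (- u + - u))" by simp
 also have "... = exp (1 / c) * (exp (- u) * exp (- u))" by (simp only: exp_add)
 finally have "u ^ k * exp (- (c * u\<^sup>2)) <= u ^ k * (exp (1 / c) * (exp (- u) * exp (- u)))"
  using assms by (intro mult_left_mono) auto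
 also have "... = exp (1 / c) * (u ^ k * exp (- u)) * exp (- u)" by simp
 also have "... <= exp (1 / c) * real k ^ k * exp (- u)"
 proof (intro mult_right_mono mult_left_mono)
  have "exp (- (1 * u)) <= (real k / 1) ^ k / u ^ k" using assms by (intro exp_neg_le_power) auto
  then show "u ^ k * exp (- u) <= real k ^ k" using assms by (simp add: field_simps)
 qed auto
 finally show ?thesis .
qed

lemma exists_component_ge:
 fixes v :: "'n::finite => real"
 shows "\<exists>k. (\<Sum>k\<in>UNIV. v k) / real CARD('n) <= v k"
proof (rule ccontr)
 assume "\<not> ?thesis"
 then have "(\<Sum>k\<in>UNIV. v k) < (\<Sum>k\<in>(UNIV :: 'n set). (\<Sum>k\<in>UNIV. v k) / real CARD('n))"
  by (intro sum_strict_mono) (auto simp: not_le)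
 then show False by simp
qed

lemma inverse_sqrt_scale:
 assumes "1 <= \<bar>t\<bar>" "1 <= (R::real)" "r = 1 / sqrt (\<bar>t\<bar> * R ^ d)"
 shows "0 < r" "r <= 1" "\<bar>t\<bar> * r\<^sup>2 * R ^ d = 1"
proof -
 have "1 * 1 <= \<bar>t\<bar> * R ^ d" using assms by (intro mult_mono one_le_power) auto
 then have 1: "1 <= \<bar>t\<bar> * R ^ d" by simp
 then have "1 <= sqrt (\<bar>t\<bar> * R ^ d)" by simp
 then show "0 < r" "r <= 1" unfolding assms(3) by (auto simp: divide_le_eq)
 have "r\<^sup>2 = 1 / (\<bar>t\<bar> * R ^ d)" using 1 unfolding assms(3) power_divide by simp
 then show "\<bar>t\<bar> * r\<^sup>2 * R ^ d = 1" using 1 assms by auto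
qed

context elliptic_estimates
begin

text \<open>Beyond \<open>C1 * R\<close> the gradient of \<open>t * sqrt P\<close> is at least twice
  as large in some component as the linear phase can be, so that there is no stationary point. The
  resulting gain \<open>ka * G\<close> is at least a multiple of \<open>L / r\<close> and grows with
  the frequency.\<close>

lemma packet_high_decay:
 obtains C1 K c where "1 <= C1" "0 < K" "0 < c"
  "\<And>ta t ep (y :: real^'n) R r ze. 0 < ta ==> ta <= 1 ==> 1 <= \<bar>t\<bar> ==> 0 <= ep ==> ep <= 1 ==> 1 <= R ==> norm y <= \<bar>t\<bar> * R ^ (q - 1) ==>
    r = 1 / sqrt (\<bar>t\<bar> * R ^ (q - 2)) ==> C1 * R <= norm ze ==>
    norm (packet ta t ep r y ze) <= K * r ^ CARD('n) / R ^ q * exp (- (c * norm ze / r))"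
proof -
 obtain cg dg where g: "0 < cg" "0 < dg" "dg <= 1"
  "\<And>ta ze. 0 <= ta ==> ta <= dg * norm ze ==> ze ~= 0 ==> \<exists>k. cg * norm ze ^ (q - 1) <= \<bar>fir1 k ta ze\<bar>"
  by (rule gradient_lower) blast
 define n where "n = real CARD('n)"
 have n: "1 <= n" by (simp add: n_def Suc_leI)
 \<comment> \<open>The summands make, in turn, \<open>L \<ge> R\<close>, the linear phase at most
   half of the gradient, \<open>ta \<le> 1\<close> small enough for the gradient bound, and the
   packet narrow enough for the cone.\<close>
 define C1 where "C1 = 1 + 2 / cg + 1 / dg + 4 * n / c0"
 have C1parts: "1 <= C1" "2 / cg <= C1" "1 / dg <= C1" "4 * n / c0 <= C1"
 proof -
  have "0 <= 2 / cg" "0 <= 1 / dg" "0 <= 4 * n / c0" using g c0 n by auto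
  then show "1 <= C1" "2 / cg <= C1" "1 / dg <= C1" "4 * n / c0 <= C1" unfolding C1_def by linarith+
 qed
 define b where "b = 1 / (64 * n\<^sup>2)"
 have b: "0 < b" using n by (simp add: b_def)
 define c where "c = min 1 (cg / 4)"
 have c: "0 < c" "c <= 1" "c <= cg / 4" using g by (auto simp: c_def)
 define K where "K = hi_const * (1 + exp (1 / b) * real q ^ q)"
 have hi0: "0 < hi_const" unfolding hi_const_def using C1
  by (intro mult_pos_pos add_nonneg_pos zero_less_power) (auto intro: add_pos_nonneg)
 have K: "0 < K" unfolding K_def using hi0 by (intro mult_pos_pos add_pos_nonneg) auto
 show thesis
 proof (rule that[OF C1parts(1) K c(1)])
  fix ta t ep R r :: real and y ze :: "real^'n"
  assume ta: "0 < ta" "ta <= 1" and t: "1 <= \<bar>t\<bar>" and ep: "0 <= ep" "ep <= 1" and R: "1 <= R" and y: "norm y <= \<bar>t\<bar> * R ^ (q - 1)"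
   and rdef: "r = 1 / sqrt (\<bar>t\<bar> * R ^ (q - 2))" and far: "C1 * R <= norm ze"
  note r = inverse_sqrt_scale[OF t R rdef]
  define L where "L = norm ze"
  have LR: "C1 * R <= L" using far by (simp add: L_def)
  have Lge: "v <= L" if "v <= C1" "0 <= v" for v
  proof -
   have "v * 1 <= C1 * R" using that R by (intro mult_mono) auto
   then show ?thesis using LR by simp
  qed
  have RL: "R <= L"
  proof -
   have "1 * R <= C1 * R" using C1parts R by (intro mult_right_mono) auto
   then show ?thesis using LR by simp
  qed
  have L: "1 <= L" using RL R by linarith
  have ze0: "ze ~= 0" using L by (auto simp: L_def)
  have q1: "q - 1 = Suc (q - 2)" using q2 by simp
  \<comment> \<open>The largest height with
    \<open>\<bar>t\<bar> * ka * r * L ^ (q - 2) \<le> 1\<close>, because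
    \<open>\<bar>t\<bar> * r^2 * R ^ (q - 2) = 1\<close>.\<close>
  define ka where "ka = r * (R / L) ^ (q - 2)"
  have RLp: "0 <= (R / L) ^ (q - 2)" "(R / L) ^ (q - 2) <= 1" using R L RL by (auto intro!: power_le_one)
  have ka: "0 <= ka" "ka <= r" "\<bar>t\<bar> * ka * r * L ^ (q - 2) <= 1"
  proof -
   show "0 <= ka" "ka <= r" using RLp r by (auto simp: ka_def mult_left_le)
   have "\<bar>t\<bar> * ka * r * L ^ (q - 2) = \<bar>t\<bar> * r\<^sup>2 * R ^ (q - 2)"
    using L by (simp add: ka_def power_divide power2_eq_square)
   then show "\<bar>t\<bar> * ka * r * L ^ (q - 2) <= 1" using r by simp
  qed
  have "ta <= dg * L"
  proof -
   have "1 / dg <= L" using C1parts g by (intro Lge) auto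
   then have "1 <= dg * L" using g by (simp add: field_simps)
   then show ?thesis using ta by linarith
  qed
  then obtain k where k: "cg * L ^ (q - 1) <= \<bar>fir1 k ta ze\<bar>"
   using g(4)[of ta ze] ta ze0 by (auto simp: L_def)
  define G where "G = \<bar>y $ k + t * fir1 k ta ze\<bar>"
  have Gge: "\<bar>t\<bar> * (cg / 2 * L ^ (q - 1)) <= G"
  proof -
   have "\<bar>y $ k\<bar> <= \<bar>t\<bar> * R ^ (q - 1)" using component_le_norm_cart[of y k] y by linarith
   also have "... <= \<bar>t\<bar> * (cg / 2 * L ^ (q - 1))"
   proof (rule mult_left_mono)
    have "2 / cg * R <= C1 * R" using C1parts R by (intro mult_right_mono) auto
    then have "2 / cg * R <= L" using LR by linarith
    then have "R <= cg / 2 * L" using g by (simp add: field_simps)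
    then have "R ^ (q - 2) * R <= L ^ (q - 2) * (cg / 2 * L)"
     using RL R by (intro mult_mono power_mono) auto
    then show "R ^ (q - 1) <= cg / 2 * L ^ (q - 1)" unfolding q1 by (simp add: mult_ac)
   qed auto
   finally have "\<bar>y $ k\<bar> <= \<bar>t\<bar> * (cg / 2 * L ^ (q - 1))" .
   moreover have "\<bar>t\<bar> * (cg * L ^ (q - 1)) <= \<bar>t * fir1 k ta ze\<bar>" unfolding abs_mult using k by (intro mult_left_mono) auto
   moreover have "\<bar>t\<bar> * (cg * L ^ (q - 1)) = 2 * (\<bar>t\<bar> * (cg / 2 * L ^ (q - 1)))" by simp
   ultimately show ?thesis unfolding G_def by linarith
  qed
  have kaG: "c * L / r <= ka * G / 2"
  proof -
   have "ka * (\<bar>t\<bar> * (cg / 2 * L ^ (q - 1))) = cg / 2 * L * (\<bar>t\<bar> * r * R ^ (q - 2))"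
    using L unfolding q1 by (simp add: ka_def power_divide)
   also have "\<bar>t\<bar> * r * R ^ (q - 2) = 1 / r" using r by (simp add: power2_eq_square field_simps)
   finally have "cg / 2 * L * (1 / r) <= ka * G" using mult_left_mono[OF Gge ka(1)] by simp
   moreover have "c * (L / r) <= cg / 4 * (L / r)" using c L r by (intro mult_right_mono) auto
   ultimately show ?thesis by simp
  qed
  have "norm (packet ta t ep r y ze) <= hi_const * r ^ CARD('n) *
   (exp (- (ka * G / 2)) / L ^ q + exp (- (L\<^sup>2 / (64 * n\<^sup>2 * r\<^sup>2))) / r ^ q)"
   unfolding G_def L_def n_def
  proof (rule packet_high[OF ta(1) _ ze0 ep r(1,2)])
   show "ta <= norm ze" using ta L by (simp add: L_def)
   have "4 * n / c0 <= L" using C1parts n c0 by (intro Lge) auto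
   then have "4 * n <= c0 * L" using c0 by (simp add: field_simps)
   moreover have "4 * n * r <= 4 * n * 1" using r n by (intro mult_left_mono) auto
   ultimately show "4 * real CARD('n) * r <= c0 * norm ze" unfolding n_def L_def by linarith
  qed (use ka in \<open>auto simp: L_def\<close>)
  also have "... <= hi_const * r ^ CARD('n) * ((1 + exp (1 / b) * real q ^ q) / R ^ q * exp (- (c * L / r)))"
  proof (rule mult_left_mono)
   have e1: "exp (- (ka * G / 2)) / L ^ q <= exp (- (c * L / r)) / R ^ q"
    using kaG RL R by (intro frac_le power_mono) auto
   define u where "u = L / r"
   have u: "0 < u" using L r by (simp add: u_def)
   have "exp (- (L\<^sup>2 / (64 * n\<^sup>2 * r\<^sup>2))) / r ^ q = (R / r) ^ q * exp (- (b * u\<^sup>2)) / R ^ q"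
    using R r by (simp add: b_def u_def power_divide)
   also have "... <= u ^ q * exp (- (b * u\<^sup>2)) / R ^ q"
    using R r RL unfolding u_def by (intro divide_right_mono mult_right_mono power_mono) auto
   also have "... <= (exp (1 / b) * real q ^ q * exp (- u)) / R ^ q"
    using R by (intro divide_right_mono exp_neg_square_le b u) auto
   also have "... <= (exp (1 / b) * real q ^ q * exp (- (c * L / r))) / R ^ q"
   proof (intro divide_right_mono mult_left_mono)
    have "c * u <= 1 * u" using c u by (intro mult_right_mono) auto
    then show "exp (- u) <= exp (- (c * L / r))" by (simp add: u_def)
   qed (use R in auto)
   finally show "exp (- (ka * G / 2)) / L ^ q + exp (- (L\<^sup>2 / (64 * n\<^sup>2 * r\<^sup>2))) / r ^ q
    <= (1 + exp (1 / b) * real q ^ q) / R ^ q * exp (- (c * L / r))"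
    using e1 by (simp add: distrib_right add_divide_distrib)
  qed (use hi0 r in auto)
  finally show "norm (packet ta t ep r y ze) <= K * r ^ CARD('n) / R ^ q * exp (- (c * norm ze / r))"
   by (simp add: K_def L_def mult_ac)
 qed
qed

text \<open>
  On a piece where the gradient map is quantitatively injective, comparison with the point where
  the phase gradient is smallest bounds it from below by a multiple of the distance to that point.
\<close>

lemma stationary_piece:
 fixes y :: "real^'n"
 defines "\<Gamma> \<equiv> %ta t ze. \<Sum>k\<in>UNIV. \<bar>y $ k + t * fir1 k ta ze\<bar>"
 assumes E: "compact E" and ta: "0 < ta" and be: "0 < be" and A: "0 < A"
  and inj: "\<And>ze et. ze \<in> E ==> et \<in> E ==> \<exists>k. A * norm (et - ze) <= \<bar>t\<bar> * \<bar>fir1 k ta et - fir1 k ta ze\<bar>"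
 shows "(\<integral>\<^sup>+ze. indicator E ze * ennreal (exp (- (be * \<Gamma> ta t ze))) \<partial>lborel) <= ennreal ((4 * real CARD('n) / (be * A)) ^ CARD('n))"
proof (cases "E = {}")
 case True
 then show ?thesis by simp
next
 case False
 have "continuous_on E (\<Gamma> ta t)"
  unfolding \<Gamma>_def
 proof (intro continuous_intros fir1_continuous)
  show "0 <= ta \<and> 0 < ta + norm x" for x :: "real^'n" using ta by (auto intro: add_pos_nonneg)
 qed
 from continuous_attains_inf[OF E False this]
 obtain ze0 where ze0: "ze0 \<in> E" "\<And>ze. ze \<in> E ==> \<Gamma> ta t ze0 <= \<Gamma> ta t ze" by blast
 have lower: "A / 2 * norm (ze - ze0) <= \<Gamma> ta t ze" if ze: "ze \<in> E" for ze
 proof -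
  obtain k where k: "A * norm (ze - ze0) <= \<bar>t\<bar> * \<bar>fir1 k ta ze - fir1 k ta ze0\<bar>" using inj[OF ze0(1) ze] by blast
  have "\<bar>t\<bar> * \<bar>fir1 k ta ze - fir1 k ta ze0\<bar> = \<bar>(y $ k + t * fir1 k ta ze) - (y $ k + t * fir1 k ta ze0)\<bar>"
   by (simp add: abs_mult[symmetric] right_diff_distrib)
  also have "... <= \<bar>y $ k + t * fir1 k ta ze\<bar> + \<bar>y $ k + t * fir1 k ta ze0\<bar>" by (rule abs_triangle_ineq4)
  also have "... <= \<Gamma> ta t ze + \<Gamma> ta t ze0"
   unfolding \<Gamma>_def by (intro add_mono member_le_sum) auto
  also have "... <= 2 * \<Gamma> ta t ze" using ze0(2)[OF ze] by simp
  finally show ?thesis using k by simp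
 qed
 have "(\<integral>\<^sup>+ze. indicator E ze * ennreal (exp (- (be * \<Gamma> ta t ze))) \<partial>lborel) <= (\<integral>\<^sup>+ze. ennreal (exp (- ((be * A / 2) * norm (ze - ze0)))) \<partial>lborel)"
 proof (rule nn_integral_mono)
  fix ze :: "real^'n"
  show "indicator E ze * ennreal (exp (- (be * \<Gamma> ta t ze))) <= ennreal (exp (- ((be * A / 2) * norm (ze - ze0))))"
  proof (cases "ze \<in> E")
   case True
   have "be * (A / 2 * norm (ze - ze0)) <= be * \<Gamma> ta t ze" using lower[OF True] be by (intro mult_left_mono) auto
   then show ?thesis using True by (simp add: ennreal_leI)
  qed auto
 qed
 also have "... <= ennreal ((2 * real CARD('n) / (be * A / 2)) ^ CARD('n))"
  using be A by (intro nn_integral_exp_norm) auto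
 finally show ?thesis by (simp add: mult.commute)
qed

text \<open>Stationary points can occur in this annulus. It is the dilation by \<open>R\<close> of a
  fixed annulus, hence covered by a number of balls independent of \<open>R\<close> and
  \<open>t\<close>, on each of which the gradient map is injective. On one piece the packets decay
  exponentially in the distance to a best centre at the scale \<open>r\<close>, and they integrate
  to a multiple of \<open>r ^ n\<close> times the size of one packet.\<close>

lemma packet_mid_sum:
 assumes c4: "0 < c4" "c4 <= 1" and CC: "1 <= C1"
 obtains R0 K where "1 <= R0" "0 < K"
  "\<And>ta t ep (y :: real^'n) R r. 0 < ta ==> ta <= 1 ==> 1 <= \<bar>t\<bar> ==> 0 <= ep ==> ep <= 1 ==> R0 <= R ==>
    r = 1 / sqrt (\<bar>t\<bar> * R ^ (q - 2)) ==>
    (\<integral>\<^sup>+ze. indicator {ze. c4 * R <= norm ze \<and> norm ze <= C1 * R} ze * ennreal (norm (packet ta t ep r y ze)) \<partial>lborel)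
     <= ennreal (K * r ^ CARD('n) * (r ^ CARD('n) / R ^ q))"
proof -
 obtain ci di where i: "0 < ci" "0 < di" "di <= 1/2"
  "\<And>ta ze et. 0 <= ta ==> ta <= di * norm ze ==> ze ~= 0 ==> norm (et - ze) <= di * norm ze ==>
    \<exists>k. ci * norm ze ^ (q - 2) * norm (et - ze) <= \<bar>fir1 k ta et - fir1 k ta ze\<bar>"
  by (rule gradient_injective) blast
 define n where "n = real CARD('n)"
 have n: "1 <= n" by (simp add: n_def Suc_leI)
 \<comment> \<open>From \<open>R0\<close> on, every centre of the annulus has norm at least 1, the
   parameter \<open>ta \<le> 1\<close> is small enough for local injectivity, and the packets fit
   into the cone.\<close>
 define R0 where "R0 = 1 + 1 / c4 + 1 / (di * c4) + 4 * n / (c0 * c4)"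
 have R0: "1 <= R0" "1 / c4 <= R0" "1 / (di * c4) <= R0" "4 * n / (c0 * c4) <= R0"
 proof -
  have "0 <= 1 / c4" "0 <= 1 / (di * c4)" "0 <= 4 * n / (c0 * c4)" using i c0 n c4 by auto
  then show "1 <= R0" "1 / c4 <= R0" "1 / (di * c4) <= R0" "4 * n / (c0 * c4) <= R0" unfolding R0_def by linarith+
 qed
 \<comment> \<open>Two points of a ball of radius \<open>\<rho> * R\<close> differ by at most
   \<open>di * c4 * R\<close>, which is within the range of local injectivity at every centre of the
   annulus.\<close>
 define \<rho> where "\<rho> = di * c4 / 2"
 have \<rho>: "0 < \<rho>" using i c4 by (simp add: \<rho>_def)
 define An where "An = {x :: real^'n. c4 <= norm x \<and> norm x <= C1}"
 have "closed An" unfolding An_def Collect_conj_eq by (intro closed_Int closed_Collect_le continuous_intros)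
 moreover have "An \<subseteq> cball 0 C1" by (auto simp: An_def)
 ultimately have An: "compact An" by (metis closed_Int_compact compact_cball inf.absorb1)
 have "An \<subseteq> (\<Union>x\<in>An. ball x \<rho>)" using \<rho> by force
 then obtain D where D: "D \<subseteq> An" "finite D" "An \<subseteq> (\<Union>x\<in>D. ball x \<rho>)"
  using compactE_image[OF An, of An "%x. ball x \<rho>"] by blast
 define c5 where "c5 = c4 ^ (q - 2)"
 have c5: "0 < c5" "c5 <= 1" using c4 by (auto simp: c5_def power_le_one)
 define c8 where "c8 = c5 / C1 ^ (q - 2) / (2 * n)"
 have c8: "0 < c8" using c5 CC n by (simp add: c8_def)
 define b where "b = 1 / (64 * n\<^sup>2)"
 have b: "0 < b" using n by (simp add: b_def)
 define K1 where "K1 = hi_const / c4 ^ q * (1 + exp (1 / b) * real q ^ q)"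
 have hi0: "0 < hi_const" unfolding hi_const_def using C1
  by (intro mult_pos_pos add_nonneg_pos zero_less_power) (auto intro: add_pos_nonneg)
 have K1: "0 < K1" unfolding K1_def using hi0 c4 by (intro mult_pos_pos add_pos_nonneg) auto
 define A1 where "A1 = ci * c4 ^ (q - 2)"
 have A1: "0 < A1" using i c4 by (simp add: A1_def)
 define K2 where "K2 = (4 * n / (c8 * A1)) ^ CARD('n)"
 define K3 where "K3 = (2 * n) ^ CARD('n)"
 have K23: "0 <= K2" "0 < K3" using c8 A1 n by (auto simp: K2_def K3_def)
 define K where "K = K1 * (real (card D) * K2 + K3)"
 have K: "0 < K" using K1 K23 by (auto simp: K_def intro!: mult_pos_pos add_nonneg_pos)
 show thesis
 proof (rule that[OF R0(1) K])
  fix ta t ep R r :: real and y :: "real^'n"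
  assume ta: "0 < ta" "ta <= 1" and t: "1 <= \<bar>t\<bar>" and ep: "0 <= ep" "ep <= 1" and RR: "R0 <= R"
   and rdef: "r = 1 / sqrt (\<bar>t\<bar> * R ^ (q - 2))"
  have R: "1 <= R" using RR R0 by linarith
  note r = inverse_sqrt_scale[OF t R rdef]
  define \<Gamma> where "\<Gamma> = (%ta t ze. \<Sum>k\<in>UNIV. \<bar>y $ k + t * fir1 k ta ze\<bar>)"
  define A where "A = {ze :: real^'n. c4 * R <= norm ze \<and> norm ze <= C1 * R}"
  define Ex where "Ex = (%x. A \<inter> cball (R *\<^sub>R x) (\<rho> * R))"
  have c4R: "1 <= c4 * R" "1 <= di * (c4 * R)" "4 * n <= c0 * (c4 * R)"
  proof -
   have "1 / c4 <= R" "1 / (di * c4) <= R" "4 * n / (c0 * c4) <= R" using R0 RR by linarith+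
   then show "1 <= c4 * R" "1 <= di * (c4 * R)" "4 * n <= c0 * (c4 * R)" using c4 i c0 by (auto simp: divide_le_eq mult_ac)
  qed
  have pointwise: "norm (packet ta t ep r y ze) <= K1 * r ^ CARD('n) / R ^ q * (exp (- (c8 * r * \<Gamma> ta t ze)) + exp (- (1 / r * norm ze)))"
   if ze: "ze \<in> A" for ze
  proof -
   define L where "L = norm ze"
   have L: "c4 * R <= L" "L <= C1 * R" "1 <= L" using ze c4R by (auto simp: A_def L_def)
   have ze0: "ze ~= 0" using L by (auto simp: L_def)
   \<comment> \<open>The coordinate to be shifted depends on the centre: it is one in which the
     phase gradient is at least the average over all components.\<close>
   obtain k where k: "\<Gamma> ta t ze / n <= \<bar>y $ k + t * fir1 k ta ze\<bar>"
    using exists_component_ge[of "%k. \<bar>y $ k + t * fir1 k ta ze\<bar>"] unfolding \<Gamma>_def n_def by blast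
   \<comment> \<open>The factor \<open>c5 = c4 ^ (q - 2)\<close> keeps \<open>ka \<le> r\<close>
     even at the inner radius, where \<open>R / L\<close> may be as large as
     \<open>1 / c4\<close>.\<close>
   define ka where "ka = r * (c5 * (R / L) ^ (q - 2))"
   have p1: "c5 * (R / L) ^ (q - 2) <= 1"
   proof -
    have "c5 * (R / L) ^ (q - 2) = (c4 * R / L) ^ (q - 2)" by (simp add: c5_def power_mult_distrib power_divide)
    also have "... <= 1" using L R c4 by (intro power_le_one) (auto simp: divide_le_eq)
    finally show ?thesis .
   qed
   have p2: "c5 / C1 ^ (q - 2) <= c5 * (R / L) ^ (q - 2)"
   proof -
    have "1 / C1 <= R / L" using L CC R by (simp add: field_simps)
    then have "(1 / C1) ^ (q - 2) <= (R / L) ^ (q - 2)" using CC by (intro power_mono) auto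
    then have "c5 * (1 / C1) ^ (q - 2) <= c5 * (R / L) ^ (q - 2)" using c5 by (intro mult_left_mono) auto
    then show ?thesis by (simp add: power_divide)
   qed
   have ka: "0 <= ka" "ka <= r" "\<bar>t\<bar> * ka * r * L ^ (q - 2) <= 1"
   proof -
    show "0 <= ka" using r c5 R L by (simp add: ka_def)
    show "ka <= r" unfolding ka_def using p1 r by (intro mult_left_le) auto
    have "\<bar>t\<bar> * ka * r * L ^ (q - 2) = c5 * (\<bar>t\<bar> * r\<^sup>2 * R ^ (q - 2))"
     using L by (simp add: ka_def power_divide power2_eq_square)
    then show "\<bar>t\<bar> * ka * r * L ^ (q - 2) <= 1" using r c5 by simp
   qed
   define G where "G = \<bar>y $ k + t * fir1 k ta ze\<bar>"
   have kaG: "c8 * r * \<Gamma> ta t ze <= ka * G / 2"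
   proof -
    have G0: "0 <= \<Gamma> ta t ze" unfolding \<Gamma>_def by (intro sum_nonneg) auto
    have "(r * (c5 / C1 ^ (q - 2))) * (\<Gamma> ta t ze / n) <= ka * G"
     unfolding ka_def G_def using p2 k r c5 CC n G0 R L by (intro mult_mono mult_left_mono) auto
    then have le: "(r * (c5 / C1 ^ (q - 2))) * (\<Gamma> ta t ze / n) / 2 <= ka * G / 2" by (rule divide_right_mono) simp
    have eq: "c8 * r * \<Gamma> ta t ze = (r * (c5 / C1 ^ (q - 2))) * (\<Gamma> ta t ze / n) / 2" by (simp add: c8_def mult_ac)
    show ?thesis unfolding eq by (rule le)
   qed
   have "norm (packet ta t ep r y ze) <= hi_const * r ^ CARD('n) *
    (exp (- (ka * G / 2)) / L ^ q + exp (- (L\<^sup>2 / (64 * n\<^sup>2 * r\<^sup>2))) / r ^ q)"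
    unfolding G_def L_def n_def
   proof (rule packet_high[OF ta(1) _ ze0 ep r(1,2)])
    show "ta <= norm ze" using ta L by (simp add: L_def)
    have "c0 * (c4 * R) <= c0 * L" using L c0 by (intro mult_left_mono) auto
    moreover have "4 * n * r <= 4 * n * 1" using r n by (intro mult_left_mono) auto
    ultimately show "4 * real CARD('n) * r <= c0 * norm ze" using c4R(3) unfolding n_def L_def by linarith
   qed (use ka in \<open>auto simp: L_def\<close>)
   also have "... <= hi_const * r ^ CARD('n) * ((1 + exp (1 / b) * real q ^ q) / (c4 * R) ^ q * (exp (- (c8 * r * \<Gamma> ta t ze)) + exp (- (1 / r * L))))"
   proof (rule mult_left_mono)
    define Z where "Z = exp (1 / b) * real q ^ q"
    have Z: "0 <= Z" by (simp add: Z_def)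
    have e1: "exp (- (ka * G / 2)) / L ^ q <= exp (- (c8 * r * \<Gamma> ta t ze)) / (c4 * R) ^ q"
     using kaG L R c4 by (intro frac_le power_mono) auto
    define u where "u = L / r"
    have u: "0 < u" using L r by (simp add: u_def)
    have "exp (- (L\<^sup>2 / (64 * n\<^sup>2 * r\<^sup>2))) / r ^ q = (c4 * R / r) ^ q * exp (- (b * u\<^sup>2)) / (c4 * R) ^ q"
     using R r c4 by (simp add: b_def u_def power_divide)
    also have "... <= u ^ q * exp (- (b * u\<^sup>2)) / (c4 * R) ^ q"
     using R r L c4 unfolding u_def by (intro divide_right_mono mult_right_mono power_mono) auto
    also have "... <= (Z * exp (- u)) / (c4 * R) ^ q"
     using R c4 unfolding Z_def by (intro divide_right_mono exp_neg_square_le b u) auto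
    also have "u = 1 / r * L" by (simp add: u_def)
    finally have e2: "exp (- (L\<^sup>2 / (64 * n\<^sup>2 * r\<^sup>2))) / r ^ q <= (Z * exp (- (1 / r * L))) / (c4 * R) ^ q" .
    have "0 <= Z * exp (- (c8 * r * \<Gamma> ta t ze)) / (c4 * R) ^ q" "0 <= exp (- (1 / r * L)) / (c4 * R) ^ q" using Z c4 R by auto
    then show "exp (- (ka * G / 2)) / L ^ q + exp (- (L\<^sup>2 / (64 * n\<^sup>2 * r\<^sup>2))) / r ^ q
     <= (1 + exp (1 / b) * real q ^ q) / (c4 * R) ^ q * (exp (- (c8 * r * \<Gamma> ta t ze)) + exp (- (1 / r * L)))"
     using e1 e2 unfolding Z_def[symmetric] by (simp add: algebra_simps add_divide_distrib)
   qed (use hi0 r in auto)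
   finally show ?thesis by (simp add: K1_def L_def power_mult_distrib mult_ac)
  qed
  have cover: "indicator A ze <= (\<Sum>x\<in>D. indicator (Ex x) ze :: ennreal)" for ze
  proof (cases "ze \<in> A")
   case True
   have "(1 / R) *\<^sub>R ze \<in> An" using True R by (auto simp: A_def An_def field_simps)
   then obtain x where x: "x \<in> D" "dist x ((1 / R) *\<^sub>R ze) < \<rho>" using D(3) by (auto simp: mem_ball)
   have "R *\<^sub>R x - ze = R *\<^sub>R (x - (1 / R) *\<^sub>R ze)" using R by (simp add: scaleR_diff_right)
   then have "dist (R *\<^sub>R x) ze = R * dist x ((1 / R) *\<^sub>R ze)" using R by (simp add: dist_norm)
   also have "... <= R * \<rho>" using x R by (intro mult_left_mono) auto
   finally have "ze \<in> Ex x" using True by (simp add: Ex_def mult.commute)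
   then have "1 = (indicator (Ex x) ze :: ennreal)" by simp
   also have "... <= (\<Sum>x\<in>D. indicator (Ex x) ze)" using x D(2) by (intro member_le_sum) auto
   finally show ?thesis using True by simp
  qed auto
  have clA: "closed A" unfolding A_def Collect_conj_eq by (intro closed_Int closed_Collect_le continuous_intros)
  have compEx: "compact (Ex x)" for x unfolding Ex_def by (intro closed_Int_compact clA compact_cball)
  have [measurable]: "Ex x \<in> sets borel" for x using compEx by (intro borel_closed compact_imp_closed)
  have cont\<Gamma>: "continuous_on UNIV (\<Gamma> ta t)"
   unfolding \<Gamma>_def
  proof (intro continuous_intros fir1_continuous)
   show "0 <= ta \<and> 0 < ta + norm x" for x :: "real^'n" using ta by (auto intro: add_pos_nonneg)
  qed
  have [measurable]: "\<Gamma> ta t \<in> borel_measurable borel" by (rule borel_measurable_continuous_onI[OF cont\<Gamma>])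
  have piece: "(\<integral>\<^sup>+ze. indicator (Ex x) ze * ennreal (exp (- ((c8 * r) * \<Gamma> ta t ze))) \<partial>lborel) <= ennreal (K2 * r ^ CARD('n))" for x
  proof -
   have "(\<integral>\<^sup>+ze. indicator (Ex x) ze * ennreal (exp (- ((c8 * r) * \<Gamma> ta t ze))) \<partial>lborel)
    <= ennreal ((4 * real CARD('n) / ((c8 * r) * (A1 / r\<^sup>2))) ^ CARD('n))"
    unfolding \<Gamma>_def
   proof (rule stationary_piece[OF compEx ta(1)])
    show "0 < c8 * r" "0 < A1 / r\<^sup>2" using c8 r A1 by auto
    fix ze et assume *: "ze \<in> Ex x" "et \<in> Ex x"
    have ze: "c4 * R <= norm ze" using * by (auto simp: Ex_def A_def)
    have "dist et ze <= dist (R *\<^sub>R x) et + dist (R *\<^sub>R x) ze" by (rule dist_triangle3)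
    also have "... <= \<rho> * R + \<rho> * R" using * by (intro add_mono) (auto simp: Ex_def)
    also have "... = di * (c4 * R)" by (simp add: \<rho>_def)
    also have "... <= di * norm ze" using ze i by (intro mult_left_mono) auto
    finally have near: "norm (et - ze) <= di * norm ze" by (simp add: dist_norm)
    have "di * (c4 * R) <= di * norm ze" using ze i by (intro mult_left_mono) auto
    then have "ta <= di * norm ze" using c4R ta by linarith
    moreover have "ze ~= 0" using ze c4R by auto
    ultimately obtain k where k: "ci * norm ze ^ (q - 2) * norm (et - ze) <= \<bar>fir1 k ta et - fir1 k ta ze\<bar>"
     using i(4)[of ta ze et] ta near by auto
    have "ci * (c4 * R) ^ (q - 2) * norm (et - ze) <= ci * norm ze ^ (q - 2) * norm (et - ze)"
     using ze i c4 R by (intro mult_right_mono mult_left_mono power_mono) auto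
    with k have "\<bar>t\<bar> * (ci * (c4 * R) ^ (q - 2) * norm (et - ze)) <= \<bar>t\<bar> * \<bar>fir1 k ta et - fir1 k ta ze\<bar>"
     by (intro mult_left_mono) auto
    \<comment> \<open>The Hessian of the phase has size
      \<open>\<bar>t\<bar> * R ^ (q - 2) = 1 / r^2\<close>; with the rate \<open>c8 * r\<close> of
      the exponential, the decay takes place at distance \<open>r\<close>.\<close>
    moreover have "A1 / r\<^sup>2 * norm (et - ze) = \<bar>t\<bar> * (ci * (c4 * R) ^ (q - 2) * norm (et - ze))"
    proof -
     have "1 / r\<^sup>2 = \<bar>t\<bar> * R ^ (q - 2)" using r by (simp add: field_simps)
     then have "A1 / r\<^sup>2 = A1 * (\<bar>t\<bar> * R ^ (q - 2))" by (metis divide_inverse inverse_eq_divide)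
     then show ?thesis by (simp add: A1_def power_mult_distrib mult_ac)
    qed
    ultimately show "\<exists>k. A1 / r\<^sup>2 * norm (et - ze) <= \<bar>t\<bar> * \<bar>fir1 k ta et - fir1 k ta ze\<bar>" by auto
   qed
   also have "4 * real CARD('n) / ((c8 * r) * (A1 / r\<^sup>2)) = 4 * n / (c8 * A1) * r"
    using r c8 A1 by (simp add: n_def power2_eq_square field_simps)
   finally show ?thesis by (simp only: K2_def power_mult_distrib)
  qed
  define F where "F = K1 * r ^ CARD('n) / R ^ q"
  have F: "0 <= F" using K1 r R by (simp add: F_def)
  have "(\<integral>\<^sup>+ze. indicator A ze * ennreal (norm (packet ta t ep r y ze)) \<partial>lborel)
   <= (\<integral>\<^sup>+ze. ennreal F * ((\<Sum>x\<in>D. indicator (Ex x) ze * ennreal (exp (- ((c8 * r) * \<Gamma> ta t ze)))) + ennreal (exp (- (1 / r * norm (ze - 0))))) \<partial>lborel)"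
  proof (rule nn_integral_mono)
   fix ze :: "real^'n"
   show "indicator A ze * ennreal (norm (packet ta t ep r y ze))
    <= ennreal F * ((\<Sum>x\<in>D. indicator (Ex x) ze * ennreal (exp (- ((c8 * r) * \<Gamma> ta t ze)))) + ennreal (exp (- (1 / r * norm (ze - 0)))))"
   proof (cases "ze \<in> A")
    case True
    have "ennreal (norm (packet ta t ep r y ze)) <= ennreal (F * (exp (- ((c8 * r) * \<Gamma> ta t ze)) + exp (- (1 / r * norm ze))))"
     using pointwise[OF True] by (intro ennreal_leI) (simp add: F_def)
    also have "... = ennreal F * (1 * ennreal (exp (- ((c8 * r) * \<Gamma> ta t ze))) + ennreal (exp (- (1 / r * norm ze))))"
     using F by (simp add: ennreal_mult)
    also have "... <= ennreal F * ((\<Sum>x\<in>D. indicator (Ex x) ze) * ennreal (exp (- ((c8 * r) * \<Gamma> ta t ze))) + ennreal (exp (- (1 / r * norm ze))))"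
     using cover[of ze] True by (intro mult_left_mono add_right_mono mult_right_mono) auto
    finally show ?thesis using True by (simp add: sum_distrib_right)
   qed simp
  qed
  also have "... = ennreal F * (\<integral>\<^sup>+ze. (\<Sum>x\<in>D. indicator (Ex x) ze * ennreal (exp (- ((c8 * r) * \<Gamma> ta t ze)))) + ennreal (exp (- (1 / r * norm (ze - 0)))) \<partial>lborel)"
   by (rule nn_integral_cmult) measurable
  also have "(\<integral>\<^sup>+ze. (\<Sum>x\<in>D. indicator (Ex x) ze * ennreal (exp (- ((c8 * r) * \<Gamma> ta t ze)))) + ennreal (exp (- (1 / r * norm (ze - 0)))) \<partial>lborel)
   = (\<integral>\<^sup>+ze. (\<Sum>x\<in>D. indicator (Ex x) ze * ennreal (exp (- ((c8 * r) * \<Gamma> ta t ze)))) \<partial>lborel) + (\<integral>\<^sup>+ze. ennreal (exp (- (1 / r * norm (ze - (0 :: real^'n))))) \<partial>lborel)"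
   by (rule nn_integral_add) measurable
  also have "(\<integral>\<^sup>+ze. (\<Sum>x\<in>D. indicator (Ex x) ze * ennreal (exp (- ((c8 * r) * \<Gamma> ta t ze)))) \<partial>lborel)
   = (\<Sum>x\<in>D. \<integral>\<^sup>+ze. indicator (Ex x) ze * ennreal (exp (- ((c8 * r) * \<Gamma> ta t ze))) \<partial>lborel)"
   by (rule nn_integral_sum) measurable
  finally have "(\<integral>\<^sup>+ze. indicator A ze * ennreal (norm (packet ta t ep r y ze)) \<partial>lborel)
   <= ennreal F * ((\<Sum>x\<in>D. \<integral>\<^sup>+ze. indicator (Ex x) ze * ennreal (exp (- ((c8 * r) * \<Gamma> ta t ze))) \<partial>lborel) + (\<integral>\<^sup>+ze. ennreal (exp (- (1 / r * norm (ze - (0 :: real^'n))))) \<partial>lborel))" .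
  also have "... <= ennreal F * ((\<Sum>x\<in>D. ennreal (K2 * r ^ CARD('n))) + ennreal (K3 * r ^ CARD('n)))"
  proof (intro mult_left_mono add_mono sum_mono piece)
   have "(\<integral>\<^sup>+ze. ennreal (exp (- (1 / r * norm (ze - (0 :: real^'n))))) \<partial>lborel) <= ennreal ((2 * real CARD('n) / (1 / r)) ^ CARD('n))"
    using r by (intro nn_integral_exp_norm) auto
   also have "(2 * real CARD('n) / (1 / r)) ^ CARD('n) = K3 * r ^ CARD('n)" by (simp add: K3_def n_def power_mult_distrib)
   finally show "(\<integral>\<^sup>+ze. ennreal (exp (- (1 / r * norm (ze - (0 :: real^'n))))) \<partial>lborel) <= ennreal (K3 * r ^ CARD('n))" .
  qed auto
  also have "... = ennreal (F * (real (card D) * (K2 * r ^ CARD('n)) + K3 * r ^ CARD('n)))"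
   using F K23 r by (simp add: ennreal_mult ennreal_of_nat_eq_real_of_nat)
  also have "F * (real (card D) * (K2 * r ^ CARD('n)) + K3 * r ^ CARD('n)) = K * r ^ CARD('n) * (r ^ CARD('n) / R ^ q)"
   by (simp add: F_def K_def algebra_simps add_divide_distrib)
  finally show "(\<integral>\<^sup>+ze. indicator {ze. c4 * R <= norm ze \<and> norm ze <= C1 * R} ze * ennreal (norm (packet ta t ep r y ze)) \<partial>lborel)
     <= ennreal (K * r ^ CARD('n) * (r ^ CARD('n) / R ^ q))" unfolding A_def .
 qed
qed

end

section \<open>The regularised integral for large |x| / |t|\<close>

lemma cancel_gauss_mass:
 assumes "0 < r" "0 <= x" "(sqrt pi * r) ^ n * x <= D * r ^ n"
 shows "x <= D"
proof -
 have "r ^ n * (sqrt pi ^ n * x) <= r ^ n * D"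
  using assms(3) by (simp add: power_mult_distrib mult_ac)
 then have le: "sqrt pi ^ n * x <= D" using assms(1) by simp
 have "1 <= sqrt pi" using pi_ge_two by simp
 then have "1 * x <= sqrt pi ^ n * x"
  using assms(2) by (intro mult_right_mono one_le_power) auto
 then show ?thesis using le by simp
qed

context elliptic_estimates
begin

definition Jint :: "real => real => real => real^'n => complex" where
 "Jint ta t ep y = (\<integral>et. osc ta t ep y (cvec et) \<partial>lborel)"

lemma norm_osc_gaussian:
 assumes "0 < ta" "0 < ep"
 shows "norm (osc ta t ep y (cvec et)) <= C / ta ^ q * exp (- ((norm (et - (0 :: real^'n)))\<^sup>2 / (1 / sqrt ep)\<^sup>2))"
proof -
 have N: "0 < ta + norm et" using assms by (simp add: add_pos_nonneg)
 have "norm (osc ta t ep y (cvec et)) = norm (osc ta t 0 y (cvec et)) * exp (- (ep * (norm et)\<^sup>2))"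
  using norm_osc_cvec[of ta et] assms N by simp
 also have "... <= C / ta ^ q * exp (- (ep * (norm et)\<^sup>2))"
 proof (rule mult_right_mono)
  have "norm (osc ta t 0 y (cvec et)) <= C / (ta + norm et) ^ q" by (rule norm_osc_le[OF assms(1)]) simp
  also have "... <= C / ta ^ q"
   using assms C1 by (intro divide_left_mono power_mono mult_pos_pos zero_less_power) (auto intro: add_pos_nonneg)
  finally show "norm (osc ta t 0 y (cvec et)) <= C / ta ^ q" .
 qed auto
 also have "ep * (norm et)\<^sup>2 = (norm (et - (0 :: real^'n)))\<^sup>2 / (1 / sqrt ep)\<^sup>2" using assms by (simp add: power_divide)
 finally show ?thesis .
qed

lemma osc_nn_integral_finite:
 assumes "0 < ta" "0 < ep"
 shows "(\<integral>\<^sup>+et. norm (osc ta t ep y (cvec et)) \<partial>lborel) < \<infinity>"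
proof -
 have "(\<integral>\<^sup>+et. norm (osc ta t ep y (cvec et)) \<partial>lborel)
  <= (\<integral>\<^sup>+et. ennreal (C / ta ^ q) * ennreal (exp (- ((norm (et - (0 :: real^'n)))\<^sup>2 / (1 / sqrt ep)\<^sup>2))) \<partial>lborel)"
  using norm_osc_gaussian[OF assms, of t y] assms C1
  by (intro nn_integral_mono) (subst ennreal_mult[symmetric], auto intro!: ennreal_leI)
 also have "... = ennreal (C / ta ^ q) * (\<integral>\<^sup>+et. ennreal (exp (- ((norm (et - (0 :: real^'n)))\<^sup>2 / (1 / sqrt ep)\<^sup>2))) \<partial>lborel)"
  by (rule nn_integral_cmult) measurable
 also have "... < \<infinity>"
  using assms by (subst nn_integral_gaussian_vec) (auto simp: ennreal_mult_less_top)
 finally show ?thesis .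
qed

lemma osc_integrable: "0 < ta ==> 0 < ep ==> integrable lborel (%et. osc ta t ep y (cvec et))"
 using osc_nn_integral_finite[of ta ep t y] osc_measurable[of ta t ep y]
 by (intro integrableI_bounded) auto

lemma kernel_measurable:
 assumes "0 < ta"
 shows "(%x. osc ta t ep y (cvec (fst x)) * gauss r (snd x) (cvec (fst x))) \<in> borel_measurable (borel \<Otimes>\<^sub>M borel)"
  "(%x. osc ta t ep y (cvec (snd x)) * gauss r (fst x) (cvec (snd x))) \<in> borel_measurable (borel \<Otimes>\<^sub>M borel)"
proof -
 have [measurable]: "(%et. osc ta t ep y (cvec et)) \<in> borel_measurable borel" by (rule osc_measurable[OF assms])
 show "(%x. osc ta t ep y (cvec (fst x)) * gauss r (snd x) (cvec (fst x))) \<in> borel_measurable (borel \<Otimes>\<^sub>M borel)"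
  "(%x. osc ta t ep y (cvec (snd x)) * gauss r (fst x) (cvec (snd x))) \<in> borel_measurable (borel \<Otimes>\<^sub>M borel)"
  unfolding gauss_cvec by measurable
qed

lemma packet_measurable [measurable]:
 assumes "0 < ta"
 shows "(%ze. packet ta t ep r y ze) \<in> borel_measurable borel"
 unfolding packet_def
 using kernel_measurable(2)[OF assms, of t ep y r]
 by (intro lborel.borel_measurable_lebesgue_integral[unfolded split_beta']) (simp add: split_beta')

text \<open>The Gaussians with all centres add up to the constant \<open>(sqrt pi * r) ^ n\<close>,
  which recovers the integral for any width \<open>r\<close>. The damping \<open>ep > 0\<close>
  makes the double integral absolutely convergent.\<close>

lemma Jint_packets:
 assumes "0 < ta" "0 < ep" "0 < r"
 shows "integrable lborel (%ze. packet ta t ep r y ze)"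
  and "(\<integral>ze. packet ta t ep r y ze \<partial>lborel) = of_real ((sqrt pi * r) ^ CARD('n)) * Jint ta t ep y"
proof -
 let ?f = "%et ze. osc ta t ep y (cvec et) * gauss r ze (cvec et)"
 have gauss_int: "(\<integral>\<^sup>+ze. norm (gauss r ze (cvec et)) \<partial>lborel) = ennreal ((sqrt pi * r) ^ CARD('n))" for et :: "real^'n"
  unfolding gauss_cvec using nn_integral_gaussian_vec[OF assms(3), of et] by (simp add: norm_minus_commute)
 have int: "integrable (lborel \<Otimes>\<^sub>M lborel) (%(et, ze). ?f et ze)"
 proof (rule integrableI_bounded)
  show "(%(et, ze). ?f et ze) \<in> borel_measurable (lborel \<Otimes>\<^sub>M lborel)"
   using kernel_measurable(1)[OF assms(1), of t ep y r] by (simp add: split_beta')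
  then have "(\<integral>\<^sup>+x. norm (case x of (et, ze) => ?f et ze) \<partial>(lborel \<Otimes>\<^sub>M lborel)) = (\<integral>\<^sup>+et. \<integral>\<^sup>+ze. norm (?f et ze) \<partial>lborel \<partial>lborel)"
   by (subst lborel.nn_integral_fst[symmetric]) auto
  also have "... = (\<integral>\<^sup>+et. ennreal (norm (osc ta t ep y (cvec et))) * ennreal ((sqrt pi * r) ^ CARD('n)) \<partial>lborel)"
  proof (rule nn_integral_cong)
   fix et :: "real^'n"
   have m: "(%ze. ennreal (norm (gauss r ze (cvec et)))) \<in> borel_measurable lborel" unfolding gauss_cvec by measurable
   have "(\<integral>\<^sup>+ze. norm (?f et ze) \<partial>lborel) = (\<integral>\<^sup>+ze. ennreal (norm (osc ta t ep y (cvec et))) * ennreal (norm (gauss r ze (cvec et))) \<partial>lborel)"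
    by (simp add: norm_mult ennreal_mult)
   also have "... = ennreal (norm (osc ta t ep y (cvec et))) * (\<integral>\<^sup>+ze. norm (gauss r ze (cvec et)) \<partial>lborel)"
    by (rule nn_integral_cmult[OF m])
   finally show "(\<integral>\<^sup>+ze. norm (?f et ze) \<partial>lborel) = ennreal (norm (osc ta t ep y (cvec et))) * ennreal ((sqrt pi * r) ^ CARD('n))"
    by (simp only: gauss_int)
  qed
  also have "... = (\<integral>\<^sup>+et. ennreal (norm (osc ta t ep y (cvec et))) \<partial>lborel) * ennreal ((sqrt pi * r) ^ CARD('n))"
   using osc_measurable[OF assms(1)] by (intro nn_integral_multc) measurable
  also have "... < \<infinity>" using osc_nn_integral_finite[OF assms(1,2), of t y] by (simp add: ennreal_mult_less_top)
  finally show "(\<integral>\<^sup>+x. norm (case x of (et, ze) => ?f et ze) \<partial>(lborel \<Otimes>\<^sub>M lborel)) < \<infinity>" .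
 qed
 show "integrable lborel (%ze. packet ta t ep r y ze)"
  unfolding packet_def using lborel_pair.integrable_snd[OF int] by simp
 have "(\<integral>ze. packet ta t ep r y ze \<partial>lborel) = (\<integral>et. \<integral>ze. ?f et ze \<partial>lborel \<partial>lborel)"
  unfolding packet_def using lborel_pair.Fubini_integral[OF int] by simp
 also have "... = (\<integral>et. osc ta t ep y (cvec et) * of_real ((sqrt pi * r) ^ CARD('n)) \<partial>lborel)"
 proof (rule Bochner_Integration.integral_cong[OF refl])
  fix et :: "real^'n"
  have "(\<integral>ze. exp (- ((norm (et - ze))\<^sup>2 / r\<^sup>2)) \<partial>lborel) = (sqrt pi * r) ^ CARD('n)"
  proof (rule integral_eq_nn_integral[THEN trans])
   show "enn2real (\<integral>\<^sup>+ze. ennreal (exp (- ((norm (et - ze))\<^sup>2 / r\<^sup>2))) \<partial>lborel) = (sqrt pi * r) ^ CARD('n)"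
    using nn_integral_gaussian_vec[OF assms(3), of et] assms by (simp add: norm_minus_commute)
  qed auto
  then show "(\<integral>ze. ?f et ze \<partial>lborel) = osc ta t ep y (cvec et) * of_real ((sqrt pi * r) ^ CARD('n))"
   unfolding gauss_cvec by (simp only: integral_mult_right_zero integral_complex_of_real)
 qed
 also have "... = of_real ((sqrt pi * r) ^ CARD('n)) * Jint ta t ep y"
  unfolding Jint_def integral_mult_left_zero by (rule mult.commute)
 finally show "(\<integral>ze. packet ta t ep r y ze \<partial>lborel) = of_real ((sqrt pi * r) ^ CARD('n)) * Jint ta t ep y" .
qed

lemma norm_Jint_le:
 assumes "0 < ta" "0 < ep" "0 < r" "0 <= D"
  and "(\<integral>\<^sup>+ze. norm (packet ta t ep r y ze) \<partial>lborel) <= ennreal (D * r ^ CARD('n))"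
 shows "norm (Jint ta t ep y) <= D"
proof -
 have "ennreal (norm (\<integral>ze. packet ta t ep r y ze \<partial>lborel)) <= ennreal (D * r ^ CARD('n))"
  using integral_norm_bound_ennreal[OF Jint_packets(1)[OF assms(1-3)], of t y] assms(5) by (rule order_trans)
 then have "(sqrt pi * r) ^ CARD('n) * norm (Jint ta t ep y) <= D * r ^ CARD('n)"
  unfolding Jint_packets(2)[OF assms(1-3)] norm_mult norm_of_real using assms by (subst (asm) ennreal_le_iff) auto
 then show ?thesis by (rule cancel_gauss_mass[OF assms(3) norm_ge_zero])
qed

lemma nn_integral_high:
 assumes "0 < c" "0 < r" "0 <= A"
  and b: "\<And>ze :: real^'n. \<rho> <= norm ze ==> norm (f ze) <= A * exp (- (c * norm ze / r))"
 shows "(\<integral>\<^sup>+ze. indicator {ze. \<rho> <= norm ze} ze * ennreal (norm (f ze :: complex)) \<partial>lborel) <= ennreal (A * ((2 * real CARD('n) / c) ^ CARD('n) * r ^ CARD('n)))"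
proof -
 have "(\<integral>\<^sup>+ze. indicator {ze. \<rho> <= norm ze} ze * ennreal (norm (f ze)) \<partial>lborel)
  <= (\<integral>\<^sup>+ze. ennreal A * ennreal (exp (- (c / r * norm (ze - (0 :: real^'n))))) \<partial>lborel)"
 proof (rule nn_integral_mono)
  fix ze :: "real^'n"
  show "indicator {ze. \<rho> <= norm ze} ze * ennreal (norm (f ze)) <= ennreal A * ennreal (exp (- (c / r * norm (ze - (0 :: real^'n)))))"
   using b[of ze] assms(3) by (cases "\<rho> <= norm ze") (auto simp: ennreal_mult[symmetric] intro!: ennreal_leI)
 qed
 also have "... = ennreal A * (\<integral>\<^sup>+ze. ennreal (exp (- (c / r * norm (ze - (0 :: real^'n))))) \<partial>lborel)"
  by (rule nn_integral_cmult) measurable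
 also have "... <= ennreal A * ennreal ((2 * real CARD('n) / (c / r)) ^ CARD('n))"
  using assms by (intro mult_left_mono nn_integral_exp_norm) auto
 also have "... = ennreal (A * ((2 * real CARD('n) / c) ^ CARD('n) * r ^ CARD('n)))"
  using assms by (subst ennreal_mult[symmetric]) (auto simp: power_divide power_mult_distrib)
 finally show ?thesis .
qed

text \<open>The centres are divided into a cube around the origin, an annulus that may contain
  stationary points, and the exterior. Each region contributes at most a multiple of
  \<open>r ^ n / R ^ q\<close> after removal of the Gaussian mass; in the cube the shift is made in
  a coordinate where \<open>y\<close> is largest on average.\<close>

lemma Jint_large:
 obtains R0 K where "1 <= R0" "0 < K"
  "\<And>ta t ep (y :: real^'n) R. 0 < ta ==> ta <= 1 ==> 1 <= \<bar>t\<bar> ==> 0 < ep ==> ep <= 1 ==> R0 <= R ==> norm y = \<bar>t\<bar> * R ^ (q - 1) ==>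
    norm (Jint ta t ep y) <= K * ((1 / sqrt (\<bar>t\<bar> * R ^ (q - 2))) ^ CARD('n) / R ^ q)"
proof -
 define n where "n = real CARD('n)"
 have n: "1 <= n" by (simp add: n_def Suc_leI)
 define d where "d = CARD('n) - 2 * q"
 have nd: "CARD('n) = 2 * q + d" "CARD('n) - q = q + d" using qn by (auto simp: d_def)
 \<comment> \<open>Chosen so that \<open>2 * n * c3 = 1 / (2 * n * C)\<close>: on the cube of half
   side \<open>c3 * R\<close> the gradient of \<open>t * fi\<close> is then at most half of a
   component of \<open>y\<close> of size \<open>norm y / n\<close>.\<close>
 define c3 where "c3 = 1 / (2 * n * (2 * n * C))"
 have nC: "1 <= n * C" using mult_mono[of 1 n 1 C] n C1 by simp
 have c3: "0 < c3" "c3 <= 1"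
 proof -
  have "1 <= n * (n * C)" using mult_mono[of 1 n 1 "n * C"] n nC by simp
  then show "0 < c3" "c3 <= 1" unfolding c3_def using n C1 by (auto simp: divide_le_eq)
 qed
 define c4 where "c4 = c3 / 4"
 have c4: "0 < c4" "c4 <= 1" using c3 by (auto simp: c4_def)
 obtain C' K1 c where hi: "1 <= C'" "0 < K1" "0 < c"
  "\<And>ta t ep (y :: real^'n) R r ze. 0 < ta ==> ta <= 1 ==> 1 <= \<bar>t\<bar> ==> 0 <= ep ==> ep <= 1 ==> 1 <= R ==> norm y <= \<bar>t\<bar> * R ^ (q - 1) ==>
    r = 1 / sqrt (\<bar>t\<bar> * R ^ (q - 2)) ==> C' * R <= norm ze ==>
    norm (packet ta t ep r y ze) <= K1 * r ^ CARD('n) / R ^ q * exp (- (c * norm ze / r))"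
  by (rule packet_high_decay) blast
 obtain R1 K2 where mid: "1 <= R1" "0 < K2"
  "\<And>ta t ep (y :: real^'n) R r. 0 < ta ==> ta <= 1 ==> 1 <= \<bar>t\<bar> ==> 0 <= ep ==> ep <= 1 ==> R1 <= R ==>
    r = 1 / sqrt (\<bar>t\<bar> * R ^ (q - 2)) ==>
    (\<integral>\<^sup>+ze. indicator {ze. c4 * R <= norm ze \<and> norm ze <= C' * R} ze * ennreal (norm (packet ta t ep r y ze)) \<partial>lborel)
     <= ennreal (K2 * r ^ CARD('n) * (r ^ CARD('n) / R ^ q))"
  by (rule packet_mid_sum[OF c4 hi(1)]) blast
 define l where "l = lo_rate / n"
 have l: "0 < l" using lo_rate_pos n by (simp add: l_def)
 define k1 where "k1 = n ^ (CARD('n) - q)"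
 \<comment> \<open>Exponentials in \<open>R / r\<close> are exchanged for the powers
   \<open>n\<close> and \<open>n + q\<close> of \<open>r / R\<close>, because exactly these leave
   \<open>r ^ n / R ^ q\<close> in the second and third low-frequency terms.\<close>
 define k2 where "k2 = (real CARD('n) / l) ^ CARD('n)"
 define k3 where "k3 = (real (CARD('n) + q) / (c3\<^sup>2 / 32)) ^ (CARD('n) + q)"
 have k: "0 <= k1" "0 <= k2" "0 <= k3" using n l by (auto simp: k1_def k2_def k3_def)
 have lo0: "0 <= lo_const" unfolding lo_const_def using C1 lo_rate_pos by (intro mult_nonneg_nonneg add_nonneg_nonneg) auto
 define K4 where "K4 = (2 * n / c) ^ CARD('n)"
 have K4: "0 <= K4" using n hi by (simp add: K4_def)
 define K where "K = lo_const * (k1 + k2 + k3) + K2 + K1 * K4"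
 have K: "0 < K" unfolding K_def using lo0 k mid hi K4 by (intro add_nonneg_pos add_pos_nonneg mult_nonneg_nonneg add_nonneg_nonneg) auto
 define R0 where "R0 = R1 + 1 / c3 + 1 / (n * c3)"
 have R0: "R1 <= R0" "1 / c3 <= R0" "1 / (n * c3) <= R0" "1 <= R0"
 proof -
  have "0 <= 1 / c3" "0 <= 1 / (n * c3)" using n c3 by auto
  then show "R1 <= R0" "1 / c3 <= R0" "1 / (n * c3) <= R0" "1 <= R0" unfolding R0_def using mid(1) by linarith+
 qed
 show thesis
 proof (rule that[OF R0(4) K])
  fix ta t ep R :: real and y :: "real^'n"
  assume ta: "0 < ta" "ta <= 1" and t: "1 <= \<bar>t\<bar>" and ep: "0 < ep" "ep <= 1" and RR: "R0 <= R" and y: "norm y = \<bar>t\<bar> * R ^ (q - 1)"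
  have ep': "0 <= ep" using ep by simp
  define r where "r = 1 / sqrt (\<bar>t\<bar> * R ^ (q - 2))"
  have R: "1 <= R" "R1 <= R" "1 / c3 <= R" "1 / (n * c3) <= R" using RR R0 by linarith+
  note r = inverse_sqrt_scale[OF t R(1) r_def]
  define a where "a = c3 * R"
  have a: "1 <= a" "1 <= n * a" using R c3 n by (auto simp: a_def divide_le_eq mult_ac)
  define \<Lambda> where "\<Lambda> = R / r"
  have \<Lambda>: "1 <= \<Lambda>" using r R by (simp add: \<Lambda>_def le_divide_eq)
  have q1: "q - 1 = Suc (q - 2)" using q2 by simp
  have yr: "norm y = R / r\<^sup>2"
  proof -
   have "\<bar>t\<bar> * R ^ (q - 2) = 1 / r\<^sup>2" using r by (simp add: field_simps)
   then show ?thesis unfolding y q1 by (simp add: mult_ac)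
  qed
  obtain k' where k': "norm y / n <= \<bar>y $ k'\<bar>"
  proof -
   obtain k where "(\<Sum>k\<in>UNIV. \<bar>y $ k\<bar>) / real CARD('n) <= \<bar>y $ k\<bar>" using exists_component_ge by blast
   moreover have "norm y / n <= (\<Sum>k\<in>UNIV. \<bar>y $ k\<bar>) / n" using n by (intro divide_right_mono norm_le_l1_cart) auto
   ultimately show thesis by (intro that[of k]) (simp add: n_def)
  qed
  define Y where "Y = \<bar>y $ k'\<bar>"
  have Yge: "R / r\<^sup>2 / n <= Y" using k' unfolding yr Y_def .
  have Y0: "0 < R / r\<^sup>2 / n" using R r n by simp
  have Ycond: "\<bar>t\<bar> * C * (ta + real CARD('n) * a) ^ (q - 1) <= \<bar>y $ k'\<bar> / 2"
  proof -
   have "ta + n * a <= 2 * (n * a)" using ta a by linarith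
   then have "ta + n * a <= 2 * n * c3 * R" by (simp add: a_def mult_ac)
   then have "(ta + n * a) ^ (q - 1) <= (2 * n * c3 * R) ^ (q - 1)" using ta a by (intro power_mono) auto
   also have "... = (1 / (2 * n * C)) ^ (q - 1) * R ^ (q - 1)"
   proof -
    have "2 * n * c3 = 1 / (2 * n * C)" using n by (simp add: c3_def)
    then show ?thesis by (simp only: power_mult_distrib)
   qed
   also have "... <= (1 / (2 * n * C)) * R ^ (q - 1)"
   proof (rule mult_right_mono)
    have "(1 / (2 * n * C)) ^ (q - 1) <= (1 / (2 * n * C)) ^ 1"
     using n C1 nC q2 by (intro power_decreasing) (auto simp: divide_le_eq)
    then show "(1 / (2 * n * C)) ^ (q - 1) <= 1 / (2 * n * C)" by simp
   qed (use R in auto)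
   finally have "\<bar>t\<bar> * C * (ta + n * a) ^ (q - 1) <= \<bar>t\<bar> * C * ((1 / (2 * n * C)) * R ^ (q - 1))"
    using C1 by (intro mult_left_mono) auto
   also have "... = norm y / n / 2" using C1 n unfolding y by simp
   also have "... <= \<bar>y $ k'\<bar> / 2" using k' by simp
   finally show ?thesis by (simp only: n_def)
  qed
  have yk0: "y $ k' ~= 0" using Yge Y0 unfolding Y_def by auto
  define T where "T = r ^ CARD('n) / R ^ q"
  have T: "0 <= T" using r R by (simp add: T_def)
  define P where "P = (%ze. ennreal (norm (packet ta t ep r y ze)))"
  have [measurable]: "P \<in> borel_measurable borel" unfolding P_def using packet_measurable[OF ta(1)] by measurable
  define Ic where "Ic = (%ze :: real^'n. (\<Prod>j\<in>UNIV. indicator {-(a/4)..a/4} (ze $ j)) :: ennreal)"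
  define Im where "Im = (indicator {ze :: real^'n. c4 * R <= norm ze \<and> norm ze <= C' * R} :: _ => ennreal)"
  define Ih where "Ih = (indicator {ze :: real^'n. C' * R <= norm ze} :: _ => ennreal)"
  have [measurable]: "Ic \<in> borel_measurable borel" "Im \<in> borel_measurable borel" "Ih \<in> borel_measurable borel"
   unfolding Ic_def Im_def Ih_def by measurable
  have low: "(\<integral>\<^sup>+ze. Ic ze * P ze \<partial>lborel) <= ennreal (lo_const * (k1 + k2 + k3) * T * r ^ CARD('n))"
  proof -
   have "(\<integral>\<^sup>+ze. Ic ze * P ze \<partial>lborel) <= ennreal (lo_const * r ^ CARD('n) * (1 / Y ^ (CARD('n) - q) + a ^ (CARD('n) - q) * exp (- (lo_rate * r * Y))
    + a ^ CARD('n) / r ^ q * exp (- (a\<^sup>2 / (32 * r\<^sup>2)))))"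
    unfolding Ic_def P_def Y_def using r a by (intro packet_low_sum ta ep ep' Ycond yk0) auto
   also have "... <= ennreal (lo_const * r ^ CARD('n) * (k1 * T + k2 * T + k3 * T))"
   proof (intro ennreal_leI mult_left_mono add_mono)
    \<comment> \<open>\<open>Y\<close> is at least \<open>R / r^2 / n\<close>. With
      \<open>n = 2 q + d\<close> the power equals \<open>r ^ n / R ^ q\<close> times
      \<open>(r / R) ^ d\<close>, up to \<open>k1\<close>; the last factor is at most 1, and
      \<open>d \<ge> 0\<close> is the assumption \<open>n \<ge> m\<close>.\<close>
    have "1 / Y ^ (CARD('n) - q) <= 1 / (R / r\<^sup>2 / n) ^ (CARD('n) - q)"
     using Yge Y0 by (intro divide_left_mono power_mono mult_pos_pos zero_less_power) auto
    also have "... = k1 * ((r\<^sup>2) ^ (q + d) / R ^ (q + d))" unfolding k1_def nd(2) by (simp only: power_divide power_mult_distrib divide_divide_eq_right divide_divide_eq_left times_divide_eq_right mult.commute mult_1_right)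
    also have "... <= k1 * T"
    proof (rule mult_left_mono)
     have "(r\<^sup>2) ^ (q + d) / R ^ (q + d) = r ^ (2 * q + d) / R ^ q * (r / R) ^ d"
      by (simp add: power_add power_mult power_divide power2_eq_square power_mult_distrib mult_ac)
     also have "... <= r ^ (2 * q + d) / R ^ q * 1"
      using r R by (intro mult_left_mono power_le_one) auto
     finally show "(r\<^sup>2) ^ (q + d) / R ^ (q + d) <= T" by (simp add: T_def nd(1))
    qed (rule k)
    finally show "1 / Y ^ (CARD('n) - q) <= k1 * T" .
    have "lo_rate * r * (R / r\<^sup>2 / n) <= lo_rate * r * Y" using Yge lo_rate_pos r by (intro mult_left_mono) auto
    moreover have "lo_rate * r * (R / r\<^sup>2 / n) = l * \<Lambda>" using r by (simp add: l_def \<Lambda>_def power2_eq_square)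
    ultimately have "exp (- (lo_rate * r * Y)) <= exp (- (l * \<Lambda>))" by simp
    also have "... <= k2 / \<Lambda> ^ CARD('n)" unfolding k2_def using l \<Lambda> by (intro exp_neg_le_power) auto
    finally have "a ^ (CARD('n) - q) * exp (- (lo_rate * r * Y)) <= R ^ (CARD('n) - q) * (k2 / \<Lambda> ^ CARD('n))"
     using a c3 R k by (intro mult_mono power_mono) (auto simp: a_def mult_left_le_one_le)
    also have "... = k2 * T" using R r qn by (simp add: \<Lambda>_def T_def power_divide power_diff)
    finally show "a ^ (CARD('n) - q) * exp (- (lo_rate * r * Y)) <= k2 * T" .
    have "exp (- (a\<^sup>2 / (32 * r\<^sup>2))) = exp (- (c3\<^sup>2 / 32 * \<Lambda>\<^sup>2))" by (simp add: a_def \<Lambda>_def power_mult_distrib power_divide)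
    also have "... <= exp (- (c3\<^sup>2 / 32 * \<Lambda>))"
     using \<Lambda> by (simp add: mult_left_mono power2_eq_square)
    also have "... <= k3 / \<Lambda> ^ (CARD('n) + q)" unfolding k3_def using c3 \<Lambda> by (intro exp_neg_le_power) auto
    finally have "a ^ CARD('n) / r ^ q * exp (- (a\<^sup>2 / (32 * r\<^sup>2))) <= R ^ CARD('n) / r ^ q * (k3 / \<Lambda> ^ (CARD('n) + q))"
     using a c3 R r k by (intro mult_mono divide_right_mono power_mono) (auto simp: a_def mult_left_le_one_le)
    also have "... = k3 * T" using R r by (simp add: \<Lambda>_def T_def power_divide power_add)
    finally show "a ^ CARD('n) / r ^ q * exp (- (a\<^sup>2 / (32 * r\<^sup>2))) <= k3 * T" .
   qed (use lo0 r in auto)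
   also have "lo_const * r ^ CARD('n) * (k1 * T + k2 * T + k3 * T) = lo_const * (k1 + k2 + k3) * T * r ^ CARD('n)"
    by (simp add: algebra_simps)
   finally show ?thesis .
  qed
  have midb: "(\<integral>\<^sup>+ze. Im ze * P ze \<partial>lborel) <= ennreal (K2 * T * r ^ CARD('n))"
   using mid(3)[OF ta t ep' ep(2) R(2) r_def, of y] unfolding Im_def P_def T_def by (simp add: mult_ac)
  have highb: "(\<integral>\<^sup>+ze. Ih ze * P ze \<partial>lborel) <= ennreal (K1 * K4 * T * r ^ CARD('n))"
  proof -
   have "(\<integral>\<^sup>+ze. Ih ze * P ze \<partial>lborel) <= ennreal (K1 * r ^ CARD('n) / R ^ q * ((2 * real CARD('n) / c) ^ CARD('n) * r ^ CARD('n)))"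
    unfolding Ih_def P_def
   proof (rule nn_integral_high[OF hi(3) r(1)])
    show "0 <= K1 * r ^ CARD('n) / R ^ q" using hi r R by simp
    show "norm (packet ta t ep r y ze) <= K1 * r ^ CARD('n) / R ^ q * exp (- (c * norm ze / r))" if "C' * R <= norm ze" for ze
     using hi(4)[OF ta t ep' ep(2) R(1) _ r_def that] y by simp
   qed
   then show ?thesis by (simp add: T_def K4_def n_def mult_ac)
  qed
  have "(\<integral>\<^sup>+ze. P ze \<partial>lborel) <= (\<integral>\<^sup>+ze. Ic ze * P ze + (Im ze * P ze + Ih ze * P ze) \<partial>lborel)"
  proof (rule nn_integral_mono)
   fix ze :: "real^'n"
   show "P ze <= Ic ze * P ze + (Im ze * P ze + Ih ze * P ze)"
   proof (cases "\<forall>j. \<bar>ze $ j\<bar> <= a / 4")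
    case True
    then have "\<bar>ze $ j\<bar> <= a / 4" for j by blast
    then have "-(a/4) <= ze $ j \<and> ze $ j <= a / 4" for j by (simp only: abs_le_iff minus_le_iff)
    then have "indicator {-(a/4)..a/4} (ze $ j) = (1 :: ennreal)" for j by simp
    then have "Ic ze = 1" by (simp add: Ic_def)
    then show ?thesis by simp
   next
    case False
    then obtain j where "a / 4 < \<bar>ze $ j\<bar>" by (auto simp: not_le)
    then have "c4 * R <= norm ze" using component_le_norm_cart[of ze j] by (simp add: a_def c4_def)
    then have "Im ze = 1 \<or> Ih ze = 1" unfolding Im_def Ih_def by (cases "norm ze <= C' * R") (auto simp: not_le)
    then show ?thesis by (auto intro: add_increasing add_increasing2)
   qed
  qed
  also have "... = (\<integral>\<^sup>+ze. Ic ze * P ze \<partial>lborel) + ((\<integral>\<^sup>+ze. Im ze * P ze \<partial>lborel) + (\<integral>\<^sup>+ze. Ih ze * P ze \<partial>lborel))"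
   by (subst nn_integral_add, measurable, subst nn_integral_add, measurable)
  also have "... <= ennreal (lo_const * (k1 + k2 + k3) * T * r ^ CARD('n)) + (ennreal (K2 * T * r ^ CARD('n)) + ennreal (K1 * K4 * T * r ^ CARD('n)))"
   by (intro add_mono low midb highb)
  also have "... = ennreal (K * T * r ^ CARD('n))"
  proof -
   have "0 <= lo_const * (k1 + k2 + k3) * T * r ^ CARD('n)" "0 <= K2 * T * r ^ CARD('n)" "0 <= K1 * K4 * T * r ^ CARD('n)"
    using lo0 k T r mid hi K4 by auto
   then show ?thesis by (simp add: ennreal_plus[symmetric] K_def algebra_simps del: ennreal_plus)
  qed
  finally have "norm (Jint ta t ep y) <= K * T"
   unfolding P_def using K T by (intro norm_Jint_le[OF ta(1) ep(1) r(1)]) auto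
  then show "norm (Jint ta t ep y) <= K * ((1 / sqrt (\<bar>t\<bar> * R ^ (q - 2))) ^ CARD('n) / R ^ q)"
   unfolding T_def r_def .
 qed
qed

end

section \<open>Nonvanishing derivatives of the square root along an axis\<close>

lemma Re_real_derivative:
 assumes "(f has_field_derivative f') (at (of_real s))"
 shows "((%s. Re (f (of_real s))) has_real_derivative Re f') (at s)"
proof -
 have "((%x. f (of_real x)) has_vector_derivative f') (at s)"
  using assms by (rule has_vector_derivative_real_field)
 from bounded_linear.has_vector_derivative[OF bounded_linear_Re this] show ?thesis
  by (simp add: has_real_derivative_iff_has_vector_derivative)
qed

context elliptic_symbol
begin

lemma cpoly_iter: "cpoly ((pdif k ^^ j) p)"
 by (induction j) (auto intro: cp cpoly_pdif)

lemma homog_iter: "j <= 2 * q ==> homog (2 * q - j) ((pdif k ^^ j) p)"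
proof (induction j)
 case 0
 then show ?case using hp by simp
next
 case (Suc j)
 then have "2 * q - j = Suc (2 * q - Suc j)" by simp
 with Suc show ?case by (auto intro: homog_pdif[OF cpoly_iter])
qed

text \<open>
  The derivative of order \<open>2 q\<close> along an axis is a constant, and by Maclaurin's formula for the
  principal part along that axis the constant is not zero.
\<close>

lemma top_derivative_nonzero: "(pdif k ^^ (2 * q)) p ta z ~= 0"
proof -
 define h where "h = (pdif k ^^ (2 * q)) p"
 have hc: "cpoly h" unfolding h_def by (rule cpoly_iter)
 have hh: "homog 0 h" unfolding h_def using homog_iter[of "2 * q" k] by simp
 \<comment> \<open>A function homogeneous of degree 0 is constant on rays, and by continuity equal
   to its value at the origin on all of them.\<close>
 have const: "h ta z = h 0 0" for ta z
 proof -
  have "((%s. h (s * ta) (s *\<^sub>R z)) \<longlongrightarrow> h (0 * ta) (0 *\<^sub>R z)) (at 0)"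
  proof -
   have "continuous_on UNIV (%s. h (s * ta) (s *\<^sub>R z))"
    by (intro cpoly_continuous_on[OF hc] continuous_intros)
   then show ?thesis unfolding continuous_on_eq_continuous_at[OF open_UNIV] isCont_def by blast
  qed
  then have "((%s. h (s * ta) (s *\<^sub>R z)) \<longlongrightarrow> h 0 0) (at_right 0)"
   by (simp add: filterlim_at_split)
  moreover have "\<forall>\<^sub>F s in at_right 0. h (s * ta) (s *\<^sub>R z) = h ta z"
   using hh unfolding homog_def by (auto simp: eventually_at_right_field intro!: exI[of _ 1])
  ultimately have "((%s :: real. h ta z) \<longlongrightarrow> h 0 0) (at_right 0)"
   by (rule Lim_transform_eventually)
  then show ?thesis by (simp add: tendsto_const_iff)
 qed
 \<comment> \<open>Positive degree of homogeneity forces the lower derivatives to vanish at the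
   origin, so only the remainder is left in Maclaurin's formula.\<close>
 have zero: "(pdif k ^^ j) p 0 0 = 0" if "j < 2 * q" for j
 proof -
  have "(pdif k ^^ j) p (2 * 0) (2 *\<^sub>R 0) = of_real 2 ^ (2 * q - j) * (pdif k ^^ j) p 0 0"
   using homog_iter[of j k] that unfolding homog_def by (metis less_imp_le zero_less_numeral)
  moreover have "(2 :: complex) ^ (2 * q - j) ~= 1"
  proof -
   have "norm ((2 :: complex) ^ (2 * q - j)) > 1" using that by (simp add: norm_power one_less_power)
   then show ?thesis by auto
  qed
  ultimately show ?thesis by simp
 qed
 define e where "e = (axis k 1 :: real^'n)"
 have "\<exists>s>0. s < 1 \<and> pr 0 (1 *\<^sub>R e) = (\<Sum>j<2 * q. Re ((pdif k ^^ j) p 0 (cvec (0 *\<^sub>R e))) / fact j * 1 ^ j)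
   + Re ((pdif k ^^ (2 * q)) p 0 (cvec (s *\<^sub>R e))) / fact (2 * q) * 1 ^ (2 * q)"
 proof (rule Maclaurin[where diff = "%j s. Re ((pdif k ^^ j) p 0 (cvec (s *\<^sub>R e)))" and f = "%s. pr 0 (s *\<^sub>R e)"])
  show "\<forall>m t. m < 2 * q \<and> 0 <= t \<and> t <= 1 -->
    ((%s. Re ((pdif k ^^ m) p 0 (cvec (s *\<^sub>R e)))) has_real_derivative Re ((pdif k ^^ Suc m) p 0 (cvec (t *\<^sub>R e)))) (at t)"
  proof (intro allI impI)
   fix m t
   have "((%s. Re ((pdif k ^^ m) p 0 (cvec (0 + s *\<^sub>R e)))) has_real_derivative
     (\<Sum>j\<in>UNIV. e $ j * Re (pdif j ((pdif k ^^ m) p) 0 (cvec (0 + t *\<^sub>R e))))) (at t)"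
    by (rule cpoly_real_derivative[OF cpoly_iter])
   then show "((%s. Re ((pdif k ^^ m) p 0 (cvec (s *\<^sub>R e)))) has_real_derivative Re ((pdif k ^^ Suc m) p 0 (cvec (t *\<^sub>R e)))) (at t)"
    unfolding e_def sum_axis_mult by simp
  qed
  show "(%s. Re ((pdif k ^^ 0) p 0 (cvec (s *\<^sub>R e)))) = (%s. pr 0 (s *\<^sub>R e))" by (simp add: pr_def)
 qed (use q2 in auto)
 moreover have "cvec (0 :: real^'n) = 0" by (simp add: vec_eq_iff)
 ultimately obtain s where "pr 0 e = Re (h 0 (cvec (s *\<^sub>R e))) / fact (2 * q)"
  using zero by (auto simp: h_def)
 moreover have "0 < pr 0 e" by (rule pr_pos) (auto simp: e_def norm_axis_1)
 ultimately have "h 0 0 ~= 0" using const[of 0 "cvec (s *\<^sub>R e)"] by auto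
 then show ?thesis using const[of ta z] by (simp add: h_def)
qed

text \<open>Numerators of the derivatives of the square root along axis \<open>k\<close>: the
  derivative of order \<open>l\<close> is \<open>dpoly k l * p powr (1/2 - l)\<close>. The
  coefficient \<open>1/2 - l\<close> arises from differentiating that power.\<close>

primrec dpoly :: "'n => nat => real => complex^'n => complex" where
 "dpoly k 0 = (%ta z. of_real 1)"
| "dpoly k (Suc l) = (%ta z. pdif k (dpoly k l) ta z * p ta z + of_real (1 / 2 - real l) * (dpoly k l ta z * pdif k p ta z))"

lemma cpoly_dpoly: "cpoly (dpoly k l)"
proof (induction l)
 case 0
 show ?case unfolding dpoly.simps by (rule cpoly.const)
next
 case (Suc l)
 show ?case unfolding dpoly.simps
  by (intro cpoly.add cpoly.mult cpoly.const cpoly_pdif Suc cp)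
qed

definition dfi :: "'n => nat => complex^'n => complex" where
 "dfi k l z = dpoly k l 1 z * fi 1 z / p 1 z ^ l"

lemma dfi_0: "dfi k 0 z = fi 1 z"
 by (simp add: dfi_def)

lemma dfi_deriv:
 assumes "0 < Re (p 1 (z + axis k w))"
 shows "((%w. dfi k l (z + axis k w)) has_field_derivative dfi k (Suc l) (z + axis k w)) (at w)"
proof -
 let ?y = "z + axis k w"
 have p0: "p 1 ?y ~= 0" using assms by auto
 have ph: "fi 1 ?y * fi 1 ?y = p 1 ?y" by (simp add: fi_def power2_eq_square[symmetric])
 then have ph0: "fi 1 ?y ~= 0" using p0 by auto
 define Q Q' P P' F where "Q = dpoly k l 1 ?y" "Q' = pdif k (dpoly k l) 1 ?y" "P = p 1 ?y" "P' = pdif k p 1 ?y" "F = fi 1 ?y"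
 have F1: "fi1 k 1 ?y = F * P' / (2 * P)"
  using ph ph0 p0 unfolding fi1_def Q_Q'_P_P'_F_def by (simp add: field_simps)
 have "((%w. dpoly k l 1 (z + axis k w) * fi 1 (z + axis k w) / p 1 (z + axis k w) ^ l) has_field_derivative
   ((Q * (F * P' / (2 * P)) + Q' * F) * P ^ l - (Q * F) * (of_nat l * (P' * P ^ (l - 1)))) / (P ^ l * P ^ l)) (at w)"
 proof -
  have 1: "((%w. dpoly k l 1 (z + axis k w) * fi 1 (z + axis k w)) has_field_derivative (Q * (F * P' / (2 * P)) + Q' * F)) (at w)"
   using DERIV_mult'[OF cpoly_field_derivative[OF cpoly_dpoly[of k l]] fi_field_deriv[OF assms]] unfolding F1 Q_Q'_P_P'_F_def .
  have 2: "((%w. p 1 (z + axis k w) ^ l) has_field_derivative (of_nat l * (P' * P ^ (l - 1)))) (at w)"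
   using DERIV_power[OF cpoly_field_derivative[OF cp, where ta = 1 and z = z and k = k and w = w], of l] unfolding Q_Q'_P_P'_F_def by simp
  show ?thesis
   using DERIV_divide[OF 1 2] p0 unfolding Q_Q'_P_P'_F_def by simp
 qed
 moreover have "((Q * (F * P' / (2 * P)) + Q' * F) * P ^ l - (Q * F) * (of_nat l * (P' * P ^ (l - 1)))) / (P ^ l * P ^ l)
   = dfi k (Suc l) ?y"
 proof -
  have P0: "P ~= 0" using p0 by (simp add: Q_Q'_P_P'_F_def)
  have l: "of_nat l * (P' * P ^ (l - 1)) = of_nat l * P' * P ^ l / P" using P0 by (cases l) auto
  have "dfi k (Suc l) ?y = (Q' * P + (1 / 2 - of_nat l) * (Q * P')) * F / (P * P ^ l)"
   unfolding dfi_def Q_Q'_P_P'_F_def by simp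
  also have "... = ((Q * (F * P' / (2 * P)) + Q' * F) * P ^ l - (Q * F) * (of_nat l * P' * P ^ l / P)) / (P ^ l * P ^ l)"
   using P0 by (simp add: field_simps)
  finally show ?thesis unfolding l by simp
 qed
 ultimately show ?thesis unfolding dfi_def[of k l] by simp
qed

definition Dfi :: "'n => nat => real^'n => real" where
 "Dfi k l et = Re (dfi k l (cvec et))"

lemma Dfi_0: "Dfi k 0 et = fir 1 et"
 by (simp add: Dfi_def dfi_0 fi_cvec)

lemma norm_add_pos1: "0 < 1 + norm (x :: real^'n)"
 by (simp add: add_pos_nonneg)

lemma dfi_cvec: "dfi k l (cvec et) = of_real (Re (dpoly k l 1 (cvec et)) * fir 1 et / pr 1 et ^ l)"
 unfolding dfi_def by (subst cpoly_cvec[OF cpoly_dpoly]) (simp add: fi_cvec p_cvec)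

lemma Dfi_continuous: "continuous_on S (Dfi k l)"
proof -
 have "pr 1 x ~= 0" for x using pr_pos[of 1 x] norm_add_pos1[of x] by force
 then show ?thesis
  unfolding Dfi_def[abs_def] dfi_cvec Re_complex_of_real
  by (intro continuous_intros fir_continuous pr_continuous cpoly_continuous_on[OF cpoly_dpoly]) auto
qed

lemma Dfi_deriv: "((%s. Dfi k l (x + s *\<^sub>R axis k 1)) has_real_derivative Dfi k (Suc l) (x + s *\<^sub>R axis k 1)) (at s)"
proof -
 have "0 < Re (p 1 (cvec x + axis k (of_real s)))"
  unfolding cvec_shift[symmetric] by (rule pos) (auto simp: norm_add_pos1)
 from Re_real_derivative[OF dfi_deriv[OF this]] show ?thesis
  unfolding Dfi_def cvec_shift .
qed

text \<open>By Leibniz's rule the derivative of order \<open>2 * q\<close> of the square of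
  \<open>fi\<close> is a sum of products, each with at least one factor of order between 2 and
  \<open>2 * q\<close>. If all of these vanished at a point, so would the top derivative of
  \<open>p\<close>, which is a nonzero constant.\<close>

lemma Dfi_nondegenerate: "\<exists>l\<in>{2..2 * q}. Dfi k l et ~= 0"
proof (rule ccontr)
 assume "\<not> ?thesis"
 then have zero: "dfi k l (cvec et) = 0" if "l \<in> {2..2 * q}" for l
  using that unfolding Dfi_def dfi_cvec by (metis Re_complex_of_real of_real_0)
 define S where "S = {w. 0 < Re (p 1 (cvec et + axis k w))}"
 have cont: "continuous_on UNIV (%w. p 1 (cvec et + axis k w))"
  using cpoly_field_derivative[OF cp] by (meson DERIV_isCont continuous_at_imp_continuous_on)
 have S: "open S" unfolding S_def
  by (intro open_Collect_less continuous_intros cont)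
 have S0: "0 \<in> S" unfolding S_def using pos[of 1 et] norm_add_pos1[of et] by simp
 define f where "f = (%w. fi 1 (cvec et + axis k w))"
 have hol: "f holomorphic_on S"
  unfolding f_def holomorphic_on_def S_def
  using fi_field_deriv by (meson field_differentiable_at_within field_differentiable_def mem_Collect_eq)
 have iter: "(deriv ^^ l) f w = dfi k l (cvec et + axis k w)" if "w \<in> S" for l w
  using that
 proof (induction l arbitrary: w)
  case 0
  then show ?case by (simp add: f_def dfi_0)
 next
  case (Suc l)
  have "((%w. dfi k l (cvec et + axis k w)) has_field_derivative dfi k (Suc l) (cvec et + axis k w)) (at w)"
   using Suc.prems by (intro dfi_deriv) (simp add: S_def)
  then have "((deriv ^^ l) f has_field_derivative dfi k (Suc l) (cvec et + axis k w)) (at w)"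
   by (rule has_field_derivative_transform_within_open[OF _ S Suc.prems]) (simp add: Suc.IH)
  then show ?case by (simp add: DERIV_imp_deriv)
 qed
 have iterp: "(deriv ^^ l) (%w. p 1 (cvec et + axis k w)) = (%w. (pdif k ^^ l) p 1 (cvec et + axis k w))" for l
 proof (induction l)
  case (Suc l)
  have "deriv (%w. (pdif k ^^ l) p 1 (cvec et + axis k w)) w = (pdif k ^^ Suc l) p 1 (cvec et + axis k w)" for w
   using DERIV_imp_deriv[OF cpoly_field_derivative[OF cpoly_iter[where k = k and j = l], where ta = 1 and z = "cvec et" and k = k and w = w]] by simp
  moreover have "(deriv ^^ Suc l) (%w. p 1 (cvec et + axis k w)) = deriv (%w. (pdif k ^^ l) p 1 (cvec et + axis k w))"
   unfolding Suc[symmetric] by simp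
  ultimately show ?case by (simp only:)
 qed simp
 have "(%w. f w * f w) = (%w. p 1 (cvec et + axis k w))"
  by (simp add: f_def fi_def fun_eq_iff power2_eq_square[symmetric])
 then have "(pdif k ^^ (2 * q)) p 1 (cvec et + axis k 0) = (deriv ^^ (2 * q)) (%w. f w * f w) 0"
  by (simp only: iterp)
 also have "... = (\<Sum>i = 0..2 * q. of_nat (2 * q choose i) * (deriv ^^ i) f 0 * (deriv ^^ (2 * q - i)) f 0)"
  by (rule higher_deriv_mult[OF hol hol S S0])
 also have "... = 0"
 proof (rule sum.neutral, rule ballI)
  fix i assume i: "i \<in> {0..2 * q}"
  show "of_nat (2 * q choose i) * (deriv ^^ i) f 0 * (deriv ^^ (2 * q - i)) f 0 = 0"
  proof (cases "2 <= i")
   case True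
   then show ?thesis using i zero[of i] iter[OF S0, of i] by simp
  next
   case False
   then have "2 * q - i \<in> {2..2 * q}" using q2 by auto
   then show ?thesis using zero[of "2 * q - i"] iter[OF S0, of "2 * q - i"] by simp
  qed
 qed
 finally show False using top_derivative_nonzero by blast
qed

text \<open>The sum of the absolute values over all admissible orders has a positive minimum on the
  ball. Some order, depending on the point, carries its share of it, and uniform continuity
  preserves this up to a distance \<open>de\<close> common to all points.\<close>

lemma Dfi_locally_nondegenerate:
 obtains c de where "0 < c" "c <= 1" "0 < de"
  "\<And>et :: real^'n. norm et <= \<rho> ==> \<exists>l\<in>{2..2 * q}. \<forall>\<xi>. norm \<xi> <= \<rho> --> norm (\<xi> - et) <= de --> c <= \<bar>Dfi k l \<xi>\<bar>"
proof (cases "0 <= \<rho>")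
 case False
 then have "\<not> norm x <= \<rho>" for x :: "real^'n" using norm_ge_zero[of x] by linarith
 then show thesis using that[of 1 1] by auto
next
 case True
 define K where "K = cball (0 :: real^'n) \<rho>"
 have K: "compact K" "K ~= {}" using True by (auto simp: K_def)
 define G where "G = (%et. \<Sum>l\<in>{2..2 * q}. \<bar>Dfi k l et\<bar>)"
 have "continuous_on K G" unfolding G_def by (intro continuous_intros Dfi_continuous)
 from continuous_attains_inf[OF K this] obtain x0 where x0: "x0 \<in> K" "\<And>x. x \<in> K ==> G x0 <= G x" by blast
 obtain l0 where l0: "l0 \<in> {2..2 * q}" "Dfi k l0 x0 ~= 0" using Dfi_nondegenerate by blast
 have "\<bar>Dfi k l0 x0\<bar> <= G x0" unfolding G_def by (rule member_le_sum[OF l0(1)]) auto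
 then have g: "0 < G x0" using l0 by linarith
 define N where "N = real (card {2..2 * q})"
 have N: "0 < N" unfolding N_def using q2 by simp
 define c where "c = min 1 (G x0 / (2 * N))"
 have c: "0 < c" "c <= 1" "c <= G x0 / (2 * N)" using g N by (auto simp: c_def)
 have "\<forall>l. \<exists>d>0. \<forall>x\<in>K. \<forall>y\<in>K. dist y x < d --> dist (Dfi k l y) (Dfi k l x) < c"
  using compact_uniformly_continuous[OF Dfi_continuous K(1)] c(1) unfolding uniformly_continuous_on_def by blast
 then obtain d where d: "\<And>l. 0 < d l" "\<And>l x y. x \<in> K ==> y \<in> K ==> dist y x < d l ==> dist (Dfi k l y) (Dfi k l x) < c"
  by metis
 define de where "de = Min (d ` {2..2 * q}) / 2"
 have ne: "d ` {2..2 * q} ~= {}" using q2 by simp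
 have "0 < Min (d ` {2..2 * q})" using d(1) ne by (subst Min_gr_iff) auto
 then have de: "0 < de" "\<And>l. l \<in> {2..2 * q} ==> de < d l"
 proof -
  assume m: "0 < Min (d ` {2..2 * q})"
  then show "0 < de" by (simp add: de_def)
  fix l assume "l \<in> {2..2 * q}"
  then have "Min (d ` {2..2 * q}) <= d l" by (intro Min_le) auto
  then show "de < d l" using m by (simp add: de_def)
 qed
 show thesis
 proof (rule that[OF c(1,2) de(1)])
  fix et :: "real^'n" assume et: "norm et <= \<rho>"
  have "\<exists>l\<in>{2..2 * q}. G x0 / N <= \<bar>Dfi k l et\<bar>"
  proof (rule ccontr)
   assume "\<not> ?thesis"
   then have "G et < (\<Sum>l\<in>{2..2 * q}. G x0 / N)"
    unfolding G_def using q2 by (intro sum_strict_mono) (auto simp: not_le)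
   also have "... = G x0" using N by (simp add: N_def)
   finally show False using x0(2)[of et] et by (simp add: K_def)
  qed
  then obtain l where l: "l \<in> {2..2 * q}" "G x0 / N <= \<bar>Dfi k l et\<bar>" by blast
  have "c <= \<bar>Dfi k l \<xi>\<bar>" if \<xi>: "norm \<xi> <= \<rho>" "norm (\<xi> - et) <= de" for \<xi>
  proof -
   have "dist (Dfi k l \<xi>) (Dfi k l et) < c"
    using \<xi> et de(2)[OF l(1)] by (intro d(2)) (auto simp: K_def dist_norm)
   moreover have "2 * c <= G x0 / N" using c(3) N by (simp add: field_simps)
   ultimately show ?thesis using l(2) unfolding dist_real_def by linarith
  qed
  then show "\<exists>l\<in>{2..2 * q}. \<forall>\<xi>. norm \<xi> <= \<rho> --> norm (\<xi> - et) <= de --> c <= \<bar>Dfi k l \<xi>\<bar>"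
   using l(1) by blast
 qed
qed

end

section \<open>Decay in time from bounded frequencies\<close>

context elliptic_estimates
begin

definition cube :: "real => (real^'n) set" where
 "cube A = cbox (\<chi> i. - A) (\<chi> i. A)"

lemma mem_cube: "ze \<in> cube A \<longleftrightarrow> (\<forall>j. \<bar>ze $ j\<bar> <= A)"
 by (simp add: cube_def mem_box_cart abs_le_iff minus_le_iff conj_commute)

lemma cube_measurable [measurable]: "cube A \<in> sets borel"
 by (simp add: cube_def)

lemma cube_finite: "emeasure lborel (cube A) = ennreal (measure lborel (cube A))"
 unfolding cube_def by (rule emeasure_eq_ennreal_measure) (simp add: emeasure_lborel_cbox_eq)

lemma inverse_fir_le: "0 < ta ==> 1 / fir ta et <= C / ta ^ q"
proof -
 assume ta: "0 < ta"
 have "1 / fir ta et <= C / (ta + norm et) ^ q"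
  using norm_osc_le[OF ta order_refl, of 0 0 et] norm_osc_cvec[of ta et 0 0 0] ta by (simp add: add_pos_nonneg)
 also have "... <= C / ta ^ q"
  using ta C1 by (intro divide_left_mono power_mono mult_pos_pos zero_less_power) (auto intro: add_pos_nonneg)
 finally show ?thesis .
qed

lemma osc_bounded: "0 < ta ==> 0 <= ep ==> norm (osc ta t ep y (cvec et)) <= C / ta ^ q"
proof -
 assume ta: "0 < ta" and ep: "0 <= ep"
 have N: "0 < ta + norm et" using ta by (simp add: add_pos_nonneg)
 have "norm (osc ta t ep y (cvec et)) = exp (- ep * (norm et)\<^sup>2) / fir ta et"
  by (rule norm_osc_cvec) (use ta N in auto)
 also have "... <= 1 / fir ta et" using fir_pos[of ta et] ta N ep by (intro divide_right_mono) auto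
 finally show ?thesis using inverse_fir_le[OF ta, of et] by simp
qed

text \<open>Along a line the pairing with \<open>y\<close> contributes a constant phase and a linear
  one, neither visible to derivatives of order at least 2; hence the constant depends on neither
  \<open>y\<close> nor the line. The damping factor and the denominator form an amplitude with
  bounded derivative.\<close>

lemma osc_line_integral:
 assumes A: "0 < A"
 obtains K where "0 < K"
  "\<And>t ep (y :: real^'n) v a. 1 <= \<bar>t\<bar> ==> 0 <= ep ==> ep <= 1 ==>
    (\<And>s. s \<in> {a..a + 2 * A} ==> norm (v + s *\<^sub>R axis k 1) <= \<rho>) ==>
    norm (integral {a..a + 2 * A} (%s. osc 1 t ep y (cvec (v + s *\<^sub>R axis k 1)))) <= K * \<bar>t\<bar> powr (- (1 / real (2 * q)))"
proof -
 obtain c de where nd: "0 < c" "c <= 1" "0 < de"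
  "\<And>et :: real^'n. norm et <= \<rho> ==> \<exists>l\<in>{2..2 * q}. \<forall>\<xi>. norm \<xi> <= \<rho> --> norm (\<xi> - et) <= de --> c <= \<bar>Dfi k l \<xi>\<bar>"
  by (rule Dfi_locally_nondegenerate[where \<rho> = \<rho> and k = k]) blast
 have "bounded (Dfi k 1 ` cball 0 \<rho>)"
  by (intro compact_imp_bounded compact_continuous_image Dfi_continuous) auto
 then obtain M1 where M1: "0 < M1" "\<And>x. norm x <= \<rho> ==> \<bar>Dfi k 1 x\<bar> <= M1"
  unfolding bounded_pos by auto
 define V where "V = (\<Sum>l\<le>2 * q. vdc_const l) / c"
 have V: "0 < V" unfolding V_def using vdc_const_pos nd by (intro divide_pos_pos sum_pos) auto
 \<comment> \<open>Bounds the amplitude by \<open>C\<close> and its derivative by the bracket: the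
   first term comes from the damping factor, the second from the derivative of the
   denominator.\<close>
 define B where "B = C + (2 * \<bar>\<rho>\<bar> * C + M1 * (C * C))"
 have B: "0 < B" unfolding B_def using C1 M1 by (intro add_pos_nonneg add_nonneg_nonneg mult_nonneg_nonneg) auto
 define K where "K = V * (2 * A / de + 1) * B * (1 + 2 * A)"
 have K: "0 < K" unfolding K_def using V B A nd by (intro mult_pos_pos add_pos_pos divide_pos_pos) auto
 show thesis
 proof (rule that[OF K])
  fix t ep a :: real and y v :: "real^'n"
  assume t: "1 <= \<bar>t\<bar>" and ep: "0 <= ep" "ep <= 1" and \<rho>: "\<And>s. s \<in> {a..a + 2 * A} ==> norm (v + s *\<^sub>R axis k 1) <= \<rho>"
  define e where "e = (axis k 1 :: real^'n)"
  have ee: "e \<bullet> e = 1" "v \<bullet> e = v $ k" "y \<bullet> e = y $ k" by (simp_all add: e_def inner_axis inner_axis_axis)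
  define D where "D = (%l s. Dfi k l (v + s *\<^sub>R e))"
  have D: "(D l has_real_derivative D (Suc l) s) (at s)" for l s unfolding D_def e_def by (rule Dfi_deriv)
  have Dc: "continuous_on S (D l)" for S l by (meson D DERIV_isCont continuous_at_imp_continuous_on)
  define N where "N = (%s. v \<bullet> v + 2 * s * (v $ k) + s * s)"
  have N: "(norm (v + s *\<^sub>R e))\<^sup>2 = N s" for s
   unfolding N_def power2_norm_eq_inner by (simp add: inner_add inner_commute[of e v] ee algebra_simps)
  define E where "E = (%s. exp (- ep * N s))"
  have E1: "0 < E s" "E s <= 1" for s
   using ep N[of s] zero_le_power2[of "norm (v + s *\<^sub>R e)"] by (auto simp: E_def simp del: zero_le_power2)
  have D0: "0 < D 0 s" "1 / D 0 s <= C" for s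
   unfolding D_def Dfi_0 using fir_pos[of 1 "v + s *\<^sub>R e"] inverse_fir_le[of 1 "v + s *\<^sub>R e"] norm_add_pos1[of "v + s *\<^sub>R e"] by auto
  define Am Am' where "Am = (%s. E s / D 0 s)"
   and "Am' = (%s. - (ep * (2 * (v $ k + s))) * E s / D 0 s - E s * D 1 s / (D 0 s * D 0 s))"
  have Am: "(Am has_real_derivative Am' s) (at s within S)" for s S
  proof (rule has_field_derivative_at_within)
   have N': "(N has_real_derivative 2 * (v $ k + s)) (at s)"
    unfolding N_def by (auto intro!: derivative_eq_intros)
   have E': "(E has_real_derivative E s * (- ep * (2 * (v $ k + s)))) (at s)"
    unfolding E_def by (rule DERIV_fun_exp[OF DERIV_cmult[OF N']])
   have "(Am has_real_derivative (E s * (- ep * (2 * (v $ k + s))) * D 0 s - E s * D (Suc 0) s) / (D 0 s * D 0 s)) (at s)"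
    unfolding Am_def using D0[of s] by (intro DERIV_divide E' D) auto
   moreover have "(E s * (- ep * (2 * (v $ k + s))) * D 0 s - E s * D (Suc 0) s) / (D 0 s * D 0 s) = Am' s"
    unfolding Am'_def using D0(1)[of s] by (simp add: field_simps)
   ultimately show "(Am has_real_derivative Am' s) (at s)" by simp
  qed
  have Am'c: "continuous_on S Am'" for S
   unfolding Am'_def E_def N_def using D0(1) by (intro continuous_intros Dc) (metis less_irrefl no_zero_divisors)+
  define f where "f = (%s. cis (y \<bullet> v) * cis (t * D 0 s + (y $ k) * s))"
  have osc: "osc 1 t ep y (cvec (v + s *\<^sub>R axis k 1)) = of_real (Am s) * f s" for s
  proof -
   have "osc 1 t ep y (cvec (v + s *\<^sub>R e)) = of_real (Am s) * cis (y \<bullet> (v + s *\<^sub>R e) + t * D 0 s)"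
    unfolding Am_def E_def D_def Dfi_0 N[symmetric] by (rule osc_cvec) simp
   also have "y \<bullet> (v + s *\<^sub>R e) + t * D 0 s = y \<bullet> v + (t * D 0 s + (y $ k) * s)" by (simp add: inner_add_right ee)
   finally show ?thesis unfolding f_def e_def cis_mult .
  qed
  have "norm (integral {a..a + 2 * A} (%s. of_real (Am s) * f s))
   <= V * \<bar>t\<bar> powr (- (1 / real (2 * q))) * (2 * A / de + 1) * B * (1 + (a + 2 * A - a))"
  proof (rule norm_integral_amplitude[where A' = Am'])
   show "continuous_on {a..a + 2 * A} f" unfolding f_def by (intro continuous_intros Dc)
   fix s assume s: "s \<in> {a..a + 2 * A}"
   have \<rho>0: "0 <= \<rho>" using order_trans[OF norm_ge_zero \<rho>[OF s]] .
   have Ams: "\<bar>Am s\<bar> <= C"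
   proof -
    have "\<bar>Am s\<bar> = E s * (1 / D 0 s)" unfolding Am_def using E1[of s] D0[of s] by simp
    also have "... <= 1 * C" using E1[of s] D0[of s] by (intro mult_mono) auto
    finally show ?thesis by simp
   qed
   have CB: "C <= B" unfolding B_def using C1 M1 by simp
   show "\<bar>Am s\<bar> <= B" using Ams CB by linarith
   have "\<bar>v $ k + s\<bar> <= \<rho>"
   proof -
    have "\<bar>(v + s *\<^sub>R e) $ k\<bar> <= \<rho>" using order_trans[OF component_le_norm_cart \<rho>[OF s]] unfolding e_def .
    then show ?thesis by (simp add: e_def)
   qed
   then have "ep * (2 * \<bar>v $ k + s\<bar>) <= 1 * (2 * \<bar>\<rho>\<bar>)" using ep by (intro mult_mono) auto
   then have k2: "\<bar>ep * (2 * (v $ k + s))\<bar> <= 2 * \<bar>\<rho>\<bar>" using ep unfolding abs_mult by simp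
   have "Am' s = - (ep * (2 * (v $ k + s))) * Am s - D 1 s * (Am s * (1 / D 0 s))"
    unfolding Am'_def Am_def by simp
   also have "\<bar>...\<bar> <= \<bar>ep * (2 * (v $ k + s))\<bar> * \<bar>Am s\<bar> + \<bar>D 1 s\<bar> * (\<bar>Am s\<bar> * \<bar>1 / D 0 s\<bar>)"
    unfolding abs_mult[symmetric] by (rule order_trans[OF abs_triangle_ineq4]) (simp add: abs_mult)
   also have "... <= 2 * \<bar>\<rho>\<bar> * C + M1 * (C * C)"
    using k2 Ams M1(2)[OF \<rho>[OF s]] D0[of s] C1 M1(1) unfolding D_def e_def
    by (intro add_mono mult_mono) auto
   finally show "\<bar>Am' s\<bar> <= B" unfolding B_def using C1 by linarith
   have "norm (integral {a..s} f) = norm (integral {a..s} (%s. cis (t * D 0 s + (y $ k) * s)))"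
    unfolding f_def by (simp add: norm_mult)
   also have "... <= (\<Sum>l\<le>2 * q. vdc_const l) / c * \<bar>t\<bar> powr (- (1 / real (2 * q))) * ((s - a) / de + 1)"
   proof (rule van_der_Corput_local[where D = D])
    fix x assume x: "x \<in> {a..s}"
    then obtain l where l: "l \<in> {2..2 * q}" "\<And>\<xi>. norm \<xi> <= \<rho> ==> norm (\<xi> - (v + x *\<^sub>R e)) <= de ==> c <= \<bar>Dfi k l \<xi>\<bar>"
     using nd(4)[OF \<rho>[of x]] s unfolding e_def by auto
    have "c <= \<bar>D l z\<bar>" if "z \<in> {a..s}" "\<bar>z - x\<bar> <= de" for z
    proof -
     have "norm (v + z *\<^sub>R e - (v + x *\<^sub>R e)) = \<bar>z - x\<bar>"
      unfolding e_def by (simp add: scaleR_diff_left[symmetric] norm_axis_1)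
     then show ?thesis unfolding D_def using l(2)[of "v + z *\<^sub>R e"] \<rho>[of z] that s unfolding e_def by auto
    qed
    then show "\<exists>l\<in>{2..2 * q}. \<forall>z\<in>{a..s}. \<bar>z - x\<bar> <= de --> c <= \<bar>D l z\<bar>" using l(1) by blast
   qed (use s t nd(1-3) D in auto)
   also have "... <= V * \<bar>t\<bar> powr (- (1 / real (2 * q))) * (2 * A / de + 1)"
    unfolding V_def[symmetric] using s V nd by (intro mult_left_mono add_right_mono divide_right_mono) auto
   finally show "norm (integral {a..s} f) <= V * \<bar>t\<bar> powr (- (1 / real (2 * q))) * (2 * A / de + 1)" .
  qed (use A Am Am'c in auto)
  then show "norm (integral {a..a + 2 * A} (%s. osc 1 t ep y (cvec (v + s *\<^sub>R axis k 1)))) <= K * \<bar>t\<bar> powr (- (1 / real (2 * q)))"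
   unfolding osc K_def by (simp add: mult_ac)
 qed
qed

lemma osc_continuous:
 assumes "0 < ta"
 shows "continuous_on S g ==> continuous_on S (%x. osc ta t ep y (cvec (g x)))"
proof -
 have "fir ta x ~= 0" for x using fir_pos[of ta x] assms by (simp add: add_pos_nonneg)
 then show "continuous_on S g ==> continuous_on S (%x. osc ta t ep y (cvec (g x)))"
  using assms unfolding osc_cvec[OF less_imp_le[OF assms]] by (intro continuous_intros fir_continuous) auto
qed

text \<open>Uniformity in the translation \<open>u\<close> prepares for averaging over a Gaussian;
  the radius \<open>\<rho>\<close> is that of a ball around the cube, enlarged by 1.\<close>

lemma osc_cube_integral:
 assumes A: "0 < A"
 obtains K where "0 < K"
  "\<And>t ep (y :: real^'n) u. 1 <= \<bar>t\<bar> ==> 0 <= ep ==> ep <= 1 ==> norm u <= 1 ==>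
    norm (\<integral>ze. indicator (cube A) ze *\<^sub>R osc 1 t ep y (cvec (ze + u)) \<partial>lborel) <= K * \<bar>t\<bar> powr (- (1 / real (2 * q)))"
proof -
 define k :: 'n where "k = undefined"
 define \<rho> where "\<rho> = real CARD('n) * A + 1"
 obtain K where K: "0 < K"
  "\<And>t ep (y :: real^'n) v a. 1 <= \<bar>t\<bar> ==> 0 <= ep ==> ep <= 1 ==>
    (\<And>s. s \<in> {a..a + 2 * A} ==> norm (v + s *\<^sub>R axis k 1) <= \<rho>) ==>
    norm (integral {a..a + 2 * A} (%s. osc 1 t ep y (cvec (v + s *\<^sub>R axis k 1)))) <= K * \<bar>t\<bar> powr (- (1 / real (2 * q)))"
  by (rule osc_line_integral[OF A, of k \<rho>]) blast
 define V where "V = measure lborel (cube A)"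
 show thesis
 proof (rule that[of "K / (2 * A) * V + K"])
  show "0 < K / (2 * A) * V + K" using K A by (intro add_nonneg_pos mult_nonneg_nonneg) (auto simp: V_def)
  fix t ep :: real and y u :: "real^'n"
  assume t: "1 <= \<bar>t\<bar>" and ep: "0 <= ep" "ep <= 1" and u: "norm u <= 1"
  define L where "L = \<bar>t\<bar> powr (- (1 / real (2 * q)))"
  have L: "0 <= L" by (simp add: L_def)
  define F where "F = (%ze :: real^'n. indicator (cube A) ze *\<^sub>R osc 1 t ep y (cvec (ze + u)))"
  \<comment> \<open>The bound \<open>K * L\<close> for a line segment of length \<open>2 * A\<close>
    is spread evenly over it, which produces a majorant on the cube.\<close>
  have "ennreal (norm (\<integral>ze. F ze \<partial>lborel)) <= (\<integral>\<^sup>+ze. ennreal (K * L / (2 * A)) * indicator (cube A) ze \<partial>lborel)"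
  proof (rule line_domination)
   show "integrable lborel F" unfolding F_def cube_def
    by (intro borel_integrable_compact compact_cbox osc_continuous continuous_intros) simp
   show "axis k 1 \<in> (Basis :: (real^'n) set)" unfolding Basis_vec_axis by blast
   fix x :: "real^'n"
   let ?e = "axis k 1 :: real^'n"
   define a where "a = - A - x $ k"
   have nth: "(x + s *\<^sub>R ?e) $ j = (if j = k then x $ k + s else x $ j)" for s j by (simp add: axis_def)
   show "ennreal (norm (\<integral>s. F (x + s *\<^sub>R ?e) \<partial>lborel)) <= (\<integral>\<^sup>+s. ennreal (K * L / (2 * A)) * indicator (cube A) (x + s *\<^sub>R ?e) \<partial>lborel)"
   proof (cases "\<forall>j. j ~= k --> \<bar>x $ j\<bar> <= A")
    case False
    then have "x + s *\<^sub>R ?e \<notin> cube A" for s unfolding mem_cube nth by (auto split: if_splits)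
    then show ?thesis by (simp add: F_def)
   next
    case True
    have mem: "x + s *\<^sub>R ?e \<in> cube A \<longleftrightarrow> s \<in> {a..a + 2 * A}" for s
    proof -
     have "x + s *\<^sub>R ?e \<in> cube A \<longleftrightarrow> \<bar>x $ k + s\<bar> <= A" unfolding mem_cube nth using True by auto
     then show ?thesis unfolding a_def by auto
    qed
    have ind: "indicator (cube A) (x + s *\<^sub>R ?e) = (indicator {a..a + 2 * A} s :: real)"
     "indicator (cube A) (x + s *\<^sub>R ?e) = (indicator {a..a + 2 * A} s :: ennreal)" for s
     using mem[of s] by (auto simp: indicator_def)
    have "(\<integral>s. F (x + s *\<^sub>R ?e) \<partial>lborel) = set_lebesgue_integral lborel {a..a + 2 * A} (%s. osc 1 t ep y (cvec (x + u + s *\<^sub>R ?e)))"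
     unfolding F_def set_lebesgue_integral_def ind by (simp add: add_ac)
    also have "... = integral {a..a + 2 * A} (%s. osc 1 t ep y (cvec (x + u + s *\<^sub>R ?e)))"
     by (intro set_borel_integral_eq_integral borel_integrable_atLeastAtMost' osc_continuous continuous_intros) simp
    also have "norm ... <= K * L" unfolding L_def
    proof (rule K(2)[OF t ep])
     fix s assume "s \<in> {a..a + 2 * A}"
     then have "x + s *\<^sub>R ?e \<in> cube A" using mem by blast
     then have "\<bar>(x + s *\<^sub>R ?e) $ j\<bar> <= A" for j unfolding mem_cube by blast
     then have "norm (x + s *\<^sub>R ?e) <= real CARD('n) * A" by (rule norm_le_card_bound)
     then have "norm (x + s *\<^sub>R ?e) + norm u <= \<rho>" using u unfolding \<rho>_def by linarith
     then have "norm ((x + s *\<^sub>R ?e) + u) <= \<rho>" by (rule norm_triangle_le)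
     then show "norm (x + u + s *\<^sub>R ?e) <= \<rho>" by (simp add: add_ac)
    qed
    finally have "ennreal (norm (\<integral>s. F (x + s *\<^sub>R ?e) \<partial>lborel)) <= ennreal (K * L)" by (rule ennreal_leI)
    also have "... = ennreal (K * L / (2 * A)) * ennreal (2 * A)"
     using A K L by (subst ennreal_mult[symmetric]) auto
    also have "... = (\<integral>\<^sup>+s. ennreal (K * L / (2 * A)) * indicator {a..a + 2 * A} s \<partial>lborel)"
     using A by (subst nn_integral_cmult_indicator) auto
    finally show ?thesis unfolding ind .
   qed
  qed measurable
  also have "... = ennreal (K * L / (2 * A) * V)"
   unfolding V_def using A K L by (subst nn_integral_cmult_indicator) (auto simp: cube_finite ennreal_mult[symmetric])
  finally have "norm (\<integral>ze. F ze \<partial>lborel) <= K * L / (2 * A) * V"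
   using A K L by (subst (asm) ennreal_le_iff) (auto simp: V_def)
  also have "... <= (K / (2 * A) * V + K) * L" using K L by (simp add: algebra_simps)
  finally show "norm (\<integral>ze. indicator (cube A) ze *\<^sub>R osc 1 t ep y (cvec (ze + u)) \<partial>lborel)
    <= (K / (2 * A) * V + K) * \<bar>t\<bar> powr (- (1 / real (2 * q)))" unfolding F_def L_def .
 qed
qed

end

context elliptic_estimates
begin

lemma packet_shift:
 assumes "0 < ta"
 shows "packet ta t ep r y ze = (\<integral>u. osc ta t ep y (cvec (ze + u)) * of_real (exp (- ((norm u)\<^sup>2 / r\<^sup>2))) \<partial>lborel)"
proof -
 have m: "(%et. osc ta t ep y (cvec et) * gauss r ze (cvec et)) \<in> borel_measurable borel"
  using osc_measurable[OF assms, of t ep y] unfolding gauss_cvec by measurable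
 show ?thesis
  using integral_lborel_shift[OF m, of ze] unfolding packet_def gauss_cvec by (simp add: add.commute)
qed

text \<open>A packet is an average of translates of the integrand, so the sharp cut-off can be
  applied to the centres. Translations of length at most 1 are covered by the cube estimate. For
  longer ones the Gaussian tail gives a factor \<open>r^2 \<le> 1 / \<bar>t\<bar>\<close>, which is
  better than required.\<close>

lemma cube_packet_integral:
 assumes A: "0 < A"
 obtains K where "0 < K"
  "\<And>t ep r (y :: real^'n). 1 <= \<bar>t\<bar> ==> 0 <= ep ==> ep <= 1 ==> 0 < r ==> r\<^sup>2 <= 1 / \<bar>t\<bar> ==>
    norm (\<integral>ze. indicator (cube A) ze *\<^sub>R packet 1 t ep r y ze \<partial>lborel) <= K * \<bar>t\<bar> powr (- (1 / real (2 * q))) * r ^ CARD('n)"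
proof -
 obtain K0 where K0: "0 < K0"
  "\<And>t ep (y :: real^'n) u. 1 <= \<bar>t\<bar> ==> 0 <= ep ==> ep <= 1 ==> norm u <= 1 ==>
    norm (\<integral>ze. indicator (cube A) ze *\<^sub>R osc 1 t ep y (cvec (ze + u)) \<partial>lborel) <= K0 * \<bar>t\<bar> powr (- (1 / real (2 * q)))"
  by (rule osc_cube_integral[OF A]) blast
 define V where "V = measure lborel (cube A)"
 define k1 k2 where "k1 = sqrt pi ^ CARD('n)" and "k2 = (sqrt pi * sqrt 2) ^ CARD('n)"
 have k: "0 <= V" "0 < k1" "0 <= k2" by (auto simp: V_def k1_def k2_def)
 define K where "K = K0 * k1 + C * V * 2 * k2"
 show thesis
 proof (rule that[of K])
  show "0 < K" unfolding K_def using K0 k C1 by (intro add_pos_nonneg mult_pos_pos mult_nonneg_nonneg) auto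
  fix t ep r :: real and y :: "real^'n"
  assume t: "1 <= \<bar>t\<bar>" and ep: "0 <= ep" "ep <= 1" and r: "0 < r" "r\<^sup>2 <= 1 / \<bar>t\<bar>"
  define L where "L = \<bar>t\<bar> powr (- (1 / real (2 * q)))"
  have L: "0 <= L" "r\<^sup>2 <= L"
  proof -
   show "0 <= L" by (simp add: L_def)
   have "1 / \<bar>t\<bar> = \<bar>t\<bar> powr (- 1)" using t by (simp add: powr_minus_divide)
   also have "... <= L" unfolding L_def using t q2 by (intro powr_mono) auto
   finally show "r\<^sup>2 <= L" using r by linarith
  qed
  define E where "E = (%u :: real^'n. exp (- ((norm u)\<^sup>2 / r\<^sup>2)))"
  have [measurable]: "E \<in> borel_measurable borel" unfolding E_def by measurable
  have [measurable]: "(%et. osc 1 t ep y (cvec et)) \<in> borel_measurable borel" by (rule osc_measurable) simp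
  define f where "f = (%ze u. indicator (cube A) ze *\<^sub>R (osc 1 t ep y (cvec (ze + u)) * of_real (E u)))"
  have fm: "(%(ze, u). f ze u) \<in> borel_measurable (borel \<Otimes>\<^sub>M borel)" unfolding f_def split_beta' by measurable
  have osc1: "norm (osc 1 t ep y (cvec et)) <= C" for et using osc_bounded[of 1 ep t y et] ep by simp
  have gE: "(\<integral>\<^sup>+u. ennreal (exp (- ((norm (u :: real^'n))\<^sup>2 / a\<^sup>2))) \<partial>lborel) = ennreal ((sqrt pi * a) ^ CARD('n))" if "0 < a" for a
   using nn_integral_gaussian_vec[OF that, of "0 :: real^'n"] by simp
  have int: "integrable (lborel \<Otimes>\<^sub>M lborel) (%(ze, u). f ze u)"
  proof (rule integrableI_bounded)
   show m: "(%(ze, u). f ze u) \<in> borel_measurable (lborel \<Otimes>\<^sub>M lborel)" using fm by simp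
   have "(\<integral>\<^sup>+x. norm (case x of (ze, u) => f ze u) \<partial>(lborel \<Otimes>\<^sub>M lborel)) = (\<integral>\<^sup>+ze. \<integral>\<^sup>+u. norm (f ze u) \<partial>lborel \<partial>lborel)"
    using m by (subst lborel.nn_integral_fst[symmetric]) auto
   also have "... <= (\<integral>\<^sup>+ze. ennreal (C * (sqrt pi * r) ^ CARD('n)) * indicator (cube A) ze \<partial>lborel)"
   proof (rule nn_integral_mono)
    fix ze :: "real^'n"
    have "(\<integral>\<^sup>+u. norm (f ze u) \<partial>lborel) <= (\<integral>\<^sup>+u. (ennreal C * indicator (cube A) ze) * ennreal (E u) \<partial>lborel)"
    proof (rule nn_integral_mono)
     fix u
     show "ennreal (norm (f ze u)) <= (ennreal C * indicator (cube A) ze) * ennreal (E u)"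
      using C1 osc1[of "ze + u"] by (cases "ze \<in> cube A")
       (auto simp: f_def norm_mult ennreal_mult[symmetric] E_def intro!: ennreal_leI mult_right_mono)
    qed
    also have "... = (ennreal C * indicator (cube A) ze) * ennreal ((sqrt pi * r) ^ CARD('n))"
     unfolding gE[OF r(1), symmetric] E_def by (rule nn_integral_cmult) measurable
    finally show "(\<integral>\<^sup>+u. norm (f ze u) \<partial>lborel) <= ennreal (C * (sqrt pi * r) ^ CARD('n)) * indicator (cube A) ze"
     using C1 r by (simp add: ennreal_mult mult_ac)
   qed
   also have "... < \<infinity>" by (subst nn_integral_cmult_indicator) (auto simp: cube_finite ennreal_mult_less_top)
   finally show "(\<integral>\<^sup>+x. norm (case x of (ze, u) => f ze u) \<partial>(lborel \<Otimes>\<^sub>M lborel)) < \<infinity>" .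
  qed
  define H where "H = (%u. \<integral>ze. indicator (cube A) ze *\<^sub>R osc 1 t ep y (cvec (ze + u)) \<partial>lborel)"
  have "(\<integral>ze. indicator (cube A) ze *\<^sub>R packet 1 t ep r y ze \<partial>lborel) = (\<integral>ze. \<integral>u. f ze u \<partial>lborel \<partial>lborel)"
   unfolding f_def E_def by (simp add: packet_shift)
  also have "... = (\<integral>u. \<integral>ze. f ze u \<partial>lborel \<partial>lborel)" using lborel_pair.Fubini_integral[OF int] by simp
  also have "... = (\<integral>u. H u * of_real (E u) \<partial>lborel)"
   unfolding f_def H_def mult_scaleR_left[symmetric] by (simp only: integral_mult_left_zero)
  finally have eq: "(\<integral>ze. indicator (cube A) ze *\<^sub>R packet 1 t ep r y ze \<partial>lborel) = (\<integral>u. H u * of_real (E u) \<partial>lborel)" .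
  have Hint: "integrable lborel (%u. H u * of_real (E u))"
  proof -
   have "integrable lborel (%u. \<integral>ze. f ze u \<partial>lborel)" using lborel_pair.integrable_snd[OF int] by simp
   then show ?thesis unfolding f_def H_def mult_scaleR_left[symmetric] by (simp only: integral_mult_left_zero)
  qed
  have HE: "norm (H u * of_real (E u)) <= K0 * L * E u + C * V * 2 * r\<^sup>2 * exp (- ((norm u)\<^sup>2 / (sqrt 2 * r)\<^sup>2))" for u
  proof (cases "norm u <= 1")
   case True
   then have "norm (H u) <= K0 * L" unfolding H_def L_def by (rule K0(2)[OF t ep])
   then have "norm (H u * of_real (E u)) <= K0 * L * E u"
    unfolding norm_mult using K0(1) L(1) by (intro mult_mono) (auto simp: E_def)
   moreover have "0 <= C * V * 2 * r\<^sup>2 * exp (- ((norm u)\<^sup>2 / (sqrt 2 * r)\<^sup>2))" using C1 k by simp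
   ultimately show ?thesis by linarith
  next
   case False
   have "norm (H u) <= (\<integral>ze. C * indicator (cube A) ze \<partial>lborel)"
    unfolding H_def
   proof (rule integral_norm_bound[THEN order_trans], rule integral_mono')
    show "integrable lborel (%ze. C * indicator (cube A) ze :: real)"
     by (intro integrable_mult_right integrable_real_indicator) (auto simp: cube_finite)
   qed (use osc1 C1 in \<open>auto simp: indicator_def\<close>)
   also have "... = C * V" by (simp add: V_def)
   finally have HV: "norm (H u) <= C * V" .
   \<comment> \<open>Half of the Gaussian exponent. For \<open>norm u > 1\<close> it exceeds
     \<open>1 / (2 * r^2)\<close>, whence \<open>exp (- w) \<le> 1 / w \<le> 2 * r^2\<close>; the
     other half remains integrable.\<close>
   define w where "w = (norm u)\<^sup>2 / (2 * r\<^sup>2)"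
   have "1 <= (norm u)\<^sup>2" using False by simp
   then have w: "1 / (2 * r\<^sup>2) <= w" unfolding w_def using r by (intro divide_right_mono) auto
   then have "0 < w" using r by (intro order.strict_trans2[OF _ w]) simp
   have "E u = exp (- w) * exp (- ((norm u)\<^sup>2 / (sqrt 2 * r)\<^sup>2))"
    unfolding E_def w_def exp_add[symmetric] using r by (simp add: power_mult_distrib field_simps)
   moreover have "exp (- w) <= 2 * r\<^sup>2"
   proof -
    have "exp (- w) = 1 / exp w" by (simp add: exp_minus inverse_eq_divide)
    also have "... <= 1 / w" using \<open>0 < w\<close> order_trans[OF _ exp_ge_add_one_self[of w], of w] by (intro divide_left_mono) auto
    also have "... <= 1 / (1 / (2 * r\<^sup>2))" using w r \<open>0 < w\<close> by (intro divide_left_mono) auto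
    finally show ?thesis by simp
   qed
   ultimately have Eu: "E u <= 2 * r\<^sup>2 * exp (- ((norm u)\<^sup>2 / (sqrt 2 * r)\<^sup>2))" by (simp add: mult_right_mono)
   have "norm (H u * of_real (E u)) = norm (H u) * E u" by (simp add: norm_mult E_def)
   also have "... <= C * V * (2 * r\<^sup>2 * exp (- ((norm u)\<^sup>2 / (sqrt 2 * r)\<^sup>2)))"
    using HV Eu C1 k by (intro mult_mono) (auto simp: E_def)
   finally have "norm (H u * of_real (E u)) <= C * V * 2 * r\<^sup>2 * exp (- ((norm u)\<^sup>2 / (sqrt 2 * r)\<^sup>2))" by (simp only: mult.assoc)
   moreover have "0 <= K0 * L * E u" using K0 L by (simp add: E_def)
   ultimately show ?thesis by linarith
  qed
  have "ennreal (norm (\<integral>u. H u * of_real (E u) \<partial>lborel)) <= (\<integral>\<^sup>+u. norm (H u * of_real (E u)) \<partial>lborel)"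
   by (rule integral_norm_bound_ennreal[OF Hint])
  also have "... <= (\<integral>\<^sup>+u. ennreal (K0 * L) * ennreal (E u) + ennreal (C * V * 2 * r\<^sup>2) * ennreal (exp (- ((norm u)\<^sup>2 / (sqrt 2 * r)\<^sup>2))) \<partial>lborel)"
   using HE K0 L C1 k r by (intro nn_integral_mono) (auto simp: ennreal_mult[symmetric] ennreal_plus[symmetric] E_def simp del: ennreal_plus intro!: ennreal_leI)
  also have "... = (\<integral>\<^sup>+u. ennreal (K0 * L) * ennreal (E u) \<partial>lborel) + (\<integral>\<^sup>+u. ennreal (C * V * 2 * r\<^sup>2) * ennreal (exp (- ((norm (u :: real^'n))\<^sup>2 / (sqrt 2 * r)\<^sup>2))) \<partial>lborel)"
   by (rule nn_integral_add) measurable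
  also have "(\<integral>\<^sup>+u. ennreal (K0 * L) * ennreal (E u) \<partial>lborel) = ennreal (K0 * L) * (\<integral>\<^sup>+u. ennreal (E u) \<partial>lborel)"
   by (rule nn_integral_cmult) measurable
  also have "(\<integral>\<^sup>+u. ennreal (C * V * 2 * r\<^sup>2) * ennreal (exp (- ((norm (u :: real^'n))\<^sup>2 / (sqrt 2 * r)\<^sup>2))) \<partial>lborel)
    = ennreal (C * V * 2 * r\<^sup>2) * (\<integral>\<^sup>+u. ennreal (exp (- ((norm (u :: real^'n))\<^sup>2 / (sqrt 2 * r)\<^sup>2))) \<partial>lborel)"
   by (rule nn_integral_cmult) measurable
  also have "(\<integral>\<^sup>+u. ennreal (E u) \<partial>lborel) = ennreal ((sqrt pi * r) ^ CARD('n))" unfolding E_def by (rule gE[OF r(1)])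
  also have "(\<integral>\<^sup>+u. ennreal (exp (- ((norm (u :: real^'n))\<^sup>2 / (sqrt 2 * r)\<^sup>2))) \<partial>lborel) = ennreal ((sqrt pi * (sqrt 2 * r)) ^ CARD('n))"
   using r by (intro gE) simp
  also have "ennreal (K0 * L) * ennreal ((sqrt pi * r) ^ CARD('n)) + ennreal (C * V * 2 * r\<^sup>2) * ennreal ((sqrt pi * (sqrt 2 * r)) ^ CARD('n))
    = ennreal (K0 * L * (sqrt pi * r) ^ CARD('n) + C * V * 2 * r\<^sup>2 * (sqrt pi * (sqrt 2 * r)) ^ CARD('n))"
   using K0 L C1 k r by (simp add: ennreal_mult[symmetric] ennreal_plus[symmetric] del: ennreal_plus)
  finally have "norm (\<integral>u. H u * of_real (E u) \<partial>lborel) <= K0 * L * (sqrt pi * r) ^ CARD('n) + C * V * 2 * r\<^sup>2 * (sqrt pi * (sqrt 2 * r)) ^ CARD('n)"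
   using K0 L C1 k r by (subst (asm) ennreal_le_iff) auto
  also have "... = K0 * L * k1 * r ^ CARD('n) + r\<^sup>2 * (C * V * 2 * k2 * r ^ CARD('n))"
   by (simp add: k1_def k2_def power_mult_distrib mult_ac)
  also have "... <= K0 * L * k1 * r ^ CARD('n) + L * (C * V * 2 * k2 * r ^ CARD('n))"
   using L C1 k r by (intro add_left_mono mult_right_mono) auto
  also have "... = K * L * r ^ CARD('n)" by (simp add: K_def algebra_simps)
  finally show "norm (\<integral>ze. indicator (cube A) ze *\<^sub>R packet 1 t ep r y ze \<partial>lborel) <= K * \<bar>t\<bar> powr (- (1 / real (2 * q))) * r ^ CARD('n)"
   unfolding eq L_def .
 qed
qed

text \<open>For bounded \<open>norm y / \<bar>t\<bar>\<close> the distant centres decay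
  exponentially and only a cube is left. The alternative in the hypotheses separates the two
  regimes: for \<open>ta = 1\<close> the time may be large and van der Corput's lemma gives the
  decay; for \<open>\<bar>t\<bar> = 1\<close> no decay in time is needed, and the crude bound is
  uniform in \<open>ta\<close>.\<close>

lemma Jint_small:
 assumes R: "1 <= R"
 obtains K where "0 < K"
  "\<And>ta t ep (y :: real^'n). 0 < ta ==> ta <= 1 ==> 1 <= \<bar>t\<bar> ==> ta = 1 \<or> \<bar>t\<bar> = 1 ==> 0 < ep ==> ep <= 1 ==> norm y <= \<bar>t\<bar> * R ^ (q - 1) ==>
    norm (Jint ta t ep y) <= K * \<bar>t\<bar> powr (- (1 / real (2 * q)))"
proof -
 obtain C' K1 c where hi: "1 <= C'" "0 < K1" "0 < c"
  "\<And>ta t ep (y :: real^'n) R r ze. 0 < ta ==> ta <= 1 ==> 1 <= \<bar>t\<bar> ==> 0 <= ep ==> ep <= 1 ==> 1 <= R ==> norm y <= \<bar>t\<bar> * R ^ (q - 1) ==>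
    r = 1 / sqrt (\<bar>t\<bar> * R ^ (q - 2)) ==> C' * R <= norm ze ==>
    norm (packet ta t ep r y ze) <= K1 * r ^ CARD('n) / R ^ q * exp (- (c * norm ze / r))"
  by (rule packet_high_decay) blast
 define A where "A = C' * R"
 have A: "0 < A" unfolding A_def using hi R by simp
 obtain K2 where K2: "0 < K2"
  "\<And>t ep r (y :: real^'n). 1 <= \<bar>t\<bar> ==> 0 <= ep ==> ep <= 1 ==> 0 < r ==> r\<^sup>2 <= 1 / \<bar>t\<bar> ==>
    norm (\<integral>ze. indicator (cube A) ze *\<^sub>R packet 1 t ep r y ze \<partial>lborel) <= K2 * \<bar>t\<bar> powr (- (1 / real (2 * q))) * r ^ CARD('n)"
  by (rule cube_packet_integral[OF A]) blast
 define V where "V = measure lborel (cube A)"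
 have V: "0 <= V" by (simp add: V_def)
 define r1 where "r1 = 1 / sqrt (R ^ (q - 2))"
 have r1: "0 < r1" using R by (simp add: r1_def)
 define K3 where "K3 = C * (4 + sqrt pi) ^ CARD('n) * r1 ^ (CARD('n) - q) * V / r1 ^ CARD('n)"
 have K3: "0 <= K3" unfolding K3_def using C1 r1 V by auto
 define K4 where "K4 = K1 * (2 * real CARD('n) / c) ^ CARD('n)"
 have K4: "0 <= K4" unfolding K4_def using hi by simp
 show thesis
 proof (rule that[of "K2 + K3 + K4"])
  show "0 < K2 + K3 + K4" using K2(1) K3 K4 by linarith
  fix ta t ep :: real and y :: "real^'n"
  assume ta: "0 < ta" "ta <= 1" and t: "1 <= \<bar>t\<bar>" "ta = 1 \<or> \<bar>t\<bar> = 1" and ep: "0 < ep" "ep <= 1" and y: "norm y <= \<bar>t\<bar> * R ^ (q - 1)"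
  have ep0: "0 <= ep" using ep by simp
  define r where "r = 1 / sqrt (\<bar>t\<bar> * R ^ (q - 2))"
  note r = inverse_sqrt_scale[OF t(1) R r_def]
  define L where "L = \<bar>t\<bar> powr (- (1 / real (2 * q)))"
  have L0: "0 <= L" by (simp add: L_def)
  have r2: "r\<^sup>2 <= 1 / \<bar>t\<bar>"
  proof -
   have "\<bar>t\<bar> * r\<^sup>2 * 1 <= \<bar>t\<bar> * r\<^sup>2 * R ^ (q - 2)" using R by (intro mult_left_mono one_le_power) auto
   then have "\<bar>t\<bar> * r\<^sup>2 <= 1" using r(3) by simp
   then show ?thesis using t by (simp add: pos_le_divide_eq mult.commute)
  qed
  \<comment> \<open>The exterior contribution contains an additional factor \<open>r ^ n\<close>,
    which is at most \<open>r^2 \<le> 1 / \<bar>t\<bar>\<close> and so is covered by the required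
    decay.\<close>
  have rL: "r ^ CARD('n) <= L"
  proof -
   have "r ^ CARD('n) <= r ^ 2" using r q2 qn by (intro power_decreasing) auto
   also have "... <= 1 / \<bar>t\<bar>" by (rule r2)
   also have "... = \<bar>t\<bar> powr (- 1)" using t by (simp add: powr_minus_divide)
   also have "... <= L" unfolding L_def using t q2 by (intro powr_mono) auto
   finally show ?thesis .
  qed
  define P where "P = packet ta t ep r y"
  have Pint: "integrable lborel P" unfolding P_def by (rule Jint_packets(1)[OF ta(1) ep(1) r(1)])
  have ci: "integrable lborel (%ze. indicator (cube A) ze *\<^sub>R P ze)"
   using integrable_mult_indicator[OF _ Pint, of "cube A"] by simp
  have oi: "integrable lborel (%ze. indicator (- cube A) ze *\<^sub>R P ze)"
   using integrable_mult_indicator[OF _ Pint, of "- cube A"] by simp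
  have out: "norm (\<integral>ze. indicator (- cube A) ze *\<^sub>R P ze \<partial>lborel) <= K4 * L * r ^ CARD('n)"
  proof -
   have "ennreal (norm (\<integral>ze. indicator (- cube A) ze *\<^sub>R P ze \<partial>lborel)) <= (\<integral>\<^sup>+ze. norm (indicator (- cube A) ze *\<^sub>R P ze) \<partial>lborel)"
    by (rule integral_norm_bound_ennreal[OF oi])
   also have "... <= (\<integral>\<^sup>+ze. indicator {ze. A <= norm ze} ze * ennreal (norm (P ze)) \<partial>lborel)"
   proof (rule nn_integral_mono)
    fix ze :: "real^'n"
    have "A <= norm ze" if out: "ze \<notin> cube A"
    proof -
     obtain j where "\<not> \<bar>ze $ j\<bar> <= A" using out unfolding mem_cube not_all by (rule exE)
     then show ?thesis using component_le_norm_cart[of ze j] by linarith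
    qed
    then show "ennreal (norm (indicator (- cube A) ze *\<^sub>R P ze)) <= indicator {ze. A <= norm ze} ze * ennreal (norm (P ze))"
     by (cases "ze \<in> cube A") auto
   qed
   also have "... <= ennreal (K1 * r ^ CARD('n) / R ^ q * ((2 * real CARD('n) / c) ^ CARD('n) * r ^ CARD('n)))"
   proof (rule nn_integral_high[OF hi(3) r(1)])
    show "0 <= K1 * r ^ CARD('n) / R ^ q" using hi r R by simp
    show "norm (P ze) <= K1 * r ^ CARD('n) / R ^ q * exp (- (c * norm ze / r))" if "A <= norm ze" for ze
     unfolding P_def using hi(4)[OF ta t(1) ep0 ep(2) R y r_def] that by (simp add: A_def)
   qed
   finally have "norm (\<integral>ze. indicator (- cube A) ze *\<^sub>R P ze \<partial>lborel) <= K1 * r ^ CARD('n) / R ^ q * ((2 * real CARD('n) / c) ^ CARD('n) * r ^ CARD('n))"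
    using hi r R by (subst (asm) ennreal_le_iff) auto
   also have "... = r ^ CARD('n) / R ^ q * (K4 * r ^ CARD('n))" by (simp add: K4_def)
   also have "... <= L * (K4 * r ^ CARD('n))"
   proof (rule mult_right_mono)
    have "r ^ CARD('n) / R ^ q <= r ^ CARD('n) / 1" using r R by (intro divide_left_mono) auto
    then show "r ^ CARD('n) / R ^ q <= L" using rL by simp
   qed (use K4 r in auto)
   finally show ?thesis by (simp only: mult_ac)
  qed
  have inn: "norm (\<integral>ze. indicator (cube A) ze *\<^sub>R P ze \<partial>lborel) <= (K2 + K3) * L * r ^ CARD('n)"
   using t(2)
  proof
   assume "ta = 1"
   then have "norm (\<integral>ze. indicator (cube A) ze *\<^sub>R P ze \<partial>lborel) <= K2 * L * r ^ CARD('n)"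
    unfolding P_def L_def using K2(2)[OF t(1) ep0 ep(2) r(1) r2] by simp
   also have "... <= (K2 + K3) * L * r ^ CARD('n)" using K3 L0 r by (intro mult_right_mono) auto
   finally show ?thesis .
  next
   assume t1: "\<bar>t\<bar> = 1"
   \<comment> \<open>For \<open>\<bar>t\<bar> = 1\<close> the width depends on \<open>R\<close>
     alone, and division by \<open>r ^ n\<close> costs only a constant.\<close>
   then have rr: "r = r1" and L1: "L = 1" unfolding r_def r1_def L_def by simp_all
   define B where "B = C * (4 + sqrt pi) ^ CARD('n) * r ^ (CARD('n) - q)"
   have B: "norm (P ze) <= B" for ze unfolding P_def B_def by (rule packet_crude[OF ta(1) ep0 r(1)])
   have "norm (\<integral>ze. indicator (cube A) ze *\<^sub>R P ze \<partial>lborel) <= (\<integral>ze. B * indicator (cube A) ze \<partial>lborel)"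
   proof (rule integral_norm_bound[THEN order_trans], rule integral_mono')
    show "integrable lborel (%ze. B * indicator (cube A) ze :: real)"
     by (intro integrable_mult_right integrable_real_indicator) (auto simp: cube_finite)
   qed (use B order_trans[OF norm_ge_zero B] in \<open>auto simp: indicator_def\<close>)
   also have "... = B * V" by (simp add: V_def)
   also have "... = K3 * r ^ CARD('n)" unfolding B_def K3_def rr using r1 by simp
   also have "... <= (K2 + K3) * L * r ^ CARD('n)" unfolding L1 using K2(1) r by (intro mult_right_mono) auto
   finally show ?thesis .
  qed
  have "(\<integral>ze. P ze \<partial>lborel) = (\<integral>ze. indicator (cube A) ze *\<^sub>R P ze + indicator (- cube A) ze *\<^sub>R P ze \<partial>lborel)"
   by (intro Bochner_Integration.integral_cong refl) (auto simp: indicator_def)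
  also have "... = (\<integral>ze. indicator (cube A) ze *\<^sub>R P ze \<partial>lborel) + (\<integral>ze. indicator (- cube A) ze *\<^sub>R P ze \<partial>lborel)"
   by (rule Bochner_Integration.integral_add[OF ci oi])
  finally have "norm (\<integral>ze. P ze \<partial>lborel) <= (K2 + K3) * L * r ^ CARD('n) + K4 * L * r ^ CARD('n)"
   using norm_triangle_le[OF add_mono[OF inn out]] by simp
  then have "(sqrt pi * r) ^ CARD('n) * norm (Jint ta t ep y) <= (K2 + K3 + K4) * L * r ^ CARD('n)"
   using r unfolding P_def Jint_packets(2)[OF ta(1) ep(1) r(1)] norm_mult norm_of_real by (simp add: algebra_simps)
  then show "norm (Jint ta t ep y) <= (K2 + K3 + K4) * \<bar>t\<bar> powr (- (1 / real (2 * q)))"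
   unfolding L_def[symmetric] by (rule cancel_gauss_mass[OF r(1) norm_ge_zero])
 qed
qed

end

section \<open>Schwartz functions, their inverse Fourier transforms, and uniqueness of continuous
  representatives\<close>

lemma integrable_one_plus_norm: "integrable lborel (%x :: real^'n::finite. 1 / (1 + norm x) ^ (2 * CARD('n)))"
proof (rule integrableI_bounded)
 show "(%x :: real^'n. 1 / (1 + norm x) ^ (2 * CARD('n))) \<in> borel_measurable lborel" by measurable
 have one: "(\<integral>\<^sup>+x. ennreal (1 / (1 + x\<^sup>2)) \<partial>lborel) < \<infinity>"
 proof -
  have half: "(\<integral>\<^sup>+x. ennreal (1 / (1 + x\<^sup>2)) * indicator {0..} x \<partial>lborel) = ennreal (pi / 2)"
   by (rule nn_integral_FTC_atLeast[where F = arctan, THEN trans])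
    (auto intro!: derivative_eq_intros tendsto_arctan_at_top simp: inverse_eq_divide)
  have "(\<integral>\<^sup>+x. ennreal (1 / (1 + x\<^sup>2)) \<partial>lborel)
   <= (\<integral>\<^sup>+x. ennreal (1 / (1 + x\<^sup>2)) * indicator {0..} x + ennreal (1 / (1 + (- x)\<^sup>2)) * indicator {0..} (- x) \<partial>lborel)"
   by (intro nn_integral_mono) (auto simp: indicator_def)
  also have "... = (\<integral>\<^sup>+x. ennreal (1 / (1 + x\<^sup>2)) * indicator {0..} x \<partial>lborel)
    + (\<integral>\<^sup>+x. ennreal (1 / (1 + (- x)\<^sup>2)) * indicator {0..} (- x) \<partial>lborel)"
   by (rule nn_integral_add) measurable
  also have "(\<integral>\<^sup>+x. ennreal (1 / (1 + (- x)\<^sup>2)) * indicator {0..} (- x) \<partial>lborel) = (\<integral>\<^sup>+x. ennreal (1 / (1 + x\<^sup>2)) * indicator {0..} x \<partial>lborel)"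
   using nn_integral_real_affine[of "%x. ennreal (1 / (1 + x\<^sup>2)) * indicator {0..} x" "-1" 0] by simp
  also note half
  finally show ?thesis by (rule order.strict_trans1) (simp add: ennreal_plus[symmetric] del: ennreal_plus)
 qed
 have "(\<integral>\<^sup>+x. norm (1 / (1 + norm (x :: real^'n)) ^ (2 * CARD('n))) \<partial>lborel)
  <= (\<integral>\<^sup>+x. (\<Prod>i\<in>UNIV. ennreal (1 / (1 + ((x :: real^'n) $ i)\<^sup>2))) \<partial>lborel)"
 proof (rule nn_integral_mono)
  fix x :: "real^'n"
  have "(\<Prod>i\<in>UNIV. 1 + (x $ i)\<^sup>2) <= (\<Prod>i\<in>(UNIV :: 'n set). (1 + norm x)\<^sup>2)"
  proof (intro prod_mono conjI)
   fix i
   have "(x $ i)\<^sup>2 <= (norm x)\<^sup>2" using power_mono[OF component_le_norm_cart[of x i] abs_ge_zero, of 2] by simp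
   then show "1 + (x $ i)\<^sup>2 <= (1 + norm x)\<^sup>2" by (auto simp: power2_sum intro!: add_increasing2)
  qed (simp add: add_nonneg_nonneg)
  then have "1 / (1 + norm x) ^ (2 * CARD('n)) <= 1 / (\<Prod>i\<in>UNIV. 1 + (x $ i)\<^sup>2)"
   by (intro divide_left_mono) (auto simp: power_mult intro!: mult_pos_pos prod_pos add_pos_nonneg zero_less_power)
  also have "... = (\<Prod>i\<in>UNIV. 1 / (1 + (x $ i)\<^sup>2))" by (simp add: prod_dividef)
  finally have "ennreal (1 / (1 + norm x) ^ (2 * CARD('n))) <= ennreal (\<Prod>i\<in>UNIV. 1 / (1 + (x $ i)\<^sup>2))" by (rule ennreal_leI)
  then show "ennreal (norm (1 / (1 + norm x) ^ (2 * CARD('n)))) <= (\<Prod>i\<in>UNIV. ennreal (1 / (1 + (x $ i)\<^sup>2)))"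
   by (subst prod_ennreal) (auto simp: norm_divide norm_power)
 qed
 also have "... = (\<Prod>i\<in>(UNIV :: 'n set). \<integral>\<^sup>+s. ennreal (1 / (1 + s\<^sup>2)) \<partial>lborel)"
  by (rule nn_integral_vec_prod) measurable
 also have "... < \<infinity>" using one by (simp add: power_less_top_ennreal)
 finally show "(\<integral>\<^sup>+x. norm (1 / (1 + norm (x :: real^'n)) ^ (2 * CARD('n))) \<partial>lborel) < \<infinity>" .
qed

lemma schwartz_bound:
 assumes "schwartz fi"
 obtains M where "0 < M" "\<And>x. norm (foldr partial_derivative is fi x) <= M / (1 + norm x) ^ k"
proof -
 have "bounded (range (%x. (1 + norm x) ^ k *\<^sub>R foldr partial_derivative is fi x))"
  using conjunct2[OF assms[unfolded schwartz_def]] by (elim allE)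
 then obtain M where M: "0 < M" "\<And>x. norm ((1 + norm x) ^ k *\<^sub>R foldr partial_derivative is fi x) <= M"
  unfolding bounded_pos by (auto simp del: norm_scaleR)
 have N: "0 < 1 + norm x" for x :: "real^'a" by (simp add: add_pos_nonneg)
 have "norm (foldr partial_derivative is fi x) <= M / (1 + norm x) ^ k" for x
  using M(2)[of x] N[of x] by (simp add: pos_le_divide_eq mult.commute norm_power)
 then show thesis using M(1) that by blast
qed

lemma schwartz_differentiable: "schwartz fi ==> fi differentiable at x"
 unfolding schwartz_def by (metis foldr.simps(1) id_apply)

lemma schwartz_continuous: "schwartz fi ==> continuous_on UNIV fi"
 by (simp add: continuous_at_imp_continuous_on differentiable_imp_continuous_within schwartz_differentiable)

lemma schwartz_measurable: "schwartz fi ==> fi \<in> borel_measurable borel"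
 by (intro borel_measurable_continuous_onI schwartz_continuous)

lemma schwartz_partial: "schwartz fi ==> schwartz (partial_derivative i fi)"
proof -
 have "foldr partial_derivative is (partial_derivative i fi) = foldr partial_derivative (is @ [i]) fi" for "is" by simp
 then show "schwartz fi ==> schwartz (partial_derivative i fi)" unfolding schwartz_def by (simp del: foldr_append)
qed

lemma schwartz_integrable:
 assumes "schwartz fi"
 shows "integrable lborel (fi :: real^'n::finite => complex)"
proof -
 obtain M where M: "0 < M" "\<And>x. norm (foldr partial_derivative [] fi x) <= M / (1 + norm x) ^ (2 * CARD('n))"
  using schwartz_bound[OF assms] by blast
 show ?thesis
 proof (rule Bochner_Integration.integrable_bound[OF integrable_mult_right[OF integrable_one_plus_norm, of M]])
  show "AE x in lborel. norm (fi x) <= norm (M * (1 / (1 + norm x) ^ (2 * CARD('n))))"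
  proof (rule AE_I2)
   fix x
   have "norm (fi x) <= M * (1 / (1 + norm x) ^ (2 * CARD('n)))" using M(2)[of x] by simp
   then show "norm (fi x) <= norm (M * (1 / (1 + norm x) ^ (2 * CARD('n))))"
    unfolding real_norm_def by (rule order_trans) (rule abs_ge_self)
  qed
 qed (use schwartz_measurable[OF assms] in simp)
qed

lemma cis_measurable [measurable]: "cis \<in> borel_measurable borel"
 by (rule borel_measurable_continuous_onI[OF continuous_on_cis[OF continuous_on_id]])

lemma cis_mult_integrable:
 "integrable lborel fi ==> integrable lborel (%x :: real^'n::finite. cis (x \<bullet> \<xi>) * fi x)"
 by (rule Bochner_Integration.integrable_bound[of _ fi]) (auto simp: norm_mult)

lemma norm_inverse_fourier_le: "norm (inverse_fourier fi \<xi>) <= (\<integral>x. norm (fi x) \<partial>lborel)"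
 unfolding inverse_fourier_def by (rule integral_norm_bound[THEN order_trans]) (simp add: norm_mult)

lemma inverse_fourier_shift:
 assumes "schwartz fi"
 shows "(\<integral>x. cis (x \<bullet> \<xi>) * fi (x + a) \<partial>lborel) = cis (- (a \<bullet> \<xi>)) * inverse_fourier fi \<xi>"
proof -
 have [measurable]: "fi \<in> borel_measurable borel" by (rule schwartz_measurable[OF assms])
 have "(\<integral>x. cis (x \<bullet> \<xi>) * fi (x + a) \<partial>lborel) = (\<integral>x. (%x. cis (- (a \<bullet> \<xi>)) * (cis (x \<bullet> \<xi>) * fi x)) (x + a) \<partial>lborel)"
  by (intro Bochner_Integration.integral_cong refl) (simp add: cis_mult inner_add_left mult.assoc[symmetric])
 also have "... = (\<integral>x. cis (- (a \<bullet> \<xi>)) * (cis (x \<bullet> \<xi>) * fi x) \<partial>lborel)"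
  by (rule integral_lborel_shift) measurable
 finally show ?thesis by (simp add: inverse_fourier_def)
qed

text \<open>The derivative is taken as a limit of difference quotients under the integral.
  Translation of \<open>fi\<close> becomes multiplication by a phase, so the limit can also be
  evaluated outside the integral, which avoids integration by parts.\<close>

lemma inverse_fourier_partial:
 fixes fi :: "real^'n::finite => complex"
 assumes S: "schwartz fi"
 shows "inverse_fourier (partial_derivative i fi) \<xi> = - \<i> * of_real (\<xi> $ i) * inverse_fourier fi \<xi>"
proof -
 define e where "e = (axis i 1 :: real^'n)"
 have ne: "norm e = 1" by (simp add: e_def norm_axis_1)
 \<comment> \<open>Steps of length at most 1 make \<open>1 + norm x\<close> at most twice its value
   at the intermediate point, so that one integrable function dominates all quotients.\<close>
 define s where "s = (%k. inverse (real (Suc k)))"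
 have s: "0 < s k" "s k <= 1" for k by (auto simp: s_def inverse_le_1_iff)
 have s0: "s \<longlonglongrightarrow> 0" unfolding s_def by (rule LIMSEQ_inverse_real_of_nat)
 define F where "F = (%k x. cis (x \<bullet> \<xi>) * ((fi (x + s k *\<^sub>R e) - fi x) / of_real (s k)))"
 have [measurable]: "fi \<in> borel_measurable borel" by (rule schwartz_measurable[OF S])
 have [measurable]: "partial_derivative i fi \<in> borel_measurable borel" by (rule schwartz_measurable[OF schwartz_partial[OF S]])
 have der: "(fi has_derivative frechet_derivative fi (at x)) (at x)" for x
  using schwartz_differentiable[OF S, of x] frechet_derivative_works by blast
 have lin: "frechet_derivative fi (at x) (h *\<^sub>R e) = of_real h * partial_derivative i fi x" for x h
  using linear_scale[OF has_derivative_linear[OF der[of x]], of h e]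
  by (simp add: partial_derivative_def e_def scaleR_conv_of_real)
 obtain M where M: "0 < M" "\<And>x. norm (foldr partial_derivative [i] fi x) <= M / (1 + norm x) ^ (2 * CARD('n))"
  using schwartz_bound[OF S] by blast
 have lim: "(%k. \<integral>x. F k x \<partial>lborel) \<longlonglongrightarrow> (\<integral>x. cis (x \<bullet> \<xi>) * partial_derivative i fi x \<partial>lborel)"
 proof (rule integral_dominated_convergence[where w = "%x. (M * 2 ^ (2 * CARD('n))) * (1 / (1 + norm x) ^ (2 * CARD('n)))"])
  show "integrable lborel (%x :: real^'n. (M * 2 ^ (2 * CARD('n))) * (1 / (1 + norm x) ^ (2 * CARD('n))))"
   by (intro integrable_mult_right integrable_one_plus_norm)
  show "AE x in lborel. (%k. F k x) \<longlonglongrightarrow> cis (x \<bullet> \<xi>) * partial_derivative i fi x"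
  proof (rule AE_I2)
   fix x :: "real^'n"
   have "(%h. norm (fi (x + h) - fi x - frechet_derivative fi (at x) h) / norm h) \<midarrow>0\<rightarrow> 0"
    using der[of x] unfolding has_derivative_at by blast
   moreover have "filterlim (%k. s k *\<^sub>R e) (at 0) sequentially"
   proof -
    have "(%k. s k *\<^sub>R e) \<longlonglongrightarrow> 0" using tendsto_scaleR[OF s0 tendsto_const[of e]] by simp
    moreover have "s k *\<^sub>R e ~= 0" for k using s(1)[of k] ne by auto
    ultimately show ?thesis by (simp add: filterlim_at)
   qed
   ultimately have "(%k. norm (fi (x + s k *\<^sub>R e) - fi x - frechet_derivative fi (at x) (s k *\<^sub>R e)) / norm (s k *\<^sub>R e)) \<longlonglongrightarrow> 0"
    by (rule filterlim_compose)
   moreover have "norm (fi (x + s k *\<^sub>R e) - fi x - frechet_derivative fi (at x) (s k *\<^sub>R e)) / norm (s k *\<^sub>R e)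
     = norm ((fi (x + s k *\<^sub>R e) - fi x) / of_real (s k) - partial_derivative i fi x)" for k
   proof -
    have "(fi (x + s k *\<^sub>R e) - fi x) / of_real (s k) - partial_derivative i fi x
     = (fi (x + s k *\<^sub>R e) - fi x - frechet_derivative fi (at x) (s k *\<^sub>R e)) / of_real (s k)"
     unfolding lin using s(1)[of k] by (simp add: field_simps)
    then show ?thesis using s(1)[of k] by (simp add: norm_divide ne)
   qed
   ultimately have "(%k. (fi (x + s k *\<^sub>R e) - fi x) / of_real (s k)) \<longlonglongrightarrow> partial_derivative i fi x"
    by (simp add: tendsto_norm_zero_iff LIM_zero_iff)
   then show "(%k. F k x) \<longlonglongrightarrow> cis (x \<bullet> \<xi>) * partial_derivative i fi x"
    unfolding F_def by (intro tendsto_mult tendsto_const)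
  qed
  fix k
  show "AE x in lborel. norm (F k x) <= (M * 2 ^ (2 * CARD('n))) * (1 / (1 + norm x) ^ (2 * CARD('n)))"
  proof (rule AE_I2)
   fix x :: "real^'n"
   have dl: "((%h. fi (x + h *\<^sub>R e)) has_derivative (%h. of_real h * partial_derivative i fi (x + z *\<^sub>R e))) (at z)" for z
   proof -
    have "((%h. x + h *\<^sub>R e) has_derivative (%h. h *\<^sub>R e)) (at z)" by (auto intro!: derivative_eq_intros)
    from has_derivative_compose[OF this der] show ?thesis unfolding lin .
   qed
   have "\<exists>z\<in>{0<..<s k}. norm (fi (x + s k *\<^sub>R e) - fi (x + 0 *\<^sub>R e)) <= norm (of_real (s k - 0) * partial_derivative i fi (x + z *\<^sub>R e))"
    by (rule mvt_general[OF s(1) _ dl]) (intro continuous_at_imp_continuous_on ballI has_derivative_continuous[OF dl])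
   then obtain z where z: "z \<in> {0<..<s k}" "norm (fi (x + s k *\<^sub>R e) - fi x) <= s k * norm (partial_derivative i fi (x + z *\<^sub>R e))"
    using s(1)[of k] by (auto simp: norm_mult)
   have z1: "\<bar>z\<bar> <= 1" using z(1) s(2)[of k] by auto
   have "norm (F k x) = norm (fi (x + s k *\<^sub>R e) - fi x) / s k" unfolding F_def using s(1)[of k] by (simp add: norm_mult norm_divide)
   also have "... <= norm (partial_derivative i fi (x + z *\<^sub>R e))" using z(2) s(1)[of k] by (simp add: pos_divide_le_eq mult.commute)
   also have "... <= M / (1 + norm (x + z *\<^sub>R e)) ^ (2 * CARD('n))" using M(2)[of "x + z *\<^sub>R e"] by simp
   also have "... <= M / ((1 + norm x) / 2) ^ (2 * CARD('n))"
   proof -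
    have "norm x <= norm (x + z *\<^sub>R e) + \<bar>z\<bar>" using norm_triangle_ineq4[of "x + z *\<^sub>R e" "z *\<^sub>R e"] ne by simp
    then have "norm x <= norm (x + z *\<^sub>R e) + 1" using z1 by linarith
    moreover have "1 + u <= 2 + 2 * v" if "u <= v + 1" "0 <= v" for u v :: real using that by linarith
    ultimately have "1 + norm x <= 2 + 2 * norm (x + z *\<^sub>R e)" using norm_ge_zero by blast
    then have "(1 + norm x) / 2 <= 1 + norm (x + z *\<^sub>R e)" by simp
    moreover have "0 < (1 + norm x) / 2" by (simp add: add_pos_nonneg)
    ultimately show ?thesis using M(1) by (intro divide_left_mono power_mono mult_pos_pos zero_less_power) auto
   qed
   finally show "norm (F k x) <= (M * 2 ^ (2 * CARD('n))) * (1 / (1 + norm x) ^ (2 * CARD('n)))"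
    by (simp add: power_divide)
  qed
 qed (unfold F_def, measurable)
 have Fk: "(\<integral>x. F k x \<partial>lborel) = (exp (- \<i> * of_real (\<xi> $ i) * of_real (s k)) - 1) / of_real (s k) * inverse_fourier fi \<xi>" for k
 proof -
  have "integrable lborel (%x. cis (x \<bullet> \<xi>) * fi (x + s k *\<^sub>R e))" "integrable lborel (%x. cis (x \<bullet> \<xi>) * fi x)"
   using schwartz_integrable[OF S] by (auto intro!: cis_mult_integrable integrable_lborel_shift)
  then have "(\<integral>x. F k x \<partial>lborel) = ((\<integral>x. cis (x \<bullet> \<xi>) * fi (x + s k *\<^sub>R e) \<partial>lborel) - (\<integral>x. cis (x \<bullet> \<xi>) * fi x \<partial>lborel)) / of_real (s k)"
   unfolding F_def by (simp add: right_diff_distrib)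
  also have "... = (cis (- (s k *\<^sub>R e \<bullet> \<xi>)) - 1) / of_real (s k) * inverse_fourier fi \<xi>"
   unfolding inverse_fourier_shift[OF S] by (simp add: inverse_fourier_def algebra_simps)
  also have "cis (- (s k *\<^sub>R e \<bullet> \<xi>)) = exp (- \<i> * of_real (\<xi> $ i) * of_real (s k))"
   by (simp add: cis_conv_exp e_def inner_axis' mult_ac)
  finally show ?thesis .
 qed
 have "((%w. exp (- \<i> * of_real (\<xi> $ i) * w)) has_field_derivative - \<i> * of_real (\<xi> $ i)) (at 0)"
  by (auto intro!: derivative_eq_intros)
 then have "(%h. (exp (- \<i> * of_real (\<xi> $ i) * (0 + h)) - exp (- \<i> * of_real (\<xi> $ i) * 0)) / h) \<midarrow>0\<rightarrow> - \<i> * of_real (\<xi> $ i)"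
  unfolding DERIV_def .
 moreover have "filterlim (%k. of_real (s k) :: complex) (at 0) sequentially"
  using s0 s(1) by (auto simp: filterlim_at less_imp_neq tendsto_of_real_iff[symmetric, where 'a = complex] intro!: always_eventually dest: less_imp_neq[symmetric])
 ultimately have "(%k. (exp (- \<i> * of_real (\<xi> $ i) * (0 + of_real (s k))) - exp (- \<i> * of_real (\<xi> $ i) * 0)) / of_real (s k)) \<longlonglongrightarrow> - \<i> * of_real (\<xi> $ i)"
  by (rule filterlim_compose)
 then have "(%k. \<integral>x. F k x \<partial>lborel) \<longlonglongrightarrow> - \<i> * of_real (\<xi> $ i) * inverse_fourier fi \<xi>"
  unfolding Fk by (intro tendsto_mult tendsto_const) simp
 from LIMSEQ_unique[OF lim this] show ?thesis unfolding inverse_fourier_def .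
qed

text \<open>Taking \<open>2 n\<close> derivatives in the direction of the largest component of
  \<open>\<xi>\<close> shows decay like \<open>(1 + norm \<xi>) powr (- 2 n)\<close>. This decay
  justifies the passage to the limit on the frequency side.\<close>

lemma inverse_fourier_integrable:
 fixes fi :: "real^'n::finite => complex"
 assumes S: "schwartz fi"
 shows "integrable lborel (inverse_fourier fi)"
proof -
 let ?n = "CARD('n)"
 have it: "schwartz ((partial_derivative i ^^ k) fi)
   \<and> inverse_fourier ((partial_derivative i ^^ k) fi) \<xi> = (- \<i> * of_real (\<xi> $ i)) ^ k * inverse_fourier fi \<xi>" for i k \<xi>
  by (induction k) (auto simp: S inverse_fourier_partial intro: schwartz_partial)
 define M where "M = (\<integral>x. norm (fi x) \<partial>lborel) + (\<Sum>i\<in>UNIV. \<integral>x. norm ((partial_derivative i ^^ (2 * ?n)) fi x) \<partial>lborel)"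
 have M0: "(\<integral>x. norm (fi x) \<partial>lborel) <= M" unfolding M_def by (simp add: sum_nonneg)
 have Mi: "(\<integral>x. norm ((partial_derivative i ^^ (2 * ?n)) fi x) \<partial>lborel) <= M" for i
  unfolding M_def using member_le_sum[of i UNIV "%i. \<integral>x. norm ((partial_derivative i ^^ (2 * ?n)) fi x) \<partial>lborel"]
  by (simp add: add_increasing)
 have b: "norm (inverse_fourier fi \<xi>) * (1 + norm \<xi>) ^ (2 * ?n) <= M * (1 + real ?n) ^ (2 * ?n)" for \<xi>
 proof -
  have Mpos: "0 <= M" using order_trans[OF _ M0] by (simp add: integral_nonneg)
  obtain i where i: "\<And>j. \<bar>\<xi> $ j\<bar> <= \<bar>\<xi> $ i\<bar>"
   using Max_in[of "range (%j. \<bar>\<xi> $ j\<bar>)"] Max_ge[of "range (%j. \<bar>\<xi> $ j\<bar>)"] by (metis (mono_tags, lifting) finite UNIV_not_empty finite_imageI image_iff image_is_empty rangeI)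
  define v where "v = max 1 \<bar>\<xi> $ i\<bar>"
  have "norm \<xi> <= real ?n * \<bar>\<xi> $ i\<bar>" by (rule norm_le_card_bound[OF i])
  also have "... <= real ?n * v" by (intro mult_left_mono) (auto simp: v_def)
  finally have nv: "1 + norm \<xi> <= (1 + real ?n) * v" by (simp add: algebra_simps v_def add_mono)
  have "norm (inverse_fourier fi \<xi>) * v ^ (2 * ?n) <= M"
  proof (cases "\<bar>\<xi> $ i\<bar> <= 1")
   case True
   then have "v = 1" by (simp add: v_def)
   then show ?thesis using norm_inverse_fourier_le[of fi \<xi>] M0 by simp
  next
   case False
   then have "v = \<bar>\<xi> $ i\<bar>" by (simp add: v_def)
   then have "norm (inverse_fourier fi \<xi>) * v ^ (2 * ?n) = norm (inverse_fourier ((partial_derivative i ^^ (2 * ?n)) fi) \<xi>)"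
    using it[where i = i and k = "2 * ?n" and \<xi> = \<xi>] by (simp add: norm_mult norm_power mult.commute)
   also have "... <= M" using norm_inverse_fourier_le Mi by (rule order_trans)
   finally show ?thesis .
  qed
  then have le: "norm (inverse_fourier fi \<xi>) * v ^ (2 * ?n) * (1 + real ?n) ^ (2 * ?n) <= M * (1 + real ?n) ^ (2 * ?n)"
   by (rule mult_right_mono) simp
  have "norm (inverse_fourier fi \<xi>) * (1 + norm \<xi>) ^ (2 * ?n) <= norm (inverse_fourier fi \<xi>) * ((1 + real ?n) * v) ^ (2 * ?n)"
   using nv by (intro mult_left_mono power_mono) auto
  also have "... = norm (inverse_fourier fi \<xi>) * v ^ (2 * ?n) * (1 + real ?n) ^ (2 * ?n)"
   by (simp only: power_mult_distrib mult_ac)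
  also note le
  finally show ?thesis .
 qed
 have [measurable]: "fi \<in> borel_measurable borel" by (rule schwartz_measurable[OF S])
 show ?thesis
 proof (rule Bochner_Integration.integrable_bound[OF integrable_mult_right[OF integrable_one_plus_norm, of "M * (1 + real ?n) ^ (2 * ?n)"]])
  show "inverse_fourier fi \<in> borel_measurable lborel"
  proof -
   have "(%x. cis (snd x \<bullet> fst x) * fi (snd x)) \<in> borel_measurable (borel \<Otimes>\<^sub>M borel)" by measurable
   then show ?thesis unfolding inverse_fourier_def[abs_def]
    by (intro lborel.borel_measurable_lebesgue_integral[unfolded split_beta']) (simp add: split_beta')
  qed
  have "norm (inverse_fourier fi \<xi>) <= M * (1 + real ?n) ^ (2 * ?n) * (1 / (1 + norm \<xi>) ^ (2 * ?n))" for \<xi>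
  proof -
   have "0 < (1 + norm \<xi>) ^ (2 * ?n)" by (intro zero_less_power) (simp add: add_pos_nonneg)
   then show ?thesis using b[of \<xi>] by (simp add: pos_le_divide_eq)
  qed
  then show "AE \<xi> in lborel. norm (inverse_fourier fi \<xi>) <= norm (M * (1 + real ?n) ^ (2 * ?n) * (1 / (1 + norm \<xi>) ^ (2 * ?n)))"
   unfolding real_norm_def by (intro AE_I2) (rule order_trans, assumption, rule abs_ge_self)
 qed
qed

text \<open>Polynomial multiples of a Gaussian are closed under partial derivatives, which a
  Gaussian alone is not; the Schwartz property then needs one bound for the whole family.\<close>

definition gaussian_poly :: "real => real^'n::finite => (real => complex^'n => complex) => real^'n => complex" where
 "gaussian_poly s a f x = f 1 (cvec x) * of_real (exp (- (s * ((x - a) \<bullet> (x - a)))))"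

lemma gaussian_poly_has_derivative:
 assumes "cpoly f"
 shows "(gaussian_poly s a f has_derivative (%h. f 1 (cvec x) * of_real (exp (- (s * ((x - a) \<bullet> (x - a)))) * (- (2 * s * ((x - a) \<bullet> h))))
  + (\<Sum>j\<in>UNIV. of_real (h $ j) * pdif j f 1 (cvec x)) * of_real (exp (- (s * ((x - a) \<bullet> (x - a))))))) (at x)"
proof -
 have 1: "((%x. f 1 (cvec x)) has_derivative (%h. \<Sum>j\<in>UNIV. of_real (h $ j) * pdif j f 1 (cvec x))) (at x)"
  using has_derivative_compose[OF bounded_linear_imp_has_derivative[OF bounded_linear_cvec] cpoly_has_derivative[OF assms]] by simp
 have "((%x. exp (- (s * ((x - a) \<bullet> (x - a))))) has_derivative (%h. exp (- (s * ((x - a) \<bullet> (x - a)))) * (- (2 * s * ((x - a) \<bullet> h))))) (at x)"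
  by (auto intro!: derivative_eq_intros simp: fun_eq_iff inner_commute algebra_simps)
 from has_derivative_of_real[OF this]
 have 2: "((%x. of_real (exp (- (s * ((x - a) \<bullet> (x - a))))) :: complex) has_derivative
   (%h. of_real (exp (- (s * ((x - a) \<bullet> (x - a)))) * (- (2 * s * ((x - a) \<bullet> h)))))) (at x)" .
 show ?thesis unfolding gaussian_poly_def[abs_def] by (rule has_derivative_mult[OF 1 2])
qed

lemma gaussian_poly_partial:
 assumes "cpoly f"
 shows "\<exists>g. cpoly g \<and> partial_derivative i (gaussian_poly s a f) = gaussian_poly s a g"
proof (intro exI conjI)
 let ?g = "%ta z. pdif i f ta z + of_real (- (2 * s)) * ((z $ i + of_real (- (a $ i))) * f ta z)"
 show "cpoly ?g" by (intro cpoly.add cpoly.mult cpoly.const cpoly.coord cpoly_pdif assms)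
 show "partial_derivative i (gaussian_poly s a f) = gaussian_poly s a ?g"
 proof
  fix x
  have "(\<Sum>j\<in>UNIV. of_real (axis i 1 $ j) * pdif j f 1 (cvec x)) = (\<Sum>j\<in>UNIV. axis i 1 $ j * pdif j f 1 (cvec x))"
   by (intro sum.cong refl) (simp add: axis_def)
  then show "partial_derivative i (gaussian_poly s a f) x = gaussian_poly s a ?g x"
   unfolding partial_derivative_def frechet_derivative_at[OF gaussian_poly_has_derivative[OF assms], symmetric]
   by (simp add: sum_axis_mult inner_axis gaussian_poly_def algebra_simps)
 qed
qed

lemma gaussian_poly_foldr:
 "cpoly f ==> \<exists>g. cpoly g \<and> foldr partial_derivative is (gaussian_poly s a f) = gaussian_poly s a g"
 proof (induction "is")
 case (Cons i "is")
 then obtain g where g: "cpoly g" "foldr partial_derivative is (gaussian_poly s a f) = gaussian_poly s a g" by blast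
 then show ?case using gaussian_poly_partial[OF g(1), of i s a] by simp
qed auto

lemma cpoly_growth:
 assumes "cpoly f"
 shows "\<exists>M N. 0 <= M \<and> (\<forall>x. norm (f 1 (cvec x)) <= M * (1 + norm x) ^ N)"
 using assms
proof induction
 case (const c)
 show ?case by (rule exI[of _ "\<bar>c\<bar>"], rule exI[of _ 0]) simp
next
 case param
 show ?case by (rule exI[of _ 1], rule exI[of _ 0]) simp
next
 case (coord i)
 have "\<bar>x $ i\<bar> <= 1 + norm x" for x :: "real^'a" using component_le_norm_cart[of x i] by linarith
 then show ?case by (intro exI[of _ 1]) (auto intro!: exI[of _ 1])
next
 case (add f g)
 then obtain M N M' N' where h: "0 <= M" "\<And>x. norm (f 1 (cvec x)) <= M * (1 + norm x) ^ N" "0 <= M'" "\<And>x. norm (g 1 (cvec x)) <= M' * (1 + norm x) ^ N'"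
  by blast
 have "norm (f 1 (cvec x) + g 1 (cvec x)) <= (M + M') * (1 + norm x) ^ (N + N')" for x
 proof -
  have "M * (1 + norm x) ^ N <= M * (1 + norm x) ^ (N + N')" "M' * (1 + norm x) ^ N' <= M' * (1 + norm x) ^ (N + N')"
   using h by (auto intro!: mult_left_mono power_increasing)
  then show ?thesis using h(2)[of x] h(4)[of x] norm_triangle_ineq[of "f 1 (cvec x)" "g 1 (cvec x)"] by (simp add: distrib_right)
 qed
 then show ?case using h by (intro exI[of _ "M + M'"]) auto
next
 case (mult f g)
 then obtain M N M' N' where h: "0 <= M" "\<And>x. norm (f 1 (cvec x)) <= M * (1 + norm x) ^ N" "0 <= M'" "\<And>x. norm (g 1 (cvec x)) <= M' * (1 + norm x) ^ N'"
  by blast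
 have "norm (f 1 (cvec x) * g 1 (cvec x)) <= (M * M') * (1 + norm x) ^ (N + N')" for x
  using mult_mono[OF h(2)[of x] h(4)[of x]] h by (simp add: norm_mult power_add mult_ac)
 then show ?case using h by (intro exI[of _ "M * M'"]) auto
qed

lemma gaussian_poly_bounded:
 assumes "cpoly f" and s: "0 < s"
 shows "bounded (range (%x :: real^'n::finite. (1 + norm x) ^ k *\<^sub>R gaussian_poly s a f x))"
proof -
 obtain M N where M: "0 <= M" "\<And>x. norm (f 1 (cvec x)) <= M * (1 + norm x) ^ N" using cpoly_growth[OF assms(1)] by blast
 define L where "L = real (k + N)"
 have "norm ((1 + norm x) ^ k *\<^sub>R gaussian_poly s a f x) <= M * (exp (L * norm a) * exp (L\<^sup>2 / (4 * s)))" for x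
 proof -
  define u where "u = norm (x - a)"
  have "norm ((1 + norm x) ^ k *\<^sub>R gaussian_poly s a f x) = (1 + norm x) ^ k * (norm (f 1 (cvec x)) * exp (- (s * u\<^sup>2)))"
   unfolding gaussian_poly_def u_def power2_norm_eq_inner by (simp add: norm_mult norm_power)
  also have "... <= (1 + norm x) ^ k * (M * (1 + norm x) ^ N * exp (- (s * u\<^sup>2)))"
   by (intro mult_left_mono mult_right_mono M) auto
  also have "... = M * ((1 + norm x) ^ (k + N) * exp (- (s * u\<^sup>2)))" by (simp add: power_add mult_ac)
  also have "... <= M * (exp (norm x) ^ (k + N) * exp (- (s * u\<^sup>2)))"
   using M(1) exp_ge_add_one_self[of "norm x"] by (intro mult_left_mono mult_right_mono power_mono) auto
  also have "exp (norm x) ^ (k + N) * exp (- (s * u\<^sup>2)) = exp (L * norm x - s * u\<^sup>2)"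
   by (simp add: L_def exp_of_nat_mult[symmetric] exp_add[symmetric])
  also have "L * norm x - s * u\<^sup>2 <= L * norm a + L\<^sup>2 / (4 * s)"
  proof -
   have "norm x <= norm a + u" unfolding u_def using norm_triangle_sub[of x a] by simp
   then have "L * norm x <= L * norm a + L * u" by (simp add: L_def distrib_left[symmetric] mult_left_mono)
   moreover have "0 <= s * (u - L / (2 * s))\<^sup>2" using s by simp
   moreover have "s * (u - L / (2 * s))\<^sup>2 = s * u\<^sup>2 - L * u + L\<^sup>2 / (4 * s)"
    using s by (simp add: power2_diff power2_eq_square algebra_simps)
   ultimately show ?thesis by linarith
  qed
  finally show ?thesis using M(1) by (simp add: exp_add mult_left_mono)
 qed
 then show ?thesis unfolding bounded_iff by blast
qed

lemma schwartz_gaussian: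
 fixes a :: "real^'n::finite"
 assumes "0 < s"
 shows "schwartz (%x. of_real (exp (- (s * (norm (x - a))\<^sup>2))))"
proof -
 have "(%x. of_real (exp (- (s * (norm (x - a))\<^sup>2)))) = gaussian_poly s a (%ta z. of_real 1)"
  by (simp add: gaussian_poly_def fun_eq_iff power2_norm_eq_inner)
 moreover have "schwartz (gaussian_poly s a (%ta z. of_real 1))"
  unfolding schwartz_def
 proof (intro conjI allI)
  fix "is" x k
  obtain g where g: "cpoly g" "foldr partial_derivative is (gaussian_poly s a (%ta z. of_real 1)) = gaussian_poly s a g"
   using gaussian_poly_foldr[OF cpoly.const[of 1]] by blast
  show "foldr partial_derivative is (gaussian_poly s a (%ta z. of_real 1)) differentiable at x"
   unfolding g(2) differentiable_def using gaussian_poly_has_derivative[OF g(1)] by blast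
  show "bounded (range (%x. (1 + norm x) ^ k *\<^sub>R foldr partial_derivative is (gaussian_poly s a (%ta z. of_real 1)) x))"
   unfolding g(2) by (rule gaussian_poly_bounded[OF g(1) assms])
 qed
 ultimately show ?thesis by simp
qed

text \<open>
  Test against \<open>exp (- s |x - a|\<^sup>2)\<close> and let \<open>s\<close> grow: what lies outside a ball around \<open>a\<close> becomes
  exponentially smaller than the contribution of a concentric ball of half the radius.
\<close>

lemma continuous_weakly_zero:
 fixes h :: "real^'n::finite => complex"
 assumes cont: "continuous_on UNIV h"
  and weak: "\<And>fi. schwartz fi ==> integrable lborel (%x. h x * fi x) \<and> (\<integral>x. h x * fi x \<partial>lborel) = 0"
 shows "h a = 0"
proof (rule ccontr)
 assume ha: "h a ~= 0"
 \<comment> \<open>A real function with the same vanishing property that is positive at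
   \<open>a\<close>.\<close>
 define G where "G = (%x. Re (cnj (h a) * h x))"
 have Ga: "0 < G a" using ha by (simp add: G_def complex_eq_iff sum_power2_gt_zero_iff power2_eq_square[symmetric])
 have Gc: "continuous_on UNIV G" unfolding G_def by (intro continuous_intros cont)
 then have "isCont G a" by (simp add: continuous_on_eq_continuous_at)
 then obtain de where de: "0 < de" "\<And>x. dist x a < de ==> dist (G x) (G a) < G a / 2"
  using Ga unfolding continuous_at_eps_delta by (metis half_gt_zero)
 define c where "c = G a / 2"
 have c: "0 < c" "\<And>x. norm (x - a) < de ==> c <= G x"
  using Ga de(2) by (auto simp: c_def dist_norm dist_real_def abs_if split: if_splits) (smt (verit, best) field_sum_of_halves)
 define E where "E = (%s x. exp (- (s * (norm (x - a))\<^sup>2)))"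
 have [measurable]: "G \<in> borel_measurable borel" using Gc by (rule borel_measurable_continuous_onI)
 have GE: "integrable lborel (%x. G x * E s x)" "(\<integral>x. G x * E s x \<partial>lborel) = 0" if "0 < s" for s
 proof -
  note w = weak[OF schwartz_gaussian[OF that, of a]]
  have eq: "G x * E s x = Re (cnj (h a) * (h x * of_real (E s x)))" for x by (simp add: G_def algebra_simps)
  have i: "integrable lborel (%x. cnj (h a) * (h x * of_real (E s x)))"
   using w unfolding E_def by (intro integrable_mult_right) blast
  then show "integrable lborel (%x. G x * E s x)" unfolding eq by (rule integrable_Re)
  have "(\<integral>x. G x * E s x \<partial>lborel) = Re (\<integral>x. cnj (h a) * (h x * of_real (E s x)) \<partial>lborel)"
   unfolding eq by (rule integral_Re[OF i])
  also have "... = 0" using w unfolding E_def by simp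
  finally show "(\<integral>x. G x * E s x \<partial>lborel) = 0" .
 qed
 define V where "V = measure lborel (ball a (de / 2))"
 have V: "0 < V" unfolding V_def using de(1) by (simp add: content_ball_pos)
 define J where "J = (\<integral>x. \<bar>G x\<bar> * E 1 x \<partial>lborel)"
 have Jint: "integrable lborel (%x. \<bar>G x\<bar> * E 1 x)"
  using integrable_abs[OF GE(1)[of 1]] by (simp add: abs_mult E_def)
 have key: "c * V * exp (- (s * (de / 2)\<^sup>2)) <= exp (- ((s - 1) * de\<^sup>2)) * J" if s: "1 <= s" for s
 proof -
  have pw: "c * exp (- (s * (de / 2)\<^sup>2)) * indicator (ball a (de / 2)) x <= G x * E s x + exp (- ((s - 1) * de\<^sup>2)) * (\<bar>G x\<bar> * E 1 x)" for x
  proof (cases "norm (x - a) < de")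
   case True
   have "c * exp (- (s * (de / 2)\<^sup>2)) * indicator (ball a (de / 2)) x <= G x * E s x"
   proof (cases "x \<in> ball a (de / 2)")
    case in_ball: True
    then have "(norm (x - a))\<^sup>2 <= (de / 2)\<^sup>2" by (intro power_mono) (auto simp: dist_norm norm_minus_commute)
    then have "exp (- (s * (de / 2)\<^sup>2)) <= E s x" using s by (simp add: E_def mult_left_mono)
    then show ?thesis using c(2)[OF True] c(1) in_ball by (simp add: mult_mono)
   next
    case False
    then show ?thesis using c(2)[OF True] c(1) by (simp add: E_def)
   qed
   then show ?thesis by (rule order_trans) (simp add: E_def)
  next
   case False
   then have "de\<^sup>2 <= (norm (x - a))\<^sup>2" using de(1) by (intro power_mono) auto
   then have "(s - 1) * de\<^sup>2 <= (s - 1) * (norm (x - a))\<^sup>2" using s by (intro mult_left_mono) auto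
   then have "E s x <= exp (- ((s - 1) * de\<^sup>2)) * E 1 x"
    unfolding E_def exp_add[symmetric] by (simp add: algebra_simps)
   then have "\<bar>G x\<bar> * E s x <= exp (- ((s - 1) * de\<^sup>2)) * (\<bar>G x\<bar> * E 1 x)"
    using mult_left_mono[of "E s x" "exp (- ((s - 1) * de\<^sup>2)) * E 1 x" "\<bar>G x\<bar>"] by (simp add: mult_ac)
   moreover have "- (\<bar>G x\<bar> * E s x) <= G x * E s x"
    using mult_right_mono[of "- \<bar>G x\<bar>" "G x" "E s x"] by (simp add: E_def)
   moreover have "x \<notin> ball a (de / 2)" using False de(1) by (auto simp: dist_norm norm_minus_commute)
   ultimately show ?thesis by simp
  qed
  have "(\<integral>x. c * exp (- (s * (de / 2)\<^sup>2)) * indicator (ball a (de / 2)) x \<partial>lborel)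
    <= (\<integral>x. G x * E s x + exp (- ((s - 1) * de\<^sup>2)) * (\<bar>G x\<bar> * E 1 x) \<partial>lborel)"
   using GE(1)[of s] Jint s pw emeasure_bounded_finite[OF bounded_ball, of a "de / 2"]
   by (intro integral_mono integrable_add integrable_mult_right integrable_real_indicator) auto
  also have "... = exp (- ((s - 1) * de\<^sup>2)) * J"
   using GE[of s] Jint s by (simp add: J_def)
  finally show ?thesis by (simp add: V_def mult_ac)
 qed
 define d where "d = 3 / 4 * de\<^sup>2"
 have d: "0 < d" using de(1) by (simp add: d_def)
 have "c * V * exp (s * d) <= exp (de\<^sup>2) * J" if "1 <= s" for s
 proof -
  have "c * V * exp (s * d) = c * V * exp (- (s * (de / 2)\<^sup>2)) * exp (s * de\<^sup>2)"
   by (simp add: d_def exp_add[symmetric] power_divide algebra_simps)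
  also have "... <= exp (- ((s - 1) * de\<^sup>2)) * J * exp (s * de\<^sup>2)" by (intro mult_right_mono key that) auto
  also have "... = (exp (- ((s - 1) * de\<^sup>2)) * exp (s * de\<^sup>2)) * J" by simp
  also have "... = exp (de\<^sup>2) * J" unfolding exp_add[symmetric] by (simp add: algebra_simps)
  finally show ?thesis .
 qed
 \<comment> \<open>From this value on, \<open>s * d < exp (s * d)\<close> makes the growing side
   exceed the fixed bound.\<close>
 moreover define s where "s = max 1 (exp (de\<^sup>2) * J / (c * V * d))"
 moreover have "exp (de\<^sup>2) * J < c * V * exp (s * d)"
 proof -
  have "exp (de\<^sup>2) * J / (c * V * d) <= s" by (simp add: s_def)
  then have "exp (de\<^sup>2) * J <= c * V * (s * d)" using c V d by (simp add: pos_divide_le_eq mult_ac)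
  also have "... < c * V * exp (s * d)"
   using exp_ge_add_one_self[of "s * d"] by (intro mult_strict_left_mono mult_pos_pos c(1) V) linarith
  finally show ?thesis .
 qed
 ultimately show False by (metis max.cobounded1 not_le)
qed

text \<open>The definite description in \<open>I2\<close> is evaluated by exhibiting one continuous
  candidate: two of them differ by a continuous function whose integrals against all Schwartz
  functions vanish.\<close>

lemma I2_eqI:
 assumes "continuous_on UNIV g" "is_distributional_inverse_fourier (I2_symbol \<sigma> P t) g"
 shows "I2 \<sigma> P t = g"
 unfolding I2_def
proof (rule the_equality)
 fix g' assume g': "continuous_on UNIV g' \<and> is_distributional_inverse_fourier (I2_symbol \<sigma> P t) g'"
 have "g' a - g a = 0" for a
 proof (rule continuous_weakly_zero[where h = "%x. g' x - g x"])
  show "continuous_on UNIV (%x. g' x - g x)" using assms g' by (intro continuous_intros) auto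
  fix fi :: "real^'a => complex" assume "schwartz fi"
  then show "integrable lborel (%x. (g' x - g x) * fi x) \<and> (\<integral>x. (g' x - g x) * fi x \<partial>lborel) = 0"
   using assms(2) g' unfolding is_distributional_inverse_fourier_def by (simp add: left_diff_distrib)
 qed
 then show "g' = g" by (simp add: fun_eq_iff)
qed (use assms in auto)

lemma integral_lborel_scale:
 fixes f :: "'a::euclidean_space => complex"
 assumes [measurable]: "f \<in> borel_measurable borel" and c: "0 < c"
 shows "(\<integral>x. f x \<partial>lborel) = of_real (c ^ DIM('a)) * (\<integral>x. f (c *\<^sub>R x) \<partial>lborel)"
proof -
 have "(\<integral>x. f x \<partial>lborel) = (\<integral>x. f x \<partial>density (distr lborel borel (%x. 0 + c *\<^sub>R x)) (%_. ennreal (\<bar>c\<bar> ^ DIM('a))))"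
  using lborel_affine[of c "0 :: 'a"] c by (simp add: ennreal_power[symmetric])
 also have "... = (\<integral>x. c ^ DIM('a) *\<^sub>R f x \<partial>distr lborel borel (%x. 0 + c *\<^sub>R x))"
  using c by (subst integral_density) auto
 also have "... = (\<integral>x. c ^ DIM('a) *\<^sub>R f (c *\<^sub>R x) \<partial>lborel)" by (subst integral_distr) auto
 finally show ?thesis by (simp add: scaleR_conv_of_real)
qed

section \<open>The uniform bound, removal of the regularisation, and small times\<close>

context elliptic_estimates
begin

text \<open>Both regimes are expressed by one formula. For bounded
  \<open>norm y / \<bar>t\<bar>\<close> the factor with exponent \<open>- \<mu>\<close> is bounded
  below by a constant. Otherwise the large-distance estimate has exactly the exponent
  \<open>- \<mu>\<close> in space and \<open>- n / 2\<close> in time, and the latter is stronger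
  than required for \<open>\<bar>t\<bar> \<ge> 1\<close>.\<close>

lemma Jint_bound:
 assumes mu: "\<mu> = (real CARD('n) * (real q - 2) / 2 + real q) / (real q - 1)"
 obtains K where "0 < K"
  "\<And>ta t ep (y :: real^'n). 0 < ta ==> ta <= 1 ==> 1 <= \<bar>t\<bar> ==> ta = 1 \<or> \<bar>t\<bar> = 1 ==> 0 < ep ==> ep <= 1 ==>
    norm (Jint ta t ep y) <= K * \<bar>t\<bar> powr (- (1 / real (2 * q))) * (1 + norm y / \<bar>t\<bar>) powr (- \<mu>)"
proof -
 define n where "n = real CARD('n)"
 obtain R0 K1 where large: "1 <= R0" "0 < K1"
  "\<And>ta t ep (y :: real^'n) R. 0 < ta ==> ta <= 1 ==> 1 <= \<bar>t\<bar> ==> 0 < ep ==> ep <= 1 ==> R0 <= R ==> norm y = \<bar>t\<bar> * R ^ (q - 1) ==>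
    norm (Jint ta t ep y) <= K1 * ((1 / sqrt (\<bar>t\<bar> * R ^ (q - 2))) ^ CARD('n) / R ^ q)"
  by (rule Jint_large) blast
 obtain K2 where small: "0 < K2"
  "\<And>ta t ep (y :: real^'n). 0 < ta ==> ta <= 1 ==> 1 <= \<bar>t\<bar> ==> ta = 1 \<or> \<bar>t\<bar> = 1 ==> 0 < ep ==> ep <= 1 ==> norm y <= \<bar>t\<bar> * R0 ^ (q - 1) ==>
    norm (Jint ta t ep y) <= K2 * \<bar>t\<bar> powr (- (1 / real (2 * q)))"
  by (rule Jint_small[OF large(1)]) blast
 define W where "W = 1 + R0 ^ (q - 1)"
 have W: "0 < W" unfolding W_def using large(1) by (intro add_pos_nonneg) auto
 have q: "0 < real q - 1" "0 <= real q - 2" using q2 by auto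
 have mu0: "0 <= \<mu>" unfolding mu using q by (intro divide_nonneg_nonneg add_nonneg_nonneg mult_nonneg_nonneg) auto
 define K where "K = K2 * W powr \<mu> + K1 * 2 powr \<mu>"
 have K: "0 <= K2 * W powr \<mu>" "0 <= K1 * 2 powr \<mu>" using large(2) small(1) by auto
 show thesis
 proof (rule that[of K])
  show "0 < K" unfolding K_def using large(2) small(1) W by (intro add_pos_pos mult_pos_pos) auto
  fix ta t ep :: real and y :: "real^'n"
  assume ta: "0 < ta" "ta <= 1" and t: "1 <= \<bar>t\<bar>" "ta = 1 \<or> \<bar>t\<bar> = 1" and ep: "0 < ep" "ep <= 1"
  define L where "L = \<bar>t\<bar> powr (- (1 / real (2 * q)))"
  have L: "0 <= L" by (simp add: L_def)
  define s where "s = norm y / \<bar>t\<bar>"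
  have s0: "0 <= s" by (simp add: s_def)
  have ys: "norm y = \<bar>t\<bar> * s" using t by (auto simp: s_def)
  define D where "D = (1 + s) powr (- \<mu>)"
  have D: "0 <= D" by (simp add: D_def)
  have "norm (Jint ta t ep y) <= K * L * D"
  proof (cases "s <= R0 ^ (q - 1)")
   case True
   then have "norm y <= \<bar>t\<bar> * R0 ^ (q - 1)" unfolding ys using t by (intro mult_left_mono) auto
   then have "norm (Jint ta t ep y) <= K2 * L * 1" unfolding L_def using small(2)[OF ta t ep] by simp
   also have "... <= K2 * L * (W powr \<mu> * D)"
   proof (rule mult_left_mono)
    have "(1 + s) powr \<mu> <= W powr \<mu>" unfolding W_def using True s0 mu0 by (intro powr_mono2) auto
    then have "(1 + s) powr \<mu> * D <= W powr \<mu> * D" using D by (rule mult_right_mono)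
    moreover have "(1 + s) powr \<mu> * D = 1" unfolding D_def using s0 by (simp add: powr_add[symmetric])
    ultimately show "1 <= W powr \<mu> * D" by simp
   qed (use small(1) L in auto)
   also have "... = (K2 * W powr \<mu>) * (L * D)" by (simp only: mult_ac)
   also have "... <= K * (L * D)" unfolding K_def using K L D by (intro mult_right_mono) auto
   finally show ?thesis by (simp only: mult.assoc)
  next
   case False
   have R01: "1 <= R0 ^ (q - 1)" using large(1) by (rule one_le_power)
   then have s1: "1 <= s" using False by simp
   \<comment> \<open>The frequency at which the gradient of the phase can balance \<open>y\<close>,
     determined by \<open>norm y = \<bar>t\<bar> * R ^ (q - 1)\<close>.\<close>
   define R where "R = s powr (1 / (real q - 1))"
   have R: "1 <= R" unfolding R_def using s1 q by (intro ge_one_powr_ge_zero) auto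
   have Rpow: "R powr a = s powr (a / (real q - 1))" for a unfolding R_def powr_powr by simp
   have Rn: "R ^ k = R powr real k" for k using R by (simp add: powr_realpow)
   have Rq: "R ^ (q - 1) = s" unfolding Rn Rpow using q2 s1 by (simp add: of_nat_diff)
   have "R0 <= R"
   proof (rule ccontr)
    assume "\<not> R0 <= R"
    then have "R ^ (q - 1) <= R0 ^ (q - 1)" using R by (intro power_mono) auto
    then show False using False unfolding Rq by simp
   qed
   then have "norm (Jint ta t ep y) <= K1 * ((1 / sqrt (\<bar>t\<bar> * R ^ (q - 2))) ^ CARD('n) / R ^ q)"
    by (intro large(3) ta t(1) ep) (simp_all only: Rq ys)
   also have "(1 / sqrt (\<bar>t\<bar> * R ^ (q - 2))) ^ CARD('n) / R ^ q = \<bar>t\<bar> powr (- (n / 2)) * s powr (- \<mu>)"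
   proof -
    define X where "X = \<bar>t\<bar> * R ^ (q - 2)"
    have X: "0 < X" unfolding X_def using t R by (intro mult_pos_pos) auto
    have "(1 / sqrt X) ^ CARD('n) = (X powr (- (1 / 2))) ^ CARD('n)"
     using X by (simp add: powr_minus_divide powr_half_sqrt)
    also have "... = X powr (- (n / 2))" using X by (simp add: powr_power n_def)
    also have "... = \<bar>t\<bar> powr (- (n / 2)) * (R powr (real q - 2)) powr (- (n / 2))"
     unfolding X_def Rn using q2 by (subst powr_mult) (auto simp: of_nat_diff)
    also have "(R powr (real q - 2)) powr (- (n / 2)) = R powr (- (n * (real q - 2) / 2))"
     unfolding powr_powr by (simp add: mult_ac)
    finally have 1: "(1 / sqrt X) ^ CARD('n) = \<bar>t\<bar> powr (- (n / 2)) * R powr (- (n * (real q - 2) / 2))" .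
    have "R powr (- (n * (real q - 2) / 2)) / R ^ q = R powr (- (n * (real q - 2) / 2 + real q))"
     unfolding Rn by (simp add: powr_diff[symmetric])
    also have "... = s powr (- \<mu>)" unfolding Rpow mu n_def by (simp only: minus_divide_left)
    finally have 2: "R powr (- (n * (real q - 2) / 2)) / R ^ q = s powr (- \<mu>)" .
    show ?thesis unfolding 1[unfolded X_def] 2[symmetric] by simp
   qed
   also have "K1 * (\<bar>t\<bar> powr (- (n / 2)) * s powr (- \<mu>)) <= K1 * (L * (2 powr \<mu> * D))"
   proof (intro mult_left_mono mult_mono)
    have "1 / real (2 * q) <= n / 2"
    proof -
     have "1 / real (2 * q) <= 1 / 2" using q2 by (intro divide_left_mono) auto
     also have "... <= n / 2" using qn q2 by (simp add: n_def)
     finally show ?thesis .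
    qed
    then show "\<bar>t\<bar> powr (- (n / 2)) <= L" unfolding L_def using t by (intro powr_mono) auto
    have "s powr (- \<mu>) <= ((1 + s) / 2) powr (- \<mu>)" using s1 mu0 by (intro powr_mono2') auto
    also have "... = 2 powr \<mu> * D" unfolding D_def using s1 by (simp add: powr_divide powr_minus_divide)
    finally show "s powr (- \<mu>) <= 2 powr \<mu> * D" .
   qed (use large(2) L in auto)
   also have "... = (K1 * 2 powr \<mu>) * (L * D)" by (simp only: mult_ac)
   also have "... <= K * (L * D)" unfolding K_def using K L D by (intro mult_right_mono) auto
   finally show ?thesis by (simp only: mult.assoc)
  qed
  then show "norm (Jint ta t ep y) <= K * \<bar>t\<bar> powr (- (1 / real (2 * q))) * (1 + norm y / \<bar>t\<bar>) powr (- \<mu>)"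
   unfolding L_def D_def s_def .
 qed
qed

lemma osc_tendsto:
 fixes f :: "_ => real"
 assumes "0 < ta" "(f \<longlongrightarrow> ep) F" "(h \<longlongrightarrow> y) F"
 shows "((%i. osc ta t (f i) (h i) (cvec et)) \<longlongrightarrow> osc ta t ep y (cvec et)) F"
proof -
 have "fir ta et ~= 0" using fir_pos[of ta et] assms(1) by (simp add: add_pos_nonneg)
 then show ?thesis unfolding osc_cvec[OF less_imp_le[OF assms(1)]] using assms(2,3) by (auto intro!: tendsto_intros)
qed

lemma packet_tendsto:
 assumes "0 < ta" "0 < r" "\<And>i. 0 <= f i" "f \<longlonglongrightarrow> ep" "h \<longlonglongrightarrow> y"
 shows "(%i. packet ta t (f i) r (h i) ze) \<longlonglongrightarrow> packet ta t ep r y ze"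
 unfolding packet_def
proof (rule integral_dominated_convergence[where w = "%et. C / ta ^ q * exp (- ((norm (et - ze))\<^sup>2 / r\<^sup>2))"])
 have m: "(%et. osc ta t ep y (cvec et) * gauss r ze (cvec et)) \<in> borel_measurable lborel" for ep y
  using osc_measurable[OF assms(1), of t ep y] unfolding gauss_cvec by measurable
 show "(%et. osc ta t ep y (cvec et) * gauss r ze (cvec et)) \<in> borel_measurable lborel"
  "(%et. osc ta t (f i) (h i) (cvec et) * gauss r ze (cvec et)) \<in> borel_measurable lborel" for i by (rule m)+
 show "integrable lborel (%et. C / ta ^ q * exp (- ((norm (et - ze))\<^sup>2 / r\<^sup>2)))"
  by (intro integrable_mult_right integrableI_bounded) (use nn_integral_gaussian_vec[OF assms(2), of ze] in auto)
 show "AE et in lborel. (%i. osc ta t (f i) (h i) (cvec et) * gauss r ze (cvec et)) \<longlonglongrightarrow> osc ta t ep y (cvec et) * gauss r ze (cvec et)"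
  by (intro AE_I2 tendsto_mult tendsto_const osc_tendsto assms)
 show "AE et in lborel. norm (osc ta t (f i) (h i) (cvec et) * gauss r ze (cvec et)) <= C / ta ^ q * exp (- ((norm (et - ze))\<^sup>2 / r\<^sup>2))" for i
  unfolding gauss_cvec norm_mult norm_of_real abs_exp_cancel by (intro AE_I2 mult_right_mono osc_bounded assms) auto
qed

text \<open>The crude bound on a ball and the exponential decay outside form a majorant in the
  centre that depends neither on \<open>ep\<close> nor on \<open>y\<close> within the given range.
  The packets are therefore absolutely integrable over the centres even for
  \<open>ep = 0\<close>.\<close>

lemma packet_integral_tendsto:
 assumes ta: "0 < ta" "ta <= 1" and t: "1 <= \<bar>t\<bar>" and R: "1 <= R" and r: "r = 1 / sqrt (\<bar>t\<bar> * R ^ (q - 2))"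
  and f: "\<And>i. 0 <= f i" "\<And>i. f i <= 1" "f \<longlonglongrightarrow> ep" and h: "\<And>i. norm (h i) <= \<bar>t\<bar> * R ^ (q - 1)" "h \<longlonglongrightarrow> y"
 shows "(%i. \<integral>ze. packet ta t (f i) r (h i) ze \<partial>lborel) \<longlonglongrightarrow> (\<integral>ze. packet ta t ep r y ze \<partial>lborel)"
proof -
 note r' = inverse_sqrt_scale[OF t R r]
 obtain C' K c where hi: "1 <= C'" "0 < K" "0 < c"
  "\<And>ta t ep (y :: real^'n) R r ze. 0 < ta ==> ta <= 1 ==> 1 <= \<bar>t\<bar> ==> 0 <= ep ==> ep <= 1 ==> 1 <= R ==> norm y <= \<bar>t\<bar> * R ^ (q - 1) ==>
    r = 1 / sqrt (\<bar>t\<bar> * R ^ (q - 2)) ==> C' * R <= norm ze ==>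
    norm (packet ta t ep r y ze) <= K * r ^ CARD('n) / R ^ q * exp (- (c * norm ze / r))"
  by (rule packet_high_decay) blast
 define a b where "a = C * (4 + sqrt pi) ^ CARD('n) * r ^ (CARD('n) - q)" and "b = K * r ^ CARD('n) / R ^ q"
 have ab: "0 <= a" "0 <= b" unfolding a_def b_def using C1 r' R hi by auto
 show ?thesis
 proof (rule integral_dominated_convergence[where w = "%ze. a * indicator (cball 0 (C' * R)) ze + b * exp (- (c / r * norm (ze - 0)))"])
  have "integrable lborel (%ze :: real^'n. exp (- (c / r * norm (ze - 0))))"
  proof (rule integrableI_bounded)
   have "(\<integral>\<^sup>+ze. norm (exp (- (c / r * norm (ze - (0 :: real^'n))))) \<partial>lborel) <= ennreal ((2 * real CARD('n) / (c / r)) ^ CARD('n))"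
    using nn_integral_exp_norm[of "c / r" "0 :: real^'n"] hi r' by simp
   also have "... < \<infinity>" by simp
   finally show "(\<integral>\<^sup>+ze. norm (exp (- (c / r * norm (ze - (0 :: real^'n))))) \<partial>lborel) < \<infinity>" .
  qed measurable
  then show "integrable lborel (%ze :: real^'n. a * indicator (cball 0 (C' * R)) ze + b * exp (- (c / r * norm (ze - 0))))"
   using emeasure_bounded_finite[OF bounded_cball, of "0 :: real^'n" "C' * R"]
   by (intro Bochner_Integration.integrable_add Bochner_Integration.integrable_mult_right integrable_real_indicator) auto
  show "AE ze in lborel. (%i. packet ta t (f i) r (h i) ze) \<longlonglongrightarrow> packet ta t ep r y ze"
   by (intro AE_I2 packet_tendsto ta r' f h)
  fix i
  show "AE ze in lborel. norm (packet ta t (f i) r (h i) ze) <= a * indicator (cball 0 (C' * R)) ze + b * exp (- (c / r * norm (ze - 0)))"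
  proof (rule AE_I2)
   fix ze :: "real^'n"
   show "norm (packet ta t (f i) r (h i) ze) <= a * indicator (cball 0 (C' * R)) ze + b * exp (- (c / r * norm (ze - 0)))"
   proof (cases "norm ze <= C' * R")
    case True
    have "norm (packet ta t (f i) r (h i) ze) <= a" unfolding a_def by (rule packet_crude[OF ta(1) f(1) r'(1)])
    then show ?thesis using True ab by (simp add: add_increasing2)
   next
    case False
    then show ?thesis using hi(4)[OF ta t f(1,2) R h(1) r, of ze i i] ab by (simp add: b_def)
   qed
  qed
 qed (use packet_measurable[OF ta(1)] in auto)
qed

text \<open>The original integral need not converge absolutely without damping, but its packet
  decomposition does. For a fixed width the limit is continuous in \<open>y\<close> on a ball; the
  widths for different balls give the same limit by uniqueness, which yields continuity
  everywhere.\<close>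

lemma Jint_limit:
 assumes ta: "0 < ta" "ta <= 1" and t: "1 <= \<bar>t\<bar>"
 obtains g where "continuous_on UNIV g" "\<And>y :: real^'n. ((%ep. Jint ta t ep y) \<longlongrightarrow> g y) (at_right 0)"
proof -
 define r where "r = (%R. 1 / sqrt (\<bar>t\<bar> * R ^ (q - 2)))"
 define G where "G = (%R y. (\<integral>ze. packet ta t 0 (r R) y ze \<partial>lborel) / of_real ((sqrt pi * r R) ^ CARD('n)))"
 have mass: "(sqrt pi * r R) ^ CARD('n) ~= 0" if "1 <= R" for R 
 proof -
  have "0 < r R" unfolding r_def by (rule inverse_sqrt_scale(1)[OF t that refl])
  then show ?thesis by simp
 qed
 have le: "norm y <= \<bar>t\<bar> * (1 + B) ^ (q - 1)" if "norm y <= B" for y :: "real^'n" and B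
 proof -
  have B: "1 <= 1 + B" using that norm_ge_zero[of y] by linarith
  have "norm y <= (1 + B) ^ 1" using that by simp
  also have "... <= (1 + B) ^ (q - 1)" using q2 by (intro power_increasing B) auto
  also have "... = 1 * (1 + B) ^ (q - 1)" by simp
  also have "... <= \<bar>t\<bar> * (1 + B) ^ (q - 1)" using t B by (intro mult_right_mono) auto
  finally show ?thesis .
 qed
 have lim: "((%ep. Jint ta t ep y) \<longlongrightarrow> G (1 + B) y) (at_right 0)" if y: "norm y <= B" for y B
 proof (rule tendsto_at_right_sequentially[of 0 1])
  have B: "1 <= 1 + B" using y norm_ge_zero[of y] by linarith
  have rp: "0 < r (1 + B)" unfolding r_def by (rule inverse_sqrt_scale(1)[OF t B refl])
  fix S :: "nat => real" assume S: "\<And>n. 0 < S n" "\<And>n. S n < 1" "S \<longlonglongrightarrow> 0"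
  have "(%i. (\<integral>ze. packet ta t (S i) (r (1 + B)) y ze \<partial>lborel) / of_real ((sqrt pi * r (1 + B)) ^ CARD('n))) \<longlonglongrightarrow> G (1 + B) y"
   unfolding G_def using S less_imp_le mass[OF B]
   by (intro tendsto_divide tendsto_const packet_integral_tendsto[OF ta t B] le y) (auto simp: r_def intro: less_imp_le simp del: of_real_power)
  then show "(%i. Jint ta t (S i) y) \<longlonglongrightarrow> G (1 + B) y"
   using Jint_packets(2)[OF ta(1) S(1) rp] mass[OF B] by simp
 qed simp
 \<comment> \<open>The width is allowed to depend on \<open>y\<close> here; near any point it can be
   replaced by a common one, because \<open>G (1 + B) y\<close> takes the same value for every
   \<open>B\<close> with \<open>norm y \<le> B\<close>.\<close>
 define g where "g = (%y. G (1 + norm y) y)"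
 have gG: "g y = G (1 + B) y" if "norm y <= B" for y B
  unfolding g_def by (rule tendsto_unique[OF _ lim[OF order_refl] lim[OF that]]) simp
 show thesis
 proof (rule that[of g])
  show "((%ep. Jint ta t ep y) \<longlongrightarrow> g y) (at_right 0)" for y unfolding g_def by (rule lim[OF order_refl])
  show "continuous_on UNIV g"
  proof (intro continuous_at_imp_continuous_on ballI)
   fix y0
   show "isCont g y0"
    unfolding continuous_at_sequentially
   proof (intro allI impI)
    fix X assume X: "X \<longlonglongrightarrow> y0"
    obtain B where B: "0 < B" "\<And>i. norm (X i) <= B"
     using convergent_imp_bounded[OF X] unfolding bounded_pos by auto
    have B0: "norm y0 <= B" by (rule LIMSEQ_le_const2[OF tendsto_norm[OF X]]) (use B in auto)
    have B1: "1 <= 1 + B" using B by simp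
    have "(%i. G (1 + B) (X i)) \<longlonglongrightarrow> G (1 + B) y0"
     unfolding G_def using mass[OF B1]
     by (intro tendsto_divide tendsto_const packet_integral_tendsto[OF ta t B1] le B X) (auto simp: r_def simp del: of_real_power)
    then show "(g \<circ> X) \<longlonglongrightarrow> g y0" unfolding comp_def gG[OF B(2)] gG[OF B0] .
   qed
  qed
 qed
qed

text \<open>The substitution \<open>et / s\<close> with \<open>s ^ q = \<bar>t\<bar>\<close> moves
  the time into the parameter of the homogenised symbol and leaves only its sign. The Jacobian and
  the degree \<open>q\<close> of the denominator give the power of \<open>s\<close>.\<close>

lemma Jint_scale:
 assumes s: "0 < s" "\<bar>t\<bar> = s ^ q" and ep: "0 < ep"
 shows "Jint 1 t ep x = of_real (s ^ q / s ^ CARD('n)) * Jint s (sgn t) (ep / s\<^sup>2) ((1 / s) *\<^sub>R x)"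
proof -
 have t: "t = sgn t * s ^ q" using s(2) by (metis sgn_mult_abs)
 have "Jint 1 t ep x = of_real ((1 / s) ^ CARD('n)) * (\<integral>et. osc 1 t ep x (cvec ((1 / s) *\<^sub>R et)) \<partial>lborel)"
  unfolding Jint_def using s by (subst integral_lborel_scale[OF osc_measurable, of 1 "1 / s"]) auto
 also have "... = of_real ((1 / s) ^ CARD('n)) * (\<integral>et. of_real (s ^ q) * osc s (sgn t) (ep / s\<^sup>2) ((1 / s) *\<^sub>R x) (cvec et) \<partial>lborel)"
 proof (intro arg_cong2[where f = "(*)"] refl Bochner_Integration.integral_cong)
  fix et :: "real^'n"
  have "fir (1 / s * s) ((1 / s) *\<^sub>R et) = (1 / s) ^ q * fir s et" using s by (intro fir_homog) simp
  then have ph: "fir 1 ((1 / s) *\<^sub>R et) = fir s et / s ^ q" using s by (simp add: power_divide)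
  have "osc 1 t ep x (cvec ((1 / s) *\<^sub>R et)) = of_real (exp (- ep * (norm ((1 / s) *\<^sub>R et))\<^sup>2) / (fir s et / s ^ q))
    * cis (x \<bullet> ((1 / s) *\<^sub>R et) + t * (fir s et / s ^ q))"
   unfolding ph[symmetric] by (rule osc_cvec) simp
  also have "- ep * (norm ((1 / s) *\<^sub>R et))\<^sup>2 = - (ep / s\<^sup>2) * (norm et)\<^sup>2" by (simp add: power_divide)
  also have "x \<bullet> ((1 / s) *\<^sub>R et) + t * (fir s et / s ^ q) = ((1 / s) *\<^sub>R x) \<bullet> et + sgn t * fir s et"
   using s by (subst t) simp
  also have "exp (- (ep / s\<^sup>2) * (norm et)\<^sup>2) / (fir s et / s ^ q) = s ^ q * (exp (- (ep / s\<^sup>2) * (norm et)\<^sup>2) / fir s et)" by simp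
  finally show "osc 1 t ep x (cvec ((1 / s) *\<^sub>R et)) = of_real (s ^ q) * osc s (sgn t) (ep / s\<^sup>2) ((1 / s) *\<^sub>R x) (cvec et)"
   using osc_cvec[OF less_imp_le[OF s(1)], of "sgn t" "ep / s\<^sup>2" "(1 / s) *\<^sub>R x" et] by (simp add: mult.assoc)
 qed
 also have "... = of_real (s ^ q / s ^ CARD('n)) * Jint s (sgn t) (ep / s\<^sup>2) ((1 / s) *\<^sub>R x)"
  unfolding Jint_def by (simp add: power_divide)
 finally show ?thesis .
qed

definition dispersive_bound :: "real => real => real => real^'n => real" where
 "dispersive_bound \<mu> K t x = (if \<bar>t\<bar> <= 1
   then K * \<bar>t\<bar> powr (- ((real CARD('n) - real q) / real q)) * (1 + \<bar>t\<bar> powr (- (1 / real q)) * norm x) powr (- \<mu>)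
   else K * \<bar>t\<bar> powr (- (1 / real (2 * q))) * (1 + \<bar>t\<bar> powr (- 1) * norm x) powr (- \<mu>))"

text \<open>For small times the damping becomes \<open>ep / s^2\<close> after scaling, so the
  admissible range \<open>de = s^2\<close> of \<open>ep\<close> shrinks with \<open>t\<close>,
  whereas \<open>K\<close> does not depend on \<open>t\<close>. This is harmless because
  \<open>ep\<close> tends to 0 for fixed \<open>t\<close>.\<close>

lemma Jint_1_limit:
 assumes mu: "\<mu> = (real CARD('n) * (real q - 2) / 2 + real q) / (real q - 1)"
 obtains K where "0 < K"
  "\<And>t. t ~= 0 ==> \<exists>g de. 0 < de \<and> continuous_on UNIV g \<and> (\<forall>x. ((%ep. Jint 1 t ep x) \<longlongrightarrow> g x) (at_right 0)) \<and>
    (\<forall>x ep. 0 < ep --> ep <= de --> norm (Jint 1 t ep x) <= dispersive_bound \<mu> K t x)"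
proof -
 obtain K where K: "0 < K"
  "\<And>ta t ep (y :: real^'n). 0 < ta ==> ta <= 1 ==> 1 <= \<bar>t\<bar> ==> ta = 1 \<or> \<bar>t\<bar> = 1 ==> 0 < ep ==> ep <= 1 ==>
    norm (Jint ta t ep y) <= K * \<bar>t\<bar> powr (- (1 / real (2 * q))) * (1 + norm y / \<bar>t\<bar>) powr (- \<mu>)"
  by (rule Jint_bound[OF mu]) blast
 show thesis
 proof (rule that[OF K(1)])
  fix t :: real assume t0: "t ~= 0"
  show "\<exists>g de. 0 < de \<and> continuous_on UNIV g \<and> (\<forall>x. ((%ep. Jint 1 t ep x) \<longlongrightarrow> g x) (at_right 0)) \<and>
    (\<forall>x ep. 0 < ep --> ep <= de --> norm (Jint 1 t ep x) <= dispersive_bound \<mu> K t x)"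
  proof (cases "\<bar>t\<bar> <= 1")
   case False
   then have t: "1 <= \<bar>t\<bar>" by simp
   obtain g where "continuous_on UNIV g" "\<And>y :: real^'n. ((%ep. Jint 1 t ep y) \<longlongrightarrow> g y) (at_right 0)"
    using Jint_limit[of 1 t] t by auto
   moreover have "norm (Jint 1 t ep x) <= dispersive_bound \<mu> K t x" if "0 < ep" "ep <= 1" for x ep
    using K(2)[of 1 t ep x] False t that unfolding dispersive_bound_def by (simp add: powr_minus_divide)
   ultimately show ?thesis by (intro exI[of _ g] exI[of _ 1]) auto
  next
   case True
   define s where "s = \<bar>t\<bar> powr (1 / real q)"
   have s: "0 < s" "s <= 1" using t0 True q2 by (auto simp: s_def powr_le1)
   have sq: "\<bar>t\<bar> = s ^ q" using t0 q2 by (simp add: s_def powr_power)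
   have sg: "\<bar>sgn t\<bar> = 1" using t0 by (simp add: abs_sgn_eq)
   obtain g where g: "continuous_on UNIV g" "\<And>y :: real^'n. ((%ep. Jint s (sgn t) ep y) \<longlongrightarrow> g y) (at_right 0)"
    using Jint_limit[of s "sgn t"] s sg by auto
   define k where "k = s ^ q / s ^ CARD('n)"
   have k: "0 < k" using s by (simp add: k_def)
   define g' where "g' = (%x. of_real k * g ((1 / s) *\<^sub>R x))"
   have "continuous_on UNIV g'" unfolding g'_def
    by (intro continuous_intros continuous_on_compose2[OF g(1)]) auto
   moreover have "((%ep. Jint 1 t ep x) \<longlongrightarrow> g' x) (at_right 0)" for x
   proof -
    have "filterlim (%ep. ep / s\<^sup>2) (at_right 0) (at_right 0)"
     unfolding filterlim_at
    proof
     have "((%ep. ep / s\<^sup>2) \<longlongrightarrow> 0 / s\<^sup>2) (at_right 0)" using s by (intro tendsto_intros) auto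
     then show "((%ep. ep / s\<^sup>2) \<longlongrightarrow> 0) (at_right 0)" by simp
     show "\<forall>\<^sub>F ep in at_right 0. ep / s\<^sup>2 \<in> {0<..} \<and> ep / s\<^sup>2 ~= 0"
      using s by (intro eventually_at_rightI[of 0 1]) auto
    qed
    from filterlim_compose[OF g(2) this]
    have "((%ep. of_real k * Jint s (sgn t) (ep / s\<^sup>2) ((1 / s) *\<^sub>R x)) \<longlongrightarrow> g' x) (at_right 0)"
     unfolding g'_def by (intro tendsto_mult tendsto_const)
    moreover have "\<forall>\<^sub>F ep in at_right 0. of_real k * Jint s (sgn t) (ep / s\<^sup>2) ((1 / s) *\<^sub>R x) = Jint 1 t ep x"
     by (rule eventually_at_rightI[of 0 1]) (simp_all add: Jint_scale[OF s(1) sq] k_def)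
    ultimately show ?thesis by (rule Lim_transform_eventually)
   qed
   moreover have "norm (Jint 1 t ep x) <= dispersive_bound \<mu> K t x" if "0 < ep" "ep <= s\<^sup>2" for x ep
   proof -
    have e: "0 < ep / s\<^sup>2" "ep / s\<^sup>2 <= 1" using that s by auto
    have "norm (Jint 1 t ep x) = k * norm (Jint s (sgn t) (ep / s\<^sup>2) ((1 / s) *\<^sub>R x))"
     unfolding Jint_scale[OF s(1) sq that(1)] k_def[symmetric] norm_mult using k by simp
    also have "... <= k * (K * (1 + norm x / s) powr (- \<mu>))"
    proof (rule mult_left_mono)
     have "norm (Jint s (sgn t) (ep / s\<^sup>2) ((1 / s) *\<^sub>R x)) <= K * \<bar>sgn t\<bar> powr (- (1 / real (2 * q))) * (1 + norm ((1 / s) *\<^sub>R x) / \<bar>sgn t\<bar>) powr (- \<mu>)"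
      by (intro K(2) s e) (simp_all only: sg order_refl simp_thms)
     then show "norm (Jint s (sgn t) (ep / s\<^sup>2) ((1 / s) *\<^sub>R x)) <= K * (1 + norm x / s) powr (- \<mu>)"
      using s unfolding sg by simp
    qed (use k in simp)
    also have "k = \<bar>t\<bar> powr (- ((real CARD('n) - real q) / real q))"
     unfolding k_def s_def using t0 q2 by (simp add: powr_power powr_diff diff_divide_distrib)
    also have "norm x / s = \<bar>t\<bar> powr (- (1 / real q)) * norm x" unfolding s_def by (simp add: powr_minus_divide)
    finally show ?thesis using True unfolding dispersive_bound_def by (simp add: mult_ac)
   qed
   ultimately show ?thesis using s by (intro exI[of _ g'] exI[of _ "s\<^sup>2"]) auto
  qed
 qed
qed

end

context elliptic_estimates
begin

lemma osc_split: "0 <= ta ==> osc ta t ep y (cvec et) = osc ta t ep 0 (cvec et) * cis (y \<bullet> et)"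
 by (simp add: osc_cvec mult.assoc cis_mult add.commute)

text \<open>For \<open>ep > 0\<close> the identity is Fubini's theorem. The limit on the space side
  is dominated through the bound \<open>B\<close>, uniform in \<open>ep\<close> and
  \<open>x\<close>; on the frequency side through the boundedness of the symbol and the
  integrability of the transformed test function.\<close>

lemma osc_distribution:
 fixes g :: "real^'n => complex"
 assumes de: "0 < de" and cont: "continuous_on UNIV g"
  and lim: "\<And>x. ((%ep. Jint 1 t ep x) \<longlongrightarrow> g x) (at_right 0)"
  and bound: "\<And>x ep. 0 < ep ==> ep <= de ==> norm (Jint 1 t ep x) <= B"
 shows "is_distributional_inverse_fourier (%\<xi>. osc 1 t 0 0 (cvec \<xi>)) g"
 unfolding is_distributional_inverse_fourier_def
proof (intro allI impI)
 fix \<psi> :: "real^'n => complex" assume S: "schwartz \<psi>"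
 note I = schwartz_integrable[OF S] inverse_fourier_integrable[OF S]
 have [measurable]: "\<psi> \<in> borel_measurable borel" "inverse_fourier \<psi> \<in> borel_measurable borel"
  using borel_measurable_integrable[OF I(1)] borel_measurable_integrable[OF I(2)] by simp_all
 have [measurable]: "g \<in> borel_measurable borel" using cont by (rule borel_measurable_continuous_onI)
 have om [measurable]: "(%et. osc 1 t ep 0 (cvec et)) \<in> borel_measurable borel" for ep by (rule osc_measurable) simp
 have Jm [measurable]: "(%x. Jint 1 t ep x) \<in> borel_measurable borel" for ep
 proof -
  have "(%z. osc 1 t ep 0 (cvec (snd z)) * cis (fst z \<bullet> snd z)) \<in> borel_measurable (borel \<Otimes>\<^sub>M borel)" by measurable
  then show ?thesis unfolding Jint_def
   by (subst osc_split, simp) (intro lborel.borel_measurable_lebesgue_integral[unfolded split_beta'], simp add: split_beta')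
 qed
 define f where "f = (%k. de / real (Suc k))"
 have f: "0 < f k" "f k <= de" for k using de by (auto simp: f_def pos_divide_le_eq mult_le_cancel_left1)
 have f0: "f \<longlonglongrightarrow> 0"
  using tendsto_mult[OF tendsto_const[of de] LIMSEQ_inverse_real_of_nat] by (simp add: f_def divide_inverse)
 have "f k ~= 0" for k using f(1)[of k] by simp
 then have f_right: "filterlim f (at_right 0) sequentially" using f0 f(1) by (simp add: filterlim_at)
 have limf: "(%k. Jint 1 t (f k) x) \<longlonglongrightarrow> g x" for x by (rule filterlim_compose[OF lim f_right])
 have gB: "norm (g x) <= B" for x
  by (rule LIMSEQ_le_const2[OF tendsto_norm[OF limf]]) (use bound f in auto)
 have wint: "integrable lborel (%x. B * norm (\<psi> x))" using I(1) by (intro integrable_mult_right integrable_norm)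
 have B0: "0 <= B" using order_trans[OF norm_ge_zero gB] .
 have gint: "integrable lborel (%x. g x * \<psi> x)"
  by (rule Bochner_Integration.integrable_bound[OF wint]) (use gB B0 in \<open>auto simp: norm_mult intro!: mult_right_mono\<close>)
 have lim1: "(%k. \<integral>x. Jint 1 t (f k) x * \<psi> x \<partial>lborel) \<longlonglongrightarrow> (\<integral>x. g x * \<psi> x \<partial>lborel)"
 proof (rule integral_dominated_convergence[OF _ _ wint])
  show "AE x in lborel. (%k. Jint 1 t (f k) x * \<psi> x) \<longlonglongrightarrow> g x * \<psi> x"
   by (intro AE_I2 tendsto_mult tendsto_const limf)
  show "AE x in lborel. norm (Jint 1 t (f k) x * \<psi> x) <= B * norm (\<psi> x)" for k
   unfolding norm_mult using bound f by (intro AE_I2 mult_right_mono) auto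
 qed simp_all
 have fubini: "(\<integral>x. Jint 1 t ep x * \<psi> x \<partial>lborel) = (\<integral>\<xi>. osc 1 t ep 0 (cvec \<xi>) * inverse_fourier \<psi> \<xi> \<partial>lborel)" if ep: "0 < ep" for ep
 proof -
  define F where "F = (%x \<xi>. osc 1 t ep 0 (cvec \<xi>) * (cis (x \<bullet> \<xi>) * \<psi> x))"
  have oi: "integrable lborel (%et. osc 1 t ep 0 (cvec et))" by (rule osc_integrable) (use ep in auto)
  have int: "integrable (lborel \<Otimes>\<^sub>M lborel) (%(x, \<xi>). F x \<xi>)"
  proof (rule lborel_pair.Fubini_integrable)
   show "(%(x, \<xi>). F x \<xi>) \<in> borel_measurable (lborel \<Otimes>\<^sub>M lborel)" unfolding F_def split_beta' by measurable
   have nF: "norm (F x \<xi>) = norm (osc 1 t ep 0 (cvec \<xi>)) * norm (\<psi> x)" for x \<xi> by (simp add: F_def norm_mult)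
   show "integrable lborel (%x. \<integral>\<xi>. norm (case (x, \<xi>) of (x, \<xi>) => F x \<xi>) \<partial>lborel)"
    using I(1) by (simp add: nF integrable_norm)
   have "integrable lborel (%\<xi>. F x \<xi>)" for x
    by (rule Bochner_Integration.integrable_bound[OF integrable_mult_left[OF oi, of "\<psi> x"]])
     (auto simp: F_def norm_mult)
   then show "AE x in lborel. integrable lborel (%\<xi>. case (x, \<xi>) of (x, \<xi>) => F x \<xi>)" by simp
  qed
  have "(\<integral>x. Jint 1 t ep x * \<psi> x \<partial>lborel) = (\<integral>x. \<integral>\<xi>. F x \<xi> \<partial>lborel \<partial>lborel)"
  proof (intro Bochner_Integration.integral_cong refl)
   fix x
   have "Jint 1 t ep x * \<psi> x = (\<integral>\<xi>. osc 1 t ep x (cvec \<xi>) * \<psi> x \<partial>lborel)" unfolding Jint_def by (simp only: integral_mult_left_zero)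
   also have "... = (\<integral>\<xi>. F x \<xi> \<partial>lborel)" unfolding F_def by (subst osc_split) (simp_all add: mult.assoc)
   finally show "Jint 1 t ep x * \<psi> x = (\<integral>\<xi>. F x \<xi> \<partial>lborel)" .
  qed
  also have "... = (\<integral>\<xi>. \<integral>x. F x \<xi> \<partial>lborel \<partial>lborel)" using lborel_pair.Fubini_integral[OF int] by simp
  also have "... = (\<integral>\<xi>. osc 1 t ep 0 (cvec \<xi>) * inverse_fourier \<psi> \<xi> \<partial>lborel)"
   unfolding F_def inverse_fourier_def by (simp only: integral_mult_right_zero)
  finally show ?thesis .
 qed
 have lim2: "(%k. \<integral>\<xi>. osc 1 t (f k) 0 (cvec \<xi>) * inverse_fourier \<psi> \<xi> \<partial>lborel) \<longlonglongrightarrow> (\<integral>\<xi>. osc 1 t 0 0 (cvec \<xi>) * inverse_fourier \<psi> \<xi> \<partial>lborel)"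
 proof (rule integral_dominated_convergence[where w = "%\<xi>. C * norm (inverse_fourier \<psi> \<xi>)"])
  show "integrable lborel (%\<xi>. C * norm (inverse_fourier \<psi> \<xi>))" using I(2) by (intro integrable_mult_right integrable_norm)
  have "((%k. osc 1 t (f k) 0 (cvec \<xi>)) \<longlongrightarrow> osc 1 t 0 0 (cvec \<xi>)) sequentially" for \<xi>
   by (rule osc_tendsto) (use f0 in auto)
  then show "AE \<xi> in lborel. (%k. osc 1 t (f k) 0 (cvec \<xi>) * inverse_fourier \<psi> \<xi>) \<longlonglongrightarrow> osc 1 t 0 0 (cvec \<xi>) * inverse_fourier \<psi> \<xi>"
   by (intro AE_I2 tendsto_mult tendsto_const)
  show "AE \<xi> in lborel. norm (osc 1 t (f k) 0 (cvec \<xi>) * inverse_fourier \<psi> \<xi>) <= C * norm (inverse_fourier \<psi> \<xi>)" for k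
   unfolding norm_mult using osc_bounded[of 1 "f k" t 0] less_imp_le[OF f(1)] by (intro AE_I2 mult_right_mono) auto
 qed simp_all
 have "(\<integral>x. g x * \<psi> x \<partial>lborel) = (\<integral>\<xi>. osc 1 t 0 0 (cvec \<xi>) * inverse_fourier \<psi> \<xi> \<partial>lborel)"
  using LIMSEQ_unique[OF lim1] lim2 unfolding fubini[OF f(1)] by blast
 then show "integrable lborel (%x. g x * \<psi> x) \<and> (\<integral>x. g x * \<psi> x \<partial>lborel) = (\<integral>\<xi>. osc 1 t 0 0 (cvec \<xi>) * inverse_fourier \<psi> \<xi> \<partial>lborel)"
  using gint by blast
qed

end

section \<open>From the given polynomial to the locale, and the theorem\<close>

text \<open>
  The homogenisation \<open>ta\<^sup>m P(z / ta)\<close>: it is \<open>P\<close> at \<open>ta = 1\<close> and the principal part at \<open>ta = 0\<close>.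
\<close>

definition homogenised :: "'n::finite polynomial => real => complex^'n => complex" where
 "homogenised P ta z = (\<Sum>\<alpha>\<in>Poly_Mapping.keys P. of_real (Poly_Mapping.lookup P \<alpha>) *
   (of_real ta ^ (polynomial_order P - monomial_degree \<alpha>) * (\<Prod>i\<in>UNIV. (z $ i) ^ Poly_Mapping.lookup \<alpha> i)))"

lemma monomial_degree_le_order: "\<alpha> \<in> Poly_Mapping.keys P ==> monomial_degree \<alpha> <= polynomial_order P"
 unfolding polynomial_order_def by (intro Max_ge) auto

lemma cpoly_homogenised: "cpoly (homogenised P)"
proof -
 have "cpoly (%ta z. homogenised P ta z)" unfolding homogenised_def
  by (intro cpoly_sum cpoly.mult cpoly.const cpoly_power cpoly.param cpoly_prod cpoly.coord)
 then show ?thesis .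
qed

lemma homog_homogenised: "homog (polynomial_order P) (homogenised P)"
 unfolding homog_def
proof (intro allI impI)
 fix s ta :: real and z :: "complex^'a"
 have "of_real (s * ta) ^ (polynomial_order P - monomial_degree \<alpha>) * (\<Prod>i\<in>UNIV. ((s *\<^sub>R z) $ i) ^ Poly_Mapping.lookup \<alpha> i)
  = of_real s ^ polynomial_order P * (of_real ta ^ (polynomial_order P - monomial_degree \<alpha>) * (\<Prod>i\<in>UNIV. (z $ i) ^ Poly_Mapping.lookup \<alpha> i))"
  if "\<alpha> \<in> Poly_Mapping.keys P" for \<alpha>
 proof -
  have "(\<Prod>i\<in>UNIV. ((s *\<^sub>R z) $ i) ^ Poly_Mapping.lookup \<alpha> i) = of_real s ^ monomial_degree \<alpha> * (\<Prod>i\<in>UNIV. (z $ i) ^ Poly_Mapping.lookup \<alpha> i)"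
   by (simp add: scaleR_complex power_mult_distrib prod.distrib power_sum monomial_degree_def)
  moreover have "(of_real s :: complex) ^ polynomial_order P = of_real s ^ (polynomial_order P - monomial_degree \<alpha>) * of_real s ^ monomial_degree \<alpha>"
   unfolding power_add[symmetric] using monomial_degree_le_order[OF that] by simp
  ultimately show ?thesis by (simp add: power_mult_distrib mult_ac)
 qed
 then show "homogenised P (s * ta) (s *\<^sub>R z) = of_real s ^ polynomial_order P * homogenised P ta z"
  unfolding homogenised_def sum_distrib_left by (intro sum.cong refl) (simp add: mult.left_commute)
qed

lemma homogenised_1: "homogenised P 1 (cvec \<xi>) = of_real (polynomial_value P \<xi>)"
 by (simp add: homogenised_def polynomial_value_def monomial_value_def)

lemma homogenised_0: "homogenised P 0 (cvec \<xi>) = of_real (principal_part P \<xi>)"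
proof -
 have "homogenised P 0 (cvec \<xi>) = (\<Sum>\<alpha>\<in>Poly_Mapping.keys P. if monomial_degree \<alpha> = polynomial_order P
   then of_real (Poly_Mapping.lookup P \<alpha> * monomial_value \<alpha> \<xi>) else 0)"
  unfolding homogenised_def
 proof (intro sum.cong refl)
  fix \<alpha> assume "\<alpha> \<in> Poly_Mapping.keys P"
  from monomial_degree_le_order[OF this]
  show "of_real (Poly_Mapping.lookup P \<alpha>) * (of_real 0 ^ (polynomial_order P - monomial_degree \<alpha>) * (\<Prod>i\<in>UNIV. (cvec \<xi> $ i) ^ Poly_Mapping.lookup \<alpha> i))
   = (if monomial_degree \<alpha> = polynomial_order P then of_real (Poly_Mapping.lookup P \<alpha> * monomial_value \<alpha> \<xi>) else 0)"
   by (auto simp: monomial_value_def power_0_left)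
 qed
 also have "... = of_real (principal_part P \<xi>)"
  unfolding principal_part_def by (simp add: sum.inter_filter[symmetric])
 finally show ?thesis .
qed

lemma partial_derivative_cpoly:
 assumes "cpoly f"
 shows "partial_derivative i (%x. Re (f ta (cvec x))) = (%x. Re (pdif i f ta (cvec x)))"
proof
 fix x
 have "((%x. f ta (cvec x)) has_derivative (%h. \<Sum>j\<in>UNIV. cvec h $ j * pdif j f ta (cvec x))) (at x)"
  by (rule has_derivative_compose[OF bounded_linear_imp_has_derivative[OF bounded_linear_cvec] cpoly_has_derivative[OF assms]])
 from bounded_linear.has_derivative[OF bounded_linear_Re this]
 have der: "((%x. Re (f ta (cvec x))) has_derivative (%h. Re (\<Sum>j\<in>UNIV. cvec h $ j * pdif j f ta (cvec x)))) (at x)" .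
 have "partial_derivative i (%x. Re (f ta (cvec x))) x = Re (\<Sum>j\<in>UNIV. cvec (axis i 1) $ j * pdif j f ta (cvec x))"
  unfolding partial_derivative_def frechet_derivative_at[OF der, symmetric] ..
 also have "cvec (axis i 1) = axis i 1" by (simp add: vec_eq_iff axis_def)
 finally show "partial_derivative i (%x. Re (f ta (cvec x))) x = Re (pdif i f ta (cvec x))" by (simp add: sum_axis_mult)
qed

text \<open>For \<open>ta > 0\<close> positivity is that of \<open>P\<close> after scaling. At
  \<open>ta = 0\<close> it passes to the limit as an inequality, and ellipticity excludes the value
  0; hence the principal part is positive and not merely nonzero.\<close>

lemma elliptic_symbol_homogenised:
 fixes P :: "'n::finite polynomial"
 assumes m: "polynomial_order P = 2 * q" "2 <= q" "2 * q <= CARD('n)"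
  and ell: "elliptic P" and pos: "\<And>\<xi>. polynomial_value P \<xi> > 0"
  and det: "\<And>\<xi>. \<xi> ~= 0 ==> det (hessian (principal_part P) \<xi>) ~= 0"
 shows "elliptic_symbol (homogenised P) q"
proof
 show "cpoly (homogenised P)" by (rule cpoly_homogenised)
 show h: "homog (2 * q) (homogenised P)" using homog_homogenised[of P] m by simp
 have pos1: "0 < Re (homogenised P ta (cvec et))" if ta: "0 < ta" for ta et
 proof -
  have "homogenised P (ta * 1) (ta *\<^sub>R cvec ((1 / ta) *\<^sub>R et)) = of_real ta ^ (2 * q) * homogenised P 1 (cvec ((1 / ta) *\<^sub>R et))"
   using h ta unfolding homog_def by blast
  moreover have "ta *\<^sub>R cvec ((1 / ta) *\<^sub>R et) = cvec et" unfolding cvec_scaleR[symmetric] using ta by simp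
  ultimately have "homogenised P ta (cvec et) = of_real (ta ^ (2 * q) * polynomial_value P ((1 / ta) *\<^sub>R et))"
   by (simp add: homogenised_1)
  then show ?thesis using ta pos by simp
 qed
 show "0 < Re (homogenised P ta (cvec et))" if "0 <= ta" "0 < ta + norm et" for ta et
 proof (cases "ta = 0")
  case False
  then show ?thesis using pos1 that by simp
 next
  case True
  have "continuous_on UNIV (%s. Re (homogenised P s (cvec et)))"
   by (intro continuous_intros cpoly_continuous_on[OF cpoly_homogenised])
  then have "((%s. Re (homogenised P s (cvec et))) \<longlongrightarrow> Re (homogenised P 0 (cvec et))) (at_right 0)"
   by (simp add: continuous_on_eq_continuous_within continuous_within filterlim_at_split)
  then have "0 <= Re (homogenised P 0 (cvec et))"
   by (rule tendsto_lowerbound) (auto intro!: eventually_at_rightI[of 0 1] less_imp_le[OF pos1])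
  moreover have "principal_part P et ~= 0" using ell that True unfolding elliptic_def by auto
  ultimately show ?thesis unfolding True homogenised_0 by simp
 qed
 fix et w :: "real^'n"
 assume et: "et ~= 0" and w: "\<And>k. (\<Sum>j\<in>UNIV. Re (pdif j (pdif k (homogenised P)) 0 (cvec et)) * w $ j) = 0"
 have pp: "principal_part P = (%x. Re (homogenised P 0 (cvec x)))" by (simp add: homogenised_0)
 \<comment> \<open>The transpose puts the derivatives into the order used in the nondegeneracy
   condition, so that symmetry of the Hessian need not be invoked.\<close>
 define H where "H = transpose (hessian (principal_part P) et)"
 have "H $ k $ j = Re (pdif j (pdif k (homogenised P)) 0 (cvec et))" for k j
  unfolding H_def hessian_def transpose_def pp
  by (simp add: partial_derivative_cpoly cpoly_homogenised cpoly_pdif)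
 then have "H *v w = 0" using w by (simp add: vec_eq_iff matrix_vector_mult_def)
 moreover have "invertible H" unfolding invertible_det_nz H_def det_transpose by (rule det[OF et])
 then obtain B where "B ** H = mat 1" unfolding invertible_def by blast
 ultimately show "w = 0" by (metis matrix_vector_mul_assoc matrix_vector_mul_lid matrix_vector_mult_0_right)
qed (rule m)+

theorem theorem3p1:
  fixes P :: "'n::finite polynomial" and m :: nat and n m\<^sub>1 \<mu> \<sigma> :: real
  assumes "CARD('n) \<ge> 2" and "m \<ge> 4" and "even m"
    and "polynomial_order P = m" and "elliptic P"
    and "\<And>\<xi>. polynomial_value P \<xi> > 0"
    and "\<And>\<xi>. \<xi> \<noteq> 0 \<Longrightarrow> det (hessian (principal_part P) \<xi>) \<noteq> 0"
    and "CARD('n) \<ge> m"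
    and "\<sigma> = 1 \<or> \<sigma> = - 1"
    and "n = real CARD('n)" and "m\<^sub>1 = real m / 2"
    and "\<mu> = (real m * n - 4 * n + 2 * real m) / (2 * (real m - 2))"
  shows "\<mu> > 0 \<and>
    (\<exists>C>0. \<forall>x.
      (\<forall>t. 0 < \<bar>t\<bar> \<and> \<bar>t\<bar> \<le> 1 \<longrightarrow>
        norm (I2 \<sigma> P t x) \<le>
          C * \<bar>t\<bar> powr (- ((n - m\<^sub>1) / m\<^sub>1)) * (1 + \<bar>t\<bar> powr (- (1 / m\<^sub>1)) * norm x) powr (- \<mu>)) \<and>
      (\<forall>t. \<bar>t\<bar> \<ge> 1 \<longrightarrow>
        norm (I2 \<sigma> P t x) \<le>
          C * \<bar>t\<bar> powr (- (1 / real m)) * (1 + \<bar>t\<bar> powr (- 1) * norm x) powr (- \<mu>)))"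
proof -
 define q where "q = m div 2"
 have mq: "m = 2 * q" using assms(3) by (simp add: q_def)
 have q: "2 <= q" "2 * q <= CARD('n)" "polynomial_order P = 2 * q" using assms(2,4,8) mq by auto
 have m1: "m\<^sub>1 = real q" using assms(11) mq by simp
 have mu: "\<mu> = (real CARD('n) * (real q - 2) / 2 + real q) / (real q - 1)"
  using q(1) unfolding assms(12,10) mq by (simp add: field_simps)
 have q': "2 <= real q" using q(1) by simp
 have mu_pos: "0 < \<mu>"
  unfolding mu using q' by (intro divide_pos_pos add_nonneg_pos divide_nonneg_pos mult_nonneg_nonneg) auto
 interpret elliptic_symbol "homogenised P" q
  by (rule elliptic_symbol_homogenised[OF q(3,1,2) assms(5-7)])
 obtain c0 C where "0 < c0" "c0 <= 1/2" "1 <= C"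
  "\<And>ta et z. 0 <= ta ==> 0 < ta + norm et ==> norm (z - cvec et) <= c0 * (ta + norm et) ==>
    0 < Re (homogenised P ta z) \<and> (ta + norm et) ^ q <= C * norm (fi ta z) \<and> norm (fi ta z) <= C * (ta + norm et) ^ q
    \<and> (\<forall>k j. norm (fi1 k ta z) <= C * (ta + norm et) ^ (q - 1) \<and> norm (fi2 k j ta z) <= C * (ta + norm et) ^ (q - 2))"
  by (rule symbol_estimates) blast
 then interpret elliptic_estimates "homogenised P" q c0 C by unfold_locales
 obtain K where K: "0 < K"
  "\<And>t. t ~= 0 ==> \<exists>g de. 0 < de \<and> continuous_on UNIV g \<and> (\<forall>x. ((%ep. Jint 1 t ep x) \<longlongrightarrow> g x) (at_right 0)) \<and>
    (\<forall>x ep. 0 < ep --> ep <= de --> norm (Jint 1 t ep x) <= dispersive_bound \<mu> K t x)"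
  by (rule Jint_1_limit[OF mu]) blast
 have bound: "norm (I2 \<sigma> P t x) <= dispersive_bound \<mu> K t x" if t: "t ~= 0" for t x
 proof -
  \<comment> \<open>Both signs are covered by letting the time have either sign.\<close>
  define t' where "t' = \<sigma> * t"
  have t': "t' ~= 0" "\<bar>t'\<bar> = \<bar>t\<bar>" using t assms(9) by (auto simp: t'_def)
  obtain g de where g: "0 < de" "continuous_on UNIV g" "\<And>x. ((%ep. Jint 1 t' ep x) \<longlongrightarrow> g x) (at_right 0)"
   "\<And>x ep. 0 < ep ==> ep <= de ==> norm (Jint 1 t' ep x) <= dispersive_bound \<mu> K t' x"
   using K(2)[OF t'(1)] by blast
  \<comment> \<open>A bound independent of \<open>x\<close>, as the passage to the limit under the
    integral requires; it is obtained by dropping the spatial factor, which is at most 1 because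
    \<open>\<mu> > 0\<close>.\<close>
  define B where "B = (if \<bar>t'\<bar> <= 1 then K * \<bar>t'\<bar> powr (- ((real CARD('n) - real q) / real q)) else K * \<bar>t'\<bar> powr (- (1 / real (2 * q))))"
  have B: "dispersive_bound \<mu> K t' x <= B" for x
  proof -
   have le1: "a * (1 + b * norm x) powr (- \<mu>) <= a" if "0 <= a" "0 <= b" for a b
   proof -
    have "(1 + b * norm x) powr (- \<mu>) <= 1 powr (- \<mu>)" using that mu_pos by (intro powr_mono2') auto
    then show ?thesis using that mult_left_mono[of "(1 + b * norm x) powr (- \<mu>)" 1 a] by simp
   qed
   show ?thesis
   proof (cases "\<bar>t'\<bar> <= 1")
    case True
    then show ?thesis unfolding dispersive_bound_def B_def if_P[OF True] by (intro le1) (use K(1) in auto)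
   next
    case False
    then show ?thesis unfolding dispersive_bound_def B_def if_not_P[OF False] by (intro le1) (use K(1) in auto)
   qed
  qed
  have "is_distributional_inverse_fourier (%\<xi>. osc 1 t' 0 0 (cvec \<xi>)) g"
   by (rule osc_distribution[OF g(1-3) order_trans[OF g(4) B]])
  moreover have "(%\<xi>. osc 1 t' 0 0 (cvec \<xi>)) = I2_symbol \<sigma> P t"
  proof
   fix \<xi> :: "real^'n"
   have "fir 1 \<xi> = sqrt (polynomial_value P \<xi>)" by (simp add: fir_def pr_def homogenised_1)
   then show "osc 1 t' 0 0 (cvec \<xi>) = I2_symbol \<sigma> P t \<xi>" by (simp add: osc_cvec I2_symbol_def t'_def)
  qed
  ultimately have "I2 \<sigma> P t = g" using g(2) by (intro I2_eqI) auto
  moreover have "norm (g x) <= dispersive_bound \<mu> K t' x"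
   by (rule tendsto_upperbound[OF tendsto_norm[OF g(3)]]) (use g(1,4) in \<open>auto intro!: eventually_at_rightI[of 0 de]\<close>)
  moreover have "dispersive_bound \<mu> K t' x = dispersive_bound \<mu> K t x" unfolding dispersive_bound_def t'(2) ..
  ultimately show ?thesis by simp
 qed
 show ?thesis
 proof (intro conjI mu_pos exI[of _ K] allI impI K(1))
  fix x :: "real^'n" and t :: real
  assume t: "0 < \<bar>t\<bar> \<and> \<bar>t\<bar> <= 1"
  then show "norm (I2 \<sigma> P t x) <= K * \<bar>t\<bar> powr (- ((n - m\<^sub>1) / m\<^sub>1)) * (1 + \<bar>t\<bar> powr (- (1 / m\<^sub>1)) * norm x) powr (- \<mu>)"
   using bound[of t x] unfolding dispersive_bound_def m1 assms(10) by simp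
 next
  fix x :: "real^'n" and t :: real
  assume t: "1 <= \<bar>t\<bar>"
  show "norm (I2 \<sigma> P t x) <= K * \<bar>t\<bar> powr (- (1 / real m)) * (1 + \<bar>t\<bar> powr (- 1) * norm x) powr (- \<mu>)"
  \<comment> \<open>\<open>dispersive_bound\<close> assigns \<open>\<bar>t\<bar> = 1\<close> to the
    small times; there all powers of \<open>\<bar>t\<bar>\<close> equal 1, so both formulas
    agree.\<close>
  proof (cases "\<bar>t\<bar> = 1")
   case True
   then have "norm (I2 \<sigma> P t x) <= dispersive_bound \<mu> K t x" by (intro bound) auto
   then show ?thesis unfolding dispersive_bound_def True by simp
  next
   case False
   then have "\<not> \<bar>t\<bar> <= 1" "t ~= 0" using t by auto
   then show ?thesis using bound[of t x] unfolding dispersive_bound_def mq by simp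
  qed
 qed
qed

end
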